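(* Let $I,J_1,J_2\subset\mathbb{R}$ be open, connected, bounded, non-empty intervals with $\overline I\cap\overline{J_j}=\emptyset$ for $j=1,2$, with $J_1$ located to the left of $I$ and $J_2$ to the right of $I$, and let $J=J_1\cup J_2$. Let $Q\subset\mathbb{R}^{n-1}$ be an open, bounded set, and put $\mathcal{I}=Q\times I\subset\mathbb{R}^n$, $\mathcal{J}=Q\times J\subset\mathbb{R}^n$. Let $$P(D)=|D_{x_n}|^{2s}+L(D)+m(D'),$$ where $s\in[\tfrac12,1)$, $L(D)$ is a constant coefficient local (differential) operator and $m(D')$ is a (constant coefficient) pseudodifferential operator in the derivatives $\partial_{x_1},\dots,\partial_{x_{n-1}}$ such that $m(D')g|_{\mathcal{J}}=0$ for all functions $g$ which are compactly supported in $\mathcal{I}$. Then there exist $C>0$, $\mu>0$ such that for any $g\in C_c^\infty(\mathcal{I})$ $$\|g\|_{H^{2s}(\mathcal{I})}\le C\,e^{C\left(\frac{\|g\|_{H^{2s}(\mathcal{I})}}{\|g\|_{L^2(\mathcal{I})}}\right)^{\mu}}\,\|P(D)g\|_{H^{-s}(\mathcal{J})}.$$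
   Context: Points of $\mathbb{R}^n$ are written $x=(x',x_n)$ with $x'\in\mathbb{R}^{n-1}$, and $D_{x_j}=i\,\partial_{x_j}$. $|D_{x_n}|^{2s}$ is the Fourier multiplier with symbol $|\xi_n|^{2s}$; $L(D)=\sum_{|\alpha|\le m}a_\alpha D^\alpha$ is a finite sum over multi-indices $\alpha\in\mathbb{N}_0^n$ with constants $a_\alpha$; $m(D')$ is a Fourier multiplier whose symbol depends only on $\xi'=(\xi_1,\dots,\xi_{n-1})$. For $r\in\mathbb{R}$, $H^r(\mathbb{R}^n)=\{f\in\mathcal{S}'(\mathbb{R}^n):\|(1+|\cdot|^2)^{r/2}\hat f\|_{L^2}<\infty\}$, and for open $U\subset\mathbb{R}^n$, $H^r(U)$ is the space of restrictions to $U$ of elements of $H^r(\mathbb{R}^n)$ with the quotient norm. For $g=0$ the inequality is understood to hold trivially. *)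

theory Defs
  imports "HOL-Analysis.Analysis"
begin

text \<open>
  The space \<open>R^n\<close> is \<open>real^'n\<close> with \<open>n = CARD('n) \<ge> 1\<close>; the linear order on the index type
  numbers the coordinates, so the last one, \<open>x_n\<close>, has the index \<open>Max UNIV\<close>.
  The space \<open>R^(n-1)\<close> is identified with the hyperplane \<open>x_n = 0\<close> (which is a single point for
  \<open>n = 1\<close>), and \<open>xprime x\<close> is \<open>x'\<close> under this identification.
\<close>

definition last_ix :: "'n::{finite,linorder}" where
  "last_ix = Max UNIV"

definition base_plane :: "(real^'n::{finite,linorder}) set" where
  "base_plane = {x. x $ last_ix = 0}"

definition xprime :: "real^'n::{finite,linorder} \<Rightarrow> real^'n::{finite,linorder}" where
  "xprime x = (\<chi> i. if i = last_ix then 0 else x $ i)"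

text \<open>The product \<open>Q \<times> K\<close> of \<open>Q \<subseteq> R^(n-1)\<close> and \<open>K \<subseteq> R\<close>.\<close>

definition cylinder :: "(real^'n::{finite,linorder}) set \<Rightarrow> real set \<Rightarrow> (real^'n::{finite,linorder}) set" where
  "cylinder Q K = {x. xprime x \<in> Q \<and> x $ last_ix \<in> K}"

definition partial_deriv :: "'n \<Rightarrow> (real^'n \<Rightarrow> complex) \<Rightarrow> real^'n::finite \<Rightarrow> complex" where
  "partial_deriv i f = (\<lambda>x. frechet_derivative f (at x) (axis i 1))"

definition partials :: "'n list \<Rightarrow> (real^'n \<Rightarrow> complex) \<Rightarrow> real^'n::finite \<Rightarrow> complex" where
  "partials is f = foldr partial_deriv is f"

definition smooth :: "(real^'n::finite \<Rightarrow> complex) \<Rightarrow> bool" where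
  "smooth f \<longleftrightarrow> (\<forall>is x. partials is f differentiable (at x))"

text \<open>The convention is \<open>D_j = i \<partial>_j\<close>.\<close>

definition D_multi :: "('n \<Rightarrow> nat) \<Rightarrow> (real^'n::{finite,linorder} \<Rightarrow> complex) \<Rightarrow> real^'n::{finite,linorder} \<Rightarrow> complex" where
  "D_multi \<alpha> f x = \<i> ^ (\<Sum>i\<in>UNIV. \<alpha> i) *
     partials (concat (map (\<lambda>i. replicate (\<alpha> i) i) (sorted_list_of_set UNIV))) f x"

definition test_fun :: "(real^'n::finite) set \<Rightarrow> (real^'n \<Rightarrow> complex) \<Rightarrow> bool" where
  "test_fun U f \<longleftrightarrow> smooth f \<and> compact (closure {x. f x \<noteq> 0}) \<and> closure {x. f x \<noteq> 0} \<subseteq> U"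

definition schwartz :: "(real^'n::finite \<Rightarrow> complex) \<Rightarrow> bool" where
  "schwartz f \<longleftrightarrow> smooth f \<and>
     (\<forall>N is. \<exists>B. \<forall>x. (1 + norm x) ^ N * norm (partials is f x) \<le> B)"

definition schwartz_norm :: "nat \<Rightarrow> (real^'n::finite \<Rightarrow> complex) \<Rightarrow> real" where
  "schwartz_norm N f =
     (SUP (is, x) \<in> {is. length is \<le> N} \<times> UNIV. (1 + norm x) ^ N * norm (partials is f x))"

text \<open>
  The sign and the normalisation of the Fourier transform are immaterial below: the Sobolev norms
  change by a constant factor only, and the class of symbols is invariant under reflection.
\<close>

definition fourier :: "(real^'n::finite \<Rightarrow> complex) \<Rightarrow> real^'n \<Rightarrow> complex" where
  "fourier f \<xi> = (LINT x|lborel. cis (- (x \<bullet> \<xi>)) * f x)"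

definition inv_fourier :: "(real^'n::finite \<Rightarrow> complex) \<Rightarrow> real^'n \<Rightarrow> complex" where
  "inv_fourier h x = (LINT \<xi>|lborel. cis (x \<bullet> \<xi>) * h \<xi>) / of_real ((2 * pi) ^ CARD('n))"

text \<open>
  Symbols are (representatives of) measurable functions that are integrable up to a polynomial
  weight. This covers every measurable symbol of polynomial growth. For such a symbol \<open>p\<close> and a
  Schwartz function \<open>f\<close>, the product of \<open>p\<close> with the Fourier transform of \<open>f\<close> is integrable, so
  \<open>multiplier p f\<close> is a bounded continuous function.
\<close>

definition tempered_symbol :: "(real^'n::finite \<Rightarrow> complex) \<Rightarrow> bool" where
  "tempered_symbol p \<longleftrightarrow> p \<in> borel_measurable borel \<and>
     (\<exists>N. integrable lborel (\<lambda>\<xi>. p \<xi> / of_real ((1 + norm \<xi>) ^ N)))"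

definition multiplier :: "(real^'n::finite \<Rightarrow> complex) \<Rightarrow> (real^'n \<Rightarrow> complex) \<Rightarrow> real^'n \<Rightarrow> complex" where
  "multiplier p f = inv_fourier (\<lambda>\<xi>. p \<xi> * fourier f \<xi>)"

definition frac_D_last :: "real \<Rightarrow> (real^'n::{finite,linorder} \<Rightarrow> complex) \<Rightarrow> real^'n::{finite,linorder} \<Rightarrow> complex" where
  "frac_D_last s = multiplier (\<lambda>\<xi>. of_real (\<bar>\<xi> $ last_ix\<bar> powr (2 * s)))"

definition diff_op ::
  "nat \<Rightarrow> (('n \<Rightarrow> nat) \<Rightarrow> complex) \<Rightarrow> (real^'n::{finite,linorder} \<Rightarrow> complex) \<Rightarrow> real^'n::{finite,linorder} \<Rightarrow> complex" where
  "diff_op k a f x = (\<Sum>\<alpha> | (\<Sum>i\<in>UNIV. \<alpha> i) \<le> k. a \<alpha> * D_multi \<alpha> f x)"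

text \<open>Only the values of \<open>m\<close> on \<^const>\<open>base_plane\<close> matter.\<close>

definition tangential_op ::
  "(real^'n::{finite,linorder} \<Rightarrow> complex) \<Rightarrow> (real^'n::{finite,linorder} \<Rightarrow> complex) \<Rightarrow> real^'n::{finite,linorder} \<Rightarrow> complex" where
  "tangential_op m = multiplier (\<lambda>\<xi>. m (xprime \<xi>))"

definition P_op ::
  "real \<Rightarrow> nat \<Rightarrow> (('n \<Rightarrow> nat) \<Rightarrow> complex) \<Rightarrow> (real^'n::{finite,linorder} \<Rightarrow> complex) \<Rightarrow>
   (real^'n::{finite,linorder} \<Rightarrow> complex) \<Rightarrow> real^'n::{finite,linorder} \<Rightarrow> complex" where
  "P_op s k a m f x = frac_D_last s f x + diff_op k a f x + tangential_op m f x"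

text \<open>
  Distributions are functionals on functions, of which only the values on Schwartz functions
  (respectively on test functions) matter.
\<close>

type_synonym 'n functional = "(real^'n \<Rightarrow> complex) \<Rightarrow> complex"

definition tempered_distribution :: "'n::finite functional \<Rightarrow> bool" where
  "tempered_distribution T \<longleftrightarrow>
     (\<forall>\<phi> \<psi>. schwartz \<phi> \<longrightarrow> schwartz \<psi> \<longrightarrow> T (\<lambda>x. \<phi> x + \<psi> x) = T \<phi> + T \<psi>) \<and>
     (\<forall>c \<phi>. schwartz \<phi> \<longrightarrow> T (\<lambda>x. c * \<phi> x) = c * T \<phi>) \<and>
     (\<exists>N B. \<forall>\<phi>. schwartz \<phi> \<longrightarrow> norm (T \<phi>) \<le> B * schwartz_norm N \<phi>)"

definition fourier_dist :: "'n::finite functional \<Rightarrow> 'n functional" where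
  "fourier_dist T = (\<lambda>\<phi>. T (fourier \<phi>))"

definition dist_of :: "(real^'n::finite \<Rightarrow> complex) \<Rightarrow> 'n functional" where
  "dist_of f = (\<lambda>\<phi>. LINT x|lborel. f x * \<phi> x)"

text \<open>
  \<open>sobolev_density r T h\<close>: the Fourier transform of \<open>T\<close> is the function \<open>h\<close>, and
  \<open>(1 + |\<xi>|^2)^(r/2) h\<close> is square integrable. Such an \<open>h\<close> is unique almost everywhere.
\<close>

definition sobolev_density :: "real \<Rightarrow> 'n::finite functional \<Rightarrow> (real^'n \<Rightarrow> complex) \<Rightarrow> bool" where
  "sobolev_density r T h \<longleftrightarrow> h \<in> borel_measurable borel \<and>
     integrable lborel (\<lambda>\<xi>. ((1 + (norm \<xi>)\<^sup>2) powr (r / 2) * norm (h \<xi>))\<^sup>2) \<and>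
     (\<forall>\<phi>. schwartz \<phi> \<longrightarrow> fourier_dist T \<phi> = dist_of h \<phi>)"

definition sobolev :: "real \<Rightarrow> 'n::finite functional set" where
  "sobolev r = {T. tempered_distribution T \<and> (\<exists>h. sobolev_density r T h)}"

definition sobolev_norm :: "real \<Rightarrow> 'n::finite functional \<Rightarrow> real" where
  "sobolev_norm r T = sqrt (LINT \<xi>|lborel.
     ((1 + (norm \<xi>)\<^sup>2) powr (r / 2) * norm ((SOME h. sobolev_density r T h) \<xi>))\<^sup>2)"

definition extensions :: "real \<Rightarrow> (real^'n::finite) set \<Rightarrow> 'n functional \<Rightarrow> 'n functional set" where
  "extensions r U u = {T \<in> sobolev r. \<forall>\<phi>. test_fun U \<phi> \<longrightarrow> T \<phi> = u \<phi>}"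

definition sobolev_on :: "real \<Rightarrow> (real^'n::finite) set \<Rightarrow> 'n functional set" where
  "sobolev_on r U = {u. extensions r U u \<noteq> {}}"

definition sobolev_on_norm :: "real \<Rightarrow> (real^'n::finite) set \<Rightarrow> 'n functional \<Rightarrow> real" where
  "sobolev_on_norm r U u = (INF T \<in> extensions r U u. sobolev_norm r T)"

definition L2_norm_on :: "(real^'n::finite) set \<Rightarrow> (real^'n \<Rightarrow> complex) \<Rightarrow> real" where
  "L2_norm_on U f = sqrt (LINT x:U|lborel. (norm (f x))\<^sup>2)"

end

theory Submission
  imports Defs "HOL-Probability.Probability" "HOL-Computational_Algebra.Polynomial"
begin

text \<open>
  Only the values on \<open>Q \<times> J2\<close> are used; there the local and the tangential part of \<open>P(D) g\<close> vanish, and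
  \<open>|D_n|^(2s) g\<close> is, up to a constant, the integral of \<open>g(x', y) (t - y)^(-1-2s)\<close> over \<open>y\<close>. By duality it is
  enough to write \<open>g\<close> as such an integral of a test function \<open>\<Psi>\<close> on \<open>Q \<times> J2\<close>, up to an error of relative
  size \<open>1/2\<close> in \<open>L^2\<close>, and to bound the \<open>H^1\<close> norm of \<open>\<Psi>\<close>. Derivatives of the kernel at a point \<open>t0\<close> of
  \<open>J2\<close> are the functions \<open>p^(1+2s+l)\<close> with \<open>p = d / (t0 - y)\<close>, so every fibre \<open>g(x', .)\<close> is convolved with the
  polynomial Landau kernel of degree \<open>2N\<close> in the variable \<open>p\<close>. The error is \<open>O(N^(-1/4))\<close> times the \<open>H^1\<close> norm
  of \<open>g\<close>, the cost is \<open>exp(O(N^2))\<close>, and \<open>N\<close> of the order \<open>R^4\<close>, where \<open>R\<close> is the quotient of the norms,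
  gives the claim with \<open>\<mu> = 8\<close>. Since \<open>2s \<ge> 1\<close>, the \<open>H^1\<close> norm of \<open>g\<close> is bounded by the quotient norm in
  \<open>H^(2s)\<close> without any regularity of \<open>Q\<close>.
\<close>

section \<open>Smooth functions and Schwartz functions\<close>

text \<open>Everything happens in the variable \<open>x_n\<close>. The dual function is a sum of
  terms \<open>weighted_fibre (W l) G x * \<psi> l (x $ last_ix)\<close>: the weights integrate the
  conjugate of g along a fibre, the profiles live in J2. Tangential derivatives pass to g and the
  normal one hits the profiles, so the cost is that of the profiles alone. The obstacle is
  quantitative. For every l up to 2N a profile close to the l-th derivative of a delta at t0 is
  required, of explicit size, whereas the derivatives of a compactly supported smooth bump cannot
  have analytic growth. Iterated difference quotients with step \<delta> replace them. Since the
  coefficients of the normalised Landau polynomial are of size 8^N, the step must be exponentially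
  small in N, and 2N quotients then cost \<delta>^(-2N): this is the origin of
  \<open>exp(O(N^2))\<close>. The exponent 1/4 is half of 1/2: on a line, functions in H^1 are
  Hoelder continuous of order 1/2, and the Landau kernel, of variance 1/(2N+3), has width of order
  N^(-1/2).\<close>

lemma partials_simps [simp]:
  "partials [] f = f" "partials (i # is) f = partial_deriv i (partials is f)"
  by (simp_all add: partials_def)

lemma partials_append: "partials (is @ js) f = partials is (partials js f)"
  by (simp add: partials_def)

lemma frechet_derivative_worksI:
  "f differentiable (at x) \<Longrightarrow> (f has_derivative frechet_derivative f (at x)) (at x)"
  by (simp add: frechet_derivative_works[symmetric])

lemma partial_deriv_eq:
  assumes "(f has_derivative f') (at x)"
  shows "partial_deriv i f x = f' (axis i 1)"
  using frechet_derivative_at[OF assms] by (simp add: partial_deriv_def)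

lemma smooth_differentiable: "smooth f \<Longrightarrow> f differentiable (at x)"
  unfolding smooth_def using partials_simps(1)[of f] by (elim allE[of _ "[]"]) simp

lemma smooth_partial: "smooth f \<Longrightarrow> smooth (partial_deriv i f)"
  using partials_append[of _ "[i]" f] unfolding smooth_def by (metis partials_simps)

lemma has_derivative_partial:
  fixes f :: "real^'n::finite \<Rightarrow> complex"
  assumes "f differentiable (at x)"
  shows "(f has_derivative (\<lambda>h. \<Sum>i\<in>UNIV. h $ i *\<^sub>R partial_deriv i f x)) (at x)"
proof -
  let ?D = "frechet_derivative f (at x)"
  have D: "(f has_derivative ?D) (at x)"
    using assms by (rule frechet_derivative_worksI)
  then have lin: "linear ?D" using has_derivative_linear by blast
  have "?D h = (\<Sum>i\<in>UNIV. h $ i *\<^sub>R partial_deriv i f x)" for h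
  proof -
    have "h = (\<Sum>i\<in>UNIV. h $ i *\<^sub>R axis i 1)"
      using basis_expansion[of h] by (simp add: scalar_mult_eq_scaleR)
    then have "?D h = ?D (\<Sum>i\<in>UNIV. h $ i *\<^sub>R axis i 1)" by metis
    also have "\<dots> = (\<Sum>i\<in>UNIV. h $ i *\<^sub>R ?D (axis i 1))"
      by (simp add: linear_sum[OF lin] linear_scale[OF lin])
    finally show ?thesis by (simp add: partial_deriv_def)
  qed
  then have "?D = (\<lambda>h. \<Sum>i\<in>UNIV. h $ i *\<^sub>R partial_deriv i f x)" by blast
  then show ?thesis using D by metis
qed

lemma smooth_has_derivative:
  "smooth f \<Longrightarrow> (f has_derivative (\<lambda>h. \<Sum>i\<in>UNIV. h $ i *\<^sub>R partial_deriv i f x)) (at x)"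
  by (intro has_derivative_partial smooth_differentiable)

lemma smooth_continuous_on: "smooth f \<Longrightarrow> continuous_on A f"
  by (intro continuous_at_imp_continuous_on ballI differentiable_imp_continuous_within smooth_differentiable)

lemma smooth_borel: "smooth f \<Longrightarrow> f \<in> borel_measurable borel"
  by (intro borel_measurable_continuous_onI smooth_continuous_on)

text \<open>\<open>smooth\<close> speaks about all iterated partials at once. A set of
  differentiable functions that is stable under \<open>partial_deriv\<close> contains them all by
  induction on the list, so each closure property below reduces to the choice of a stable set and
  one first-order derivative rule.\<close>

lemma smooth_coinduct:
  assumes "f \<in> X"
    and "\<And>f x. f \<in> X \<Longrightarrow> f differentiable (at x)"
    and "\<And>f i. f \<in> X \<Longrightarrow> partial_deriv i f \<in> X"
  shows "smooth f"
proof -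
  have "partials is f \<in> X" for "is"
    by (induction "is") (auto intro: assms)
  then show ?thesis unfolding smooth_def using assms(2) by blast
qed

text \<open>The decay is asked of the members of the stable set themselves; as iterated partials
  stay in the set, their decay comes with it.\<close>

lemma schwartz_coinduct:
  assumes "f \<in> X"
    and "\<And>f x. f \<in> X \<Longrightarrow> f differentiable (at x)"
    and "\<And>f i. f \<in> X \<Longrightarrow> partial_deriv i f \<in> X"
    and "\<And>f N. f \<in> X \<Longrightarrow> \<exists>B. \<forall>x. (1 + norm x) ^ N * norm (f x) \<le> B"
  shows "schwartz f"
proof -
  have "partials is f \<in> X" for "is"
    by (induction "is") (auto intro: assms)
  then show ?thesis unfolding schwartz_def using smooth_coinduct[of f X] assms by blast
qed

lemma schwartz_smooth: "schwartz f \<Longrightarrow> smooth f"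
  by (simp add: schwartz_def)

lemma schwartz_partial: "schwartz f \<Longrightarrow> schwartz (partial_deriv i f)"
  using partials_append[of _ "[i]" f] smooth_partial[of f i] unfolding schwartz_def
  by (metis partials_simps)

lemma schwartz_decay: "schwartz f \<Longrightarrow> \<exists>B. \<forall>x. (1 + norm x) ^ N * norm (f x) \<le> B"
  unfolding schwartz_def using partials_simps(1)[of f] by (elim conjE allE[of _ N] allE[of _ "[]"]) simp

lemma partial_deriv_add:
  assumes "f differentiable (at x)" "g differentiable (at x)"
  shows "partial_deriv i (\<lambda>x. f x + g x) x = partial_deriv i f x + partial_deriv i g x"
  using partial_deriv_eq[OF has_derivative_add[OF frechet_derivative_worksI[OF assms(1)]
      frechet_derivative_worksI[OF assms(2)]]]
  by (simp add: partial_deriv_def)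

lemma partial_deriv_mult:
  assumes "f differentiable (at x)" "g differentiable (at x)"
  shows "partial_deriv i (\<lambda>x. f x * g x) x = partial_deriv i f x * g x + f x * partial_deriv i g x"
  using partial_deriv_eq[OF has_derivative_mult[OF frechet_derivative_worksI[OF assms(1)]
      frechet_derivative_worksI[OF assms(2)]]]
  by (simp add: partial_deriv_def algebra_simps)

lemma partial_deriv_const [simp]: "partial_deriv i (\<lambda>x. c) = (\<lambda>x. 0)"
  using partial_deriv_eq[OF has_derivative_const] by blast

lemma differentiable_cnj: "f differentiable (at x) \<Longrightarrow> (\<lambda>x. cnj (f x)) differentiable (at x)"
  unfolding differentiable_def
  using bounded_linear.has_derivative[OF bounded_linear_cnj] by blast

lemma partial_deriv_cnj:
  assumes "f differentiable (at x)"
  shows "partial_deriv i (\<lambda>x. cnj (f x)) x = cnj (partial_deriv i f x)"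
  using partial_deriv_eq[OF bounded_linear.has_derivative[OF bounded_linear_cnj frechet_derivative_worksI[OF assms]]]
  by (simp add: partial_deriv_def)

lemma smooth_const: "smooth (\<lambda>x. c)"
  by (rule smooth_coinduct[of _ "range (\<lambda>c x. c)"]) auto

lemma smooth_cnj: "smooth f \<Longrightarrow> smooth (\<lambda>x. cnj (f x))"
proof (rule smooth_coinduct[of _ "{(\<lambda>x. cnj (f x)) | f. smooth f}"], blast, goal_cases)
  case (1 f x)
  then show ?case
    by (auto intro!: differentiable_cnj intro: smooth_differentiable)
next
  case (2 h i)
  then obtain f where h: "h = (\<lambda>x. cnj (f x))" "smooth f" by blast
  then have "partial_deriv i h = (\<lambda>x. cnj (partial_deriv i f x))"
    by (auto simp: partial_deriv_cnj smooth_differentiable)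
  then show ?case using smooth_partial[OF h(2)] by blast
qed

lemma smooth_add: "smooth f \<Longrightarrow> smooth g \<Longrightarrow> smooth (\<lambda>x. f x + g x)"
proof (rule smooth_coinduct[of _ "{(\<lambda>x. f x + g x) | f g. smooth f \<and> smooth g}"], blast, goal_cases)
  case (1 f x)
  then show ?case by (auto intro!: differentiable_add intro: smooth_differentiable)
next
  case (2 h i)
  then obtain f g where h: "h = (\<lambda>x. f x + g x)" "smooth f" "smooth g" by blast
  then have "partial_deriv i h = (\<lambda>x. partial_deriv i f x + partial_deriv i g x)"
    by (auto simp: partial_deriv_add smooth_differentiable)
  then show ?case using smooth_partial[OF h(2)] smooth_partial[OF h(3)] by blast
qed

text \<open>The Leibniz rule leads out of the set of products of two smooth functions, but not out
  of its closure under sums, which is therefore the stable set for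
  \<open>smooth_mult\<close>.\<close>

inductive_set smooth_prods :: "(real^'n::finite \<Rightarrow> complex) set" where
  prod: "smooth f \<Longrightarrow> smooth g \<Longrightarrow> (\<lambda>x. f x * g x) \<in> smooth_prods"
| plus: "f \<in> smooth_prods \<Longrightarrow> g \<in> smooth_prods \<Longrightarrow> (\<lambda>x. f x + g x) \<in> smooth_prods"

lemma smooth_mult:
  fixes f g :: "real^'n::finite \<Rightarrow> complex"
  assumes "smooth f" "smooth g" shows "smooth (\<lambda>x. f x * g x)"
proof (rule smooth_coinduct[of _ smooth_prods])
  show d: "f differentiable (at x)" if "f \<in> smooth_prods" for f and x :: "real^'n"
    using that by induction (auto intro!: differentiable_mult differentiable_add intro: smooth_differentiable)
  show "partial_deriv i f \<in> smooth_prods" if "f \<in> smooth_prods" for f and i :: 'n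
    using that
  proof induction
    case (prod f g)
    have "partial_deriv i (\<lambda>x. f x * g x) = (\<lambda>x. partial_deriv i f x * g x + f x * partial_deriv i g x)"
      using prod by (auto simp: partial_deriv_mult smooth_differentiable)
    then show ?case using prod by (auto intro!: smooth_prods.intros smooth_partial)
  next
    case (plus f g)
    then have "partial_deriv i (\<lambda>x. f x + g x) = (\<lambda>x. partial_deriv i f x + partial_deriv i g x)"
      by (auto simp: partial_deriv_add d)
    then show ?case using plus by (auto intro!: smooth_prods.intros)
  qed
qed (use assms in \<open>auto intro: smooth_prods.intros\<close>)

lemma smooth_sum: "(\<And>i. i \<in> A \<Longrightarrow> smooth (f i)) \<Longrightarrow> smooth (\<lambda>x. \<Sum>i\<in>A. f i x)"
  by (induction A rule: infinite_finite_induct) (auto intro!: smooth_add smooth_const)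

lemma smooth_prod: "(\<And>i. i \<in> A \<Longrightarrow> smooth (f i)) \<Longrightarrow> smooth (\<lambda>x. \<Prod>i\<in>A. f i x)"
  by (induction A rule: infinite_finite_induct) (auto intro!: smooth_mult smooth_const)

lemma smooth_translate: "smooth f \<Longrightarrow> smooth (\<lambda>x. f (x + v))"
proof (rule smooth_coinduct[of _ "{(\<lambda>x. f (x + v)) | f. smooth f}"], blast, goal_cases)
  case (1 f x)
  then show ?case
    using differentiable_chain_at[of "\<lambda>x. x + v" x] smooth_differentiable by (fastforce simp: o_def)
next
  case (2 h i)
  then obtain f where f: "h = (\<lambda>x. f (x + v))" "smooth f" by blast
  have "((\<lambda>x. f (x + v)) has_derivative (\<lambda>h. \<Sum>i\<in>UNIV. h $ i *\<^sub>R partial_deriv i f (x + v))) (at x)" for x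
    by (rule has_derivative_compose[where f = "\<lambda>x. x + v", OF _ smooth_has_derivative[OF f(2)]])
      (auto intro!: derivative_eq_intros)
  from partial_deriv_eq[OF this, of i]
  have "partial_deriv i h = (\<lambda>x. partial_deriv i f (x + v))"
    unfolding f(1)
    by (intro ext) (simp add: axis_def if_distrib[of "\<lambda>c. c *\<^sub>R _"] cong: if_cong)
  then show ?case using smooth_partial[OF f(2)] by blast
qed

lemma smooth_coord: "smooth (\<lambda>x::real^'n::finite. of_real (x $ i))"
proof (rule smooth_coinduct[of _ "insert (\<lambda>x. of_real (x $ i)) (range (\<lambda>c x. c))"])
  have D: "((\<lambda>x. complex_of_real (x $ i)) has_derivative (\<lambda>h. of_real (h $ i))) (at x)" for x :: "real^'n"
    by (intro bounded_linear_imp_has_derivative bounded_linear_compose[OF bounded_linear_of_real bounded_linear_vec_nth])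
  then show "f differentiable (at x)" if "f \<in> insert (\<lambda>x. of_real (x $ i)) (range (\<lambda>c x. c))" for f :: "real^'n \<Rightarrow> complex" and x :: "real^'n"
    using that differentiableI[OF D] by auto
  show "partial_deriv j f \<in> insert (\<lambda>x. of_real (x $ i)) (range (\<lambda>c x. c))" if "f \<in> insert (\<lambda>x. of_real (x $ i)) (range (\<lambda>c x. c))" for f :: "real^'n \<Rightarrow> complex" and j
  proof (cases "f = (\<lambda>x. of_real (x $ i))")
    case True
    then have "partial_deriv j f = (\<lambda>x. of_real (axis j 1 $ i))"
      using partial_deriv_eq[OF D] by blast
    then show ?thesis by blast
  qed (use that in auto)
qed simp

section \<open>Closure properties of the Schwartz class\<close>

lemma schwartz_differentiable: "schwartz f \<Longrightarrow> f differentiable (at x)"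
  by (intro smooth_differentiable schwartz_smooth)

lemma schwartz_cnj: "schwartz f \<Longrightarrow> schwartz (\<lambda>x. cnj (f x))"
proof (rule schwartz_coinduct[of _ "{(\<lambda>x. cnj (f x)) | f. schwartz f}"], blast, goal_cases)
  case (1 f x)
  then show ?case
    by (auto intro!: differentiable_cnj intro: schwartz_differentiable)
next
  case (2 h i)
  then obtain f where h: "h = (\<lambda>x. cnj (f x))" "schwartz f" by blast
  then have "partial_deriv i h = (\<lambda>x. cnj (partial_deriv i f x))"
    by (auto simp: partial_deriv_cnj schwartz_differentiable)
  then show ?case using schwartz_partial[OF h(2)] by blast
next
  case (3 f N)
  then show ?case by (auto dest: schwartz_decay[where N = N])
qed

lemma schwartz_add: "schwartz f \<Longrightarrow> schwartz g \<Longrightarrow> schwartz (\<lambda>x. f x + g x)"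
proof (rule schwartz_coinduct[of _ "{(\<lambda>x. f x + g x) | f g. schwartz f \<and> schwartz g}"], blast, goal_cases)
  case (1 f x)
  then show ?case by (auto intro!: differentiable_add intro: schwartz_differentiable)
next
  case (2 h i)
  then obtain f g where h: "h = (\<lambda>x. f x + g x)" "schwartz f" "schwartz g" by blast
  then have "partial_deriv i h = (\<lambda>x. partial_deriv i f x + partial_deriv i g x)"
    by (auto simp: partial_deriv_add schwartz_differentiable)
  then show ?case using schwartz_partial[OF h(2)] schwartz_partial[OF h(3)] by blast
next
  case (3 h N)
  then obtain f g where h: "h = (\<lambda>x. f x + g x)" "schwartz f" "schwartz g" by blast
  obtain A B where "\<And>x. (1 + norm x) ^ N * norm (f x) \<le> A" "\<And>x. (1 + norm x) ^ N * norm (g x) \<le> B"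
    using schwartz_decay[OF h(2), of N] schwartz_decay[OF h(3), of N] by blast
  moreover have "(1 + norm x) ^ N * norm (h x) \<le> (1 + norm x) ^ N * norm (f x) + (1 + norm x) ^ N * norm (g x)" for x
    unfolding h(1) by (simp add: distrib_left[symmetric] mult_left_mono norm_triangle_ineq)
  ultimately have "(1 + norm x) ^ N * norm (h x) \<le> A + B" for x
    by (meson add_mono order_trans)
  then show ?case by blast
qed

lemma schwartz_cmult: "schwartz f \<Longrightarrow> schwartz (\<lambda>x. c * f x)"
proof (rule schwartz_coinduct[of _ "{(\<lambda>x. c * f x) | f. schwartz f}"], blast, goal_cases)
  case (1 f x)
  then show ?case by (auto intro!: differentiable_mult intro: schwartz_differentiable)
next
  case (2 h i)
  then obtain f where h: "h = (\<lambda>x. c * f x)" "schwartz f" by blast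
  then have "partial_deriv i h = (\<lambda>x. c * partial_deriv i f x)"
    by (auto simp: partial_deriv_mult schwartz_differentiable)
  then show ?case using schwartz_partial[OF h(2)] by blast
next
  case (3 h N)
  then obtain f where h: "h = (\<lambda>x. c * f x)" "schwartz f" by blast
  obtain A where "\<And>x. (1 + norm x) ^ N * norm (f x) \<le> A"
    using schwartz_decay[OF h(2), of N] by blast
  then have "(1 + norm x) ^ N * norm (h x) \<le> norm c * A" for x
    unfolding h(1) using mult_left_mono[of _ A "norm c"] by (simp add: norm_mult mult.left_commute[of _ "norm c"])
  then show ?case by blast
qed

text \<open>Differentiating \<open>x_j f\<close> produces the extra summand f when the directions
  agree; adding an arbitrary Schwartz function g makes the set stable. Decay of order N then uses
  the decay of f of order N + 1.\<close>

lemma schwartz_coord_mult: "schwartz f \<Longrightarrow> schwartz (\<lambda>x. of_real (x $ j) * f x)"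
proof (rule schwartz_coinduct[of _ "{(\<lambda>x. of_real (x $ j) * f x + g x) | f g. schwartz f \<and> schwartz g}"], goal_cases)
  case 1
  moreover have "schwartz (\<lambda>x::real^'a. 0)" using schwartz_cmult[OF 1, of 0] by simp
  ultimately show ?case by (intro CollectI exI[of _ f] exI[of _ "\<lambda>x. 0"]) simp
next
  case (2 f x)
  then show ?case
    by (auto intro!: differentiable_mult differentiable_add intro: schwartz_differentiable smooth_differentiable smooth_coord)
next
  case (3 h i)
  then obtain f g where h: "h = (\<lambda>x. of_real (x $ j) * f x + g x)" "schwartz f" "schwartz g" by blast
  have D: "((\<lambda>x. complex_of_real (x $ j)) has_derivative (\<lambda>h. of_real (h $ j))) (at x)" for x :: "real^'a"
    by (intro bounded_linear_imp_has_derivative bounded_linear_compose[OF bounded_linear_of_real bounded_linear_vec_nth])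
  have "partial_deriv i h = (\<lambda>x. of_real (x $ j) * partial_deriv i f x + ((if j = i then 1 else 0) * f x + partial_deriv i g x))"
    unfolding h(1) using h
    by (intro ext, subst partial_deriv_add)
      (auto intro!: differentiable_mult intro: schwartz_differentiable smooth_differentiable smooth_coord
        simp: partial_deriv_mult schwartz_differentiable smooth_differentiable smooth_coord partial_deriv_eq[OF D] axis_def)
  moreover have "schwartz (\<lambda>x. (if j = i then 1 else 0) * f x + partial_deriv i g x)"
    using h by (intro schwartz_add schwartz_cmult schwartz_partial)
  ultimately show ?case using schwartz_partial[OF h(2), of i] by (intro CollectI exI conjI)
next
  case (4 h N)
  then obtain f g where h: "h = (\<lambda>x. of_real (x $ j) * f x + g x)" "schwartz f" "schwartz g" by blast
  obtain A B where A: "\<And>x. (1 + norm x) ^ (Suc N) * norm (f x) \<le> A" and B: "\<And>x. (1 + norm x) ^ N * norm (g x) \<le> B"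
    using schwartz_decay[OF h(2), of "Suc N"] schwartz_decay[OF h(3), of N] by blast
  have "(1 + norm x) ^ N * norm (h x) \<le> A + B" for x
  proof -
    have "norm (h x) \<le> (1 + norm x) * norm (f x) + norm (g x)"
      unfolding h(1) using component_le_norm_cart[of x j]
      by (intro order_trans[OF norm_triangle_ineq] add_mono) (auto simp: norm_mult intro!: mult_right_mono)
    then have "(1 + norm x) ^ N * norm (h x) \<le> (1 + norm x) ^ N * ((1 + norm x) * norm (f x) + norm (g x))"
      by (intro mult_left_mono) auto
    also have "\<dots> = (1 + norm x) ^ (Suc N) * norm (f x) + (1 + norm x) ^ N * norm (g x)"
      by (simp add: algebra_simps)
    finally show ?thesis using A[of x] B[of x] by linarith
  qed
  then show ?case by blast
qed

lemma has_derivative_cis: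
  assumes "(f has_derivative f') (at x)"
  shows "((\<lambda>x. cis (f x)) has_derivative (\<lambda>h. f' h *\<^sub>R (\<i> * cis (f x)))) (at x)"
proof -
  have "(cis has_derivative (\<lambda>h. h *\<^sub>R (\<i> * cis t))) (at t)" for t
  proof -
    have "((\<lambda>t. \<i> * of_real t) has_derivative (\<lambda>h. \<i> * of_real h)) (at t)" for t :: real
      by (intro bounded_linear_imp_has_derivative bounded_linear_compose[OF bounded_linear_mult_right bounded_linear_of_real])
    moreover have "(exp has_derivative (\<lambda>h. exp z * h)) (at z)" for z :: complex
      using DERIV_exp[of z] by (simp add: has_field_derivative_def)
    ultimately have "((\<lambda>t. exp (\<i> * of_real t)) has_derivative (\<lambda>h. exp (\<i> * of_real t) * (\<i> * of_real h))) (at t)"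
      by (rule has_derivative_compose)
    then show ?thesis by (simp add: cis_conv_exp[abs_def] scaleR_conv_of_real ac_simps)
  qed
  from has_derivative_compose[OF assms this] show ?thesis .
qed

lemma has_derivative_cis_inner:
  fixes \<xi> :: "'a::euclidean_space"
  shows "((\<lambda>x. cis (- (x \<bullet> \<xi>))) has_derivative (\<lambda>h. (- (h \<bullet> \<xi>)) *\<^sub>R (\<i> * cis (- (x \<bullet> \<xi>))))) (at x)"
  by (rule has_derivative_cis) (auto intro!: derivative_eq_intros)

lemma partial_deriv_cis_mult:
  assumes "f differentiable (at x)"
  shows "partial_deriv i (\<lambda>x. cis (- (x \<bullet> \<xi>)) * f x) x =
    cis (- (x \<bullet> \<xi>)) * (partial_deriv i f x + (- (\<i> * of_real (\<xi> $ i))) * f x)"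
proof -
  have "partial_deriv i (\<lambda>x. cis (- (x \<bullet> \<xi>))) x = - (of_real (\<xi> $ i) * (\<i> * cis (- (x \<bullet> \<xi>))))"
    by (subst partial_deriv_eq[OF has_derivative_cis_inner]) (simp add: inner_axis' scaleR_conv_of_real)
  then show ?thesis
    by (subst partial_deriv_mult[OF differentiableI[OF has_derivative_cis_inner] assms]) (simp add: algebra_simps)
qed

lemma schwartz_cis_mult: "schwartz f \<Longrightarrow> schwartz (\<lambda>x. cis (- (x \<bullet> \<xi>)) * f x)"
proof (rule schwartz_coinduct[of _ "{(\<lambda>x. cis (- (x \<bullet> \<xi>)) * f x) | f. schwartz f}"], blast, goal_cases)
  case (1 f x)
  then obtain g where g: "f = (\<lambda>x. cis (- (x \<bullet> \<xi>)) * g x)" "schwartz g" by blast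
  show ?case unfolding g(1)
    by (intro differentiable_mult differentiableI[OF has_derivative_cis_inner] schwartz_differentiable g)
next
  case (2 h i)
  then obtain f where h: "h = (\<lambda>x. cis (- (x \<bullet> \<xi>)) * f x)" "schwartz f" by blast
  have "partial_deriv i h = (\<lambda>x. cis (- (x \<bullet> \<xi>)) * (partial_deriv i f x + (- (\<i> * of_real (\<xi> $ i))) * f x))"
    unfolding h(1) by (intro ext partial_deriv_cis_mult schwartz_differentiable h)
  then show ?case using schwartz_add[OF schwartz_partial[OF h(2), of i] schwartz_cmult[OF h(2), of "- (\<i> * of_real (\<xi> $ i))"]]
    by (intro CollectI exI conjI)
next
  case (3 h N)
  then obtain f where h: "h = (\<lambda>x. cis (- (x \<bullet> \<xi>)) * f x)" "schwartz f" by blast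
  show ?case unfolding h(1) using schwartz_decay[OF h(2), of N] by (simp add: norm_mult)
qed

lemma schwartz_reflect: "schwartz f \<Longrightarrow> schwartz (\<lambda>x. f (- x))"
proof (rule schwartz_coinduct[of _ "{(\<lambda>x. f (- x)) | f. schwartz f}"], blast, goal_cases)
  case (1 f x)
  then show ?case
    using differentiable_chain_at[of "\<lambda>x. - x" x] schwartz_differentiable by (fastforce simp: o_def)
next
  case (2 h i)
  then obtain f where f: "h = (\<lambda>x. f (- x))" "schwartz f" by blast
  have "((\<lambda>x. f (- x)) has_derivative (\<lambda>h. \<Sum>i\<in>UNIV. (- h) $ i *\<^sub>R partial_deriv i f (- x))) (at x)" for x
    by (rule has_derivative_compose[where f = "\<lambda>x. - x", OF _ smooth_has_derivative[OF schwartz_smooth[OF f(2)]]])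
      (auto intro!: derivative_eq_intros)
  from partial_deriv_eq[OF this, of i]
  have P: "partial_deriv i h x = (\<Sum>j\<in>UNIV. (- axis i 1) $ j *\<^sub>R partial_deriv j f (- x))" for x
    unfolding f(1) .
  have "(- axis i 1) $ j *\<^sub>R partial_deriv j f (- x) = (if j = i then - partial_deriv i f (- x) else 0)" for x j
    by (simp add: axis_def)
  then have "partial_deriv i h = (\<lambda>x. (-1) * partial_deriv i f (- x))"
    unfolding P[abs_def] by simp
  then show ?case using schwartz_cmult[OF schwartz_partial[OF f(2), of i], of "-1"]
    by (intro CollectI exI conjI)
next
  case (3 h N)
  then obtain f where f: "h = (\<lambda>x. f (- x))" "schwartz f" by blast
  obtain A where "\<And>x. (1 + norm x) ^ N * norm (f x) \<le> A"
    using schwartz_decay[OF f(2), of N] by blast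
  from this[of "- _"] show ?case unfolding f(1) by (auto intro!: exI[of _ A])
qed

section \<open>Test functions\<close>

lemma test_fun_partial:
  assumes "test_fun U f" shows "test_fun U (partial_deriv i f)"
proof -
  let ?S = "closure {x. f x \<noteq> 0}"
  have "{x. partial_deriv i f x \<noteq> 0} \<subseteq> ?S"
  proof (rule ccontr)
    assume "\<not> ?thesis"
    then obtain x where x: "partial_deriv i f x \<noteq> 0" "x \<in> - ?S" by blast
    have "(f has_derivative (\<lambda>h. 0)) (at x)"
    proof (rule has_derivative_transform_within_open[of "\<lambda>x. 0" _ _ _ "- ?S"])
      show "open (- ?S)" by (simp add: open_Compl)
      show "0 = f y" if "y \<in> - ?S" for y
        using that closure_subset[of "{x. f x \<noteq> 0}"] by auto
    qed (use x in auto)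
    from partial_deriv_eq[OF this] x show False by simp
  qed
  then have sub: "closure {x. partial_deriv i f x \<noteq> 0} \<subseteq> ?S"
    by (simp add: closure_minimal)
  moreover have "compact ?S" using assms by (simp only: test_fun_def)
  ultimately have "compact (closure {x. partial_deriv i f x \<noteq> 0})"
    using compact_Int_closed[OF _ closed_closure] by (metis inf.absorb_iff2)
  with sub show ?thesis using assms smooth_partial[of f i] unfolding test_fun_def by blast
qed

lemma test_fun_partials: "test_fun U f \<Longrightarrow> test_fun U (partials is f)"
  by (induction "is") (auto intro: test_fun_partial)

lemma test_fun_smooth: "test_fun U f \<Longrightarrow> smooth f"
  by (simp add: test_fun_def)

lemma test_fun_support: "test_fun U f \<Longrightarrow> x \<notin> U \<Longrightarrow> f x = 0"
  unfolding test_fun_def using closure_subset[of "{x. f x \<noteq> 0}"] by blast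

lemma test_fun_schwartz:
  assumes "test_fun U f" shows "schwartz f"
proof (rule schwartz_coinduct[of _ "{f. test_fun U f}"])
  fix f and N :: nat assume "f \<in> {f. test_fun U f}"
  then have f: "test_fun U f" by simp
  have "continuous_on (closure {x. f x \<noteq> 0}) (\<lambda>x. (1 + norm x) ^ N * norm (f x))"
    by (intro continuous_intros smooth_continuous_on) (use f in \<open>simp add: test_fun_def\<close>)
  then have "bounded ((\<lambda>x. (1 + norm x) ^ N * norm (f x)) ` closure {x. f x \<noteq> 0})"
    using f compact_continuous_image compact_imp_bounded unfolding test_fun_def by blast
  then obtain B where B: "\<And>x. x \<in> closure {x. f x \<noteq> 0} \<Longrightarrow> (1 + norm x) ^ N * norm (f x) \<le> B" "B > 0"
    unfolding bounded_pos by fastforce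
  have "(1 + norm x) ^ N * norm (f x) \<le> B" for x
  proof (cases "f x = 0")
    case False
    then show ?thesis using closure_subset[of "{x. f x \<noteq> 0}"] by (intro B) auto
  qed (use B in auto)
  then show "\<exists>B. \<forall>x. (1 + norm x) ^ N * norm (f x) \<le> B" by blast
next
  show "partial_deriv i f \<in> {f. test_fun U f}" if "f \<in> {f. test_fun U f}" for f i
    using that test_fun_partial by blast
  show "f differentiable (at x)" if "f \<in> {f. test_fun U f}" for f x
    using that smooth_differentiable test_fun_smooth by blast
qed (use assms in simp)

lemma test_funI:
  assumes "smooth f" "compact K" "K \<subseteq> U" "\<And>x. x \<notin> K \<Longrightarrow> f x = 0"
  shows "test_fun U f"
proof -
  have "closure {x. f x \<noteq> 0} \<subseteq> K"
    using assms by (intro closure_minimal) (auto simp: compact_imp_closed)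
  moreover from this have "compact (closure {x. f x \<noteq> 0})"
    using compact_Int_closed[OF \<open>compact K\<close> closed_closure] by (metis inf.absorb_iff2)
  ultimately show ?thesis using assms unfolding test_fun_def by blast
qed

lemma test_fun_cnj: "test_fun U f \<Longrightarrow> test_fun U (\<lambda>x. cnj (f x))"
  unfolding test_fun_def by (auto intro: smooth_cnj)

lemma test_fun_mult: "test_fun U f \<Longrightarrow> smooth g \<Longrightarrow> test_fun U (\<lambda>x. f x * g x)"
  by (rule test_funI[of _ "closure {x. f x \<noteq> 0}"])
    (use closure_subset[of "{x. f x \<noteq> 0}"] in \<open>auto simp: test_fun_def intro!: smooth_mult\<close>)

section \<open>The Fourier transform of Schwartz functions\<close>

lemma nn_integral_lborel_affine:
  fixes f :: "'a::euclidean_space \<Rightarrow> ennreal"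
  assumes [measurable]: "f \<in> borel_measurable borel" and c: "c \<noteq> 0"
  shows "(\<integral>\<^sup>+x. f x \<partial>lborel) = ennreal (\<bar>c\<bar> ^ DIM('a)) * (\<integral>\<^sup>+x. f (t + c *\<^sub>R x) \<partial>lborel)"
  by (subst lborel_affine[OF c, of t])
    (simp add: nn_integral_density nn_integral_distr nn_integral_cmult ennreal_power)

lemma integrable_lborel_affine:
  fixes f :: "'a::euclidean_space \<Rightarrow> 'b::{banach, second_countable_topology}"
  assumes f: "integrable lborel f" and c: "c \<noteq> 0"
  shows "integrable lborel (\<lambda>x. f (t + c *\<^sub>R x))"
proof -
  have [measurable]: "f \<in> borel_measurable borel" using f by auto
  have "(\<integral>\<^sup>+x. norm (f x) \<partial>lborel) = ennreal (\<bar>c\<bar> ^ DIM('a)) * (\<integral>\<^sup>+x. norm (f (t + c *\<^sub>R x)) \<partial>lborel)"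
    using nn_integral_lborel_affine[OF _ c, of "\<lambda>x. ennreal (norm (f x))" t] by (simp add: ennreal_power)
  then show ?thesis using f c unfolding integrable_iff_bounded
    by (auto simp: ennreal_mult_less_top)
qed

lemma LINT_lborel_affine:
  fixes f :: "'a::euclidean_space \<Rightarrow> 'b::{banach, second_countable_topology}"
  assumes [measurable]: "f \<in> borel_measurable borel" and c: "c \<noteq> 0"
  shows "(LINT x|lborel. f x) = \<bar>c\<bar> ^ DIM('a) *\<^sub>R (LINT x|lborel. f (t + c *\<^sub>R x))"
  by (subst lborel_affine[OF c, of t])
    (simp add: integral_density integral_distr)

lemma LINT_lborel_translate:
  fixes f :: "'a::euclidean_space \<Rightarrow> 'b::{banach, second_countable_topology}"
  assumes "f \<in> borel_measurable borel"
  shows "(LINT x|lborel. f (x + t)) = (LINT x|lborel. f x)"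
  using LINT_lborel_affine[OF assms, of 1 t] by (simp add: add.commute)

lemma LINT_lborel_reflect:
  fixes f :: "'a::euclidean_space \<Rightarrow> 'b::{banach, second_countable_topology}"
  assumes "f \<in> borel_measurable borel"
  shows "(LINT x|lborel. f (- x)) = (LINT x|lborel. f x)"
  using LINT_lborel_affine[OF assms, of "-1" 0] by simp

text \<open>Lebesgue measure on \<open>real^'n\<close> is the image of a product measure indexed by
  \<open>Basis\<close> instead of the index type. The factors are therefore transported along the
  bijection sending i to \<open>axis i 1\<close>, whose inverse is the choice inside
  \<open>G\<close>.\<close>

lemma
  fixes F :: "'n::finite \<Rightarrow> real \<Rightarrow> 'b::{real_normed_field,banach,second_countable_topology}"
  assumes F: "\<And>i. integrable lborel (F i)"
  shows integrable_prod_coord: "integrable lborel (\<lambda>x::real^'n. \<Prod>i\<in>UNIV. F i (x $ i))"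
    and LINT_prod_coord: "(LINT x|lborel. (\<Prod>i\<in>UNIV. F i ((x::real^'n) $ i))) = (\<Prod>i\<in>UNIV. (LINT t|lborel. F i t))"
proof -
  interpret product_sigma_finite "\<lambda>_::real^'n. lborel :: real measure"
    by standard
  define G where "G b = F (SOME i. axis i 1 = b)" for b :: "real^'n"
  have bij: "bij_betw (\<lambda>i. axis i (1::real)) UNIV (Basis :: (real^'n) set)"
    by (auto simp: bij_betw_def inj_on_def axis_eq_axis Basis_vec_def)
  have G: "G (axis i 1) = F i" for i
    unfolding G_def by (rule arg_cong[of _ _ F], rule some_equality) (auto simp: axis_eq_axis)
  have prod_eq: "(\<Prod>i\<in>UNIV. H (axis i (1::real))) = (\<Prod>b\<in>Basis. H b)" for H :: "real^'n \<Rightarrow> 'b"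
    using prod.reindex_bij_betw[OF bij, of H] .
  have 1: "(\<Prod>i\<in>UNIV. F i (x $ i)) = (\<Prod>b\<in>Basis. G b (x \<bullet> b))" for x :: "real^'n"
    using prod_eq[of "\<lambda>b. G b (x \<bullet> b)"] by (simp add: G inner_axis)
  have [measurable]: "\<And>i. F i \<in> borel_measurable borel" using F by auto
  have intG: "integrable lborel (G b)" for b using F by (simp add: G_def)
  have 2: "(\<Prod>b\<in>Basis. G b ((\<Sum>b\<in>Basis. f b *\<^sub>R b) \<bullet> b)) = (\<Prod>b\<in>Basis. G b (f b))" for f :: "real^'n \<Rightarrow> real"
  proof (intro prod.cong refl)
    fix b :: "real^'n" assume "b \<in> Basis"
    then show "G b ((\<Sum>b\<in>Basis. f b *\<^sub>R b) \<bullet> b) = G b (f b)"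
      by (simp add: inner_sum_left_Basis)
  qed
  have [measurable]: "(\<lambda>f. \<Sum>b\<in>Basis. f b *\<^sub>R b) \<in> (\<Pi>\<^sub>M b\<in>Basis. lborel) \<rightarrow>\<^sub>M (borel :: (real^'n) measure)"
    by measurable
  have [measurable]: "(\<lambda>x::real^'n. \<Prod>i\<in>UNIV. F i (x $ i)) \<in> borel_measurable borel"
    by measurable
  have m: "(\<lambda>x::real^'n. \<Prod>b\<in>Basis. G b (x \<bullet> b)) \<in> borel_measurable borel"
    unfolding 1[symmetric] by measurable
  show "integrable lborel (\<lambda>x::real^'n. \<Prod>i\<in>UNIV. F i (x $ i))"
    unfolding 1 
    by (subst lborel_eq, subst integrable_distr_eq) (use m in \<open>simp_all add: 2 product_integrable_prod intG\<close>)
  have "(LINT x|lborel. (\<Prod>b\<in>Basis. G b ((x::real^'n) \<bullet> b))) = (\<Prod>b\<in>Basis. (LINT t|lborel. G b t))"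
    by (subst lborel_eq, subst integral_distr) (use m in \<open>simp_all add: 2 product_integral_prod intG\<close>)
  then show "(LINT x|lborel. (\<Prod>i\<in>UNIV. F i ((x::real^'n) $ i))) = (\<Prod>i\<in>UNIV. (LINT t|lborel. F i t))"
    unfolding 1 using prod_eq[of "\<lambda>b. LINT t|lborel. G b t"] by (simp add: G)
qed

text \<open>Each \<open>1 + (x $ i)^2\<close> is at most \<open>(1 + norm x)^2\<close>, so the power
  \<open>2 * CARD('n)\<close> is dominated by a product of one-dimensional Cauchy densities. This
  explains the exponent in the decay estimates below.\<close>

lemma integrable_decay: "integrable lborel (\<lambda>x::real^'n::finite. 1 / (1 + norm x) ^ (2 * CARD('n)))"
proof (rule Bochner_Integration.integrable_bound)
  have "einterval (-\<infinity>) \<infinity> = UNIV" by (auto simp: einterval_iff)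
  then have "integrable lborel (\<lambda>x::real. inverse (1 + x\<^sup>2))"
    using integrable_inverse_1_plus_square by (simp add: set_integrable_def)
  then show "integrable lborel (\<lambda>x::real^'n. \<Prod>i\<in>UNIV. inverse (1 + (x $ i)\<^sup>2))"
    by (intro integrable_prod_coord)
  have "norm (1 / (1 + norm x) ^ (2 * CARD('n))) \<le> norm (\<Prod>i\<in>UNIV. inverse (1 + (x $ i)\<^sup>2))" for x :: "real^'n"
  proof -
    have "1 / (1 + norm x) ^ (2 * CARD('n)) = (\<Prod>i\<in>(UNIV::'n set). inverse ((1 + norm x)\<^sup>2))"
      by (simp add: power_mult power_inverse[symmetric] inverse_eq_divide[symmetric])
    also have "\<dots> \<le> (\<Prod>i\<in>UNIV. inverse (1 + (x $ i)\<^sup>2))"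
    proof (intro prod_mono conjI le_imp_inverse_le)
      fix i
      have "(x $ i)\<^sup>2 \<le> (norm x)\<^sup>2"
        using component_le_norm_cart[of x i] by (metis abs_ge_zero power2_abs power_mono)
      then show "1 + (x $ i)\<^sup>2 \<le> (1 + norm x)\<^sup>2"
        using norm_ge_zero[of x] unfolding power2_sum by (simp add: add_increasing2)
    qed (auto intro: add_pos_nonneg)
    finally show ?thesis by (simp add: prod_nonneg)
  qed
  then show "AE x in lborel. norm (1 / (1 + norm (x::real^'n)) ^ (2 * CARD('n))) \<le> norm (\<Prod>i\<in>UNIV. inverse (1 + (x $ i)\<^sup>2))"
    by simp
qed measurable

lemma integrable_of_decay:
  fixes f :: "real^'n::finite \<Rightarrow> 'b::{banach, second_countable_topology}"
  assumes "f \<in> borel_measurable borel" "\<And>x. (1 + norm x) ^ (2 * CARD('n)) * norm (f x) \<le> B"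
  shows "integrable lborel f"
proof (rule Bochner_Integration.integrable_bound)
  show "integrable lborel (\<lambda>x::real^'n. B * (1 / (1 + norm x) ^ (2 * CARD('n))))"
    by (intro integrable_mult_right integrable_decay)
  have "norm (f x) \<le> norm (B * (1 / (1 + norm x) ^ (2 * CARD('n))))" for x
  proof -
    have "norm (f x) \<le> B / (1 + norm x) ^ (2 * CARD('n))"
      using assms(2)[of x] by (simp add: pos_le_divide_eq add_pos_nonneg mult.commute)
    also have "\<dots> \<le> norm (B * (1 / (1 + norm x) ^ (2 * CARD('n))))"
      by (simp add: divide_right_mono)
    finally show ?thesis .
  qed
  then show "AE x in lborel. norm (f x) \<le> norm (B * (1 / (1 + norm x) ^ (2 * CARD('n))))"
    by simp
qed (use assms in simp)

lemma schwartz_borel: "schwartz f \<Longrightarrow> f \<in> borel_measurable borel"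
  by (intro smooth_borel schwartz_smooth)

lemma schwartz_integrable: 
  fixes f :: "real^'n::finite \<Rightarrow> complex"
  assumes "schwartz f" shows "integrable lborel f"
proof -
  obtain B where "\<And>x. (1 + norm x) ^ (2 * CARD('n)) * norm (f x) \<le> B"
    using schwartz_decay[OF assms] by blast
  then show ?thesis by (rule integrable_of_decay[OF schwartz_borel[OF assms]])
qed

lemma schwartz_bound:
  assumes "schwartz f" shows "\<exists>B\<ge>0. \<forall>x. norm (f x) \<le> B / (1 + norm x) ^ N"
proof -
  obtain B where B: "\<And>x. (1 + norm x) ^ N * norm (f x) \<le> B"
    using schwartz_decay[OF assms] by blast
  have "B \<ge> 0" using B[of 0] norm_ge_zero[of "f 0"] by (simp del: norm_ge_zero)
  moreover have "norm (f x) \<le> B / (1 + norm x) ^ N" for x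
    using B[of x] by (simp add: pos_le_divide_eq add_pos_nonneg mult.commute)
  ultimately show ?thesis by blast
qed

lemma norm_partial_sum_le:
  fixes p :: "'n::finite \<Rightarrow> complex"
  assumes "\<And>i. norm (p i) \<le> B i"
  shows "norm (\<Sum>i\<in>UNIV. h $ i *\<^sub>R p i) \<le> norm h * (\<Sum>i\<in>UNIV. B i)"
proof -
  have "norm (\<Sum>i\<in>UNIV. h $ i *\<^sub>R p i) \<le> (\<Sum>i\<in>UNIV. norm h * B i)"
    using assms component_le_norm_cart[of h]
    by (intro sum_norm_le) (auto intro!: mult_mono)
  then show ?thesis by (simp add: sum_distrib_left)
qed

lemma bounded_linear_partial_sum:
  "bounded_linear (\<lambda>h. \<Sum>i\<in>UNIV. h $ i *\<^sub>R (p i :: complex))"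
  by (intro bounded_linear_sum bounded_linear_scaleR_left[THEN bounded_linear_compose] bounded_linear_vec_nth)

lemma segment_decay:
  fixes x y :: "'a::real_normed_vector"
  assumes "norm (y - x) \<le> 1"
  shows "1 / (1 + norm y) ^ N \<le> 2 ^ N / (1 + norm x) ^ N"
proof -
  have "norm x \<le> norm y + 1"
    using norm_triangle_ineq2[of x y] assms by (simp add: norm_minus_commute)
  then have "1 + norm x \<le> 2 * (1 + norm y)" using norm_ge_zero[of y] unfolding distrib_left by linarith
  then have "(1 + norm x) ^ N \<le> 2 ^ N * (1 + norm y) ^ N"
    unfolding power_mult_distrib[symmetric] by (intro power_mono) auto
  then show ?thesis
    by (simp add: pos_divide_le_eq pos_le_divide_eq add_pos_nonneg mult.commute)
qed

text \<open>Along a segment of length at most 1 the weights \<open>(1 + norm y) ^ N\<close> are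
  comparable with the one at its end point (\<open>segment_decay\<close>), so the decay of the
  gradient survives the mean value inequality.\<close>

lemma schwartz_lipschitz:
  fixes f :: "real^'n::finite \<Rightarrow> complex"
  assumes f: "schwartz f"
  shows "\<exists>B\<ge>0. \<forall>x h. norm h \<le> 1 \<longrightarrow> norm (f (x + h) - f x) \<le> norm h * (B / (1 + norm x) ^ N)"
proof -
  have "\<forall>i. \<exists>B\<ge>0. \<forall>x. norm (partial_deriv i f x) \<le> B / (1 + norm x) ^ N"
    using schwartz_bound schwartz_partial f by blast
  from choice[OF this] obtain B where "\<forall>i. B i \<ge> 0 \<and> (\<forall>x. norm (partial_deriv i f x) \<le> B i / (1 + norm x) ^ N)" ..
  then have B: "\<And>i. B i \<ge> 0" "\<And>i x. norm (partial_deriv i f x) \<le> B i / (1 + norm x) ^ N" by simp_all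
  have "norm (f (x + h) - f x) \<le> norm h * ((\<Sum>i\<in>UNIV. B i) * 2 ^ N / (1 + norm x) ^ N)" if h: "norm h \<le> 1" for x h
  proof -
    have "norm (f (x + h) - f x) \<le> ((\<Sum>i\<in>UNIV. B i) * 2 ^ N / (1 + norm x) ^ N) * norm (x + h - x)"
    proof (rule differentiable_bound[of "closed_segment x (x + h)" f "\<lambda>y h. \<Sum>i\<in>UNIV. h $ i *\<^sub>R partial_deriv i f y"])
      fix y assume y: "y \<in> closed_segment x (x + h)"
      show "(f has_derivative (\<lambda>h. \<Sum>i\<in>UNIV. h $ i *\<^sub>R partial_deriv i f y)) (at y within closed_segment x (x + h))"
        by (rule has_derivative_at_withinI[OF smooth_has_derivative[OF schwartz_smooth[OF f]]])
      have "norm (y - x) \<le> 1" using segment_bound1[OF y] h by simp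
      from segment_decay[OF this, of N] have d: "1 / (1 + norm y) ^ N \<le> 2 ^ N / (1 + norm x) ^ N" .
      have "norm (partial_deriv i f y) \<le> B i * (2 ^ N / (1 + norm x) ^ N)" for i
        using B(2)[of i y] mult_left_mono[OF d B(1)[of i]] by simp
      from norm_partial_sum_le[of "\<lambda>i. partial_deriv i f y", OF this]
      show "onorm (\<lambda>h. \<Sum>i\<in>UNIV. h $ i *\<^sub>R partial_deriv i f y) \<le> (\<Sum>i\<in>UNIV. B i) * 2 ^ N / (1 + norm x) ^ N"
        by (intro onorm_le) (simp add: sum_distrib_right[symmetric] sum_divide_distrib[symmetric] mult.commute)
    qed auto
    then show ?thesis by (simp add: mult.commute)
  qed
  moreover have "(\<Sum>i\<in>UNIV. B i) * 2 ^ N \<ge> 0" using B by (simp add: sum_nonneg)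
  ultimately show ?thesis by blast
qed

text \<open>The Lipschitz bound for the gradient, linearised along the segment. Uniform in x and
  with decay, this is the quadratic remainder that \<open>has_derivative_LINT\<close> asks
  for.\<close>

lemma schwartz_taylor:
  fixes f :: "real^'n::finite \<Rightarrow> complex"
  assumes f: "schwartz f"
  shows "\<exists>B\<ge>0. \<forall>x h. norm h \<le> 1 \<longrightarrow>
    norm (f (x + h) - f x - (\<Sum>i\<in>UNIV. h $ i *\<^sub>R partial_deriv i f x)) \<le> (norm h)\<^sup>2 * (B / (1 + norm x) ^ N)"
proof -
  have "\<forall>i. \<exists>B\<ge>0. \<forall>x h. norm h \<le> 1 \<longrightarrow> norm (partial_deriv i f (x + h) - partial_deriv i f x) \<le> norm h * (B / (1 + norm x) ^ N)"
    using schwartz_lipschitz schwartz_partial f by blast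
  from choice[OF this] obtain B where "\<forall>i. B i \<ge> 0 \<and>
      (\<forall>x h. norm h \<le> 1 \<longrightarrow> norm (partial_deriv i f (x + h) - partial_deriv i f x) \<le> norm h * (B i / (1 + norm x) ^ N))" ..
  then have B: "\<And>i. B i \<ge> 0"
      "\<And>i x h. norm h \<le> 1 \<Longrightarrow> norm (partial_deriv i f (x + h) - partial_deriv i f x) \<le> norm h * (B i / (1 + norm x) ^ N)"
    by simp_all
  let ?D = "\<lambda>y h. \<Sum>i\<in>UNIV. h $ i *\<^sub>R partial_deriv i f y"
  have "norm (f (x + h) - f x - ?D x h) \<le> (norm h)\<^sup>2 * ((\<Sum>i\<in>UNIV. B i) / (1 + norm x) ^ N)" if h: "norm h \<le> 1" for x h
  proof -
    have "norm (f (x + h) - f x - ?D x (x + h - x)) \<le> norm (x + h - x) * (norm h * ((\<Sum>i\<in>UNIV. B i) / (1 + norm x) ^ N))"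
    proof (rule differentiable_bound_linearization[of _ _ "closed_segment x (x + h)"])
      fix y assume y: "y \<in> closed_segment x (x + h)"
      show "(f has_derivative ?D y) (at y within closed_segment x (x + h))"
        by (rule has_derivative_at_withinI[OF smooth_has_derivative[OF schwartz_smooth[OF f]]])
      have yx: "norm (y - x) \<le> norm h" using segment_bound1[OF y] by simp
      have "norm (partial_deriv i f y - partial_deriv i f x) \<le> norm h * (B i / (1 + norm x) ^ N)" for i
        using B(2)[of "y - x" i x] yx h B(1)[of i] mult_right_mono[OF yx, of "B i / (1 + norm x) ^ N"]
        by (simp add: divide_nonneg_nonneg)
      from norm_partial_sum_le[of "\<lambda>i. partial_deriv i f y - partial_deriv i f x", OF this]
      show "onorm (?D y - ?D x) \<le> norm h * ((\<Sum>i\<in>UNIV. B i) / (1 + norm x) ^ N)"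
        unfolding fun_diff_def sum_subtractf[symmetric] scaleR_diff_right[symmetric]
        by (intro onorm_le) (simp add: sum_distrib_left sum_divide_distrib sum_distrib_right mult_ac)
        next
      fix t :: real assume "t \<in> {0..1}"
      then show "x + t *\<^sub>R (x + h - x) \<in> closed_segment x (x + h)"
        unfolding in_segment by (intro exI[of _ t]) (auto simp: algebra_simps)
    qed simp
    then show ?thesis by (simp add: power2_eq_square mult.assoc)
  qed
  moreover have "(\<Sum>i\<in>UNIV. B i) \<ge> 0" using B by (simp add: sum_nonneg)
  ultimately show ?thesis by blast
qed

section \<open>Differentiation under the integral sign\<close>

lemma norm_LINT_le:
  fixes f :: "'a \<Rightarrow> 'b::{banach, second_countable_topology}"
  assumes "integrable M f" "integrable M g" "\<And>x. x \<in> space M \<Longrightarrow> norm (f x) \<le> g x"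
  shows "norm (LINT x|M. f x) \<le> (LINT x|M. g x)"
  by (rule order_trans[OF integral_norm_bound integral_mono]) (use assms in auto)

text \<open>A quadratic remainder estimate is enough here, since all integrands below are smooth; it
  replaces the usual domination of the derivative.\<close>

lemma has_derivative_LINT:
  fixes f :: "real^'n::finite \<Rightarrow> 'a \<Rightarrow> complex"
  assumes f: "\<And>y. integrable M (f y)" and d: "\<And>i. integrable M (d i)" and B: "integrable M B"
    and bound: "\<And>h \<omega>. norm h \<le> 1 \<Longrightarrow>
      norm (f (x + h) \<omega> - f x \<omega> - (\<Sum>i\<in>UNIV. h $ i *\<^sub>R d i \<omega>)) \<le> (norm h)\<^sup>2 * B \<omega>"
  shows "((\<lambda>y. LINT \<omega>|M. f y \<omega>) has_derivative (\<lambda>h. \<Sum>i\<in>UNIV. h $ i *\<^sub>R (LINT \<omega>|M. d i \<omega>))) (at x)"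
proof (rule has_derivativeI_sandwich[of 1 _ _ _ _ "\<lambda>y. norm (y - x) * (LINT \<omega>|M. B \<omega>)"])
  fix y assume y: "y \<noteq> x" "dist y x < 1"
  define h where "h = y - x"
  have h: "norm h \<le> 1" "norm h > 0" "y = x + h" using y by (auto simp: h_def dist_norm)
  have "(LINT \<omega>|M. f y \<omega>) - (LINT \<omega>|M. f x \<omega>) - (\<Sum>i\<in>UNIV. h $ i *\<^sub>R (LINT \<omega>|M. d i \<omega>))
      = (LINT \<omega>|M. f (x + h) \<omega> - f x \<omega> - (\<Sum>i\<in>UNIV. h $ i *\<^sub>R d i \<omega>))"
    unfolding h(3) using f d by simp
  also have "norm \<dots> \<le> (LINT \<omega>|M. (norm h)\<^sup>2 * B \<omega>)"
    by (rule norm_LINT_le) (use f d B bound h in auto)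
  also have "\<dots> = (norm h)\<^sup>2 * (LINT \<omega>|M. B \<omega>)" by simp
  finally show "norm ((LINT \<omega>|M. f y \<omega>) - (LINT \<omega>|M. f x \<omega>) - (\<Sum>i\<in>UNIV. (y - x) $ i *\<^sub>R (LINT \<omega>|M. d i \<omega>))) / norm (y - x)
     \<le> norm (y - x) * (LINT \<omega>|M. B \<omega>)"
    using h unfolding h_def[symmetric] by (simp add: divide_simps power2_eq_square mult.commute mult.left_commute)
next
  have "((\<lambda>y. norm (y - x) * (LINT \<omega>|M. B \<omega>)) \<longlongrightarrow> norm (x - x) * (LINT \<omega>|M. B \<omega>)) (at x)"
    by (intro tendsto_intros)
  then show "((\<lambda>y. norm (y - x) * (LINT \<omega>|M. B \<omega>)) \<longlongrightarrow> 0) (at x)" by simp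
qed (auto intro: bounded_linear_partial_sum)

text \<open>The integral of a translate \<open>f (x + y)\<close> does not depend on y. Its
  derivative in y is thus zero, and by differentiation under the integral sign it is also given by
  the integrals of the partial derivatives.\<close>

lemma LINT_partial_deriv:
  fixes f :: "real^'n::finite \<Rightarrow> complex"
  assumes f: "schwartz f"
  shows "(LINT x|lborel. partial_deriv i f x) = 0"
proof -
  obtain B where B: "\<And>x h. norm h \<le> 1 \<Longrightarrow>
    norm (f (x + h) - f x - (\<Sum>i\<in>UNIV. h $ i *\<^sub>R partial_deriv i f x)) \<le> (norm h)\<^sup>2 * (B / (1 + norm x) ^ (2 * CARD('n)))"
    using schwartz_taylor[OF f] by blast
  have "((\<lambda>y. LINT x|lborel. f (x + y)) has_derivative (\<lambda>h. \<Sum>i\<in>UNIV. h $ i *\<^sub>R (LINT x|lborel. partial_deriv i f x))) (at 0)"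
  proof (rule has_derivative_LINT[where f = "\<lambda>y x. f (x + y)" and B = "\<lambda>x. B / (1 + norm x) ^ (2 * CARD('n))"])
    show "integrable lborel (\<lambda>x. f (x + y))" for y
      using integrable_lborel_affine[OF schwartz_integrable[OF f], of 1 y] by (simp add: add.commute)
    show "integrable lborel (\<lambda>x::real^'n. B / (1 + norm x) ^ (2 * CARD('n)))"
      using integrable_mult_right[OF integrable_decay, of B] by (simp only: times_divide_eq_right mult_1_right)
  qed (use B f in \<open>auto intro: schwartz_integrable schwartz_partial\<close>)
  moreover have "(\<lambda>y. LINT x|lborel. f (x + y)) = (\<lambda>y. LINT x|lborel. f x)"
    by (intro ext LINT_lborel_translate schwartz_borel f)
  ultimately have "((\<lambda>y::real^'n. LINT x|lborel. f x) has_derivative (\<lambda>h. \<Sum>i\<in>UNIV. h $ i *\<^sub>R (LINT x|lborel. partial_deriv i f x))) (at 0)"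
    by simp
  from has_derivative_unique[OF this has_derivative_const]
  have "(\<Sum>j\<in>UNIV. axis i 1 $ j *\<^sub>R (LINT x|lborel. partial_deriv j f x)) = 0" by meson
  moreover have "axis i 1 $ j *\<^sub>R (LINT x|lborel. partial_deriv j f x) = (if j = i then LINT x|lborel. partial_deriv i f x else 0)" for j
    by (simp add: axis_def)
  ultimately show ?thesis by simp
qed

lemma schwartz_cis_mult_pos: "schwartz f \<Longrightarrow> schwartz (\<lambda>x. cis (x \<bullet> \<xi>) * f x)"
  using schwartz_cis_mult[of f "- \<xi>"] by simp

lemma fourier_norm_le:
  assumes "schwartz f" shows "norm (fourier f \<xi>) \<le> (LINT x|lborel. norm (f x))"
  unfolding fourier_def
  using integral_norm_bound[of lborel "\<lambda>x. cis (- (x \<bullet> \<xi>)) * f x"] by (simp add: norm_mult)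

lemma fourier_partial_deriv:
  assumes f: "schwartz f"
  shows "fourier (partial_deriv i f) \<xi> = \<i> * of_real (\<xi> $ i) * fourier f \<xi>"
proof -
  have eq: "partial_deriv i (\<lambda>x. cis (- (x \<bullet> \<xi>)) * f x) =
      (\<lambda>x. cis (- (x \<bullet> \<xi>)) * partial_deriv i f x - (\<i> * of_real (\<xi> $ i)) * (cis (- (x \<bullet> \<xi>)) * f x))"
  proof
    fix x
    show "partial_deriv i (\<lambda>x. cis (- (x \<bullet> \<xi>)) * f x) x =
      cis (- (x \<bullet> \<xi>)) * partial_deriv i f x - (\<i> * of_real (\<xi> $ i)) * (cis (- (x \<bullet> \<xi>)) * f x)"
      unfolding partial_deriv_cis_mult[OF schwartz_differentiable[OF f]] by (simp add: algebra_simps)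
  qed
  have "integrable lborel (\<lambda>x. cis (- (x \<bullet> \<xi>)) * partial_deriv i f x)" "integrable lborel (\<lambda>x. cis (- (x \<bullet> \<xi>)) * f x)"
    by (intro schwartz_integrable schwartz_cis_mult schwartz_partial f)+
  then have "(LINT x|lborel. partial_deriv i (\<lambda>x. cis (- (x \<bullet> \<xi>)) * f x) x) =
     fourier (partial_deriv i f) \<xi> - \<i> * of_real (\<xi> $ i) * fourier f \<xi>"
    unfolding eq fourier_def by simp
  then show ?thesis using LINT_partial_deriv[OF schwartz_cis_mult[OF f]] by simp
qed

lemma cis_remainder: "norm (cis (s + t) - cis s - of_real t * (\<i> * cis s)) \<le> t\<^sup>2"
proof -
  have "cis (s + t) - cis s - of_real t * (\<i> * cis s) = cis s * (exp (\<i> * of_real t) - (1 + \<i> * of_real t))"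
    unfolding cis_mult[symmetric] by (simp add: cis_conv_exp algebra_simps)
  moreover have "norm (exp (\<i> * of_real t) - (1 + \<i> * of_real t)) \<le> t\<^sup>2 / 2"
    using iexp_approx1[of t 1] by (simp add: power2_eq_square)
  moreover have "t\<^sup>2 / 2 \<le> t\<^sup>2" by simp
  ultimately show ?thesis by (metis norm_mult norm_cis mult_1_left order_trans)
qed

lemma has_derivative_fourier:
  fixes f :: "real^'n::finite \<Rightarrow> complex" and \<xi> :: "real^'n"
  assumes f: "schwartz f"
  shows "(fourier f has_derivative (\<lambda>h. \<Sum>i\<in>UNIV. h $ i *\<^sub>R fourier (\<lambda>x. - \<i> * (of_real (x $ i) * f x)) \<xi>)) (at \<xi>)"
  unfolding fourier_def
proof (rule has_derivative_LINT[of lborel "\<lambda>\<xi> x. cis (- (x \<bullet> \<xi>)) * f x" "\<lambda>i x. cis (- (x \<bullet> \<xi>)) * (- \<i> * (of_real (x $ i) * f x))"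
      "\<lambda>x. (norm x)\<^sup>2 * norm (f x)"])
  show "integrable lborel (\<lambda>x. cis (- (x \<bullet> y)) * f x)" for y
    by (intro schwartz_integrable schwartz_cis_mult f)
  show "integrable lborel (\<lambda>x. cis (- (x \<bullet> \<xi>)) * (- \<i> * (of_real (x $ i) * f x)))" for i
    by (intro schwartz_integrable schwartz_cis_mult schwartz_cmult schwartz_coord_mult f)
  obtain B where B: "\<And>x. (1 + norm x) ^ (2 * CARD('n) + 2) * norm (f x) \<le> B"
    using schwartz_decay[OF f] by blast
  show "integrable lborel (\<lambda>x. (norm x)\<^sup>2 * norm (f x))"
  proof (rule integrable_of_decay[of _ B])
    have [measurable]: "f \<in> borel_measurable borel" by (rule schwartz_borel[OF f])
    show "(\<lambda>x. (norm x)\<^sup>2 * norm (f x)) \<in> borel_measurable borel" by measurable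
    fix x :: "real^'n"
    have "(norm x)\<^sup>2 \<le> (1 + norm x)\<^sup>2" by (intro power_mono) auto
    then have "(1 + norm x) ^ (2 * CARD('n)) * ((norm x)\<^sup>2 * norm (f x)) \<le> (1 + norm x) ^ (2 * CARD('n)) * ((1 + norm x)\<^sup>2 * norm (f x))"
      by (intro mult_left_mono mult_right_mono) auto
    also have "\<dots> = (1 + norm x) ^ (2 * CARD('n) + 2) * norm (f x)" by (simp add: power_add power2_eq_square)
    finally show "(1 + norm x) ^ (2 * CARD('n)) * norm ((norm x)\<^sup>2 * norm (f x)) \<le> B"
      using B[of x] by simp
  qed
  fix h x :: "real^'n"
  have "(\<Sum>i\<in>UNIV. h $ i *\<^sub>R (cis (- (x \<bullet> \<xi>)) * (- \<i> * (of_real (x $ i) * f x)))) = of_real (- (x \<bullet> h)) * (\<i> * cis (- (x \<bullet> \<xi>))) * f x"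
    by (simp add: inner_vec_def sum_distrib_left sum_distrib_right sum_negf scaleR_conv_of_real algebra_simps)
  then have "cis (- (x \<bullet> (\<xi> + h))) * f x - cis (- (x \<bullet> \<xi>)) * f x - (\<Sum>i\<in>UNIV. h $ i *\<^sub>R (cis (- (x \<bullet> \<xi>)) * (- \<i> * (of_real (x $ i) * f x))))
    = (cis (- (x \<bullet> \<xi>) + - (x \<bullet> h)) - cis (- (x \<bullet> \<xi>)) - of_real (- (x \<bullet> h)) * (\<i> * cis (- (x \<bullet> \<xi>)))) * f x"
    by (simp add: inner_add_right algebra_simps)
  also have "norm \<dots> \<le> (x \<bullet> h)\<^sup>2 * norm (f x)"
    unfolding norm_mult using cis_remainder[of "- (x \<bullet> \<xi>)" "- (x \<bullet> h)"] by (intro mult_right_mono) auto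
  also have "\<dots> \<le> (norm x * norm h)\<^sup>2 * norm (f x)"
    using Cauchy_Schwarz_ineq2[of x h] by (intro mult_right_mono) (auto simp: abs_le_square_iff[symmetric] abs_mult)
  finally show "norm (cis (- (x \<bullet> (\<xi> + h))) * f x - cis (- (x \<bullet> \<xi>)) * f x - (\<Sum>i\<in>UNIV. h $ i *\<^sub>R (cis (- (x \<bullet> \<xi>)) * (- \<i> * (of_real (x $ i) * f x)))))
     \<le> (norm h)\<^sup>2 * ((norm x)\<^sup>2 * norm (f x))"
    by (simp add: power_mult_distrib mult_ac)
qed

lemma sum_axis_scaleR: "(\<Sum>j\<in>UNIV. axis i 1 $ j *\<^sub>R p j) = (p i :: 'a::real_vector)"
proof -
  have "axis i 1 $ j *\<^sub>R p j = (if j = i then p i else 0)" for j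
    by (simp add: axis_def)
  then show ?thesis by simp
qed

lemma partial_deriv_fourier:
  assumes f: "schwartz f"
  shows "partial_deriv i (fourier f) = fourier (\<lambda>x. - \<i> * (of_real (x $ i) * f x))"
  using partial_deriv_eq[OF has_derivative_fourier[OF f]] by (auto simp: sum_axis_scaleR)

lemma one_plus_norm_le: "1 + norm x \<le> 1 + (\<Sum>i\<in>UNIV. \<bar>x $ i\<bar>)" for x :: "real^'n::finite"
  using norm_le_l1_cart[of x] by simp

text \<open>Multiplying the transform by \<open>\<xi> $ i\<close> amounts, up to a factor of modulus
  1, to differentiating f, and \<open>norm \<xi>\<close> is at most the sum of the moduli of the
  coordinates. Each power of the weight costs one derivative of f, whence the induction over all
  Schwartz functions.\<close>

lemma fourier_decay:
  fixes f :: "real^'n::finite \<Rightarrow> complex"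
  assumes "schwartz f" shows "\<exists>B. \<forall>\<xi>. (1 + norm \<xi>) ^ N * norm (fourier f \<xi>) \<le> B"
  using assms
proof (induction N arbitrary: f)
  case 0
  then show ?case using fourier_norm_le by auto
next
  case (Suc N)
  obtain B where B: "\<And>\<xi>. (1 + norm \<xi>) ^ N * norm (fourier f \<xi>) \<le> B" using Suc by blast
  have "\<forall>i. \<exists>B. \<forall>\<xi>. (1 + norm \<xi>) ^ N * norm (fourier (partial_deriv i f) \<xi>) \<le> B"
    using Suc schwartz_partial by blast
  from choice[OF this] obtain C where "\<forall>i \<xi>. (1 + norm \<xi>) ^ N * norm (fourier (partial_deriv i f) \<xi>) \<le> C i" ..
  then have C: "\<And>i \<xi>. (1 + norm \<xi>) ^ N * norm (fourier (partial_deriv i f) \<xi>) \<le> C i" by simp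
  have "(1 + norm \<xi>) ^ Suc N * norm (fourier f \<xi>) \<le> B + (\<Sum>i\<in>UNIV. C i)" for \<xi>
  proof -
    have "(1 + norm \<xi>) ^ Suc N * norm (fourier f \<xi>) = (1 + norm \<xi>) * ((1 + norm \<xi>) ^ N * norm (fourier f \<xi>))" by simp
    also have "\<dots> \<le> (1 + (\<Sum>i\<in>UNIV. \<bar>\<xi> $ i\<bar>)) * ((1 + norm \<xi>) ^ N * norm (fourier f \<xi>))"
      by (intro mult_right_mono one_plus_norm_le) auto
    also have "\<dots> = (1 + norm \<xi>) ^ N * norm (fourier f \<xi>) + (\<Sum>i\<in>UNIV. (1 + norm \<xi>) ^ N * norm (fourier (partial_deriv i f) \<xi>))"
      by (simp add: fourier_partial_deriv Suc.prems norm_mult distrib_left sum_distrib_left sum_distrib_right mult_ac)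
    finally show ?thesis using B[of \<xi>] sum_mono[of UNIV "\<lambda>i. (1 + norm \<xi>) ^ N * norm (fourier (partial_deriv i f) \<xi>)" C] C
      by fastforce
  qed
  then show ?case by blast
qed

lemma schwartz_fourier:
  assumes "schwartz f" shows "schwartz (fourier f)"
proof (rule schwartz_coinduct[of _ "{fourier f | f. schwartz f}"])
  fix h :: "real^'a \<Rightarrow> complex" and i assume "h \<in> {fourier f | f. schwartz f}"
  then obtain f where f: "h = fourier f" "schwartz f" by blast
  show "h differentiable (at x)" for x unfolding f(1) by (rule differentiableI[OF has_derivative_fourier[OF f(2)]])
  have "schwartz (\<lambda>x. - \<i> * (of_real (x $ i) * f x))"
    by (intro schwartz_cmult schwartz_coord_mult f)
  then show "partial_deriv i h \<in> {fourier f | f. schwartz f}"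
    unfolding f(1) partial_deriv_fourier[OF f(2)] by blast
  show "\<exists>B. \<forall>x. (1 + norm x) ^ N * norm (h x) \<le> B" for N
    unfolding f(1) by (rule fourier_decay[OF f(2)])
qed (use assms in blast)

section \<open>Fourier inversion\<close>

lemma borel_measurable_cis [measurable]: "cis \<in> borel_measurable borel"
  by (intro borel_measurable_continuous_onI continuous_intros)

text \<open>The kernels exchanged with this rule have a majorant of product form, so absolute
  integrability on the product space reduces to two integrals in one variable each.\<close>

lemma Fubini_dominated:
  fixes K :: "'a::euclidean_space \<Rightarrow> 'b::euclidean_space \<Rightarrow> complex"
  assumes [measurable]: "(\<lambda>(x, y). K x y) \<in> borel_measurable (lborel \<Otimes>\<^sub>M lborel)"
    and F: "integrable lborel F" and G: "integrable lborel G"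
    and bound: "\<And>x y. norm (K x y) \<le> F x * G y"
  shows "(LINT x|lborel. (LINT y|lborel. K x y)) = (LINT y|lborel. (LINT x|lborel. K x y))"
proof -
  have FG: "F x * G y \<ge> 0" for x y using bound[of x y] by (meson norm_ge_zero order_trans)
  have [measurable]: "F \<in> borel_measurable borel" "G \<in> borel_measurable borel"
    using F G by auto
  have "integrable (lborel \<Otimes>\<^sub>M lborel) (\<lambda>(x, y). F x * G y)"
  proof (rule lborel_pair.Fubini_integrable)
    show "integrable lborel (\<lambda>x. LINT y|lborel. norm (case (x, y) of (x, y) \<Rightarrow> F x * G y))"
      using F by (simp add: abs_mult)
    show "AE x in lborel. integrable lborel (\<lambda>y. case (x, y) of (x, y) \<Rightarrow> F x * G y)"
      using G by simp
  qed measurable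
  then have "integrable (lborel \<Otimes>\<^sub>M lborel) (\<lambda>(x, y). K x y)"
    by (rule Bochner_Integration.integrable_bound) (use bound FG in \<open>auto intro!: AE_I2\<close>)
  from lborel_pair.Fubini_integral[OF this] show ?thesis by simp
qed

section \<open>The Gaussian and its transform\<close>

definition gauss :: "real^'n::finite \<Rightarrow> real" where
  "gauss x = (\<Prod>i\<in>UNIV. exp (- (x $ i)\<^sup>2 / 2))"

lemma gauss_0 [simp]: "gauss 0 = 1"
  by (simp add: gauss_def)

lemma gauss_nonneg: "0 \<le> gauss x"
  unfolding gauss_def by (intro prod_nonneg) simp

lemma gauss_le_1: "gauss x \<le> 1"
  unfolding gauss_def by (intro prod_le_1) auto

lemma continuous_on_gauss: "continuous_on A gauss"
  unfolding gauss_def by (intro continuous_intros) auto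

lemma borel_measurable_gauss [measurable]: "gauss \<in> borel_measurable borel"
  by (intro borel_measurable_continuous_onI continuous_on_gauss)

lemma integrable_exp_square: "integrable lborel (\<lambda>t::real. exp (- t\<^sup>2 / 2))"
proof -
  have "integrable lborel (\<lambda>t. sqrt (2 * pi) * std_normal_density t)"
    by (intro integrable_mult_right integrable_normal_density) simp
  then show ?thesis by (simp add: std_normal_density_def)
qed

lemma integrable_gauss: "integrable lborel (gauss :: real^'n::finite \<Rightarrow> real)"
  unfolding gauss_def[abs_def] by (intro integrable_prod_coord integrable_exp_square)

text \<open>Up to normalisation this is the characteristic function of the standard normal
  distribution at \<open>- u\<close>; the product form of \<open>gauss\<close> carries it to several
  variables.\<close>

lemma LINT_cis_gauss_1d:
  "(LINT t|lborel. cis (- (t * u)) * of_real (exp (- t\<^sup>2 / 2))) = of_real (sqrt (2 * pi) * exp (- u\<^sup>2 / 2))"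
proof -
  have "char std_normal_distribution (- u) = (LINT t|lborel. std_normal_density t *\<^sub>R iexp (- u * t))"
    unfolding char_def by (subst integral_density) auto
  also have "\<dots> = (LINT t|lborel. (1 / of_real (sqrt (2 * pi))) * (cis (- (t * u)) * of_real (exp (- t\<^sup>2 / 2))))"
    by (simp add: std_normal_density_def scaleR_conv_of_real cis_conv_exp mult_ac)
  also have "\<dots> = (1 / of_real (sqrt (2 * pi))) * (LINT t|lborel. cis (- (t * u)) * of_real (exp (- t\<^sup>2 / 2)))"
    by (rule integral_mult_right_zero)
  finally show ?thesis
    by (simp add: char_std_normal_distribution field_simps)
qed

lemma cis_sum: "finite A \<Longrightarrow> cis (\<Sum>i\<in>A. f i) = (\<Prod>i\<in>A. cis (f i))"
  by (induction A rule: finite_induct) (auto simp: cis_mult[symmetric])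

lemma fourier_gauss:
  "fourier (\<lambda>x. of_real (gauss x)) (w :: real^'n::finite) = of_real (sqrt (2 * pi) ^ CARD('n) * gauss w)"
proof -
  have "cis (- (x \<bullet> w)) * of_real (gauss x) = (\<Prod>i\<in>UNIV. cis (- (x $ i * w $ i)) * of_real (exp (- (x $ i)\<^sup>2 / 2)))" for x :: "real^'n"
    by (simp add: gauss_def prod.distrib cis_sum[symmetric] inner_vec_def sum_negf)
  then have "fourier (\<lambda>x. of_real (gauss x)) w =
      (LINT x|lborel. (\<Prod>i\<in>UNIV. cis (- ((x::real^'n) $ i * w $ i)) * of_real (exp (- (x $ i)\<^sup>2 / 2))))"
    by (simp add: fourier_def)
  also have "\<dots> = (\<Prod>i\<in>UNIV. (LINT t|lborel. cis (- (t * w $ i)) * of_real (exp (- t\<^sup>2 / 2))))"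
  proof (rule LINT_prod_coord[of "\<lambda>i t. cis (- (t * w $ i)) * of_real (exp (- t\<^sup>2 / 2))"])
    show "integrable lborel (\<lambda>t. cis (- (t * w $ i)) * of_real (exp (- t\<^sup>2 / 2)))" for i
      by (rule Bochner_Integration.integrable_bound[OF integrable_exp_square])
        (auto simp: norm_mult)
  qed
  also have "\<dots> = of_real (sqrt (2 * pi) ^ CARD('n) * gauss w)"
    unfolding LINT_cis_gauss_1d gauss_def by (simp add: prod.distrib)
  finally show ?thesis .
qed

lemma LINT_gauss: "(LINT x|lborel. gauss (x::real^'n::finite)) = sqrt (2 * pi) ^ CARD('n)"
proof -
  have "fourier (\<lambda>x::real^'n. of_real (gauss x)) 0 = of_real (LINT x|lborel. gauss (x::real^'n))"
    by (simp add: fourier_def)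
  then have "complex_of_real (LINT x|lborel. gauss (x::real^'n)) = of_real (sqrt (2 * pi) ^ CARD('n))"
    unfolding fourier_gauss by simp
  then show ?thesis using of_real_eq_iff by blast
qed

lemma fourier_gauss_scaled:
  fixes w :: "real^'n::finite"
  assumes "\<epsilon> > 0"
  shows "(LINT \<xi>|lborel. cis (- (\<xi> \<bullet> w)) * of_real (gauss (\<epsilon> *\<^sub>R \<xi>))) =
    of_real ((sqrt (2 * pi) / \<epsilon>) ^ CARD('n) * gauss ((1 / \<epsilon>) *\<^sub>R w))"
proof -
  have "fourier (\<lambda>x. of_real (gauss x)) ((1 / \<epsilon>) *\<^sub>R w) =
      \<epsilon> ^ CARD('n) *\<^sub>R (LINT \<xi>|lborel. cis (- ((0 + \<epsilon> *\<^sub>R \<xi>) \<bullet> ((1 / \<epsilon>) *\<^sub>R w))) * of_real (gauss (0 + \<epsilon> *\<^sub>R \<xi>)))"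
    unfolding fourier_def
    by (subst LINT_lborel_affine[of _ \<epsilon> 0]) (use assms in auto)
  moreover have "(0 + \<epsilon> *\<^sub>R \<xi>) \<bullet> ((1 / \<epsilon>) *\<^sub>R w) = \<xi> \<bullet> w" for \<xi>
    using assms by simp
  ultimately have "fourier (\<lambda>x. of_real (gauss x)) ((1 / \<epsilon>) *\<^sub>R w) =
      \<epsilon> ^ CARD('n) *\<^sub>R (LINT \<xi>|lborel. cis (- (\<xi> \<bullet> w)) * of_real (gauss (\<epsilon> *\<^sub>R \<xi>)))"
    by (simp only: add_0)
  then have "of_real (\<epsilon> ^ CARD('n)) * (LINT \<xi>|lborel. cis (- (\<xi> \<bullet> w)) * of_real (gauss (\<epsilon> *\<^sub>R \<xi>))) =
      of_real (sqrt (2 * pi) ^ CARD('n) * gauss ((1 / \<epsilon>) *\<^sub>R w))"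
    unfolding fourier_gauss using assms by (simp add: scaleR_conv_of_real)
  then show ?thesis using assms by (simp add: power_divide field_simps)
qed

text \<open>The double integral is not absolutely convergent, so the factor
  \<open>gauss (\<epsilon> k *\<^sub>R \<xi>)\<close> is inserted. Fubini turns the regularised
  integral into a Gaussian average of f around x at scale \<epsilon>, and dominated convergence
  along \<epsilon> \<rightarrow> 0 evaluates both expressions. The constant
  \<open>(2 * pi) ^ n\<close> is the square of the mass of \<open>gauss\<close>.\<close>

theorem fourier_inversion:
  fixes f :: "real^'n::finite \<Rightarrow> complex"
  assumes f: "schwartz f"
  shows "inv_fourier (fourier f) x = f x"
proof -
  define \<epsilon> where "\<epsilon> k = 1 / real (Suc k)" for k
  have \<epsilon>: "\<epsilon> k > 0" for k by (simp add: \<epsilon>_def)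
  have \<epsilon>0: "\<epsilon> \<longlonglongrightarrow> 0" unfolding \<epsilon>_def by (rule lim_1_over_n[THEN LIMSEQ_Suc])
  define n where "n = CARD('n)"
  have [measurable]: "f \<in> borel_measurable borel" "fourier f \<in> borel_measurable borel"
    using schwartz_borel f schwartz_fourier by auto
  obtain Bf where Bf: "\<And>x. norm (f x) \<le> Bf" using schwartz_decay[OF f, of 0] by auto
  have g0: "(\<lambda>k. gauss (\<epsilon> k *\<^sub>R \<xi>)) \<longlonglongrightarrow> 1" for \<xi> :: "real^'n"
  proof -
    have "(\<lambda>k. \<epsilon> k *\<^sub>R \<xi>) \<longlonglongrightarrow> 0 *\<^sub>R \<xi>" by (intro tendsto_intros \<epsilon>0)
    then have "(\<lambda>k. gauss (\<epsilon> k *\<^sub>R \<xi>)) \<longlonglongrightarrow> gauss (0 *\<^sub>R \<xi>)"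
      by (rule continuous_on_tendsto_compose[OF continuous_on_gauss[of UNIV]]) auto
    then show ?thesis by simp
  qed
  let ?A = "\<lambda>k. LINT \<xi>|lborel. cis (x \<bullet> \<xi>) * fourier f \<xi> * of_real (gauss (\<epsilon> k *\<^sub>R \<xi>))"
  have "?A \<longlonglongrightarrow> (LINT \<xi>|lborel. cis (x \<bullet> \<xi>) * fourier f \<xi> * of_real 1)"
  proof (rule integral_dominated_convergence[where w = "\<lambda>\<xi>. norm (fourier f \<xi>)"])
    show "AE \<xi> in lborel. (\<lambda>k. cis (x \<bullet> \<xi>) * fourier f \<xi> * of_real (gauss (\<epsilon> k *\<^sub>R \<xi>))) \<longlonglongrightarrow> cis (x \<bullet> \<xi>) * fourier f \<xi> * of_real 1"
      by (intro AE_I2 tendsto_intros g0)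
    show "AE \<xi> in lborel. norm (cis (x \<bullet> \<xi>) * fourier f \<xi> * of_real (gauss (\<epsilon> k *\<^sub>R \<xi>))) \<le> norm (fourier f \<xi>)" for k
      by (intro AE_I2) (simp add: norm_mult mult_left_le gauss_nonneg gauss_le_1)
  qed (auto intro: schwartz_integrable schwartz_fourier f)
  then have lim1: "?A \<longlonglongrightarrow> of_real ((2 * pi) ^ n) * inv_fourier (fourier f) x"
    by (simp add: inv_fourier_def n_def)
  have A: "?A k = (LINT u|lborel. of_real (sqrt (2 * pi) ^ n * gauss u) * f (x + \<epsilon> k *\<^sub>R u))" for k
  proof -
    have "?A k = (LINT \<xi>|lborel. (LINT y|lborel. cis (- (\<xi> \<bullet> (y - x))) * of_real (gauss (\<epsilon> k *\<^sub>R \<xi>)) * f y))"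
    proof (rule Bochner_Integration.integral_cong[OF refl])
      fix \<xi> :: "real^'n"
      have "cis (x \<bullet> \<xi>) * cis (- (y \<bullet> \<xi>)) = cis (- (\<xi> \<bullet> (y - x)))" for y
        by (simp add: cis_mult inner_diff_right inner_commute)
      then have E: "cis (- (\<xi> \<bullet> (y - x))) * of_real (gauss (\<epsilon> k *\<^sub>R \<xi>)) * f y =
          (cis (x \<bullet> \<xi>) * of_real (gauss (\<epsilon> k *\<^sub>R \<xi>))) * (cis (- (y \<bullet> \<xi>)) * f y)" for y
        by (metis (no_types, lifting) mult.assoc mult.commute)
      show "cis (x \<bullet> \<xi>) * fourier f \<xi> * of_real (gauss (\<epsilon> k *\<^sub>R \<xi>)) =
          (LINT y|lborel. cis (- (\<xi> \<bullet> (y - x))) * of_real (gauss (\<epsilon> k *\<^sub>R \<xi>)) * f y)"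
        unfolding E integral_mult_right_zero by (simp add: fourier_def mult_ac)
    qed
    also have "\<dots> = (LINT y|lborel. (LINT \<xi>|lborel. cis (- (\<xi> \<bullet> (y - x))) * of_real (gauss (\<epsilon> k *\<^sub>R \<xi>)) * f y))"
    proof (rule Fubini_dominated[where F = "\<lambda>\<xi>. gauss (\<epsilon> k *\<^sub>R \<xi>)" and G = "\<lambda>y. norm (f y)"])
      show "integrable lborel (\<lambda>\<xi>::real^'n. gauss (\<epsilon> k *\<^sub>R \<xi>))"
        using integrable_lborel_affine[OF integrable_gauss, of "\<epsilon> k" 0] \<epsilon>[of k] by simp
    qed (auto simp: norm_mult gauss_nonneg intro: integrable_norm schwartz_integrable f)
    also have "\<dots> = (LINT y|lborel. of_real ((sqrt (2 * pi) / \<epsilon> k) ^ n * gauss ((1 / \<epsilon> k) *\<^sub>R (y - x))) * f y)"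
      by (simp add: fourier_gauss_scaled[OF \<epsilon>] n_def)
    also have "\<dots> = \<bar>\<epsilon> k\<bar> ^ DIM(real^'n) *\<^sub>R (LINT u|lborel. of_real ((sqrt (2 * pi) / \<epsilon> k) ^ n * gauss ((1 / \<epsilon> k) *\<^sub>R (x + \<epsilon> k *\<^sub>R u - x))) * f (x + \<epsilon> k *\<^sub>R u))"
      by (rule LINT_lborel_affine) (use \<epsilon>[of k] in auto)
    also have "(LINT u|lborel. of_real ((sqrt (2 * pi) / \<epsilon> k) ^ n * gauss ((1 / \<epsilon> k) *\<^sub>R (x + \<epsilon> k *\<^sub>R u - x))) * f (x + \<epsilon> k *\<^sub>R u)) =
        (LINT u|lborel. of_real (1 / \<epsilon> k ^ n) * (of_real (sqrt (2 * pi) ^ n * gauss u) * f (x + \<epsilon> k *\<^sub>R u)))"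
      using \<epsilon>[of k] by (intro Bochner_Integration.integral_cong) (auto simp: power_divide)
    also have "\<bar>\<epsilon> k\<bar> ^ DIM(real^'n) *\<^sub>R \<dots> = (LINT u|lborel. of_real (sqrt (2 * pi) ^ n * gauss u) * f (x + \<epsilon> k *\<^sub>R u))"
      unfolding integral_mult_right_zero using \<epsilon>[of k] by (simp add: n_def scaleR_conv_of_real)
    finally show ?thesis .
  qed
  have "(\<lambda>k. LINT u|lborel. of_real (sqrt (2 * pi) ^ n * gauss u) * f (x + \<epsilon> k *\<^sub>R u)) \<longlonglongrightarrow> (LINT u|lborel. of_real (sqrt (2 * pi) ^ n * gauss (u::real^'n)) * f x)"
  proof (rule integral_dominated_convergence[where w = "\<lambda>u::real^'n. sqrt (2 * pi) ^ n * gauss u * Bf"])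
    have "(\<lambda>k. f (x + \<epsilon> k *\<^sub>R u)) \<longlonglongrightarrow> f x" for u
    proof -
      have "(\<lambda>k. x + \<epsilon> k *\<^sub>R u) \<longlonglongrightarrow> x + 0 *\<^sub>R u" by (intro tendsto_intros \<epsilon>0)
      then have "(\<lambda>k. f (x + \<epsilon> k *\<^sub>R u)) \<longlonglongrightarrow> f (x + 0 *\<^sub>R u)"
        by (rule continuous_on_tendsto_compose[OF smooth_continuous_on[OF schwartz_smooth[OF f], of UNIV]]) auto
      then show ?thesis by simp
    qed
    then show "AE u in lborel. (\<lambda>k. of_real (sqrt (2 * pi) ^ n * gauss u) * f (x + \<epsilon> k *\<^sub>R u)) \<longlonglongrightarrow> of_real (sqrt (2 * pi) ^ n * gauss (u::real^'n)) * f x"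
      by (intro AE_I2 tendsto_intros)
    show "AE u in lborel. norm (of_real (sqrt (2 * pi) ^ n * gauss u) * f (x + \<epsilon> k *\<^sub>R u)) \<le> sqrt (2 * pi) ^ n * gauss u * Bf" for k
      by (intro AE_I2) (simp add: norm_mult norm_power gauss_nonneg mult_left_mono Bf)
  qed (simp_all add: integrable_gauss)
  then have "?A \<longlonglongrightarrow> (LINT u|lborel. of_real (sqrt (2 * pi) ^ n * gauss (u::real^'n)) * f x)" unfolding A .
  from LIMSEQ_unique[OF this lim1]
  have "of_real ((2 * pi) ^ n) * inv_fourier (fourier f) x = (LINT u|lborel. of_real (sqrt (2 * pi) ^ n * gauss (u::real^'n)) * f x)" by simp
  also have "\<dots> = of_real (sqrt (2 * pi) ^ n) * of_real (LINT u|lborel. gauss (u::real^'n)) * f x"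
    by simp
  also have "\<dots> = of_real ((2 * pi) ^ n) * f x"
  proof -
    have s: "sqrt (2 * pi) ^ n * sqrt (2 * pi) ^ n = (2 * pi) ^ n"
      unfolding power_mult_distrib[symmetric] by simp
    show ?thesis unfolding LINT_gauss n_def[symmetric] of_real_mult[symmetric] s ..
  qed
  finally show ?thesis by simp
qed

lemma inv_fourier_eq: "inv_fourier h x = fourier h (- x) / of_real ((2 * pi) ^ CARD('n))"
  for x :: "real^'n::finite"
  by (simp add: inv_fourier_def fourier_def inner_commute)

lemma schwartz_inv_fourier:
  assumes "schwartz f" shows "schwartz (inv_fourier f)"
proof -
  have "inv_fourier f = (\<lambda>x. (1 / of_real ((2 * pi) ^ CARD('a))) * fourier f (- x))"
    by (auto simp: inv_fourier_eq)
  then show ?thesis using schwartz_cmult[OF schwartz_reflect[OF schwartz_fourier[OF assms]]] by metis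
qed

lemma fourier_inv_fourier:
  assumes "schwartz f" shows "fourier (inv_fourier f) \<xi> = f \<xi>"
proof -
  have m: "(\<lambda>x. cis (x \<bullet> \<xi>) * fourier f x) \<in> borel_measurable borel"
    by (intro schwartz_borel schwartz_cis_mult_pos schwartz_fourier assms)
  have "fourier (inv_fourier f) \<xi> = (LINT x|lborel. cis ((- x) \<bullet> \<xi>) * fourier f (- x)) / of_real ((2 * pi) ^ CARD('a))"
    by (simp add: fourier_def[of "inv_fourier f"] inv_fourier_eq)
  also have "\<dots> = inv_fourier (fourier f) \<xi>"
    unfolding LINT_lborel_reflect[OF m] by (simp add: inv_fourier_def inner_commute)
  finally show ?thesis using fourier_inversion[OF assms] by simp
qed

lemma LINT_fourier_mult:
  fixes f g :: "real^'n::finite \<Rightarrow> complex"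
  assumes f: "integrable lborel f" and g: "integrable lborel g"
  shows "(LINT x|lborel. fourier f x * g x) = (LINT x|lborel. f x * fourier g x)"
proof -
  have [measurable]: "f \<in> borel_measurable borel" "g \<in> borel_measurable borel" using f g by auto
  have "(LINT x|lborel. fourier f x * g x) = (LINT x|lborel. (LINT y|lborel. cis (- (y \<bullet> x)) * f y * g x))"
    by (simp add: fourier_def)
  also have "\<dots> = (LINT y|lborel. (LINT x|lborel. cis (- (y \<bullet> x)) * f y * g x))"
    by (rule Fubini_dominated[where F = "\<lambda>x. norm (g x)" and G = "\<lambda>y. norm (f y)"])
      (use f g in \<open>auto simp: norm_mult intro!: integrable_norm\<close>)
  also have "\<dots> = (LINT y|lborel. (LINT x|lborel. f y * (cis (- (x \<bullet> y)) * g x)))"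
    by (simp add: mult_ac inner_commute)
  finally show ?thesis by (simp add: fourier_def)
qed

text \<open>With h merely integrable this covers transforms multiplied by a non-smooth symbol. It
  says that the distributional Fourier transform of \<open>inv_fourier h\<close> is h, and it uses
  inversion for \<phi> alone.\<close>

lemma LINT_inv_fourier_mult:
  fixes h \<phi> :: "real^'n::finite \<Rightarrow> complex"
  assumes h: "integrable lborel h" and \<phi>: "schwartz \<phi>"
  shows "(LINT x|lborel. inv_fourier h x * fourier \<phi> x) = (LINT x|lborel. h x * \<phi> x)"
proof -
  have [measurable]: "h \<in> borel_measurable borel" "fourier \<phi> \<in> borel_measurable borel"
    using h \<phi> by (auto intro: schwartz_borel schwartz_fourier)
  have "(LINT x|lborel. inv_fourier h x * fourier \<phi> x) =
      (LINT x|lborel. (LINT y|lborel. cis (x \<bullet> y) * h y * fourier \<phi> x)) / of_real ((2 * pi) ^ CARD('n))"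
    by (simp add: inv_fourier_def)
  also have "(LINT x|lborel. (LINT y|lborel. cis (x \<bullet> y) * h y * fourier \<phi> x)) =
      (LINT y|lborel. (LINT x|lborel. cis (x \<bullet> y) * h y * fourier \<phi> x))"
    by (rule Fubini_dominated[where F = "\<lambda>x. norm (fourier \<phi> x)" and G = "\<lambda>y. norm (h y)"])
      (use h \<phi> in \<open>auto simp: norm_mult intro!: integrable_norm schwartz_integrable schwartz_fourier\<close>)
  also have "\<dots> / of_real ((2 * pi) ^ CARD('n)) = (LINT y|lborel. h y * inv_fourier (fourier \<phi>) y)"
    by (simp add: inv_fourier_def inner_commute mult_ac flip: integral_mult_right_zero)
  finally show ?thesis by (simp add: fourier_inversion[OF \<phi>])
qed

text \<open>The conjugate of \<open>inv_fourier \<phi>\<close> is, up to the power of 2 pi, the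
  transform of the conjugate of \<phi>; moving this transform to the other factor undoes the inverse
  transform there.\<close>

lemma parseval:
  fixes \<phi> :: "real^'n::finite \<Rightarrow> complex"
  assumes \<phi>: "schwartz \<phi>"
  shows "(LINT x|lborel. (norm (inv_fourier \<phi> x))\<^sup>2) = (LINT x|lborel. (norm (\<phi> x))\<^sup>2) / (2 * pi) ^ CARD('n)"
proof -
  let ?\<psi> = "inv_fourier \<phi>"
  have c: "cnj (?\<psi> x) = fourier (\<lambda>x. cnj (\<phi> x)) x / of_real ((2 * pi) ^ CARD('n))" for x
  proof -
    have "cnj (LINT \<xi>|lborel. cis (x \<bullet> \<xi>) * \<phi> \<xi>) = (LINT \<xi>|lborel. cnj (cis (x \<bullet> \<xi>) * \<phi> \<xi>))"
      by (rule Bochner_Integration.integral_cnj[symmetric])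
    then show ?thesis
      unfolding inv_fourier_def fourier_def by (simp add: cis_cnj inner_commute)
  qed
  have sq: "complex_of_real ((norm z)\<^sup>2) = z * cnj z" for z
    by (rule complex_norm_square)
  have "complex_of_real (LINT x|lborel. (norm (?\<psi> x))\<^sup>2) = (LINT x|lborel. ?\<psi> x * cnj (?\<psi> x))"
    unfolding sq[symmetric] by (rule integral_complex_of_real[symmetric])
  also have "\<dots> = (LINT x|lborel. fourier (\<lambda>x. cnj (\<phi> x)) x * ?\<psi> x) / of_real ((2 * pi) ^ CARD('n))"
    unfolding c by (simp add: mult.commute)
  also have "(LINT x|lborel. fourier (\<lambda>x. cnj (\<phi> x)) x * ?\<psi> x) = (LINT x|lborel. cnj (\<phi> x) * fourier ?\<psi> x)"
    by (intro LINT_fourier_mult schwartz_integrable schwartz_cnj schwartz_inv_fourier \<phi>)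
  also have "\<dots> = of_real (LINT x|lborel. (norm (\<phi> x))\<^sup>2)"
    unfolding fourier_inv_fourier[OF \<phi>] integral_complex_of_real[symmetric] sq by (simp add: mult.commute)
  finally have "complex_of_real (LINT x|lborel. (norm (?\<psi> x))\<^sup>2) = of_real ((LINT x|lborel. (norm (\<phi> x))\<^sup>2) / (2 * pi) ^ CARD('n))"
    by simp
  then show ?thesis using of_real_eq_iff by blast
qed

lemma inv_fourier_partial_deriv:
  fixes f :: "real^'n::finite \<Rightarrow> complex"
  assumes f: "schwartz f"
  shows "inv_fourier (partial_deriv i f) \<xi> = - (\<i> * of_real (\<xi> $ i)) * inv_fourier f \<xi>"
  unfolding inv_fourier_eq fourier_partial_deriv[OF f] by simp

section \<open>Lower bounds for Sobolev norms by duality\<close>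

lemma LINT_Cauchy_Schwarz:
  fixes f g :: "'a \<Rightarrow> real"
  assumes [measurable]: "f \<in> borel_measurable M" "g \<in> borel_measurable M"
    and f: "integrable M (\<lambda>x. (f x)\<^sup>2)" and g: "integrable M (\<lambda>x. (g x)\<^sup>2)"
  shows "integrable M (\<lambda>x. f x * g x)"
    and "\<bar>LINT x|M. f x * g x\<bar> \<le> sqrt (LINT x|M. (f x)\<^sup>2) * sqrt (LINT x|M. (g x)\<^sup>2)"
proof -
  show fg: "integrable M (\<lambda>x. f x * g x)"
  proof (rule Bochner_Integration.integrable_bound)
    show "integrable M (\<lambda>x. (f x)\<^sup>2 + (g x)\<^sup>2)" using f g by simp
    have "\<bar>a * b\<bar> \<le> \<bar>a\<^sup>2 + b\<^sup>2\<bar>" for a b :: real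
    proof -
      have "2 * (\<bar>a\<bar> * \<bar>b\<bar>) \<le> a\<^sup>2 + b\<^sup>2" "0 \<le> \<bar>a\<bar> * \<bar>b\<bar>"
        using sum_squares_bound[of "\<bar>a\<bar>" "\<bar>b\<bar>"] by (simp_all add: mult.assoc)
      then have "\<bar>a\<bar> * \<bar>b\<bar> \<le> a\<^sup>2 + b\<^sup>2" by linarith
      then show ?thesis by (simp add: abs_mult)
    qed
    then show "AE x in M. norm (f x * g x) \<le> norm ((f x)\<^sup>2 + (g x)\<^sup>2)" by simp
  qed measurable
  define A B C where "A = (LINT x|M. (f x)\<^sup>2)" "B = (LINT x|M. (g x)\<^sup>2)" "C = (LINT x|M. f x * g x)"
  note ABC = this
  have quad: "0 \<le> A + 2 * t * C + t\<^sup>2 * B" for t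
  proof -
    have "0 \<le> (LINT x|M. (f x + t * g x)\<^sup>2)" by simp
    also have "\<dots> = (LINT x|M. (f x)\<^sup>2 + (2 * t * (f x * g x) + t\<^sup>2 * (g x)\<^sup>2))"
      by (simp add: power2_eq_square algebra_simps)
    also have "\<dots> = A + (2 * t * C + t\<^sup>2 * B)"
      unfolding ABC using f g fg by simp
    finally show ?thesis by simp
  qed
  have B: "0 \<le> B" "0 \<le> A" unfolding ABC by simp_all
  have "C\<^sup>2 \<le> A * B"
  proof (cases "B = 0")
    case True
    have "C = 0"
    proof (rule ccontr)
      assume "C \<noteq> 0"
      \<comment> \<open>For B = 0 the quadratic is affine in t, and this t gives it the value
        -1.\<close>
      then have "2 * (- (A + 1) / (2 * C)) * C = - (A + 1)" by (simp add: field_simps)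
      then show False using quad[of "- (A + 1) / (2 * C)"] True by simp
    qed
    then show ?thesis using True by simp
  next
    case False
    then have "0 \<le> A - C\<^sup>2 / B"
      using quad[of "- C / B"] by (simp add: power2_eq_square field_simps)
    then show ?thesis using False B by (simp add: field_simps)
  qed
  then have "\<bar>C\<bar> \<le> sqrt (A * B)" using real_le_rsqrt by (simp add: real_le_rsqrt)
  then show "\<bar>LINT x|M. f x * g x\<bar> \<le> sqrt (LINT x|M. (f x)\<^sup>2) * sqrt (LINT x|M. (g x)\<^sup>2)"
    unfolding ABC real_sqrt_mult .
qed

section \<open>Functions as tempered distributions\<close>

lemma schwartz_norm_ge:
  fixes \<phi> :: "real^'n::finite \<Rightarrow> complex"
  assumes \<phi>: "schwartz \<phi>"
  shows "(1 + norm x) ^ N * norm (\<phi> x) \<le> schwartz_norm N \<phi>"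
proof -
  let ?F = "\<lambda>(is, x). (1 + norm x) ^ N * norm (partials is \<phi> x)"
  have "\<forall>is. \<exists>B. \<forall>x. (1 + norm x) ^ N * norm (partials is \<phi> x) \<le> B"
    using \<phi> unfolding schwartz_def by blast
  from choice[OF this] obtain B where B: "\<forall>is x. (1 + norm x) ^ N * norm (partials is \<phi> x) \<le> B is" ..
  \<comment> \<open>The supremum in \<open>schwartz_norm\<close> runs over all points but only
    finitely many index lists, so the bounds for the single lists have a maximum.\<close>
  have fin: "finite {is :: 'n list. length is \<le> N}"
    using finite_lists_length_le[of "UNIV :: 'n set" N] by simp
  have "bdd_above (?F ` ({is. length is \<le> N} \<times> UNIV))"
  proof (rule bdd_aboveI2[of _ _ "Max (B ` {is. length is \<le> N})"])
    fix p assume "p \<in> {is :: 'n list. length is \<le> N} \<times> (UNIV :: (real^'n) set)"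
    then obtain "is" x where p: "p = (is, x)" "length is \<le> N" by auto
    have "?F p \<le> B is" using B p by simp
    also have "\<dots> \<le> Max (B ` {is. length is \<le> N})"
      by (rule Max_ge) (use fin p in auto)
    finally show "?F p \<le> Max (B ` {is. length is \<le> N})" .
  qed
  from cSUP_upper[OF _ this, of "([], x)"] show ?thesis
    unfolding schwartz_norm_def by simp
qed

lemma integrable_bounded_mult_schwartz:
  fixes f \<phi> :: "real^'n::finite \<Rightarrow> complex"
  assumes f: "f \<in> borel_measurable borel" "\<And>x. norm (f x) \<le> A" and \<phi>: "schwartz \<phi>"
  shows "integrable lborel (\<lambda>x. f x * \<phi> x)"
proof (rule Bochner_Integration.integrable_bound)
  show "integrable lborel (\<lambda>x. of_real A * \<phi> x)"
    using schwartz_integrable[OF \<phi>] by simp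
  show "(\<lambda>x. f x * \<phi> x) \<in> borel_measurable lborel"
    using f(1) schwartz_borel[OF \<phi>] by simp
  have "norm (f x) \<le> \<bar>A\<bar>" for x using f(2)[of x] by simp
  then show "AE x in lborel. norm (f x * \<phi> x) \<le> norm (of_real A * \<phi> x)"
    by (simp add: norm_mult mult_right_mono)
qed

lemma tempered_dist_of:
  fixes f :: "real^'n::finite \<Rightarrow> complex"
  assumes f: "f \<in> borel_measurable borel" "\<And>x. norm (f x) \<le> A"
  shows "tempered_distribution (dist_of f)"
  unfolding tempered_distribution_def
proof (intro conjI allI impI)
  note int = integrable_bounded_mult_schwartz[OF f]
  show "dist_of f (\<lambda>x. \<phi> x + \<psi> x) = dist_of f \<phi> + dist_of f \<psi>" if "schwartz \<phi>" "schwartz \<psi>" for \<phi> \<psi>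
    unfolding dist_of_def using int[OF that(1)] int[OF that(2)] by (simp add: distrib_left)
  show "dist_of f (\<lambda>x. c * \<phi> x) = c * dist_of f \<phi>" for c \<phi>
    unfolding dist_of_def by (simp add: mult.left_commute)
  define K where "K = (LINT x|lborel. 1 / (1 + norm (x::real^'n)) ^ (2 * CARD('n)))"
  have A: "A \<ge> 0" using f(2)[of 0] norm_ge_zero order_trans by blast
  have "norm (dist_of f \<phi>) \<le> A * K * schwartz_norm (2 * CARD('n)) \<phi>" if \<phi>: "schwartz \<phi>" for \<phi>
  proof -
    have "norm (dist_of f \<phi>) \<le> (LINT x|lborel. A * schwartz_norm (2 * CARD('n)) \<phi> * (1 / (1 + norm (x::real^'n)) ^ (2 * CARD('n))))"
      unfolding dist_of_def
    proof (rule norm_LINT_le[OF int[OF \<phi>]])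
      show "integrable lborel (\<lambda>x::real^'n. A * schwartz_norm (2 * CARD('n)) \<phi> * (1 / (1 + norm x) ^ (2 * CARD('n))))"
        by (intro integrable_mult_right integrable_decay)
      fix x :: "real^'n"
      have "norm (\<phi> x) \<le> schwartz_norm (2 * CARD('n)) \<phi> * (1 / (1 + norm x) ^ (2 * CARD('n)))"
        using schwartz_norm_ge[OF \<phi>, of x "2 * CARD('n)"]
        by (simp add: pos_le_divide_eq add_pos_nonneg mult.commute)
      then have "norm (f x) * norm (\<phi> x) \<le> A * (schwartz_norm (2 * CARD('n)) \<phi> * (1 / (1 + norm x) ^ (2 * CARD('n))))"
        by (intro mult_mono f A) auto
      then show "norm (f x * \<phi> x) \<le> A * schwartz_norm (2 * CARD('n)) \<phi> * (1 / (1 + norm x) ^ (2 * CARD('n)))"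
        by (simp add: norm_mult mult.assoc)
    qed
    also have "\<dots> = A * K * schwartz_norm (2 * CARD('n)) \<phi>"
      unfolding K_def integral_mult_right_zero by (simp add: mult_ac)
    finally show ?thesis .
  qed
  then show "\<exists>N B. \<forall>\<phi>. schwartz \<phi> \<longrightarrow> norm (dist_of f \<phi>) \<le> B * schwartz_norm N \<phi>" by blast
qed

text \<open>The transform of \<open>frac_D_last s g\<close> is a power of
  \<open>\<bar>\<xi> $ last_ix\<bar>\<close> times a Schwartz function: it decreases rapidly but may
  fail to be smooth where that coordinate vanishes. Dropping the derivatives from the Schwartz
  condition keeps integrability and the finiteness of every Sobolev norm.\<close>

definition rapid :: "(real^'n::finite \<Rightarrow> complex) \<Rightarrow> bool" where
  "rapid h \<longleftrightarrow> h \<in> borel_measurable borel \<and> (\<forall>N. \<exists>B. \<forall>\<xi>. (1 + norm \<xi>) ^ N * norm (h \<xi>) \<le> B)"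

lemma rapid_schwartz: "schwartz f \<Longrightarrow> rapid f"
  unfolding rapid_def using schwartz_borel schwartz_decay by blast

lemma rapid_integrable:
  fixes h :: "real^'n::finite \<Rightarrow> complex"
  assumes "rapid h" shows "integrable lborel h"
proof -
  obtain B where "\<And>x. (1 + norm x) ^ (2 * CARD('n)) * norm (h x) \<le> B"
    using assms unfolding rapid_def by blast
  then show ?thesis by (rule integrable_of_decay[rotated]) (use assms in \<open>simp add: rapid_def\<close>)
qed

lemma rapid_mult:
  fixes h :: "real^'n::finite \<Rightarrow> complex"
  assumes h: "rapid h" and p: "p \<in> borel_measurable borel" "\<And>\<xi>. norm (p \<xi>) \<le> (1 + norm \<xi>) ^ M"
  shows "rapid (\<lambda>\<xi>. p \<xi> * h \<xi>)"
  unfolding rapid_def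
proof (intro conjI allI)
  have [measurable]: "h \<in> borel_measurable borel" "p \<in> borel_measurable borel"
    using h p unfolding rapid_def by auto
  show "(\<lambda>\<xi>. p \<xi> * h \<xi>) \<in> borel_measurable borel" by measurable
  fix N
  obtain B where B: "\<And>x. (1 + norm x) ^ (N + M) * norm (h x) \<le> B"
    using h unfolding rapid_def by blast
  have "(1 + norm \<xi>) ^ N * norm (p \<xi> * h \<xi>) \<le> B" for \<xi>
  proof -
    have "(1 + norm \<xi>) ^ N * norm (p \<xi> * h \<xi>) \<le> (1 + norm \<xi>) ^ N * ((1 + norm \<xi>) ^ M * norm (h \<xi>))"
      unfolding norm_mult by (intro mult_left_mono mult_right_mono p) auto
    also have "\<dots> = (1 + norm \<xi>) ^ (N + M) * norm (h \<xi>)" by (simp add: power_add)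
    finally show ?thesis using B[of \<xi>] by linarith
  qed
  then show "\<exists>B. \<forall>\<xi>. (1 + norm \<xi>) ^ N * norm (p \<xi> * h \<xi>) \<le> B" by blast
qed

lemma bessel_weight_le:
  fixes \<xi> :: "'a::real_normed_vector"
  shows "(1 + (norm \<xi>)\<^sup>2) powr (r / 2) \<le> (1 + norm \<xi>) ^ nat \<lceil>\<bar>r\<bar>\<rceil>"
proof -
  have 1: "1 \<le> 1 + norm \<xi>" "1 \<le> 1 + (norm \<xi>)\<^sup>2" by auto
  have "1 + (norm \<xi>)\<^sup>2 \<le> (1 + norm \<xi>)\<^sup>2" by (simp add: power2_sum)
  have "(1 + (norm \<xi>)\<^sup>2) powr (r / 2) \<le> (1 + (norm \<xi>)\<^sup>2) powr (\<bar>r\<bar> / 2)"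
    using 1 by (intro powr_mono) auto
  also have "\<dots> \<le> ((1 + norm \<xi>)\<^sup>2) powr (\<bar>r\<bar> / 2)"
    by (intro powr_mono2) (auto simp: power2_sum)
  also have "\<dots> = (1 + norm \<xi>) powr \<bar>r\<bar>"
    using powr_powr[of "1 + norm \<xi>" 2 "\<bar>r\<bar> / 2"] by (simp add: add_pos_nonneg)
  also have "\<dots> \<le> (1 + norm \<xi>) powr real (nat \<lceil>\<bar>r\<bar>\<rceil>)"
    using 1 by (intro powr_mono) linarith+
  also have "\<dots> = (1 + norm \<xi>) ^ nat \<lceil>\<bar>r\<bar>\<rceil>" by (intro powr_realpow) (simp add: add_pos_nonneg)
  finally show ?thesis .
qed

lemma rapid_square_integrable:
  fixes h :: "real^'n::finite \<Rightarrow> complex"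
  assumes h: "rapid h"
  shows "integrable lborel (\<lambda>\<xi>. ((1 + (norm \<xi>)\<^sup>2) powr (r / 2) * norm (h \<xi>))\<^sup>2)"
proof -
  define w where "w \<xi> = (1 + (norm \<xi>)\<^sup>2) powr (r / 2)" for \<xi> :: "real^'n"
  have [measurable]: "w \<in> borel_measurable borel" unfolding w_def[abs_def] by measurable
  have w0: "w \<xi> \<ge> 0" for \<xi> by (simp add: w_def)
  have "rapid (\<lambda>\<xi>. of_real (w \<xi>) * h \<xi>)"
    by (rule rapid_mult[OF h, of _ "nat \<lceil>\<bar>r\<bar>\<rceil>"]) (use bessel_weight_le w0 in \<open>auto simp: w_def\<close>)
  note wh = this
  obtain A where A: "\<And>\<xi>. norm (of_real (w \<xi>) * h \<xi>) \<le> A"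
    using wh unfolding rapid_def by (metis mult_1 power_0)
  have "integrable lborel (\<lambda>\<xi>. (norm (of_real (w \<xi>) * h \<xi>))\<^sup>2)"
  proof (rule Bochner_Integration.integrable_bound)
    show "integrable lborel (\<lambda>\<xi>. A * norm (of_real (w \<xi>) * h \<xi>))"
      by (intro integrable_mult_right integrable_norm rapid_integrable wh)
    have [measurable]: "h \<in> borel_measurable borel" using h by (simp add: rapid_def)
    show "(\<lambda>\<xi>. (norm (of_real (w \<xi>) * h \<xi>))\<^sup>2) \<in> borel_measurable lborel" by measurable
    have "norm ((norm z)\<^sup>2) \<le> norm (A * norm z)" if "norm z \<le> A" for z :: complex
      using mult_right_mono[of "norm z" "\<bar>A\<bar>" "norm z"] that by (simp add: power2_eq_square abs_mult)
    then show "AE \<xi> in lborel. norm ((norm (of_real (w \<xi>) * h \<xi>))\<^sup>2) \<le> norm (A * norm (of_real (w \<xi>) * h \<xi>))"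
      using A by simp
  qed
  then show ?thesis by (simp add: norm_mult w_def)
qed

lemma inv_fourier_bounded:
  assumes "integrable lborel h"
  shows "\<exists>A. \<forall>x. norm (inv_fourier h x) \<le> A"
proof -
  have "norm (inv_fourier h x) \<le> (LINT \<xi>|lborel. norm (h \<xi>)) / (2 * pi) ^ CARD('a)" for x
    using integral_norm_bound[of lborel "\<lambda>\<xi>. cis (x \<bullet> \<xi>) * h \<xi>"]
    by (simp add: inv_fourier_def norm_divide norm_mult norm_power divide_right_mono)
  then show ?thesis by blast
qed

lemma borel_measurable_inv_fourier:
  fixes h :: "real^'n::finite \<Rightarrow> complex"
  assumes "integrable lborel h"
  shows "inv_fourier h \<in> borel_measurable borel"
proof -
  have [measurable]: "h \<in> borel_measurable borel" using assms by auto
  show ?thesis unfolding inv_fourier_def[abs_def] by measurable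
qed

lemma sobolev_density_inv_fourier:
  assumes h: "rapid h"
  shows "sobolev_density r (dist_of (inv_fourier h)) h"
  unfolding sobolev_density_def
  using rapid_square_integrable[OF h, of r] LINT_inv_fourier_mult[OF rapid_integrable[OF h]] h
  by (auto simp: fourier_dist_def dist_of_def rapid_def)

lemma sobolev_inv_fourier:
  assumes h: "rapid h"
  shows "dist_of (inv_fourier h) \<in> sobolev r"
proof -
  have "\<exists>A. \<forall>x. norm (inv_fourier h x) \<le> A" by (rule inv_fourier_bounded[OF rapid_integrable[OF h]])
  then have "tempered_distribution (dist_of (inv_fourier h))"
    using tempered_dist_of borel_measurable_inv_fourier[OF rapid_integrable[OF h]] by blast
  then show ?thesis
    unfolding sobolev_def using sobolev_density_inv_fourier[OF h] by blast
qed

lemma sobolev_schwartz: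
  assumes "schwartz f" shows "dist_of f \<in> sobolev r"
proof -
  have "inv_fourier (fourier f) = f" using fourier_inversion[OF assms] by blast
  then show ?thesis
    using sobolev_inv_fourier[OF rapid_schwartz[OF schwartz_fourier[OF assms]]] by metis
qed

section \<open>Dual norms\<close>

definition dual_norm :: "real \<Rightarrow> (real^'n::finite \<Rightarrow> complex) \<Rightarrow> real" where
  "dual_norm r \<phi> = sqrt (LINT \<xi>|lborel. ((1 + (norm \<xi>)\<^sup>2) powr (- r / 2) * norm (inv_fourier \<phi> \<xi>))\<^sup>2)"

lemma dual_norm_nonneg: "dual_norm r \<phi> \<ge> 0"
  by (simp add: dual_norm_def)

lemma sobolev_norm_nonneg: "sobolev_norm r T \<ge> 0"
  by (simp add: sobolev_norm_def)

text \<open>Since \<phi> is the transform of \<open>inv_fourier \<phi>\<close>, the value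
  \<open>T \<phi>\<close> is the integral of the density of T against
  \<open>inv_fourier \<phi>\<close>. Inserting \<open>w * v = 1\<close> and applying Cauchy-Schwarz
  separates the two norms; \<open>dual_norm r\<close> is thus the norm of order -r up to
  normalisation. The argument is run with the very density that \<open>sobolev_norm\<close>
  selects.\<close>

lemma sobolev_duality:
  fixes T :: "'n::finite functional"
  assumes T: "T \<in> sobolev r" and \<phi>: "schwartz \<phi>"
  shows "norm (T \<phi>) \<le> sobolev_norm r T * dual_norm r \<phi>"
proof -
  define h where "h = (SOME h. sobolev_density r T h)"
  have h: "sobolev_density r T h"
    using T someI_ex[of "sobolev_density r T"] unfolding h_def sobolev_def by blast
  define w where "w \<xi> = (1 + (norm \<xi>)\<^sup>2) powr (r / 2)" for \<xi> :: "real^'n"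
  define v where "v \<xi> = (1 + (norm \<xi>)\<^sup>2) powr (- r / 2)" for \<xi> :: "real^'n"
  have [measurable]: "w \<in> borel_measurable borel" "v \<in> borel_measurable borel"
    unfolding w_def[abs_def] v_def[abs_def] by measurable
  have wv: "w \<xi> * v \<xi> = 1" for \<xi>
    unfolding w_def v_def powr_add[symmetric] by (simp add: add_nonneg_eq_0_iff)
  let ?\<psi> = "inv_fourier \<phi>"
  have \<psi>: "schwartz ?\<psi>" by (rule schwartz_inv_fourier[OF \<phi>])
  have [measurable]: "h \<in> borel_measurable borel" "?\<psi> \<in> borel_measurable borel"
    using h schwartz_borel[OF \<psi>] by (auto simp: sobolev_density_def)
  have i1: "integrable lborel (\<lambda>\<xi>. (w \<xi> * norm (h \<xi>))\<^sup>2)"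
    using h by (simp add: sobolev_density_def w_def)
  have i2: "integrable lborel (\<lambda>\<xi>. (v \<xi> * norm (?\<psi> \<xi>))\<^sup>2)"
    using rapid_square_integrable[OF rapid_schwartz[OF \<psi>], of "- r"] by (simp add: v_def)
  have "fourier ?\<psi> = \<phi>" using fourier_inv_fourier[OF \<phi>] by blast
  then have "T \<phi> = (LINT \<xi>|lborel. h \<xi> * ?\<psi> \<xi>)"
    using h \<psi> unfolding sobolev_density_def fourier_dist_def dist_of_def by metis
  also have "norm \<dots> \<le> (LINT \<xi>|lborel. norm (h \<xi> * ?\<psi> \<xi>))"
    by (rule integral_norm_bound)
  also have "\<dots> = (LINT \<xi>|lborel. (w \<xi> * norm (h \<xi>)) * (v \<xi> * norm (?\<psi> \<xi>)))"
  proof (rule Bochner_Integration.integral_cong[OF refl])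
    fix \<xi>
    have "(w \<xi> * norm (h \<xi>)) * (v \<xi> * norm (?\<psi> \<xi>)) = (w \<xi> * v \<xi>) * (norm (h \<xi>) * norm (?\<psi> \<xi>))"
      by (simp only: mult_ac)
    then show "norm (h \<xi> * ?\<psi> \<xi>) = (w \<xi> * norm (h \<xi>)) * (v \<xi> * norm (?\<psi> \<xi>))"
      by (simp add: wv norm_mult)
  qed
  also have "\<dots> \<le> sqrt (LINT \<xi>|lborel. (w \<xi> * norm (h \<xi>))\<^sup>2) * sqrt (LINT \<xi>|lborel. (v \<xi> * norm (?\<psi> \<xi>))\<^sup>2)"
    using LINT_Cauchy_Schwarz(2)[OF _ _ i1 i2] by simp
  also have "\<dots> = sobolev_norm r T * dual_norm r \<phi>"
    by (simp add: sobolev_norm_def dual_norm_def w_def v_def h_def)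
  finally show ?thesis .
qed

lemma sobolev_on_norm_nonneg: "u \<in> sobolev_on r U \<Longrightarrow> sobolev_on_norm r U u \<ge> 0"
  unfolding sobolev_on_norm_def sobolev_on_def
  by (intro cINF_greatest) (auto simp: sobolev_norm_nonneg)

lemma sobolev_on_norm_le: "T \<in> extensions r U u \<Longrightarrow> sobolev_on_norm r U u \<le> sobolev_norm r T"
  unfolding sobolev_on_norm_def
  by (rule cINF_lower) (auto intro!: bdd_belowI2[of _ 0] sobolev_norm_nonneg)

text \<open>All extensions take the same value on a test function of U, so the estimate for each of
  them passes to the infimum. This is how quotient norms are bounded from below.\<close>

lemma sobolev_on_duality:
  assumes u: "u \<in> sobolev_on r U" and \<phi>: "test_fun U \<phi>"
  shows "norm (u \<phi>) \<le> sobolev_on_norm r U u * dual_norm r \<phi>"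
proof -
  have ne: "extensions r U u \<noteq> {}" using u by (simp add: sobolev_on_def)
  have le: "norm (u \<phi>) \<le> sobolev_norm r T * dual_norm r \<phi>" if "T \<in> extensions r U u" for T
    using that sobolev_duality[OF _ test_fun_schwartz[OF \<phi>], of T r] \<phi> by (auto simp: extensions_def)
  show ?thesis
  proof (cases "dual_norm r \<phi> = 0")
    case True
    then show ?thesis using le ne by fastforce
  next
    case False
    then have pos: "dual_norm r \<phi> > 0" using dual_norm_nonneg[of r \<phi>] by simp
    have "norm (u \<phi>) / dual_norm r \<phi> \<le> sobolev_on_norm r U u"
      unfolding sobolev_on_norm_def
      by (rule cINF_greatest[OF ne]) (use le pos in \<open>simp add: pos_divide_le_eq\<close>)
    then show ?thesis using pos by (simp add: pos_divide_le_eq)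
  qed
qed

definition L2sq :: "(real^'n::finite \<Rightarrow> complex) \<Rightarrow> real" where
  "L2sq f = (LINT x|lborel. (norm (f x))\<^sup>2)"

lemma L2sq_nonneg: "L2sq f \<ge> 0"
  by (simp add: L2sq_def)

lemma L2sq_cnj [simp]: "L2sq (\<lambda>x. cnj (f x)) = L2sq f"
  by (simp add: L2sq_def)

lemma schwartz_square_integrable:
  fixes f :: "real^'n::finite \<Rightarrow> complex"
  assumes "schwartz f" shows "integrable lborel (\<lambda>x. (norm (f x))\<^sup>2)"
proof -
  have "1 + (norm x)\<^sup>2 \<noteq> 0" for x :: "real^'n" using zero_le_power2[of "norm x"] by linarith
  then show ?thesis
    using rapid_square_integrable[OF rapid_schwartz[OF assms], of 0] by simp
qed

lemma L2sq_inv_fourier_le: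
  assumes "schwartz \<phi>" shows "L2sq (inv_fourier \<phi>) \<le> L2sq \<phi>"
proof -
  have "1 \<le> (2 * pi) ^ CARD('a)" using pi_ge_two by (intro one_le_power) auto
  then show ?thesis
    using mult_left_mono[of 1 "(2 * pi) ^ CARD('a)" "L2sq \<phi>"] L2sq_nonneg[of \<phi>]
    unfolding L2sq_def parseval[OF assms] by (simp add: pos_divide_le_eq)
qed

lemma dual_norm_le:
  assumes "schwartz \<phi>" "r \<ge> 0" shows "dual_norm r \<phi> \<le> sqrt (L2sq \<phi>)"
proof -
  have \<psi>: "schwartz (inv_fourier \<phi>)" using assms(1) by (rule schwartz_inv_fourier)
  have "(LINT \<xi>|lborel. ((1 + (norm \<xi>)\<^sup>2) powr (- r / 2) * norm (inv_fourier \<phi> \<xi>))\<^sup>2) \<le> L2sq (inv_fourier \<phi>)"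
    unfolding L2sq_def
  proof (rule integral_mono[OF rapid_square_integrable[OF rapid_schwartz[OF \<psi>]] schwartz_square_integrable[OF \<psi>]])
    fix \<xi> :: "real^'a"
    have "(1 + (norm \<xi>)\<^sup>2) powr (- r / 2) \<le> 1"
      using powr_mono[of "- r / 2" 0 "1 + (norm \<xi>)\<^sup>2"] assms(2) by (simp add: add_nonneg_eq_0_iff)
    then show "((1 + (norm \<xi>)\<^sup>2) powr (- r / 2) * norm (inv_fourier \<phi> \<xi>))\<^sup>2 \<le> (norm (inv_fourier \<phi> \<xi>))\<^sup>2"
      by (intro power_mono) (auto intro: mult_left_le_one_le)
  qed
  then show ?thesis
    unfolding dual_norm_def using L2sq_inv_fourier_le[OF assms(1)] by (intro real_sqrt_le_mono) linarith
qed

lemma abs_component_le_weight: "\<bar>\<xi> $ i\<bar> \<le> (1 + (norm \<xi>)\<^sup>2) powr (1 / 2)" for \<xi> :: "real^'n::finite"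
proof -
  have "(\<xi> $ i)\<^sup>2 \<le> (norm \<xi>)\<^sup>2"
    using component_le_norm_cart[of \<xi> i] by (metis abs_ge_zero power2_abs power_mono)
  then have "sqrt ((\<xi> $ i)\<^sup>2) \<le> sqrt (1 + (norm \<xi>)\<^sup>2)" by (intro real_sqrt_le_mono) simp
  then show ?thesis by (simp add: powr_half_sqrt)
qed

text \<open>A derivative multiplies the transform by a coordinate of \<xi>, which the weight of
  order -r absorbs as soon as \<open>r \<ge> 1\<close>. For \<open>r = 2 * s\<close> this is where
  \<open>1 / 2 \<le> s\<close> enters.\<close>

lemma dual_norm_partial_le:
  assumes \<phi>: "schwartz \<phi>" and r: "r \<ge> 1"
  shows "dual_norm r (partial_deriv i \<phi>) \<le> sqrt (L2sq \<phi>)"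
proof -
  have \<psi>: "schwartz (inv_fourier \<phi>)" using assms(1) by (rule schwartz_inv_fourier)
  have \<psi>': "schwartz (inv_fourier (partial_deriv i \<phi>))" by (intro schwartz_inv_fourier schwartz_partial \<phi>)
  have "(LINT \<xi>|lborel. ((1 + (norm \<xi>)\<^sup>2) powr (- r / 2) * norm (inv_fourier (partial_deriv i \<phi>) \<xi>))\<^sup>2) \<le> L2sq (inv_fourier \<phi>)"
    unfolding L2sq_def
  proof (rule integral_mono[OF rapid_square_integrable[OF rapid_schwartz[OF \<psi>']] schwartz_square_integrable[OF \<psi>]])
    fix \<xi> :: "real^'a"
    have "(1 + (norm \<xi>)\<^sup>2) powr (- r / 2) * \<bar>\<xi> $ i\<bar> \<le> (1 + (norm \<xi>)\<^sup>2) powr (- (1 / 2)) * (1 + (norm \<xi>)\<^sup>2) powr (1 / 2)"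
      using r by (intro mult_mono powr_mono abs_component_le_weight) auto
    also have "\<dots> = 1" unfolding powr_add[symmetric] by (simp add: add_nonneg_eq_0_iff)
    finally have "(1 + (norm \<xi>)\<^sup>2) powr (- r / 2) * \<bar>\<xi> $ i\<bar> \<le> 1" .
    then have "((1 + (norm \<xi>)\<^sup>2) powr (- r / 2) * \<bar>\<xi> $ i\<bar>) * norm (inv_fourier \<phi> \<xi>) \<le> norm (inv_fourier \<phi> \<xi>)"
      by (intro mult_left_le_one_le) auto
    then show "((1 + (norm \<xi>)\<^sup>2) powr (- r / 2) * norm (inv_fourier (partial_deriv i \<phi>) \<xi>))\<^sup>2 \<le> (norm (inv_fourier \<phi> \<xi>))\<^sup>2"
      unfolding inv_fourier_partial_deriv[OF \<phi>] by (intro power_mono) (auto simp: norm_mult mult.assoc)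
  qed
  then show ?thesis
    unfolding dual_norm_def using L2sq_inv_fourier_le[OF assms(1)] by (intro real_sqrt_le_mono) linarith
qed

text \<open>For \<open>s \<le> 1\<close> the squared weight is at most
  \<open>1 + (norm \<xi>)^2\<close>, the weight of H^1. The fractional norm of the dual function is
  thereby replaced by L^2 norms of first derivatives, which can be computed.\<close>

lemma dual_norm_neg_le:
  fixes \<phi> :: "real^'n::finite \<Rightarrow> complex"
  assumes \<phi>: "schwartz \<phi>" and s: "s \<le> 1"
  shows "dual_norm (- s) \<phi> \<le> sqrt (L2sq \<phi> + (\<Sum>i\<in>UNIV. L2sq (partial_deriv i \<phi>)))"
proof -
  let ?\<psi> = "inv_fourier \<phi>"
  have \<psi>: "schwartz ?\<psi>" by (rule schwartz_inv_fourier[OF \<phi>])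
  have \<psi>': "schwartz (inv_fourier (partial_deriv i \<phi>))" for i by (intro schwartz_inv_fourier schwartz_partial \<phi>)
  have "(LINT \<xi>|lborel. ((1 + (norm \<xi>)\<^sup>2) powr (- (- s) / 2) * norm (?\<psi> \<xi>))\<^sup>2)
    \<le> (LINT \<xi>|lborel. (norm (?\<psi> \<xi>))\<^sup>2 + (\<Sum>i\<in>UNIV. (norm (inv_fourier (partial_deriv i \<phi>) \<xi>))\<^sup>2))"
  proof (rule integral_mono[OF rapid_square_integrable[OF rapid_schwartz[OF \<psi>]]])
    show "integrable lborel (\<lambda>\<xi>. (norm (?\<psi> \<xi>))\<^sup>2 + (\<Sum>i\<in>UNIV. (norm (inv_fourier (partial_deriv i \<phi>) \<xi>))\<^sup>2))"
      by (intro Bochner_Integration.integrable_add Bochner_Integration.integrable_sum schwartz_square_integrable \<psi> \<psi>')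
    fix \<xi> :: "real^'n"
    have "((1 + (norm \<xi>)\<^sup>2) powr (- (- s) / 2))\<^sup>2 = (1 + (norm \<xi>)\<^sup>2) powr s"
      unfolding power2_eq_square powr_add[symmetric] by simp
    also have "\<dots> \<le> (1 + (norm \<xi>)\<^sup>2) powr 1" using s by (intro powr_mono) auto
    also have "\<dots> = 1 + (\<Sum>i\<in>UNIV. (\<xi> $ i)\<^sup>2)"
      unfolding power2_norm_eq_inner by (simp add: inner_vec_def power2_eq_square sum_nonneg add_nonneg_nonneg)
    finally have "((1 + (norm \<xi>)\<^sup>2) powr (- (- s) / 2) * norm (?\<psi> \<xi>))\<^sup>2 \<le> (1 + (\<Sum>i\<in>UNIV. (\<xi> $ i)\<^sup>2)) * (norm (?\<psi> \<xi>))\<^sup>2"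
      unfolding power_mult_distrib by (intro mult_right_mono) auto
    also have "\<dots> = (norm (?\<psi> \<xi>))\<^sup>2 + (\<Sum>i\<in>UNIV. (norm (inv_fourier (partial_deriv i \<phi>) \<xi>))\<^sup>2)"
      by (simp add: inv_fourier_partial_deriv \<phi> norm_mult power_mult_distrib distrib_right sum_distrib_right)
    finally show "((1 + (norm \<xi>)\<^sup>2) powr (- (- s) / 2) * norm (?\<psi> \<xi>))\<^sup>2 \<le> \<dots>" .
  qed
  also have "\<dots> = L2sq ?\<psi> + (\<Sum>i\<in>UNIV. L2sq (inv_fourier (partial_deriv i \<phi>)))"
    unfolding L2sq_def
    by (subst Bochner_Integration.integral_add)
      (auto intro!: Bochner_Integration.integrable_sum Bochner_Integration.integral_sum schwartz_square_integrable \<psi> \<psi>')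
  also have "\<dots> \<le> L2sq \<phi> + (\<Sum>i\<in>UNIV. L2sq (partial_deriv i \<phi>))"
    by (intro add_mono sum_mono L2sq_inv_fourier_le schwartz_partial \<phi>)
  finally show ?thesis unfolding dual_norm_def by (rule real_sqrt_le_mono)
qed

lemma LINT_by_parts:
  assumes f: "test_fun U f" and g: "smooth g"
  shows "(LINT x|lborel. f x * partial_deriv i g x) = - (LINT x|lborel. partial_deriv i f x * g x)"
proof -
  have eq: "partial_deriv i (\<lambda>x. f x * g x) = (\<lambda>x. partial_deriv i f x * g x + f x * partial_deriv i g x)"
    using f g by (auto intro!: partial_deriv_mult smooth_differentiable simp: test_fun_smooth)
  have "schwartz (\<lambda>x. f x * g x)" using f g by (intro test_fun_schwartz[OF test_fun_mult])
  from LINT_partial_deriv[OF this, of i]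
  have "(LINT x|lborel. partial_deriv i f x * g x + f x * partial_deriv i g x) = 0"
    unfolding eq .
  moreover have "integrable lborel (\<lambda>x. partial_deriv i f x * g x)" "integrable lborel (\<lambda>x. f x * partial_deriv i g x)"
    by (auto intro!: schwartz_integrable test_fun_schwartz[OF test_fun_mult] test_fun_partial f smooth_partial g)
  ultimately show ?thesis by (simp add: add_eq_0_iff2)
qed

text \<open>The lower bounds come from testing g against its own conjugate and against the conjugate
  of its second derivative in direction i. Both are test functions of U, so the quotient norm
  controls these pairings directly, and one factor of the L^2 norm cancels.\<close>

lemma L2sq_le_sobolev:
  assumes g: "test_fun U g" and u: "dist_of g \<in> sobolev_on r U" and r: "r \<ge> 1"
  shows "sqrt (L2sq g) \<le> sobolev_on_norm r U (dist_of g)"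
    and "sqrt (L2sq (partial_deriv i g)) \<le> sobolev_on_norm r U (dist_of g)"
proof -
  let ?S = "sobolev_on_norm r U (dist_of g)"
  have sq: "(LINT x|lborel. f x * cnj (f x)) = of_real (L2sq f)" for f :: "real^'a \<Rightarrow> complex"
    unfolding L2sq_def integral_complex_of_real[symmetric] by (simp only: complex_norm_square)
  have cancel: "sqrt a \<le> ?S" if "a \<le> ?S * sqrt a" "a \<ge> 0" for a
  proof (cases "a = 0")
    case True
    then show ?thesis using sobolev_on_norm_nonneg[OF u] by simp
  next
    case False
    then have "sqrt a > 0" "a = sqrt a * sqrt a" using that by auto
    then show ?thesis using that by (metis mult_right_le_imp_le)
  qed
  have gs: "smooth g" "schwartz g" using g by (auto intro: test_fun_smooth test_fun_schwartz)
  have c: "test_fun U (\<lambda>x. cnj (g x))" by (rule test_fun_cnj[OF g])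
  have "L2sq g = norm (dist_of g (\<lambda>x. cnj (g x)))" by (simp add: dist_of_def sq L2sq_nonneg)
  also have "\<dots> \<le> ?S * dual_norm r (\<lambda>x. cnj (g x))" by (rule sobolev_on_duality[OF u c])
  also have "\<dots> \<le> ?S * sqrt (L2sq g)"
    using dual_norm_le[OF test_fun_schwartz[OF c], of r] r
    by (intro mult_left_mono sobolev_on_norm_nonneg u) auto
  finally show "sqrt (L2sq g) \<le> ?S" by (rule cancel[OF _ L2sq_nonneg])
  let ?d = "partial_deriv i (\<lambda>x. cnj (g x))"
  have d: "test_fun U ?d" "test_fun U (partial_deriv i ?d)" by (intro test_fun_partial c)+
  have d_eq: "?d = (\<lambda>x. cnj (partial_deriv i g x))"
    using gs by (auto intro!: partial_deriv_cnj smooth_differentiable)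
  have "dist_of g (partial_deriv i ?d) = - (LINT x|lborel. partial_deriv i g x * ?d x)"
    unfolding dist_of_def by (rule LINT_by_parts[OF g test_fun_smooth[OF d(1)]])
  also have "\<dots> = - of_real (L2sq (partial_deriv i g))" unfolding d_eq sq ..
  finally have "L2sq (partial_deriv i g) = norm (dist_of g (partial_deriv i ?d))"
    by (simp add: L2sq_nonneg)
  also have "\<dots> \<le> ?S * dual_norm r (partial_deriv i ?d)" by (rule sobolev_on_duality[OF u d(2)])
  also have "\<dots> \<le> ?S * sqrt (L2sq ?d)"
    by (intro mult_left_mono sobolev_on_norm_nonneg u dual_norm_partial_le r test_fun_schwartz[OF d(1)])
  also have "L2sq ?d = L2sq (partial_deriv i g)" unfolding d_eq by simp
  finally show "sqrt (L2sq (partial_deriv i g)) \<le> ?S" by (rule cancel[OF _ L2sq_nonneg])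
qed

section \<open>Cutoff functions\<close>

text \<open>The function \<open>exp (- 1 / t)\<close> extended by 0, with a polynomial factor in
  \<open>u = 1 / t\<close>. Differentiation maps p to \<open>u^2 * (p - p')\<close>, so the family
  is stable, as \<open>smooth_coinduct\<close> requires.\<close>

definition flat :: "real poly \<Rightarrow> real \<Rightarrow> real" where
  "flat p t = (if t > 0 then poly p (1 / t) * exp (- (1 / t)) else 0)"

text \<open>Induction on the coefficients, with half of the exponential rate spent at each step: u
  is at most \<open>2 / c * exp (c / 2 * u)\<close>.\<close>

lemma poly_le_exp:
  fixes p :: "real poly"
  assumes "c > 0" shows "\<exists>B. \<forall>u\<ge>0. \<bar>poly p u\<bar> \<le> B * exp (c * u)"
  using assms
proof (induction p arbitrary: c)
  case 0
  then show ?case by (auto intro: exI[of _ 0])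
next
  case (pCons a p)
  obtain B where B: "\<And>u. u \<ge> 0 \<Longrightarrow> \<bar>poly p u\<bar> \<le> B * exp (c / 2 * u)"
    using pCons.IH[of "c / 2"] pCons.prems by auto
  have "\<bar>poly (pCons a p) u\<bar> \<le> (\<bar>a\<bar> + 2 / c * B) * exp (c * u)" if u: "u \<ge> 0" for u
  proof -
    have "c / 2 * u \<le> exp (c / 2 * u)" using exp_ge_add_one_self[of "c / 2 * u"] by linarith
    then have ule: "u \<le> 2 / c * exp (c / 2 * u)" using pCons.prems by (simp add: field_simps)
    have "u * \<bar>poly p u\<bar> \<le> (2 / c * exp (c / 2 * u)) * (B * exp (c / 2 * u))"
      by (intro mult_mono ule B u) (use pCons.prems in auto)
    also have "\<dots> = 2 / c * B * (exp (c / 2 * u) * exp (c / 2 * u))" by (simp only: mult_ac)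
    also have "exp (c / 2 * u) * exp (c / 2 * u) = exp (c * u)"
      unfolding exp_add[symmetric] by (simp add: field_simps)
    finally have "u * \<bar>poly p u\<bar> \<le> 2 / c * B * exp (c * u)" .
    moreover have "\<bar>a\<bar> \<le> \<bar>a\<bar> * exp (c * u)"
      using u pCons.prems by (simp add: mult_left_mono[of 1, simplified] mult_le_cancel_left1)
    moreover have "\<bar>poly (pCons a p) u\<bar> \<le> \<bar>a\<bar> + u * \<bar>poly p u\<bar>"
      using abs_triangle_ineq[of a "u * poly p u"] u by (simp add: abs_mult)
    ultimately show ?thesis by (simp add: distrib_right)
  qed
  then show ?case by blast
qed

lemma flat_bounded: "\<exists>B. \<forall>t. \<bar>flat p t\<bar> \<le> B"
proof -
  obtain B where B: "\<And>u. u \<ge> 0 \<Longrightarrow> \<bar>poly p u\<bar> \<le> B * exp (1 * u)"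
    using poly_le_exp[of 1 p] by auto
  have B0: "B \<ge> 0" using B[of 0] by simp
  have "\<bar>flat p t\<bar> \<le> B" for t
  proof (cases "t > 0")
    case True
    then have "\<bar>flat p t\<bar> \<le> (B * exp (1 * (1 / t))) * exp (- (1 / t))"
      unfolding flat_def abs_mult using B[of "1 / t"] by (simp add: abs_mult)
    also have "\<dots> = B" by (simp add: mult.assoc exp_minus)
    finally show ?thesis .
  qed (use B0 in \<open>simp add: flat_def\<close>)
  then show ?thesis by blast
qed

lemma flat_has_derivative:
  "(flat p has_real_derivative flat ([:0, 0, 1:] * (p - pderiv p)) t) (at t)"
proof -
  consider "t > 0" | "t < 0" | "t = 0" by linarith
  then show ?thesis
  proof cases
    case 1
    have "((\<lambda>t. poly p (1 / t) * exp (- (1 / t))) has_real_derivative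
        flat ([:0, 0, 1:] * (p - pderiv p)) t) (at t)"
      using 1 by (auto intro!: derivative_eq_intros simp: flat_def power2_eq_square field_simps)
    then show ?thesis
      by (rule has_field_derivative_transform_within_open[of _ _ _ "{0<..}"]) (use 1 in \<open>auto simp: flat_def\<close>)
  next
    case 2
    have "((\<lambda>t. 0) has_real_derivative 0) (at t)" by simp
    then have "(flat p has_real_derivative 0) (at t)"
      by (rule has_field_derivative_transform_within_open[of _ _ _ "{..<0}"]) (use 2 in \<open>auto simp: flat_def\<close>)
    then show ?thesis using 2 by (simp add: flat_def)
  next
    case 3
    obtain B where B: "\<And>t. \<bar>flat ([:0, 0, 1:] * p) t\<bar> \<le> B" using flat_bounded by blast
    \<comment> \<open>Two powers of \<open>1 / h\<close> can be moved into the polynomial and the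
      result is still bounded. The function thus vanishes to second order at the origin, and its
      derivative there is 0.\<close>
    have sq: "\<bar>flat p h\<bar> \<le> B * h\<^sup>2" for h
    proof (cases "h > 0")
      case True
      then have "flat p h = flat ([:0, 0, 1:] * p) h * h\<^sup>2"
        by (simp add: flat_def power2_eq_square)
      then show ?thesis using B[of h] by (simp add: abs_mult mult_right_mono)
    next
      case False
      then show ?thesis using B[of 0] by (simp add: flat_def)
    qed
    have "((\<lambda>h. (flat p (0 + h) - flat p 0) / h) \<longlongrightarrow> 0) (at 0)"
    proof (rule Lim_null_comparison)
      show "((\<lambda>h. B * \<bar>h\<bar>) \<longlongrightarrow> 0) (at 0)" by (rule tendsto_eq_intros | simp)+
      have "norm ((flat p (0 + h) - flat p 0) / h) \<le> B * \<bar>h\<bar>" if "h \<noteq> 0" for h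
        using sq[of h] that by (simp add: flat_def[of _ 0] abs_mult pos_divide_le_eq power2_eq_square mult.assoc)
      then show "\<forall>\<^sub>F h in at 0. norm ((flat p (0 + h) - flat p 0) / h) \<le> B * \<bar>h\<bar>"
        by (auto simp: eventually_at intro!: exI[of _ 1])
    qed
    then show ?thesis using 3 by (simp add: DERIV_def flat_def[of _ 0])
  qed
qed

lemma smooth_flat: "smooth (\<lambda>x::real^'n::finite. of_real (flat p (c * x $ i + b)))"
proof (rule smooth_coinduct[of _ "{(\<lambda>x. of_real (k * flat p (c * x $ i + b))) | k p. True}"])
  fix f :: "real^'n \<Rightarrow> complex" and j
  assume "f \<in> {(\<lambda>x. of_real (k * flat p (c * x $ i + b))) | k p. True}"
  then obtain k p where f: "f = (\<lambda>x. of_real (k * flat p (c * x $ i + b)))" by blast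
  let ?q = "[:0, 0, 1:] * (p - pderiv p)"
  have D: "(f has_derivative (\<lambda>h. of_real (k * (c * h $ i * flat ?q (c * x $ i + b))))) (at x)" for x
  proof -
    have 1: "((\<lambda>x. c * x $ i + b) has_derivative (\<lambda>h. c * h $ i)) (at x)"
      by (auto intro!: derivative_eq_intros bounded_linear_imp_has_derivative bounded_linear_vec_nth)
    have "((\<lambda>x. flat p (c * x $ i + b)) has_derivative (\<lambda>h. flat ?q (c * x $ i + b) * (c * h $ i))) (at x)"
      by (rule has_derivative_compose[OF 1 flat_has_derivative[unfolded has_field_derivative_def]])
    from has_derivative_of_real[OF has_derivative_mult_right[OF this, of k]]
    show ?thesis unfolding f by (simp add: mult_ac)
  qed
  show "f differentiable (at x)" for x using D by (rule differentiableI)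
  have "partial_deriv j f = (\<lambda>x. of_real ((k * (c * axis j 1 $ i)) * flat ?q (c * x $ i + b)))"
    using partial_deriv_eq[OF D] by (auto simp: mult.assoc)
  then show "partial_deriv j f \<in> {(\<lambda>x. of_real (k * flat p (c * x $ i + b))) | k p. True}" by blast
qed (auto intro!: exI[of _ 1] exI[of _ p])

abbreviation "sig \<equiv> flat 1"

lemma sig_pos: "t > 0 \<Longrightarrow> sig t > 0" and sig_0: "t \<le> 0 \<Longrightarrow> sig t = 0"
  and sig_nonneg: "sig t \<ge> 0" and sig_le_1: "sig t \<le> 1"
  by (auto simp: flat_def)

text \<open>The positive and the negative part of f are densities of measures that agree on boxes, a
  generating system stable under intersection, hence agree everywhere. Densities of the same measure
  coincide almost everywhere, and the two parts of f can only coincide where both are 0.\<close>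

lemma AE_zero_if_box_zero:
  fixes f :: "'a::euclidean_space \<Rightarrow> real"
  assumes [measurable]: "f \<in> borel_measurable borel"
    and int: "\<And>a b. integrable lborel (\<lambda>x. indicator (box a b) x * f x)"
    and zero: "\<And>a b. (LINT x|lborel. indicator (box a b) x * f x) = 0"
  shows "AE x in lborel. f x = 0"
proof -
  define M where "M c = density lborel (\<lambda>x. ennreal (max 0 (c * f x)))" for c
  have box: "emeasure (M c) (box a b) = ennreal (LINT x|lborel. max 0 (c * (indicator (box a b) x * f x)))" for c a b
  proof -
    have "emeasure (M c) (box a b) = (\<integral>\<^sup>+x. ennreal (max 0 (c * (indicator (box a b) x * f x))) \<partial>lborel)"
      unfolding M_def by (subst emeasure_density) (auto intro!: nn_integral_cong simp: indicator_def)
    also have "\<dots> = ennreal (LINT x|lborel. max 0 (c * (indicator (box a b) x * f x)))"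
      using int by (intro nn_integral_eq_integral) auto
    finally show ?thesis .
  qed
  have "M 1 = M (- 1)"
  proof (rule measure_eqI_generator_eq)
    let ?E = "range (\<lambda>(a, b). box a b::'a set)"
    show "Int_stable ?E" by (auto simp: Int_stable_def box_Int_box)
    show "?E \<subseteq> Pow UNIV" "sets (M 1) = sigma_sets UNIV ?E" "sets (M (- 1)) = sigma_sets UNIV ?E"
      by (simp_all add: borel_eq_box M_def)
    let ?A = "\<lambda>n::nat. box (- (real n *\<^sub>R One)) (real n *\<^sub>R One) :: 'a set"
    show "range ?A \<subseteq> ?E" "(\<Union>i. ?A i) = UNIV" unfolding UN_box_eq_UNIV by auto
    show "emeasure (M 1) (?A i) \<noteq> \<infinity>" for i unfolding box by simp
    fix X :: "'a set" assume "X \<in> ?E"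
    then obtain a b where X: "X = box a b" by auto
    let ?g = "\<lambda>x. indicator (box a b) x * f x"
    have "(LINT x|lborel. max 0 (1 * ?g x)) - (LINT x|lborel. max 0 (- 1 * ?g x)) = (LINT x|lborel. max 0 (1 * ?g x) - max 0 (- 1 * ?g x))"
      by (rule Bochner_Integration.integral_diff[symmetric]) (use int[of a b] in auto)
    also have "\<dots> = (LINT x|lborel. ?g x)" by (intro Bochner_Integration.integral_cong) auto
    finally show "emeasure (M 1) X = emeasure (M (- 1)) X"
      unfolding X box using zero[of a b] by simp
  qed
  then have "AE x in lborel. ennreal (max 0 (1 * f x)) = ennreal (max 0 (- 1 * f x))"
    unfolding M_def by (intro sigma_finite_measure.density_unique[OF sigma_finite_lborel]) auto
  then show ?thesis
    by eventually_elim (auto simp: max_def split: if_splits)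
qed

text \<open>\<open>sobolev_norm\<close> evaluates a density picked by choice, so even for the zero
  distribution the density must be shown to vanish almost everywhere. Smooth cutoffs converging to
  the indicator of a box reduce this to \<open>AE_zero_if_box_zero\<close>.\<close>

lemma sobolev_norm_zero:
  fixes T :: "'n::finite functional"
  assumes T: "T \<in> sobolev r" and zero: "\<And>\<phi>. schwartz \<phi> \<Longrightarrow> T \<phi> = 0"
  shows "sobolev_norm r T = 0"
proof -
  define h where "h = (SOME h. sobolev_density r T h)"
  have h: "sobolev_density r T h"
    using T someI_ex[of "sobolev_density r T"] unfolding h_def sobolev_def by blast
  have [measurable]: "h \<in> borel_measurable borel" using h by (simp add: sobolev_density_def)
  have hz: "(LINT \<xi>|lborel. h \<xi> * \<phi> \<xi>) = 0" if "schwartz \<phi>" for \<phi>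
    using h zero[OF schwartz_fourier[OF that]] that by (simp add: sobolev_density_def fourier_dist_def dist_of_def)
  have int: "integrable lborel (\<lambda>\<xi>. indicator (box a b) \<xi> * h \<xi>)" for a b
  proof (rule Bochner_Integration.integrable_bound)
    \<comment> \<open>Local integrability of the density:
      \<open>norm (h \<xi>) = (w \<xi> * norm (h \<xi>)) * v \<xi>\<close> is at most the sum of the
      squares of the two factors, and v is bounded on a bounded box.\<close>
    define w where "w \<xi> = (1 + (norm \<xi>)\<^sup>2) powr (r / 2)" for \<xi> :: "real^'n"
    define v where "v \<xi> = (1 + (norm \<xi>)\<^sup>2) powr (- r / 2)" for \<xi> :: "real^'n"
    have pos: "1 + (norm \<xi>)\<^sup>2 \<noteq> 0" for \<xi> :: "real^'n" using zero_le_power2[of "norm \<xi>"] by linarith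
    have wv: "w \<xi> * v \<xi> = 1" for \<xi>
      unfolding w_def v_def powr_add[symmetric] using pos[of \<xi>] by simp
    have "continuous_on (cbox a b) (\<lambda>\<xi>. (v \<xi>)\<^sup>2)"
      unfolding v_def using pos by (intro continuous_intros) auto
    then have "integrable lborel (\<lambda>\<xi>. indicator (cbox a b) \<xi> *\<^sub>R (v \<xi>)\<^sup>2)"
      by (intro borel_integrable_compact) auto
    then show "integrable lborel (\<lambda>\<xi>. (w \<xi> * norm (h \<xi>))\<^sup>2 + indicator (cbox a b) \<xi> *\<^sub>R (v \<xi>)\<^sup>2)"
      using h by (intro Bochner_Integration.integrable_add) (auto simp: sobolev_density_def w_def)
    have "norm (indicator (box a b) \<xi> * h \<xi>) \<le> (w \<xi> * norm (h \<xi>))\<^sup>2 + indicator (cbox a b) \<xi> *\<^sub>R (v \<xi>)\<^sup>2" for \<xi>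
    proof (cases "\<xi> \<in> box a b")
      case True
      then have "\<xi> \<in> cbox a b" using box_subset_cbox by blast
      have "norm (h \<xi>) = (w \<xi> * norm (h \<xi>)) * v \<xi>" using wv[of \<xi>] by (simp add: mult_ac)
      also have "\<dots> \<le> 2 * (w \<xi> * norm (h \<xi>)) * v \<xi>" by (simp add: w_def v_def)
      also have "\<dots> \<le> (w \<xi> * norm (h \<xi>))\<^sup>2 + (v \<xi>)\<^sup>2" by (rule sum_squares_bound)
      finally show ?thesis using True \<open>\<xi> \<in> cbox a b\<close> by simp
    qed simp
    then show "AE \<xi> in lborel. norm (indicator (box a b) \<xi> * h \<xi>) \<le> norm ((w \<xi> * norm (h \<xi>))\<^sup>2 + indicator (cbox a b) \<xi> *\<^sub>R (v \<xi>)\<^sup>2)"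
      by (intro AE_I2) (smt (verit) real_norm_def)
  qed measurable
  have box0: "(LINT \<xi>|lborel. indicator (box a b) \<xi> * h \<xi>) = 0" for a b
  proof -
    \<comment> \<open>As k grows, \<open>sig (real (Suc k) * c)\<close> tends to 1 for c > 0, while
      it is 0 for \<open>c \<le> 0\<close>. With one factor for each face, the product converges
      pointwise to the indicator of the open box.\<close>
    define \<phi> where "\<phi> k \<xi> = (\<Prod>i\<in>UNIV. sig (real (Suc k) * (\<xi> $ i - a $ i)) * sig (real (Suc k) * (b $ i - \<xi> $ i)))" for k and \<xi> :: "real^'n"
    have box_iff: "\<xi> \<in> box a b \<longleftrightarrow> (\<forall>i. a $ i < \<xi> $ i \<and> \<xi> $ i < b $ i)" for \<xi> by (simp add: mem_box_cart)
    have out: "\<phi> k \<xi> = 0" if out: "\<xi> \<notin> box a b" for k \<xi>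
    proof -
      obtain i where "\<xi> $ i \<le> a $ i \<or> b $ i \<le> \<xi> $ i" using out by (auto simp: box_iff not_less)
      then have "sig (real (Suc k) * (\<xi> $ i - a $ i)) * sig (real (Suc k) * (b $ i - \<xi> $ i)) = 0"
        by (auto simp: sig_0 mult_nonneg_nonpos)
      then show ?thesis unfolding \<phi>_def by (intro prod_zero) auto
    qed
    have \<phi>01: "0 \<le> \<phi> k \<xi>" "\<phi> k \<xi> \<le> 1" for k \<xi>
      unfolding \<phi>_def by (auto intro!: prod_nonneg prod_le_1 mult_nonneg_nonneg mult_le_one sig_nonneg sig_le_1)
    have lim: "(\<lambda>k. \<phi> k \<xi>) \<longlonglongrightarrow> indicator (box a b) \<xi>" for \<xi>
    proof (cases "\<xi> \<in> box a b")
      case True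
      have 1: "(\<lambda>k. sig (real (Suc k) * c)) \<longlonglongrightarrow> 1" if "c > 0" for c
      proof -
        have "(\<lambda>k. exp (- (1 / c * (1 / real (Suc k))))) \<longlonglongrightarrow> exp (- (1 / c * 0))"
          by (intro tendsto_intros lim_1_over_n[THEN LIMSEQ_Suc])
        then show ?thesis using that by (simp add: flat_def mult.commute)
      qed
      have "(\<lambda>k. \<phi> k \<xi>) \<longlonglongrightarrow> (\<Prod>i\<in>(UNIV::'n set). 1 * 1)"
        unfolding \<phi>_def using True by (intro tendsto_intros 1) (auto simp: box_iff)
      then show ?thesis using True by simp
    qed (simp add: out)
    have "smooth (\<lambda>\<xi>. complex_of_real (\<phi> k \<xi>))" for k
    proof -
      have "smooth (\<lambda>\<xi>. \<Prod>i\<in>UNIV. complex_of_real (sig (real (Suc k) * \<xi> $ i + (- real (Suc k) * a $ i))) * of_real (sig ((- real (Suc k)) * \<xi> $ i + real (Suc k) * b $ i)))"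
        by (intro smooth_prod smooth_mult smooth_flat)
      then show ?thesis by (simp add: \<phi>_def algebra_simps)
    qed
    then have "test_fun UNIV (\<lambda>\<xi>. complex_of_real (\<phi> k \<xi>))" for k
      by (rule test_funI[where K = "cbox a b"]) (use out box_subset_cbox[of a b] in auto)
    then have \<phi>_sch: "schwartz (\<lambda>\<xi>. complex_of_real (\<phi> k \<xi>))" for k by (rule test_fun_schwartz)
    then have [measurable]: "(\<lambda>\<xi>. complex_of_real (\<phi> k \<xi>)) \<in> borel_measurable borel" for k
      by (rule schwartz_borel)
    have "(\<lambda>k. LINT \<xi>|lborel. h \<xi> * of_real (\<phi> k \<xi>)) \<longlonglongrightarrow> (LINT \<xi>|lborel. h \<xi> * of_real (indicator (box a b) \<xi>))"
    proof (rule integral_dominated_convergence[where w = "\<lambda>\<xi>. norm (indicator (box a b) \<xi> * h \<xi>)"])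
      show "integrable lborel (\<lambda>\<xi>. norm (indicator (box a b) \<xi> * h \<xi>))" by (intro integrable_norm int)
      show "AE \<xi> in lborel. (\<lambda>k. h \<xi> * of_real (\<phi> k \<xi>)) \<longlonglongrightarrow> h \<xi> * of_real (indicator (box a b) \<xi>)"
        by (intro AE_I2 tendsto_intros lim)
      show "AE \<xi> in lborel. norm (h \<xi> * of_real (\<phi> k \<xi>)) \<le> norm (indicator (box a b) \<xi> * h \<xi>)" for k
      proof (intro AE_I2)
        fix \<xi>
        show "norm (h \<xi> * of_real (\<phi> k \<xi>)) \<le> norm (indicator (box a b) \<xi> * h \<xi>)"
          using \<phi>01[of k \<xi>] out[of \<xi> k] by (cases "\<xi> \<in> box a b") (auto simp: norm_mult mult_left_le)
      qed
    qed measurable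
    then have "(\<lambda>k. 0) \<longlonglongrightarrow> (LINT \<xi>|lborel. h \<xi> * of_real (indicator (box a b) \<xi>))"
      unfolding hz[OF \<phi>_sch] .
    then have "(LINT \<xi>|lborel. h \<xi> * of_real (indicator (box a b) \<xi>)) = 0"
      by (simp add: LIMSEQ_const_iff)
    moreover have "complex_of_real (indicator (box a b) \<xi>) = indicator (box a b) \<xi>" for \<xi>
      by (simp add: indicator_def)
    ultimately show ?thesis by (simp add: mult.commute)
  qed
  have "AE \<xi> in lborel. Re (h \<xi>) = 0"
  proof (rule AE_zero_if_box_zero)
    fix a b
    have eq: "indicator (box a b) \<xi> * Re (h \<xi>) = Re (indicator (box a b) \<xi> * h \<xi>)" for \<xi> by (simp add: indicator_def)
    show "integrable lborel (\<lambda>\<xi>. indicator (box a b) \<xi> * Re (h \<xi>))" unfolding eq by (intro integrable_Re int)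
    show "(LINT \<xi>|lborel. indicator (box a b) \<xi> * Re (h \<xi>)) = 0" unfolding eq integral_Re[OF int] box0 by simp
  qed measurable
  moreover have "AE \<xi> in lborel. Im (h \<xi>) = 0"
  proof (rule AE_zero_if_box_zero)
    fix a b
    have eq: "indicator (box a b) \<xi> * Im (h \<xi>) = Im (indicator (box a b) \<xi> * h \<xi>)" for \<xi> by (simp add: indicator_def)
    show "integrable lborel (\<lambda>\<xi>. indicator (box a b) \<xi> * Im (h \<xi>))" unfolding eq by (intro integrable_Im int)
    show "(LINT \<xi>|lborel. indicator (box a b) \<xi> * Im (h \<xi>)) = 0" unfolding eq integral_Im[OF int] box0 by simp
  qed measurable
  ultimately have "AE \<xi> in lborel. ((1 + (norm \<xi>)\<^sup>2) powr (r / 2) * norm (h \<xi>))\<^sup>2 = 0"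
    by eventually_elim (simp add: complex_eq_iff)
  then have "(LINT \<xi>|lborel. ((1 + (norm \<xi>)\<^sup>2) powr (r / 2) * norm (h \<xi>))\<^sup>2) = (LINT \<xi>::real^'n|lborel. 0)"
    by (intro Bochner_Integration.integral_cong_AE) auto
  then show ?thesis by (simp add: sobolev_norm_def h_def)
qed

text \<open>A fixed profile is rescaled to width \<delta>, so B depends neither on \<delta> nor on
  t0, and the function and its first derivative scale like \<open>1 / \<delta>\<close> and
  \<open>1 / \<delta>^2\<close>. These are the two sizes that enter the H^1 norm of the dual
  function, where higher derivatives are imitated by difference quotients.\<close>

lemma bump_exists:
  "\<exists>B\<ge>1. \<forall>t0 \<delta>. \<delta> > 0 \<longrightarrow> (\<exists>e e'. (\<forall>t. (e has_real_derivative e' t) (at t)) \<and>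
     (\<forall>t. 0 \<le> e t \<and> e t \<le> B / \<delta> \<and> \<bar>e' t\<bar> \<le> B / \<delta>\<^sup>2) \<and> (\<forall>t. t \<notin> {t0..t0 + \<delta>} \<longrightarrow> e t = 0 \<and> e' t = 0) \<and>
     (LINT t|lborel. e t) = 1 \<and> smooth (\<lambda>x::real^'n::finite. of_real (e (x $ i))))"
proof -
  define f where "f t = sig t * sig (1 - t)" for t
  define q where "q = ([:0, 0, 1:] * (1 - pderiv 1) :: real poly)"
  define f' where "f' t = flat q t * sig (1 - t) - sig t * flat q (1 - t)" for t
  have f': "(f has_real_derivative f' t) (at t)" for t
  proof -
    have 1: "(sig has_real_derivative flat q t) (at t)" for t unfolding q_def by (rule flat_has_derivative)
    have "((\<lambda>t. sig (1 - t)) has_real_derivative flat q (1 - t) * (- 1)) (at t)"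
      by (rule DERIV_chain2[OF 1]) (auto intro!: derivative_eq_intros)
    from DERIV_mult[OF 1 this] show ?thesis unfolding f_def[abs_def] f'_def by (simp add: mult_ac)
  qed
  have f01: "0 \<le> f t" "f t \<le> 1" for t
    unfolding f_def by (auto intro!: mult_nonneg_nonneg mult_le_one sig_nonneg sig_le_1)
  have f0: "f t = 0" "f' t = 0" if "t \<notin> {0..1}" for t
    using that by (auto simp: f_def f'_def flat_def)
  obtain Q where Q: "\<And>t. \<bar>flat q t\<bar> \<le> Q" using flat_bounded by blast
  have Q0: "Q \<ge> 0" using Q[of 0] by linarith
  have f'_le: "\<bar>f' t\<bar> \<le> 2 * Q" for t
  proof -
    have "\<bar>flat q t * sig (1 - t)\<bar> \<le> Q * 1" "\<bar>sig t * flat q (1 - t)\<bar> \<le> 1 * Q"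
      unfolding abs_mult by (rule mult_mono; simp add: sig_nonneg sig_le_1 Q Q0)+
    then show ?thesis unfolding f'_def by linarith
  qed
  have contf: "continuous_on A f" for A
    using f' by (meson DERIV_isCont continuous_at_imp_continuous_on)
  have int_f: "integrable lborel f"
  proof -
    have "integrable lborel (\<lambda>t. indicator {0..1} t *\<^sub>R f t)"
      by (intro borel_integrable_compact contf) auto
    moreover have "(\<lambda>t. indicator {0..1} t *\<^sub>R f t) = f" by (rule ext) (use f0 in \<open>auto simp: indicator_def\<close>)
    ultimately show ?thesis by (simp only:)
  qed
  define Z where "Z = (LINT t|lborel. f t)"
  have "Z > 0"
  proof -
    have "Z \<noteq> 0"
    proof
      assume "Z = 0"
      then have "AE t in lborel. f t = 0"
        unfolding Z_def using integral_nonneg_eq_0_iff_AE[OF int_f] f01 by auto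
      moreover have "f t \<noteq> 0" if "t \<in> {0<..<1}" for t
        using that sig_pos[of t] sig_pos[of "1 - t"] by (simp add: f_def)
      ultimately have "AE t in lborel. t \<notin> {0<..<1::real}" by (auto elim!: eventually_mono)
      then have "emeasure lborel {0<..<1::real} = 0"
        by (subst (asm) AE_iff_measurable[of "{0<..<1}"]) auto
      then show False by simp
    qed
    moreover have "Z \<ge> 0" unfolding Z_def by (intro Bochner_Integration.integral_nonneg f01)
    ultimately show ?thesis by simp
  qed
  define B where "B = max 1 (max (1 / Z) (2 * Q / Z))"
  have "\<exists>e e'. (\<forall>t. (e has_real_derivative e' t) (at t)) \<and>
     (\<forall>t. 0 \<le> e t \<and> e t \<le> B / \<delta> \<and> \<bar>e' t\<bar> \<le> B / \<delta>\<^sup>2) \<and> (\<forall>t. t \<notin> {t0..t0 + \<delta>} \<longrightarrow> e t = 0 \<and> e' t = 0) \<and>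
     (LINT t|lborel. e t) = 1 \<and> smooth (\<lambda>x::real^'n. of_real (e (x $ i)))" if \<delta>: "\<delta> > 0" for t0 \<delta>
  proof (intro exI conjI allI impI)
    let ?e = "\<lambda>t. 1 / (\<delta> * Z) * f (1 / \<delta> * t + (- t0 / \<delta>))"
    let ?e' = "\<lambda>t. 1 / (\<delta> * Z) * (f' (1 / \<delta> * t + (- t0 / \<delta>)) * (1 / \<delta>))"
    show "(?e has_real_derivative ?e' t) (at t)" for t
      by (intro DERIV_cmult DERIV_chain2[OF f']) (use \<delta> in \<open>auto intro!: derivative_eq_intros\<close>)
    show "0 \<le> ?e t" for t using \<delta> \<open>Z > 0\<close> f01 by simp
    have BZ: "1 / Z \<le> B" "2 * Q / Z \<le> B" unfolding B_def by auto
    show "?e t \<le> B / \<delta>" for t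
    proof -
      have "?e t \<le> 1 / (\<delta> * Z) * 1" using \<delta> \<open>Z > 0\<close> f01 by (intro mult_left_mono) auto
      also have "\<dots> = (1 / Z) / \<delta>" by simp
      also have "\<dots> \<le> B / \<delta>" using \<delta> BZ by (intro divide_right_mono) auto
      finally show ?thesis .
    qed
    show "\<bar>?e' t\<bar> \<le> B / \<delta>\<^sup>2" for t
    proof -
      have "\<bar>?e' t\<bar> = \<bar>f' (1 / \<delta> * t + (- t0 / \<delta>))\<bar> * (1 / (\<delta>\<^sup>2 * Z))"
        using \<delta> \<open>Z > 0\<close> by (simp add: abs_mult power2_eq_square)
      also have "\<dots> \<le> 2 * Q * (1 / (\<delta>\<^sup>2 * Z))" using \<delta> \<open>Z > 0\<close> f'_le by (intro mult_right_mono) auto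
      also have "\<dots> = (2 * Q / Z) / \<delta>\<^sup>2" by simp
      also have "\<dots> \<le> B / \<delta>\<^sup>2" using BZ by (intro divide_right_mono) auto
      finally show ?thesis .
    qed
    have "1 / \<delta> * t + (- t0 / \<delta>) \<notin> {0..1}" if "t \<notin> {t0..t0 + \<delta>}" for t
      using that \<delta> by (auto simp: field_simps)
    then show "?e t = 0" "?e' t = 0" if "t \<notin> {t0..t0 + \<delta>}" for t using that f0 by simp_all
    have "Z = (1 / \<delta>) *\<^sub>R (LINT t|lborel. f (- t0 / \<delta> + 1 / \<delta> * t))"
      unfolding Z_def using lborel_integral_real_affine[of "1 / \<delta>" f "- t0 / \<delta>"] \<delta> by simp
    then have "(LINT t|lborel. f (1 / \<delta> * t + (- t0 / \<delta>))) = \<delta> * Z"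
      using \<delta> by (simp add: add.commute[of "- t0 / \<delta>"] field_simps)
    then show "(LINT t|lborel. ?e t) = 1"
      unfolding integral_mult_right_zero using \<delta> \<open>Z > 0\<close> by simp
    have "?e t = (1 / (\<delta> * Z)) * (sig (1 / \<delta> * t + (- t0 / \<delta>)) * sig (- 1 / \<delta> * t + (1 + t0 / \<delta>)))" for t
      unfolding f_def by (simp add: algebra_simps)
    moreover have "smooth (\<lambda>x::real^'n. of_real (1 / (\<delta> * Z)) * (complex_of_real (sig (1 / \<delta> * x $ i + (- t0 / \<delta>))) * of_real (sig (- 1 / \<delta> * x $ i + (1 + t0 / \<delta>)))))"
      by (intro smooth_mult smooth_const smooth_flat)
    ultimately show "smooth (\<lambda>x::real^'n. of_real (?e (x $ i)))" by (simp only: of_real_mult)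
  qed
  moreover have "B \<ge> 1" by (simp add: B_def)
  ultimately show ?thesis by blast
qed

section \<open>The fractional derivative as a singular integral\<close>

lemma borel_measurable_vec_nth' [measurable (raw)]:
  fixes f :: "'a \<Rightarrow> real^'n::finite"
  assumes "f \<in> borel_measurable M" shows "(\<lambda>x. f x $ i) \<in> borel_measurable M"
  by (rule measurable_compose[OF assms]) (intro borel_measurable_continuous_onI continuous_intros)

lemma integrable_lborel_of_has_integral:
  fixes f :: "real \<Rightarrow> real"
  assumes [measurable]: "f \<in> borel_measurable borel" "S \<in> sets borel"
    and "(f has_integral I) S" "\<And>x. x \<in> S \<Longrightarrow> f x \<ge> 0"
  shows "integrable lborel (\<lambda>x. indicator S x * f x)"
proof -
  have "f absolutely_integrable_on S"
    using assms by (intro nonnegative_absolutely_integrable_1) (auto simp: integrable_on_def)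
  then have "integrable lebesgue (\<lambda>x. indicator S x * f x)"
    by (simp add: set_integrable_def)
  then show ?thesis by (subst (asm) integrable_completion) auto
qed

lemma integrable_powr_tail:
  assumes "e < - 1" "d > 0"
  shows "integrable lborel (\<lambda>h::real. indicator {d..} h * h powr e)"
  by (rule integrable_lborel_of_has_integral[OF _ _ has_integral_powr_to_inf[OF assms]]) auto

lemma integrable_powr_near_0:
  assumes "e > - 1"
  shows "integrable lborel (\<lambda>h::real. indicator {0..1} h * h powr e)"
  by (rule integrable_lborel_of_has_integral[OF _ _ has_integral_powr_from_0[OF assms]]) auto

lemma one_minus_cos_le: "1 - cos h \<le> h\<^sup>2 / 2" for h :: real
proof -
  have "1 - cos h = 2 * (sin (h / 2))\<^sup>2"
    using cos_double_sin[of "h / 2"] by simp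
  moreover have "(sin (h / 2))\<^sup>2 \<le> (h / 2)\<^sup>2"
    using abs_sin_x_le_abs_x[of "h / 2"] by (simp only: abs_le_square_iff)
  ultimately show ?thesis by (simp add: power2_eq_square)
qed

text \<open>The bound factors into a function of u and a function of h, the form wanted by
  \<open>Fubini_dominated\<close>: quadratic at h = 0 against a singularity of order 1 + 2s < 3, and
  bounded at infinity.\<close>

lemma one_minus_cos_bound: "1 - cos (u * h) \<le> (1 + u\<^sup>2) * min 2 (h\<^sup>2 / 2)" for u h :: real
proof -
  have "1 - cos (u * h) \<le> (1 + u\<^sup>2) * 2"
    using cos_ge_minus_one[of "u * h"] zero_le_power2[of u] unfolding distrib_right by linarith
  moreover have "1 - cos (u * h) \<le> u\<^sup>2 * (h\<^sup>2 / 2)"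
    using one_minus_cos_le[of "u * h"] by (simp add: power_mult_distrib)
  then have "1 - cos (u * h) \<le> (1 + u\<^sup>2) * (h\<^sup>2 / 2)"
    using zero_le_power2[of h] unfolding distrib_right by linarith
  ultimately show ?thesis by (simp add: min_def)
qed

lemma integrable_cos_kernel_majorant:
  assumes s: "0 < s" "s < 1"
  shows "integrable lborel (\<lambda>h::real. indicator {0<..} h * min 2 (h\<^sup>2 / 2) * h powr (- (1 + 2 * s)))"
proof (rule Bochner_Integration.integrable_bound)
  show "integrable lborel (\<lambda>h::real. indicator {0..1} h * h powr (1 - 2 * s) + 2 * (indicator {1..} h * h powr (- (1 + 2 * s))))"
    using s by (intro Bochner_Integration.integrable_add integrable_mult_right integrable_powr_near_0 integrable_powr_tail) auto
  have "indicator {0<..} h * min 2 (h\<^sup>2 / 2) * h powr (- (1 + 2 * s)) \<le>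
      indicator {0..1} h * h powr (1 - 2 * s) + 2 * (indicator {1..} h * h powr (- (1 + 2 * s)))" for h :: real
  proof -
    consider "h \<le> 0" | "0 < h" "h < 1" | "h \<ge> 1" by linarith
    then show ?thesis
    proof cases
      case 2
      have "h\<^sup>2 * h powr (- (1 + 2 * s)) = h powr (1 - 2 * s)"
        using 2 powr_add[of h 2 "- (1 + 2 * s)"] by simp
      moreover have "min 2 (h\<^sup>2 / 2) \<le> h\<^sup>2" by (auto simp: min_def)
      then have "min 2 (h\<^sup>2 / 2) * h powr (- (1 + 2 * s)) \<le> h\<^sup>2 * h powr (- (1 + 2 * s))"
        by (intro mult_right_mono) auto
      ultimately show ?thesis using 2 by simp
    next
      case 3
      have "min 2 (h\<^sup>2 / 2) * h powr (- (1 + 2 * s)) \<le> 2 * h powr (- (1 + 2 * s))"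
        by (intro mult_right_mono) auto
      moreover have "0 \<le> indicator {0..1} h * h powr (1 - 2 * s)" by simp
      ultimately show ?thesis
        using 3 add_increasing[of "indicator {0..1} h * h powr (1 - 2 * s)"] by simp
    qed simp
  qed
  moreover have "0 \<le> indicator {0<..} h * min 2 (h\<^sup>2 / 2) * h powr (- (1 + 2 * s))" for h :: real by simp
  ultimately show "AE h in lborel. norm (indicator {0<..} h * min 2 (h\<^sup>2 / 2) * h powr (- (1 + 2 * s))) \<le>
      norm (indicator {0..1} h * h powr (1 - 2 * s) + 2 * (indicator {1..} (h::real) * h powr (- (1 + 2 * s))))"
    by (intro AE_I2) (smt (verit) real_norm_def)
qed measurable

definition cos_kernel :: "real \<Rightarrow> real \<Rightarrow> real \<Rightarrow> real" where
  "cos_kernel s u h = indicator {0<..} h * (1 - cos (u * h)) * h powr (- (1 + 2 * s))"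

lemma borel_measurable_cos_kernel [measurable]:
  "cos_kernel s u \<in> borel_measurable borel"
  unfolding cos_kernel_def[abs_def] by measurable

lemma cos_kernel_nonneg: "cos_kernel s u h \<ge> 0"
  by (simp add: cos_kernel_def)

lemma cos_kernel_le:
  "cos_kernel s u h \<le> (1 + u\<^sup>2) * (indicator {0<..} h * min 2 (h\<^sup>2 / 2) * h powr (- (1 + 2 * s)))"
proof -
  have "cos_kernel s u h \<le> indicator {0<..} h * ((1 + u\<^sup>2) * min 2 (h\<^sup>2 / 2)) * h powr (- (1 + 2 * s))"
    unfolding cos_kernel_def by (intro mult_right_mono mult_left_mono one_minus_cos_bound) auto
  then show ?thesis by (simp only: mult_ac)
qed

lemma integrable_cos_kernel:
  assumes "0 < s" "s < 1"
  shows "integrable lborel (cos_kernel s u)"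
proof (rule Bochner_Integration.integrable_bound)
  show "integrable lborel (\<lambda>h. (1 + u\<^sup>2) * (indicator {0<..} h * min 2 (h\<^sup>2 / 2) * h powr (- (1 + 2 * s))))"
    by (intro integrable_mult_right integrable_cos_kernel_majorant assms)
  show "AE h in lborel. norm (cos_kernel s u h) \<le> norm ((1 + u\<^sup>2) * (indicator {0<..} h * min 2 (h\<^sup>2 / 2) * h powr (- (1 + 2 * s))))"
    using cos_kernel_le[of s u] cos_kernel_nonneg[of s u] by (intro AE_I2) (smt (verit) real_norm_def)
qed measurable

definition cos_const :: "real \<Rightarrow> real" where
  "cos_const s = (LINT h|lborel. cos_kernel s 1 h)"

lemma cos_const_pos:
  assumes s: "0 < s" "s < 1" shows "cos_const s > 0"
proof -
  have "cos_const s \<noteq> 0"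
  proof
    assume "cos_const s = 0"
    then have "AE h in lborel. cos_kernel s 1 h = 0"
      unfolding cos_const_def using integral_nonneg_eq_0_iff_AE[OF integrable_cos_kernel[OF s, of 1]] cos_kernel_nonneg by auto
    moreover have "cos_kernel s 1 h \<noteq> 0" if "h \<in> {0<..<1}" for h
    proof -
      have "cos h < cos 0" using that pi_gt3 by (intro cos_monotone_0_pi) auto
      then show ?thesis using that by (simp add: cos_kernel_def)
    qed
    ultimately have "AE h in lborel. h \<notin> {0<..<1::real}" by (auto elim!: eventually_mono)
    then have "emeasure lborel {0<..<1::real} = 0"
      by (subst (asm) AE_iff_measurable[of "{0<..<1}"]) auto
    then show False by simp
  qed
  moreover have "cos_const s \<ge> 0"
    unfolding cos_const_def by (intro Bochner_Integration.integral_nonneg cos_kernel_nonneg)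
  ultimately show ?thesis by simp
qed

text \<open>Scaling h by \<open>\<bar>u\<bar>\<close> in the integral that defines
  \<open>cos_const\<close>; homogeneity of the kernel gives the power, and the constant stays
  implicit.\<close>

lemma LINT_cos_kernel:
  assumes s: "0 < s" "s < 1"
  shows "(LINT h|lborel. cos_kernel s u h) = cos_const s * \<bar>u\<bar> powr (2 * s)"
proof (cases "u = 0")
  case True
  then show ?thesis by (simp add: cos_kernel_def)
next
  case False
  define v where "v = \<bar>u\<bar>"
  have v: "v > 0" using False by (simp add: v_def)
  have cosv: "cos (v * h) = cos (u * h)" for h
    unfolding v_def by (cases "u \<ge> 0") auto
  have "cos_const s = \<bar>v\<bar> *\<^sub>R (LINT h|lborel. cos_kernel s 1 (0 + v * h))"
    unfolding cos_const_def by (rule lborel_integral_real_affine) (use v in simp)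
  also have "(\<lambda>h. cos_kernel s 1 (0 + v * h)) = (\<lambda>h. v powr (- (1 + 2 * s)) * cos_kernel s u h)"
    using v by (auto simp: cos_kernel_def cosv powr_mult indicator_def zero_less_mult_iff)
  also have "\<bar>v\<bar> *\<^sub>R (LINT h|lborel. v powr (- (1 + 2 * s)) * cos_kernel s u h) = (v powr 1 * v powr (- (1 + 2 * s))) * (LINT h|lborel. cos_kernel s u h)"
    using v by simp
  also have "v powr 1 * v powr (- (1 + 2 * s)) = v powr (- (2 * s))"
    unfolding powr_add[symmetric] by simp
  finally show ?thesis using v unfolding v_def[symmetric] by (simp add: powr_minus field_simps)
qed

text \<open>The symbol is the integral of \<open>1 - cos (\<xi>_n h)\<close> against the singular
  kernel, and this function of \<xi> is the symbol of a symmetric second difference in the last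
  direction. The integrals may be exchanged because the rapidly decreasing transform of g absorbs
  the factor \<open>1 + \<xi>_n^2\<close>.\<close>

lemma frac_D_last_eq:
  fixes g :: "real^'n::{finite,linorder} \<Rightarrow> complex"
  assumes s: "0 < s" "s < 1" and g: "schwartz g"
  shows "of_real (cos_const s) * frac_D_last s g x =
    (LINT h|lborel. of_real (indicator {0<..} h * h powr (- (1 + 2 * s))) *
       (g x - (g (x + h *\<^sub>R axis last_ix 1) + g (x - h *\<^sub>R axis last_ix 1)) / 2))"
proof -
  let ?e = "axis last_ix 1 :: (real, 'n) vec"
  define N where "N = complex_of_real ((2 * pi) ^ CARD('n))"
  have N: "N \<noteq> 0" by (simp add: N_def)
  have gh: "schwartz (fourier g)" by (rule schwartz_fourier[OF g])
  have [measurable]: "fourier g \<in> borel_measurable borel" by (rule schwartz_borel[OF gh])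
  have "of_real (cos_const s) * (N * frac_D_last s g x) =
      (LINT \<xi>|lborel. of_real (cos_const s) * (cis (x \<bullet> \<xi>) * (of_real (\<bar>\<xi> $ last_ix\<bar> powr (2 * s)) * fourier g \<xi>)))"
    unfolding integral_mult_right_zero by (simp add: frac_D_last_def multiplier_def inv_fourier_def N_def)
  also have "\<dots> = (LINT \<xi>|lborel. (LINT h|lborel. cis (x \<bullet> \<xi>) * fourier g \<xi> * of_real (cos_kernel s (\<xi> $ last_ix) h)))"
  proof (rule Bochner_Integration.integral_cong[OF refl])
    fix \<xi> :: "(real, 'n) vec"
    have "(LINT h|lborel. cis (x \<bullet> \<xi>) * fourier g \<xi> * of_real (cos_kernel s (\<xi> $ last_ix) h)) =
        cis (x \<bullet> \<xi>) * fourier g \<xi> * of_real (LINT h|lborel. cos_kernel s (\<xi> $ last_ix) h)"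
      by simp
    then show "of_real (cos_const s) * (cis (x \<bullet> \<xi>) * (of_real (\<bar>\<xi> $ last_ix\<bar> powr (2 * s)) * fourier g \<xi>)) =
        (LINT h|lborel. cis (x \<bullet> \<xi>) * fourier g \<xi> * of_real (cos_kernel s (\<xi> $ last_ix) h))"
      unfolding LINT_cos_kernel[OF s] by (auto simp: mult_ac)
  qed
  also have "\<dots> = (LINT h|lborel. (LINT \<xi>|lborel. cis (x \<bullet> \<xi>) * fourier g \<xi> * of_real (cos_kernel s (\<xi> $ last_ix) h)))"
  proof (rule Fubini_dominated[where F = "\<lambda>\<xi>. norm (of_real (1 + (\<xi> $ last_ix)\<^sup>2) * fourier g \<xi>)"
        and G = "\<lambda>h. indicator {0<..} h * min 2 (h\<^sup>2 / 2) * h powr (- (1 + 2 * s))"])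
    have "rapid (\<lambda>\<xi>. of_real (1 + (\<xi> $ last_ix)\<^sup>2) * fourier g \<xi>)"
    proof (rule rapid_mult[OF rapid_schwartz[OF gh], of _ 2])
      fix \<xi> :: "(real, 'n) vec"
      have "(\<xi> $ last_ix)\<^sup>2 \<le> (norm \<xi>)\<^sup>2"
        using component_le_norm_cart[of \<xi> last_ix] by (metis abs_ge_zero power2_abs power_mono)
      then have "1 + (\<xi> $ last_ix)\<^sup>2 \<le> (1 + norm \<xi>)\<^sup>2"
        unfolding power2_sum by (simp add: add_increasing2)
      then show "norm (complex_of_real (1 + (\<xi> $ last_ix)\<^sup>2)) \<le> (1 + norm \<xi>)\<^sup>2"
        unfolding norm_of_real by simp
    qed measurable
    then show "integrable lborel (\<lambda>\<xi>. norm (of_real (1 + (\<xi> $ last_ix)\<^sup>2) * fourier g \<xi>))"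
      by (intro integrable_norm rapid_integrable)
    show "integrable lborel (\<lambda>h. indicator {0<..} h * min 2 (h\<^sup>2 / 2) * h powr (- (1 + 2 * s)))"
      by (rule integrable_cos_kernel_majorant[OF s])
    fix \<xi> :: "(real, 'n) vec" and h
    have E: "norm (of_real (1 + (\<xi> $ last_ix)\<^sup>2) * fourier g \<xi>) = (1 + (\<xi> $ last_ix)\<^sup>2) * norm (fourier g \<xi>)"
      unfolding norm_mult norm_of_real by simp
    show "norm (cis (x \<bullet> \<xi>) * fourier g \<xi> * of_real (cos_kernel s (\<xi> $ last_ix) h)) \<le>
        norm (of_real (1 + (\<xi> $ last_ix)\<^sup>2) * fourier g \<xi>) * (indicator {0<..} h * min 2 (h\<^sup>2 / 2) * h powr (- (1 + 2 * s)))"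
      unfolding E using mult_left_mono[OF cos_kernel_le[of s "\<xi> $ last_ix" h], of "norm (fourier g \<xi>)"]
      by (simp add: norm_mult cos_kernel_nonneg mult_ac)
  next
    have [measurable]: "(\<lambda>p. cos_kernel s (fst p $ last_ix) (snd p)) \<in> borel_measurable (borel \<Otimes>\<^sub>M borel)"
      unfolding cos_kernel_def by measurable
    have [measurable]: "(\<lambda>p. cis (x \<bullet> fst p)) \<in> borel_measurable (borel \<Otimes>\<^sub>M borel)" by measurable
    show "(\<lambda>(\<xi>, h). cis (x \<bullet> \<xi>) * fourier g \<xi> * of_real (cos_kernel s (\<xi> $ last_ix) h)) \<in> borel_measurable (lborel \<Otimes>\<^sub>M lborel)"
      unfolding case_prod_beta by measurable
  qed
  also have "\<dots> = (LINT h|lborel. N * (of_real (indicator {0<..} h * h powr (- (1 + 2 * s))) *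
       (g x - (g (x + h *\<^sub>R ?e) + g (x - h *\<^sub>R ?e)) / 2)))"
  proof (rule Bochner_Integration.integral_cong[OF refl])
    fix h :: real
    have inv: "(LINT \<xi>|lborel. cis (y \<bullet> \<xi>) * fourier g \<xi>) = N * g y" for y
    proof -
      have "(LINT \<xi>|lborel. cis (y \<bullet> \<xi>) * fourier g \<xi>) / N = g y"
        using fourier_inversion[OF g, of y] by (simp only: inv_fourier_def N_def)
      then show ?thesis using N by (simp add: nonzero_divide_eq_eq mult.commute)
    qed
    have int: "integrable lborel (\<lambda>\<xi>. cis (y \<bullet> \<xi>) * fourier g \<xi>)" for y
      using schwartz_integrable[OF schwartz_cis_mult_pos[OF gh, of y]] by (simp add: inner_commute)
    define k where "k = complex_of_real (indicator {0<..} h * h powr (- (1 + 2 * s)))"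
    have "cis (x \<bullet> \<xi>) * fourier g \<xi> * of_real (cos_kernel s (\<xi> $ last_ix) h) =
        k * (cis (x \<bullet> \<xi>) * fourier g \<xi> - (cis ((x + h *\<^sub>R ?e) \<bullet> \<xi>) * fourier g \<xi> + cis ((x - h *\<^sub>R ?e) \<bullet> \<xi>) * fourier g \<xi>) / 2)" for \<xi>
    proof -
      define t where "t = \<xi> $ last_ix * h"
      have c: "cis ((x + h *\<^sub>R ?e) \<bullet> \<xi>) = cis (x \<bullet> \<xi>) * cis t" "cis ((x - h *\<^sub>R ?e) \<bullet> \<xi>) = cis (x \<bullet> \<xi>) * cis (- t)"
        by (simp_all add: cis_mult inner_add_left inner_diff_left inner_axis' t_def mult.commute)
      have d: "complex_of_real (1 - cos t) = 1 - (cis t + cis (- t)) / 2"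
        by (simp add: complex_eq_iff)
      have "of_real (cos_kernel s (\<xi> $ last_ix) h) = k * of_real (1 - cos t)"
        by (simp add: cos_kernel_def k_def t_def)
      then have "cis (x \<bullet> \<xi>) * fourier g \<xi> * of_real (cos_kernel s (\<xi> $ last_ix) h) = cis (x \<bullet> \<xi>) * fourier g \<xi> * (k * (1 - (cis t + cis (- t)) / 2))"
        unfolding d by simp
      then show ?thesis unfolding c by (simp add: algebra_simps add_divide_distrib)
    qed
    then have "(LINT \<xi>|lborel. cis (x \<bullet> \<xi>) * fourier g \<xi> * of_real (cos_kernel s (\<xi> $ last_ix) h)) =
      k * (N * g x - (N * g (x + h *\<^sub>R ?e) + N * g (x - h *\<^sub>R ?e)) / 2)"
      using int by (simp add: inv[symmetric])
    then show "(LINT \<xi>|lborel. cis (x \<bullet> \<xi>) * fourier g \<xi> * of_real (cos_kernel s (\<xi> $ last_ix) h)) =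
      N * (of_real (indicator {0<..} h * h powr (- (1 + 2 * s))) * (g x - (g (x + h *\<^sub>R ?e) + g (x - h *\<^sub>R ?e)) / 2))"
      unfolding k_def by (simp add: algebra_simps add_divide_distrib diff_divide_distrib)
  qed
  finally show ?thesis using N unfolding integral_mult_right_zero by simp
qed

text \<open>The singular kernel of \<open>frac_D_last\<close>, cut off at distance d from its
  singularity. Between supports that are d apart in the last coordinate the cut is
  invisible.\<close>

definition tail_kernel :: "real \<Rightarrow> real \<Rightarrow> real \<Rightarrow> real" where
  "tail_kernel s d h = indicator {d..} h * h powr (- (1 + 2 * s))"

lemma borel_measurable_tail_kernel [measurable]: "tail_kernel s d \<in> borel_measurable borel"
  unfolding tail_kernel_def[abs_def] by measurable

lemma integrable_tail_kernel: "0 < s \<Longrightarrow> d > 0 \<Longrightarrow> integrable lborel (tail_kernel s d)"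
  unfolding tail_kernel_def[abs_def] by (intro integrable_powr_tail) auto

lemma tail_kernel_nonneg: "tail_kernel s d h \<ge> 0"
  by (simp add: tail_kernel_def)

text \<open>Where \<phi> does not vanish, the last coordinate is at least
  \<open>\<beta> + d\<close>. With e the last unit vector, g is then 0 at x, at
  \<open>x + h e\<close> for h > 0 and at \<open>x - h e\<close> for 0 < h < d, so of the second
  difference only \<open>- g (x - h e) / 2\<close> with \<open>h \<ge> d\<close> remains.
  Translating x by \<open>h e\<close> moves the kernel from g to \<phi>.\<close>

lemma frac_D_last_pairing:
  fixes g \<phi> :: "real^'n::{finite,linorder} \<Rightarrow> complex"
  assumes s: "0 < s" "s < 1" and g: "test_fun U g" and \<phi>: "test_fun V \<phi>" and d: "d > 0"
    and gU: "\<And>x. x $ last_ix \<ge> \<beta> \<Longrightarrow> g x = 0" and \<phi>V: "\<And>x. x $ last_ix < \<beta> + d \<Longrightarrow> \<phi> x = 0"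
  shows "of_real (2 * cos_const s) * (LINT x|lborel. frac_D_last s g x * \<phi> x) =
    - (LINT x|lborel. g x * (LINT h|lborel. of_real (tail_kernel s d h) * \<phi> (x + h *\<^sub>R axis last_ix 1)))"
proof -
  let ?e = "axis last_ix 1 :: (real, 'n) vec"
  have gs: "schwartz g" and \<phi>s: "schwartz \<phi>" using g \<phi> by (auto intro: test_fun_schwartz)
  have [measurable]: "g \<in> borel_measurable borel" "\<phi> \<in> borel_measurable borel"
    using gs \<phi>s by (auto intro: schwartz_borel)
  obtain A B where AB: "\<And>x. norm (g x) \<le> A" "\<And>x. norm (\<phi> x) \<le> B"
    using schwartz_decay[OF gs, of 0] schwartz_decay[OF \<phi>s, of 0] by auto
  have AB0: "A \<ge> 0" "B \<ge> 0" using AB[of 0] norm_ge_zero order_trans by blast+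
  have e: "(x + h *\<^sub>R ?e) $ last_ix = x $ last_ix + h" for x h by simp
  have pt: "of_real (2 * cos_const s) * (frac_D_last s g x * \<phi> x) = - (LINT h|lborel. of_real (tail_kernel s d h) * g (x + (- h) *\<^sub>R ?e) * \<phi> x)" for x
  proof (cases "\<phi> x = 0")
    case False
    then have xn: "x $ last_ix \<ge> \<beta> + d" using \<phi>V[of x] by force
    have "of_real (indicator {0<..} h * h powr (- (1 + 2 * s))) * (g x - (g (x + h *\<^sub>R ?e) + g (x - h *\<^sub>R ?e)) / 2) =
       (- 1 / 2) * (of_real (tail_kernel s d h) * g (x + (- h) *\<^sub>R ?e))" for h
    proof -
      consider "h \<le> 0" | "0 < h" "h < d" | "h \<ge> d" by linarith
      then show ?thesis
      proof cases
        case 1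
        then show ?thesis using d by (simp add: tail_kernel_def)
      next
        case 2
        then have "g x = 0" "g (x + h *\<^sub>R ?e) = 0" "g (x + (- h) *\<^sub>R ?e) = 0" using xn d by (auto intro!: gU)
        then show ?thesis by simp
      next
        case 3
        then have "g x = 0" "g (x + h *\<^sub>R ?e) = 0" using xn d by (auto intro!: gU)
        then show ?thesis using 3 d by (simp add: tail_kernel_def)
      qed
    qed
    then have "of_real (cos_const s) * frac_D_last s g x = (- 1 / 2) * (LINT h|lborel. of_real (tail_kernel s d h) * g (x + (- h) *\<^sub>R ?e))"
      unfolding frac_D_last_eq[OF s gs] by (simp only: integral_mult_right_zero)
    then have "of_real (2 * cos_const s) * frac_D_last s g x = - (LINT h|lborel. of_real (tail_kernel s d h) * g (x + (- h) *\<^sub>R ?e))"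
      by (simp add: mult.assoc)
    then have "of_real (2 * cos_const s) * frac_D_last s g x * \<phi> x = - (LINT h|lborel. of_real (tail_kernel s d h) * g (x + (- h) *\<^sub>R ?e)) * \<phi> x"
      by (simp only:)
    then show ?thesis unfolding integral_mult_left_zero by (simp only: mult.assoc mult_minus_left)
  qed simp
  have "of_real (2 * cos_const s) * (LINT x|lborel. frac_D_last s g x * \<phi> x) =
     - (LINT x|lborel. (LINT h|lborel. of_real (tail_kernel s d h) * g (x + (- h) *\<^sub>R ?e) * \<phi> x))"
    unfolding integral_mult_right_zero[symmetric] pt Bochner_Integration.integral_minus ..
  also have "(LINT x|lborel. (LINT h|lborel. of_real (tail_kernel s d h) * g (x + (- h) *\<^sub>R ?e) * \<phi> x)) =
     (LINT h|lborel. (LINT x|lborel. of_real (tail_kernel s d h) * g (x + (- h) *\<^sub>R ?e) * \<phi> x))"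
  proof (rule Fubini_dominated[where F = "\<lambda>x. A * norm (\<phi> x)" and G = "tail_kernel s d"])
    show "norm (of_real (tail_kernel s d h) * g (x + (- h) *\<^sub>R ?e) * \<phi> x) \<le> A * norm (\<phi> x) * tail_kernel s d h" for x h
      using mult_left_mono[OF AB(1)[of "x + (- h) *\<^sub>R ?e"], of "tail_kernel s d h * norm (\<phi> x)"]
      by (simp add: norm_mult tail_kernel_nonneg mult_ac)
  qed (use s d in \<open>auto intro!: integrable_tail_kernel schwartz_integrable \<phi>s\<close>)
  also have "\<dots> = (LINT h|lborel. (LINT x|lborel. of_real (tail_kernel s d h) * g x * \<phi> (x + h *\<^sub>R ?e)))"
  proof (rule Bochner_Integration.integral_cong[OF refl])
    fix h
    have "(LINT x|lborel. (\<lambda>x. of_real (tail_kernel s d h) * g x * \<phi> (x + h *\<^sub>R ?e)) (x + (- h) *\<^sub>R ?e)) =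
        (LINT x|lborel. of_real (tail_kernel s d h) * g x * \<phi> (x + h *\<^sub>R ?e))"
      by (rule LINT_lborel_translate) measurable
    then show "(LINT x|lborel. of_real (tail_kernel s d h) * g (x + (- h) *\<^sub>R ?e) * \<phi> x) =
        (LINT x|lborel. of_real (tail_kernel s d h) * g x * \<phi> (x + h *\<^sub>R ?e))"
      by simp
  qed
  also have "\<dots> = (LINT x|lborel. (LINT h|lborel. of_real (tail_kernel s d h) * g x * \<phi> (x + h *\<^sub>R ?e)))"
  proof (rule Fubini_dominated[where F = "tail_kernel s d" and G = "\<lambda>x. B * norm (g x)"])
    show "norm (of_real (tail_kernel s d h) * g x * \<phi> (x + h *\<^sub>R ?e)) \<le> tail_kernel s d h * (B * norm (g x))" for x h
      using mult_left_mono[OF AB(2)[of "x + h *\<^sub>R ?e"], of "tail_kernel s d h * norm (g x)"]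
      by (simp add: norm_mult tail_kernel_nonneg mult_ac)
  qed (use s d in \<open>auto intro!: integrable_tail_kernel schwartz_integrable gs\<close>)
  also have "\<dots> = (LINT x|lborel. g x * (LINT h|lborel. of_real (tail_kernel s d h) * \<phi> (x + h *\<^sub>R ?e)))"
    by (simp add: mult_ac flip: integral_mult_right_zero)
  finally show ?thesis .
qed

section \<open>Difference quotients of the kernel\<close>

definition fdiff :: "real \<Rightarrow> (real \<Rightarrow> real) \<Rightarrow> real \<Rightarrow> real" where
  "fdiff \<delta> u t = (u (t + \<delta>) - u t) / \<delta>"

text \<open>The transpose of \<open>fdiff \<delta>\<close> under integration over the line, see
  \<open>LINT_bdiff\<close>.\<close>

definition bdiff :: "real \<Rightarrow> (real \<Rightarrow> real) \<Rightarrow> real \<Rightarrow> real" where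
  "bdiff \<delta> u t = (u (t - \<delta>) - u t) / \<delta>"

text \<open>The sequence v lists successive derivatives. The induction passes to the sequence of
  their difference quotients, which by the mean value theorem are values of the next derivative and
  so obey the bounds M shifted by one. Each of the l steps loses \<delta> times the bound of order l
  + 1.\<close>

lemma fdiff_approx:
  assumes "\<delta> > 0" "t \<ge> t0"
    and "\<And>k t. t \<ge> t0 \<Longrightarrow> (v k has_real_derivative v (Suc k) t) (at t)"
    and "\<And>k t. t \<ge> t0 \<Longrightarrow> \<bar>v k t\<bar> \<le> M k"
  shows "\<bar>(fdiff \<delta> ^^ l) (v 0) t - v l t\<bar> \<le> real l * \<delta> * M (Suc l)"
  using assms
proof (induction l arbitrary: v M)
  case 0
  then show ?case by simp
next
  case (Suc l)
  have mv: "\<exists>z>t. z < t + \<delta> \<and> fdiff \<delta> (v k) t = v (Suc k) z" if "t \<ge> t0" for k t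
  proof -
    have "\<exists>z>t. z < t + \<delta> \<and> v k (t + \<delta>) - v k t = (t + \<delta> - t) * v (Suc k) z"
      using Suc.prems that by (intro MVT2) auto
    then obtain z where "z > t" "z < t + \<delta>" "v k (t + \<delta>) - v k t = \<delta> * v (Suc k) z" by auto
    then show ?thesis using Suc.prems(1) by (intro exI[of _ z]) (simp add: fdiff_def)
  qed
  have "\<bar>(fdiff \<delta> ^^ l) (fdiff \<delta> (v 0)) t - fdiff \<delta> (v l) t\<bar> \<le> real l * \<delta> * M (Suc (Suc l))"
  proof (rule Suc.IH[of "\<lambda>k. fdiff \<delta> (v k)" "\<lambda>k. M (Suc k)"])
    fix k t assume t: "t \<ge> t0"
    have "((\<lambda>t. v k (t + \<delta>)) has_real_derivative v (Suc k) (t + \<delta>) * 1) (at t)"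
      by (rule DERIV_chain2[OF Suc.prems(3)]) (use t Suc.prems(1) in \<open>auto intro!: derivative_eq_intros\<close>)
    then show "(fdiff \<delta> (v k) has_real_derivative fdiff \<delta> (v (Suc k)) t) (at t)"
      unfolding fdiff_def[abs_def] using Suc.prems(1,3) t by (auto intro!: derivative_eq_intros)
    obtain z where z: "z > t" "fdiff \<delta> (v k) t = v (Suc k) z" using mv[OF t] by blast
    then show "\<bar>fdiff \<delta> (v k) t\<bar> \<le> M (Suc k)" using Suc.prems(4)[of z "Suc k"] t by simp
  qed (use Suc.prems in auto)
  moreover have "\<bar>fdiff \<delta> (v l) t - v (Suc l) t\<bar> \<le> \<delta> * M (Suc (Suc l))"
  proof -
    obtain z where z: "z > t" "z < t + \<delta>" "fdiff \<delta> (v l) t = v (Suc l) z" using mv[OF Suc.prems(2)] by blast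
    have "\<exists>y>t. y < z \<and> v (Suc l) z - v (Suc l) t = (z - t) * v (Suc (Suc l)) y"
      using Suc.prems z by (intro MVT2) auto
    then obtain y where y: "y > t" "v (Suc l) z - v (Suc l) t = (z - t) * v (Suc (Suc l)) y" by blast
    have "\<bar>(z - t) * v (Suc (Suc l)) y\<bar> \<le> \<delta> * M (Suc (Suc l))"
      unfolding abs_mult using z y Suc.prems(1,2) Suc.prems(4)[of y "Suc (Suc l)"] by (intro mult_mono) auto
    then show ?thesis unfolding z(3) y(2) .
  qed
  moreover have "(fdiff \<delta> ^^ Suc l) (v 0) t = (fdiff \<delta> ^^ l) (fdiff \<delta> (v 0)) t"
    by (simp add: funpow_swap1)
  ultimately show ?case by (simp add: algebra_simps)
qed

text \<open>Forward differences look to the right only. The cut of the translated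
  \<open>tail_kernel\<close>, which lies at \<open>y + d \<le> t0\<close>, is therefore not seen
  from \<open>t \<ge> t0\<close>.\<close>

lemma fdiff_cong:
  assumes "\<delta> > 0" "\<And>t. t \<ge> t0 \<Longrightarrow> u t = v t" "t \<ge> t0"
  shows "(fdiff \<delta> ^^ l) u t = (fdiff \<delta> ^^ l) v t"
  using assms(3)
proof (induction l arbitrary: t)
  case 0
  then show ?case using assms by simp
next
  case (Suc l)
  then show ?case using assms(1) by (simp add: fdiff_def)
qed

lemma fdiff_bounded_measurable:
  assumes "u \<in> borel_measurable borel" "\<And>t. \<bar>u t\<bar> \<le> A"
  shows "(fdiff \<delta> ^^ l) u \<in> borel_measurable borel \<and> (\<exists>B. \<forall>t. \<bar>(fdiff \<delta> ^^ l) u t\<bar> \<le> B)"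
proof (induction l)
  case 0
  then show ?case using assms by auto
next
  case (Suc l)
  let ?w = "(fdiff \<delta> ^^ l) u"
  obtain B where B: "\<And>t. \<bar>?w t\<bar> \<le> B" using Suc by blast
  have [measurable]: "?w \<in> borel_measurable borel" using Suc by blast
  have "\<bar>fdiff \<delta> ?w t\<bar> \<le> 2 * B / \<bar>\<delta>\<bar>" for t
    unfolding fdiff_def[of \<delta> ?w] abs_divide using B[of t] B[of "t + \<delta>"] by (intro divide_right_mono) auto
  moreover have "(\<lambda>t. (?w (t + \<delta>) - ?w t) / \<delta>) \<in> borel_measurable borel" by measurable
  then have "fdiff \<delta> ?w \<in> borel_measurable borel" unfolding fdiff_def[of \<delta> ?w, abs_def] .
  ultimately show ?case by auto
qed

lemma LINT_bdiff:
  assumes \<psi>: "integrable lborel \<psi>" and u: "u \<in> borel_measurable borel" "\<And>t. \<bar>u t\<bar> \<le> A"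
  shows "integrable lborel (bdiff \<delta> \<psi>)"
    and "(LINT t|lborel. bdiff \<delta> \<psi> t * u t) = (LINT t|lborel. \<psi> t * fdiff \<delta> u t)"
proof -
  have [measurable]: "u \<in> borel_measurable borel" "\<psi> \<in> borel_measurable borel" using assms by auto
  have sh: "integrable lborel (\<lambda>t. \<psi> (t - c))" for c
    using lborel_integrable_real_affine[OF \<psi>, of 1 "- c"] by simp
  show "integrable lborel (bdiff \<delta> \<psi>)"
    unfolding bdiff_def[abs_def] using sh[of \<delta>] \<psi> by auto
  have i: "integrable lborel (\<lambda>t. f t * w t)" if "integrable lborel f" "w \<in> borel_measurable borel" "\<And>t. \<bar>w t\<bar> \<le> A" for f w :: "real \<Rightarrow> real"
  proof (rule Bochner_Integration.integrable_bound)
    show "integrable lborel (\<lambda>t. A * f t)" using that by simp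
    have "\<bar>f t\<bar> * \<bar>w t\<bar> \<le> \<bar>f t\<bar> * \<bar>A\<bar>" for t using that(3)[of t] by (intro mult_left_mono) auto
    then show "AE t in lborel. norm (f t * w t) \<le> norm (A * f t)" by (simp add: abs_mult mult.commute)
  qed (use that in auto)
  have i1: "integrable lborel (\<lambda>t. \<psi> (t - \<delta>) * u t)" "integrable lborel (\<lambda>t. \<psi> t * u t)" "integrable lborel (\<lambda>t. \<psi> t * u (t + \<delta>))"
    using i[OF sh u] i[OF \<psi> u] i[OF \<psi>, of "\<lambda>t. u (t + \<delta>)"] u(2) by auto
  have "(LINT t|lborel. \<psi> (t - \<delta>) * u t) = (LINT t|lborel. \<psi> t * u (t + \<delta>))"
    using lborel_integral_real_affine[of 1 "\<lambda>t. \<psi> (t - \<delta>) * u t" \<delta>] by (simp add: add.commute)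
  moreover have "(LINT t|lborel. bdiff \<delta> \<psi> t * u t) = ((LINT t|lborel. \<psi> (t - \<delta>) * u t) - (LINT t|lborel. \<psi> t * u t)) / \<delta>"
    unfolding bdiff_def using i1 by (simp add: left_diff_distrib flip: integral_divide_zero)
  moreover have "(LINT t|lborel. \<psi> t * fdiff \<delta> u t) = ((LINT t|lborel. \<psi> t * u (t + \<delta>)) - (LINT t|lborel. \<psi> t * u t)) / \<delta>"
    unfolding fdiff_def using i1 by (simp add: right_diff_distrib flip: integral_divide_zero)
  ultimately show "(LINT t|lborel. bdiff \<delta> \<psi> t * u t) = (LINT t|lborel. \<psi> t * fdiff \<delta> u t)" by simp
qed

lemma LINT_bdiff_iter:
  assumes \<psi>: "integrable lborel \<psi>" and u: "u \<in> borel_measurable borel" "\<And>t. \<bar>u t\<bar> \<le> A"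
  shows "integrable lborel ((bdiff \<delta> ^^ l) \<psi>) \<and> (LINT t|lborel. (bdiff \<delta> ^^ l) \<psi> t * u t) = (LINT t|lborel. \<psi> t * (fdiff \<delta> ^^ l) u t)"
  using u
proof (induction l arbitrary: u A)
  case 0
  then show ?case using \<psi> by simp
next
  case (Suc l)
  have int: "integrable lborel ((bdiff \<delta> ^^ l) \<psi>)" using Suc by blast
  have "fdiff \<delta> u \<in> borel_measurable borel \<and> (\<exists>B. \<forall>t. \<bar>fdiff \<delta> u t\<bar> \<le> B)"
    using fdiff_bounded_measurable[OF Suc.prems, of 1 \<delta>] by simp
  then obtain B where B: "fdiff \<delta> u \<in> borel_measurable borel" "\<And>t. \<bar>fdiff \<delta> u t\<bar> \<le> B" by blast
  show ?case
    using LINT_bdiff[OF int Suc.prems, of \<delta>] Suc.IH[OF B] by (simp add: funpow_swap1)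
qed

text \<open>The difference quotients of a bump at \<open>t0\<close> reproduce the Taylor coefficients at \<open>t0\<close> of the
  translated kernel; their cost is a power of \<open>1 / \<delta>\<close> instead of the (unknown) size of the higher
  derivatives of a bump.\<close>

lemma tail_kernel_moment:
  assumes s: "0 < s" and d: "d > 0" and \<delta>: "\<delta> > 0" and y: "y + d \<le> t0"
    and e: "\<And>t. 0 \<le> e t" "integrable lborel e" "(LINT t|lborel. e t) = 1" "\<And>t. t \<notin> {t0..t0 + \<delta>} \<Longrightarrow> e t = 0"
  shows "\<bar>(LINT h|lborel. tail_kernel s d h * (bdiff \<delta> ^^ l) e (y + h)) - (- 1) ^ l * pochhammer (1 + 2 * s) l * (t0 - y) powr (- (1 + 2 * s + l))\<bar>
    \<le> (real l + 1) * \<delta> * (pochhammer (1 + 2 * s) (Suc l) * d powr (- (1 + 2 * s + Suc l)))"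
proof -
  define a where "a = 1 + 2 * s"
  define u where "u t = tail_kernel s d (t - y)" for t
  define v where "v k t = (- 1) ^ k * pochhammer a k * (t - y) powr (- (a + real k))" for k t
  define M where "M k = pochhammer a k * d powr (- (a + real k))" for k
  have a: "a > 1" using s by (simp add: a_def)
  have poch: "pochhammer a k > 0" for k using a by (intro pochhammer_pos) auto
  have ty: "t - y \<ge> d" "t - y > 0" if "t \<ge> t0" for t using that y d by auto
  have v': "(v k has_real_derivative v (Suc k) t) (at t)" if "t \<ge> t0" for k t
  proof -
    have 1: "((\<lambda>t. t - y) has_real_derivative 1) (at t)" by (auto intro!: derivative_eq_intros)
    have "((\<lambda>t. (t - y) powr (- (a + real k))) has_real_derivative (- (a + real k)) * (t - y) powr (- (a + real k) - 1) * 1) (at t)"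
      by (rule has_real_derivative_powr[THEN DERIV_chain2[OF _ 1]]) (use ty[OF that] in auto)
    moreover have "- (a + real k) - 1 = - (a + real (Suc k))" by simp
    ultimately have "((\<lambda>t. (t - y) powr (- (a + real k))) has_real_derivative (- (a + real k)) * (t - y) powr (- (a + real (Suc k)))) (at t)"
      by (simp only: mult_1_right)
    from DERIV_cmult[OF this, of "(- 1) ^ k * pochhammer a k"]
    show ?thesis unfolding v_def[abs_def] by (simp add: pochhammer_Suc algebra_simps del: of_nat_Suc)
  qed
  have vM: "\<bar>v k t\<bar> \<le> M k" if "t \<ge> t0" for k t
  proof -
    have "(t - y) powr (- (a + real k)) \<le> d powr (- (a + real k))"
      using ty[OF that] d a by (intro powr_mono2') auto
    then show ?thesis
      unfolding v_def M_def using poch[of k] by (simp add: abs_mult mult_left_mono)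
  qed
  have uv: "u t = v 0 t" if "t \<ge> t0" for t
    using ty[OF that] by (simp add: u_def v_def tail_kernel_def a_def)
  have [measurable]: "u \<in> borel_measurable borel" unfolding u_def[abs_def] by measurable
  have ub: "\<bar>u t\<bar> \<le> d powr (- a)" for t
  proof (cases "t - y \<ge> d")
    case True
    then show ?thesis using d a by (auto simp: u_def tail_kernel_def a_def intro!: powr_mono2')
  qed (simp add: u_def tail_kernel_def)
  let ?u = "(fdiff \<delta> ^^ l) u"
  obtain C where C: "?u \<in> borel_measurable borel" "\<And>t. \<bar>?u t\<bar> \<le> C"
    using fdiff_bounded_measurable[where u = u and l = l and \<delta> = \<delta>, OF _ ub] by auto
  have "(LINT h|lborel. tail_kernel s d h * (bdiff \<delta> ^^ l) e (y + h)) = (LINT t|lborel. (bdiff \<delta> ^^ l) e t * u t)"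
    using lborel_integral_real_affine[of 1 "\<lambda>t. (bdiff \<delta> ^^ l) e t * u t" y] by (simp add: u_def mult.commute)
  also have "\<dots> = (LINT t|lborel. e t * ?u t)"
    using LINT_bdiff_iter[where u = u and l = l and \<delta> = \<delta>, OF e(2) _ ub] by auto
  finally have 1: "(LINT h|lborel. tail_kernel s d h * (bdiff \<delta> ^^ l) e (y + h)) = (LINT t|lborel. e t * ?u t)" .
  have i: "integrable lborel (\<lambda>t. e t * ?u t)"
  proof (rule Bochner_Integration.integrable_bound)
    show "integrable lborel (\<lambda>t. C * e t)" using e(2) by simp
    have "\<bar>e t\<bar> * \<bar>?u t\<bar> \<le> \<bar>e t\<bar> * \<bar>C\<bar>" for t using C(2)[of t] by (intro mult_left_mono) auto
    then show "AE t in lborel. norm (e t * ?u t) \<le> norm (C * e t)" by (simp add: abs_mult mult.commute)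
  qed (use C(1) e(2) in auto)
  have "(LINT t|lborel. e t * ?u t) - v l t0 = (LINT t|lborel. e t * (?u t - v l t0))"
    using i e(2,3) by (simp add: right_diff_distrib)
  \<comment> \<open>Of the l + 1 units of error, l come from replacing the iterated quotient by the
    derivative at t, and one from moving t to t0 within the support of width \<delta>.\<close>
  also have "\<bar>\<dots>\<bar> \<le> (LINT t|lborel. e t * ((real l + 1) * \<delta> * M (Suc l)))"
    unfolding real_norm_def[symmetric]
  proof (rule norm_LINT_le)
    show "integrable lborel (\<lambda>t. e t * (?u t - v l t0))" using i e(2) by (simp add: right_diff_distrib)
    show "integrable lborel (\<lambda>t. e t * ((real l + 1) * \<delta> * M (Suc l)))" using e(2) by simp
    fix t
    show "norm (e t * (?u t - v l t0)) \<le> e t * ((real l + 1) * \<delta> * M (Suc l))"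
    proof (cases "t \<in> {t0..t0 + \<delta>}")
      case True
      then have t: "t \<ge> t0" "t - t0 \<le> \<delta>" by auto
      have "?u t = (fdiff \<delta> ^^ l) (v 0) t" by (rule fdiff_cong[OF \<delta> uv t(1)])
      then have 1: "\<bar>?u t - v l t\<bar> \<le> real l * \<delta> * M (Suc l)"
        using fdiff_approx[where v = v and M = M and l = l, OF \<delta> t(1)] v' vM by simp
      have "\<bar>v l t - v l t0\<bar> \<le> \<delta> * M (Suc l)"
      proof (cases "t = t0")
        case True
        then show ?thesis using \<delta> poch[of "Suc l"] by (simp add: M_def)
      next
        case False
        have "\<exists>z>t0. z < t \<and> v l t - v l t0 = (t - t0) * v (Suc l) z"
          using t False v' by (intro MVT2) auto
        then obtain z where z: "z > t0" "v l t - v l t0 = (t - t0) * v (Suc l) z" by blast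
        show ?thesis unfolding z(2) abs_mult using t z vM[of z "Suc l"] \<delta> by (intro mult_mono) auto
      qed
      with 1 have "\<bar>?u t - v l t0\<bar> \<le> (real l + 1) * \<delta> * M (Suc l)" by (simp add: distrib_right)
      then show ?thesis using e(1)[of t] by (simp add: abs_mult mult_left_mono)
    qed (simp add: e(4))
  qed
  also have "\<dots> = (real l + 1) * \<delta> * M (Suc l)" using e(3) by simp
  finally show ?thesis unfolding 1 v_def M_def a_def by (simp add: mult_ac)
qed

text \<open>Raising N by one multiplies by \<open>(1 - q^2) + 2 q p - p^2\<close>, so a new
  coefficient combines three old ones with factors of modulus at most 1, 2 and 1 for q in [0, 1];
  hence the base 4. Continuity in q is what makes the weights \<open>W l\<close> measurable
  later.\<close>

lemma landau_polynomial_coeffs: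
  "\<exists>B :: nat \<Rightarrow> real \<Rightarrow> real. (\<forall>l. continuous_on UNIV (B l)) \<and>
     (\<forall>p q. (1 - (p - q)\<^sup>2) ^ N = (\<Sum>l\<le>2 * N. B l q * p ^ l)) \<and> (\<forall>l. \<forall>q\<in>{0..1}. \<bar>B l q\<bar> \<le> 4 ^ N)"
proof (induction N)
  case 0
  show ?case by (rule exI[of _ "\<lambda>l q. if l = 0 then 1 else 0"]) auto
next
  case (Suc N)
  then obtain B :: "nat \<Rightarrow> real \<Rightarrow> real" where B: "\<And>l. continuous_on UNIV (B l)"
    "\<And>p q. (1 - (p - q)\<^sup>2) ^ N = (\<Sum>l\<le>2 * N. B l q * p ^ l)" "\<And>l q. q \<in> {0..1} \<Longrightarrow> \<bar>B l q\<bar> \<le> 4 ^ N" by metis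
  define b where "b l q = (if l \<le> 2 * N then B l q else 0)" for l q
  define B' where "B' l q = (1 - q\<^sup>2) * b l q + (2 * q) * (if l \<ge> 1 then b (l - 1) q else 0) - (if l \<ge> 2 then b (l - 2) q else 0)" for l q
  have cb: "continuous_on UNIV (b l)" for l unfolding b_def using B(1) by (cases "l \<le> 2 * N") auto
  have "continuous_on UNIV (B' l)" for l
    unfolding B'_def by (cases "l \<ge> 1"; cases "l \<ge> 2") (auto intro!: continuous_intros cb)
  moreover have "(1 - (p - q)\<^sup>2) ^ Suc N = (\<Sum>l\<le>2 * Suc N. B' l q * p ^ l)" for p q
  proof -
    define S where "S = (\<Sum>l\<le>2 * N. B l q * p ^ l)"
    have S0: "(\<Sum>l\<le>2 * Suc N. b l q * p ^ l) = S"
      unfolding S_def b_def by (intro sum.mono_neutral_cong_right) auto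
    have S1: "(\<Sum>l\<le>2 * Suc N. (if l \<ge> 1 then b (l - 1) q else 0) * p ^ l) = p * S"
    proof -
      have "(\<Sum>l\<le>2 * Suc N. (if l \<ge> 1 then b (l - 1) q else 0) * p ^ l) = (\<Sum>l\<le>2 * N + 1. b l q * p ^ Suc l)"
        by (simp add: sum.atMost_Suc_shift del: sum.atMost_Suc)
      also have "\<dots> = p * (\<Sum>l\<le>2 * N + 1. b l q * p ^ l)" by (simp add: sum_distrib_left mult_ac del: sum.atMost_Suc)
      also have "(\<Sum>l\<le>2 * N + 1. b l q * p ^ l) = S"
        unfolding S_def b_def by (intro sum.mono_neutral_cong_right) auto
      finally show ?thesis .
    qed
    have S2: "(\<Sum>l\<le>2 * Suc N. (if l \<ge> 2 then b (l - 2) q else 0) * p ^ l) = p\<^sup>2 * S"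
    proof -
      have "(\<Sum>l\<le>2 * Suc N. (if l \<ge> 2 then b (l - 2) q else 0) * p ^ l) = (\<Sum>l\<le>2 * N. b l q * p ^ Suc (Suc l))"
        by (simp add: sum.atMost_Suc_shift del: sum.atMost_Suc)
      also have "\<dots> = p\<^sup>2 * S" by (simp add: S_def b_def sum_distrib_left power2_eq_square mult_ac)
      finally show ?thesis .
    qed
    have "(\<Sum>l\<le>2 * Suc N. B' l q * p ^ l) = (1 - q\<^sup>2) * (\<Sum>l\<le>2 * Suc N. b l q * p ^ l) + (2 * q) * (\<Sum>l\<le>2 * Suc N. (if l \<ge> 1 then b (l - 1) q else 0) * p ^ l)
        - (\<Sum>l\<le>2 * Suc N. (if l \<ge> 2 then b (l - 2) q else 0) * p ^ l)"
      unfolding B'_def sum_distrib_left sum.distrib[symmetric] sum_subtractf[symmetric]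
      by (intro sum.cong) (auto simp: algebra_simps)
    also have "\<dots> = (1 - (p - q)\<^sup>2) * S" unfolding S0 S1 S2 by (simp add: power2_eq_square algebra_simps)
    finally show ?thesis by (simp add: B(2) S_def)
  qed
  moreover have "\<bar>B' l q\<bar> \<le> 4 ^ Suc N" if q: "q \<in> {0..1}" for l q
  proof -
    have b: "\<bar>b l q\<bar> \<le> 4 ^ N" for l unfolding b_def using B(3)[OF q] by auto
    have q2: "\<bar>1 - q\<^sup>2\<bar> \<le> 1" "\<bar>2 * q\<bar> \<le> 2" using q by (auto simp: abs_le_iff power_le_one)
    have "\<bar>(1 - q\<^sup>2) * b l q\<bar> \<le> 1 * 4 ^ N" unfolding abs_mult by (intro mult_mono q2 b) auto
    moreover have "\<bar>(2 * q) * (if l \<ge> 1 then b (l - 1) q else 0)\<bar> \<le> 2 * 4 ^ N"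
      unfolding abs_mult[of "2 * q"] by (intro mult_mono q2) (auto simp: b)
    moreover have "\<bar>if l \<ge> 2 then b (l - 2) q else 0\<bar> \<le> 4 ^ N" by (auto simp: b)
    ultimately show ?thesis unfolding B'_def power_Suc by linarith
  qed
  ultimately show ?case by blast
qed

section \<open>Approximation on a fibre\<close>

text \<open>The function \<open>r * (1 - r^2)^(N + 1)\<close> vanishes at both end points and has
  the derivative \<open>(1 - r^2)^N * (1 - (2N + 3) r^2)\<close>, which yields the second moment.
  The mass is at least \<open>1 / 2 ^ N\<close> because \<open>1 - r^2 \<ge> 1 / 2\<close> on an
  interval of length 1.\<close>

lemma landau_moments:
  defines "J N \<equiv> (LINT r::real|lborel. indicator {-1..1} r * (1 - r\<^sup>2) ^ N)"
  shows "(LINT r|lborel. indicator {-1..1} r * (r\<^sup>2 * (1 - r\<^sup>2) ^ N)) = J N / (2 * real N + 3)"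
    and "J N \<ge> 1 / 2 ^ N" 
    and "integrable lborel (\<lambda>r::real. indicator {-1..1} r * (1 - r\<^sup>2) ^ N)"
    and "integrable lborel (\<lambda>r::real. indicator {-1..1} r * (r\<^sup>2 * (1 - r\<^sup>2) ^ N))"
proof -
  have int: "integrable lborel (\<lambda>r::real. indicator S r * f r)" if "continuous_on UNIV f" "compact S" for f :: "real \<Rightarrow> real" and S
    using borel_integrable_compact[of S f] that continuous_on_subset[OF that(1)] by auto
  show i1: "integrable lborel (\<lambda>r::real. indicator {-1..1} r * (1 - r\<^sup>2) ^ N)"
    by (intro int continuous_intros) auto
  show i2: "integrable lborel (\<lambda>r::real. indicator {-1..1} r * (r\<^sup>2 * (1 - r\<^sup>2) ^ N))"
    by (intro int continuous_intros) auto
  let ?F = "\<lambda>r::real. r * (1 - r\<^sup>2) ^ Suc N"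
  let ?f = "\<lambda>r::real. (1 - r\<^sup>2) ^ N - (2 * real N + 3) * (r\<^sup>2 * (1 - r\<^sup>2) ^ N)"
  have "(LINT r|lborel. ?f r * indicator {-1..1} r) = ?F 1 - ?F (- 1)"
  proof (rule integral_FTC_Icc_real)
    fix r :: real
    have "((\<lambda>r. 1 - r\<^sup>2) has_real_derivative - (2 * r)) (at r)" by (auto intro!: derivative_eq_intros)
    from DERIV_mult[OF DERIV_ident DERIV_power_Suc[OF this, of N]]
    have "(?F has_real_derivative 1 * (1 - r\<^sup>2) ^ Suc N + (1 + real N) * (- (2 * r) * (1 - r\<^sup>2) ^ N) * r) (at r)" .
    moreover have "1 * (1 - r\<^sup>2) ^ Suc N + (1 + real N) * (- (2 * r) * (1 - r\<^sup>2) ^ N) * r = ?f r"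
      by (simp add: algebra_simps power2_eq_square)
    ultimately show "(?F has_real_derivative ?f r) (at r)" by simp
    show "isCont ?f r" by (intro continuous_intros)
  qed simp
  then have "0 = (LINT r|lborel. indicator {-1..1} r * (1 - r\<^sup>2) ^ N - (2 * real N + 3) * (indicator {-1..1} r * (r\<^sup>2 * (1 - r\<^sup>2) ^ N)))"
    by (simp add: algebra_simps)
  also have "\<dots> = J N - (2 * real N + 3) * (LINT r|lborel. indicator {-1..1} r * (r\<^sup>2 * (1 - r\<^sup>2) ^ N))"
    unfolding J_def using i1 i2 by simp
  finally show "(LINT r|lborel. indicator {-1..1} r * (r\<^sup>2 * (1 - r\<^sup>2) ^ N)) = J N / (2 * real N + 3)"
    by (simp add: field_simps)
  have "1 / 2 ^ N = (LINT r|lborel. (1 / 2 :: real) ^ N * indicator {-1/2..1/2::real} r)"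
    by (simp add: power_one_over)
  also have "\<dots> \<le> J N" unfolding J_def
  proof (rule integral_mono[OF _ i1])
    show "integrable lborel (\<lambda>r. (1 / 2 :: real) ^ N * indicator {-1/2..1/2::real} r)"
      using borel_integrable_compact[of "{-1/2..1/2::real}" "\<lambda>_. 1 :: real"] by simp
    fix r :: real
    show "(1 / 2) ^ N * indicator {-1/2..1/2} r \<le> indicator {-1..1} r * (1 - r\<^sup>2) ^ N"
    proof (cases "r \<in> {-1/2..1/2}")
      case True
      then have "\<bar>r\<bar> \<le> 1 / 2" by (auto simp: abs_le_iff)
      then have "\<bar>r\<bar>\<^sup>2 \<le> (1 / 2)\<^sup>2" by (intro power_mono) auto
      then have "1 / 2 \<le> 1 - r\<^sup>2" by (simp add: power2_eq_square)
      then have "(1 / 2) ^ N \<le> (1 - r\<^sup>2) ^ N" by (intro power_mono) auto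
      then show ?thesis using True by simp
    next
      case False
      have "0 \<le> indicator {-1..1} r * (1 - r\<^sup>2) ^ N"
        by (cases "r \<in> {-1..1}") (auto simp: abs_square_le_1 abs_le_iff intro!: zero_le_power)
      then show ?thesis using False by simp
    qed
  qed
  finally show "J N \<ge> 1 / 2 ^ N" .
qed

definition landau :: "nat \<Rightarrow> real \<Rightarrow> real" where
  "landau N r = indicator {-1..1} r * (1 - r\<^sup>2) ^ N / (LINT r|lborel. indicator {-1..1} r * (1 - r\<^sup>2) ^ N)"

lemma borel_measurable_landau [measurable]: "landau N \<in> borel_measurable borel"
  unfolding landau_def[abs_def] by measurable

lemma landau_props:
  shows "landau N r \<ge> 0" and "integrable lborel (landau N)" and "(LINT r|lborel. landau N r) = 1"
    and "integrable lborel (\<lambda>r. r\<^sup>2 * landau N r)"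
    and "(LINT r|lborel. r\<^sup>2 * landau N r) = 1 / (2 * real N + 3)" and "1 / (LINT r::real|lborel. indicator {-1..1} r * (1 - r\<^sup>2) ^ N) \<le> 2 ^ N"
    and "(LINT r::real|lborel. indicator {-1..1} r * (1 - r\<^sup>2) ^ N) > 0"
proof -
  define J where "J = (LINT r::real|lborel. indicator {-1..1} r * (1 - r\<^sup>2) ^ N)"
  note M = landau_moments[of N, folded J_def]
  show J: "(LINT r::real|lborel. indicator {-1..1} r * (1 - r\<^sup>2) ^ N) > 0"
    using M(2) unfolding J_def[symmetric] by (meson less_le_trans zero_less_divide_1_iff zero_less_numeral zero_less_power)
  then have J': "J > 0" by (simp add: J_def)
  show cJ: "1 / (LINT r::real|lborel. indicator {-1..1} r * (1 - r\<^sup>2) ^ N) \<le> 2 ^ N"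
    using M(2) J' unfolding J_def[symmetric] by (simp add: field_simps)
  have k: "0 \<le> indicator {-1..1} r * (1 - r\<^sup>2) ^ N" "indicator {-1..1} r * (1 - r\<^sup>2) ^ N \<le> 1" for r :: real
    by (cases "r \<in> {-1..1}"; auto simp: abs_square_le_1 abs_le_iff intro!: zero_le_power power_le_one)+
  show "landau N r \<ge> 0" unfolding landau_def J_def[symmetric] using k J' by simp
  show "integrable lborel (landau N)" unfolding landau_def[abs_def] using M(3) by simp
  show "(LINT r|lborel. landau N r) = 1"
    unfolding landau_def J_def[symmetric] integral_divide_zero using J' by (simp flip: J_def)
  have e: "r\<^sup>2 * landau N r = indicator {-1..1} r * (r\<^sup>2 * (1 - r\<^sup>2) ^ N) / J" for r
    unfolding landau_def J_def[symmetric] by simp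
  show "integrable lborel (\<lambda>r. r\<^sup>2 * landau N r)" unfolding e using M(4) by simp
  show "(LINT r|lborel. r\<^sup>2 * landau N r) = 1 / (2 * real N + 3)"
    unfolding e integral_divide_zero M(1) using J' by simp
qed

text \<open>The modulus \<open>sqrt \<bar>r\<bar>\<close> is majorised by
  \<open>\<kappa> + r^2 / \<kappa>^3\<close>, whose average only involves the mass 1 and the second
  moment, at most 1 / N. The choice of \<kappa> as the power -1/4 of N balances the two
  terms.\<close>

lemma landau_approx:
  fixes f :: "real \<Rightarrow> complex"
  assumes N: "N \<ge> 1" and M: "M \<ge> 0" and f: "\<And>p q. norm (f p - f q) \<le> M * sqrt \<bar>p - q\<bar>"
    and f_meas: "f \<in> borel_measurable borel" and fb: "\<And>p. norm (f p) \<le> A"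
  shows "norm (f p - (LINT q|lborel. of_real (landau N (p - q)) * f q)) \<le> 2 * M * real N powr (- (1 / 4))"
proof -
  have [measurable]: "f \<in> borel_measurable borel" by fact
  define \<kappa> where "\<kappa> = real N powr (- (1 / 4))"
  have \<kappa>: "\<kappa> > 0" using N by (simp add: \<kappa>_def)
  have \<kappa>4: "\<kappa> ^ 4 = 1 / real N"
  proof -
    have "\<kappa> ^ 4 = real N powr (real 4 * (- (1 / 4)))" unfolding \<kappa>_def by (rule powr_power) (use N in simp)
    also have "\<dots> = 1 / real N" using N by (simp add: powr_minus_divide)
    finally show ?thesis .
  qed
  have sqrt_le: "sqrt \<bar>r\<bar> \<le> \<kappa> + r\<^sup>2 * (1 / \<kappa> ^ 3)" for r
  proof (cases "\<bar>r\<bar> \<le> \<kappa>\<^sup>2")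
    case True
    then have "sqrt \<bar>r\<bar> \<le> \<kappa>" using \<kappa> by (intro real_le_lsqrt) auto
    moreover have "0 \<le> r\<^sup>2 * (1 / \<kappa> ^ 3)" using \<kappa> by simp
    ultimately show ?thesis by linarith
  next
    case False
    define t where "t = sqrt \<bar>r\<bar>"
    have t: "t \<ge> \<kappa>" "t * t = \<bar>r\<bar>" unfolding t_def using False \<kappa> by (auto intro!: real_le_rsqrt)
    have "t * \<kappa> ^ 3 \<le> t * t ^ 3" using t \<kappa> by (intro mult_left_mono power_mono) auto
    also have "\<dots> = (t * t)\<^sup>2" by (simp add: power2_eq_square power3_eq_cube)
    also have "\<dots> = r\<^sup>2" unfolding t(2) by simp
    finally have "t \<le> r\<^sup>2 * (1 / \<kappa> ^ 3)" using \<kappa> by (simp add: field_simps)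
    then show ?thesis unfolding t_def[symmetric] using \<kappa> by linarith
  qed
  have refl: "(LINT q|lborel. g (p - q)) = (LINT r|lborel. g r)" for g :: "real \<Rightarrow> real"
    using lborel_integral_real_affine[of "- 1" g p] by simp
  have refl_int: "integrable lborel (\<lambda>q. g (p - q))" if "integrable lborel g" for g :: "real \<Rightarrow> real"
    using lborel_integrable_real_affine[OF that, of "- 1" p] by simp
  have i1: "integrable lborel (\<lambda>q. landau N (p - q))" by (intro refl_int landau_props)
  have i2: "integrable lborel (\<lambda>q. of_real (landau N (p - q)) * f q)"
  proof (rule Bochner_Integration.integrable_bound)
    show "integrable lborel (\<lambda>q. A * landau N (p - q))" using i1 by simp
    have "landau N (p - q) * norm (f q) \<le> landau N (p - q) * \<bar>A\<bar>" for q using fb[of q] by (intro mult_left_mono landau_props) auto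
    then show "AE q in lborel. norm (of_real (landau N (p - q)) * f q) \<le> norm (A * landau N (p - q))"
      by (simp add: norm_mult abs_mult landau_props(1) mult.commute)
  qed measurable
  have "(LINT q|lborel. of_real (landau N (p - q)) * f p) = f p"
    using refl[of "landau N"] landau_props(3)[of N] by simp
  then have "f p - (LINT q|lborel. of_real (landau N (p - q)) * f q) = (LINT q|lborel. of_real (landau N (p - q)) * (f p - f q))"
    using i1 i2 by (simp add: right_diff_distrib)
  also have "norm \<dots> \<le> (LINT q|lborel. M * (\<kappa> * landau N (p - q) + (1 / \<kappa> ^ 3) * ((p - q)\<^sup>2 * landau N (p - q))))"
  proof (rule norm_LINT_le)
    show "integrable lborel (\<lambda>q. of_real (landau N (p - q)) * (f p - f q))"
      using i1 i2 by (simp add: right_diff_distrib)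
    show "integrable lborel (\<lambda>q. M * (\<kappa> * landau N (p - q) + (1 / \<kappa> ^ 3) * ((p - q)\<^sup>2 * landau N (p - q))))"
      using i1 refl_int[OF landau_props(4)[of N]] by simp
    fix q
    have "norm (of_real (landau N (p - q)) * (f p - f q)) \<le> landau N (p - q) * (M * sqrt \<bar>p - q\<bar>)"
      using f[of p q] by (simp add: norm_mult landau_props(1) mult_left_mono)
    also have "\<dots> \<le> landau N (p - q) * (M * (\<kappa> + (p - q)\<^sup>2 * (1 / \<kappa> ^ 3)))"
      by (intro mult_left_mono sqrt_le M landau_props)
    also have "\<dots> = M * (\<kappa> * landau N (p - q) + (1 / \<kappa> ^ 3) * ((p - q)\<^sup>2 * landau N (p - q)))"
      by (simp add: algebra_simps)
    finally show "norm (of_real (landau N (p - q)) * (f p - f q)) \<le> M * (\<kappa> * landau N (p - q) + (1 / \<kappa> ^ 3) * ((p - q)\<^sup>2 * landau N (p - q)))" .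
  qed
  also have "\<dots> = M * (\<kappa> * 1 + (1 / \<kappa> ^ 3) * (1 / (2 * real N + 3)))"
    using i1 refl_int[OF landau_props(4)[of N]] refl[of "landau N"] refl[of "\<lambda>r. r\<^sup>2 * landau N r"] landau_props(3,5)[of N] by simp
  also have "\<dots> \<le> M * (\<kappa> + \<kappa>)"
  proof (intro mult_left_mono M add_mono)
    have "1 / (2 * real N + 3) \<le> 1 / real N" using N by (intro divide_left_mono) auto
    then have "(1 / \<kappa> ^ 3) * (1 / (2 * real N + 3)) \<le> (1 / \<kappa> ^ 3) * \<kappa> ^ 4"
      unfolding \<kappa>4 using \<kappa> by (intro mult_left_mono) auto
    also have "\<dots> = \<kappa>" using \<kappa> by (simp add: power_numeral_reduce field_simps)
    finally show "(1 / \<kappa> ^ 3) * (1 / (2 * real N + 3)) \<le> \<kappa>" .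
  qed simp
  finally show ?thesis by (simp add: \<kappa>_def mult_ac)
qed

text \<open>The variable \<open>p = d / (t0 - y)\<close> turns the derivatives of the kernel at \<open>t0\<close> into the monomials \<open>p ^ l\<close>
  (up to a weight).\<close>

definition inv_coord :: "real \<Rightarrow> real \<Rightarrow> real \<Rightarrow> real" where
  "inv_coord d t0 y = d / (t0 - y)"

lemma inv_coord_props:
  assumes "d > 0" "\<alpha> < \<beta>" "t0 = \<beta> + d" "y \<in> {\<alpha>..\<beta>}"
  shows "inv_coord d t0 y > 0" "inv_coord d t0 y \<le> 1" "inv_coord d t0 \<alpha> \<le> inv_coord d t0 y"
    "(inv_coord d t0 has_real_derivative (inv_coord d t0 y)\<^sup>2 / d) (at y)"
proof -
  have y: "t0 - y \<ge> d" "t0 - y > 0" "t0 - y \<le> t0 - \<alpha>" "t0 - \<alpha> > 0" using assms by auto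
  show "inv_coord d t0 y > 0" "inv_coord d t0 y \<le> 1" using y assms(1) by (auto simp: inv_coord_def)
  show "inv_coord d t0 \<alpha> \<le> inv_coord d t0 y"
    unfolding inv_coord_def using y assms(1) by (intro divide_left_mono) auto
  show "(inv_coord d t0 has_real_derivative (inv_coord d t0 y)\<^sup>2 / d) (at y)"
  proof -
    have "((\<lambda>y. d / (t0 - y)) has_real_derivative d / (t0 - y)\<^sup>2) (at y)"
      using y by (auto intro!: derivative_eq_intros simp: power2_eq_square)
    moreover have "d / (t0 - y)\<^sup>2 = (d / (t0 - y))\<^sup>2 / d"
      using assms(1) by (simp add: power2_eq_square)
    ultimately show ?thesis unfolding inv_coord_def[abs_def] by simp
  qed
qed

text \<open>Landau convolution in the variable \<open>p = inv_coord d t0 y\<close>, written in terms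
  of y: the last factor is the Jacobian of the substitution in y'. The conjugation by the power a of
  p is there because the derivatives of the singular kernel supply the functions
  \<open>p powr (a + l)\<close>, not the bare monomials.\<close>

definition landau_kernel :: "nat \<Rightarrow> real \<Rightarrow> real \<Rightarrow> real \<Rightarrow> real \<Rightarrow> real \<Rightarrow> real" where
  "landau_kernel N a d t0 y' y = landau N (inv_coord d t0 y - inv_coord d t0 y') *
     inv_coord d t0 y powr a * inv_coord d t0 y' powr (- a) * ((inv_coord d t0 y')\<^sup>2 / d)"

text \<open>The fundamental theorem of calculus followed by Cauchy-Schwarz on the interval between
  the two points: the one-dimensional embedding of H^1 into Hoelder functions of order 1/2.\<close>

lemma holder_of_square_integrable_derivative:
  fixes G :: "real \<Rightarrow> complex"
  assumes G: "\<And>y. y \<in> {\<alpha>..\<beta>} \<Longrightarrow> (G has_vector_derivative G' y) (at y)" and cont: "continuous_on {\<alpha>..\<beta>} G'"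
    and y: "y \<in> {\<alpha>..\<beta>}" "z \<in> {\<alpha>..\<beta>}"
  shows "norm (G y - G z) \<le> sqrt \<bar>y - z\<bar> * sqrt (LINT t|lborel. indicator {\<alpha>..\<beta>} t * (norm (G' t))\<^sup>2)"
proof -
  have main: "norm (G z - G y) \<le> sqrt (z - y) * sqrt (LINT t|lborel. indicator {\<alpha>..\<beta>} t * (norm (G' t))\<^sup>2)"
    if yz: "y \<le> z" "\<alpha> \<le> y" "z \<le> \<beta>" for y z
  proof -
    have sub: "{y..z} \<subseteq> {\<alpha>..\<beta>}" using yz by auto
    have c: "continuous_on {y..z} G'" by (rule continuous_on_subset[OF cont sub])
    have "(LINT t|lborel. indicator {y..z} t *\<^sub>R G' t) = G z - G y"
      by (rule integral_FTC_Icc[OF yz(1)]) (use G sub c in \<open>auto intro: has_vector_derivative_at_within\<close>)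
    then have "norm (G z - G y) \<le> (LINT t|lborel. norm (indicator {y..z} t *\<^sub>R G' t))"
      by (metis integral_norm_bound)
    also have "\<dots> = (LINT t|lborel. indicator {y..z} t * norm (indicator {y..z} t *\<^sub>R G' t))"
      by (intro Bochner_Integration.integral_cong) (auto simp: indicator_def)
    also have "\<dots> \<le> sqrt (LINT t|lborel. (indicator {y..z} t)\<^sup>2) * sqrt (LINT t|lborel. (norm (indicator {y..z} t *\<^sub>R G' t))\<^sup>2)"
    proof -
      have i: "integrable lborel (\<lambda>t. indicator {y..z} t *\<^sub>R G' t)" by (rule borel_integrable_compact[OF _ c]) auto
      have i2: "integrable lborel (\<lambda>t. indicator {y..z} t *\<^sub>R (norm (G' t))\<^sup>2)"
        by (rule borel_integrable_compact) (auto intro!: continuous_intros c)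
      have "integrable lborel (\<lambda>t. (norm (indicator {y..z} t *\<^sub>R G' t))\<^sup>2)"
        by (rule Bochner_Integration.integrable_cong[THEN iffD1, OF refl _ i2]) (auto simp: indicator_def)
      moreover have "integrable lborel (\<lambda>t. (indicator {y..z} t :: real)\<^sup>2)"
      proof -
        have "(\<lambda>t. (indicator {y..z} t :: real)\<^sup>2) = indicator {y..z}" by (auto simp: indicator_def)
        then show ?thesis using borel_integrable_compact[of "{y..z}" "\<lambda>_. 1 :: real"] by simp
      qed
      moreover have "(\<lambda>t. norm (indicator {y..z} t *\<^sub>R G' t)) \<in> borel_measurable lborel"
        by (rule measurable_compose[OF borel_measurable_integrable[OF i] borel_measurable_norm])
      ultimately have "\<bar>LINT t|lborel. indicator {y..z} t * norm (indicator {y..z} t *\<^sub>R G' t)\<bar> \<le> sqrt (LINT t|lborel. (indicator {y..z} t)\<^sup>2) * sqrt (LINT t|lborel. (norm (indicator {y..z} t *\<^sub>R G' t))\<^sup>2)"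
        by (intro LINT_Cauchy_Schwarz(2)) auto
      then show ?thesis by linarith
    qed
    also have "(LINT t|lborel. (indicator {y..z} t)\<^sup>2) = (LINT t|lborel. indicator {y..z} t :: real)"
      by (intro Bochner_Integration.integral_cong) (auto simp: indicator_def)
    also have "\<dots> = z - y" using yz by simp
    also have "(LINT t|lborel. (norm (indicator {y..z} t *\<^sub>R G' t))\<^sup>2) \<le> (LINT t|lborel. indicator {\<alpha>..\<beta>} t * (norm (G' t))\<^sup>2)"
    proof (rule Bochner_Integration.integral_mono')
      have "integrable lborel (\<lambda>t. indicator {\<alpha>..\<beta>} t *\<^sub>R (norm (G' t))\<^sup>2)"
        by (rule borel_integrable_compact) (auto intro!: continuous_intros cont)
      then show "integrable lborel (\<lambda>t. indicator {\<alpha>..\<beta>} t * (norm (G' t))\<^sup>2)" by simp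
    qed (use sub in \<open>auto simp: indicator_def\<close>)
    finally show ?thesis using yz by (simp add: mult_left_mono)
  qed
  show ?thesis
    using main[of y z] main[of z y] y by (cases "y \<le> z") (auto simp: norm_minus_commute)
qed

lemma continuous_on_holder:
  fixes f :: "real \<Rightarrow> complex"
  assumes "\<And>p q. norm (f p - f q) \<le> M * sqrt \<bar>p - q\<bar>"
  shows "continuous_on S f"
proof (rule continuous_at_imp_continuous_on, rule ballI)
  fix p
  have "((\<lambda>q. f q - f p) \<longlongrightarrow> 0) (at p)"
  proof (rule Lim_null_comparison)
    have "((\<lambda>q. M * sqrt \<bar>q - p\<bar>) \<longlongrightarrow> M * sqrt \<bar>p - p\<bar>) (at p)" by (intro tendsto_intros)
    then show "((\<lambda>q. M * sqrt \<bar>q - p\<bar>) \<longlongrightarrow> 0) (at p)" by simp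
  qed (simp add: assms)
  then show "isCont f p" unfolding isCont_def by (rule LIM_zero_cancel)
qed

text \<open>\<open>landau_approx\<close> is applied to \<open>p powr (- a) * \<gamma>\<close>
  expressed in the variable p. The change of variables is Lipschitz with constants depending on the
  interval alone, and since \<gamma> vanishes at both end points the extension by 0 stays Hoelder
  continuous, so the estimate holds uniformly up to the boundary.\<close>

lemma landau_kernel_approx:
  assumes d: "d > 0" and ab: "\<alpha> < \<beta>" and t0: "t0 = \<beta> + d" and a: "a \<ge> 0"
  shows "\<exists>K\<ge>0. \<forall>N\<ge>1. \<forall>\<gamma> \<gamma>'. (\<forall>y\<in>{\<alpha>..\<beta>}. (\<gamma> has_vector_derivative \<gamma>' y) (at y)) \<longrightarrow>
     continuous_on {\<alpha>..\<beta>} \<gamma>' \<longrightarrow> \<gamma> \<alpha> = 0 \<longrightarrow> \<gamma> \<beta> = 0 \<longrightarrow>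
     (\<forall>y\<in>{\<alpha>..\<beta>}. norm (\<gamma> y - (LINT y'|lborel. indicator {\<alpha>..\<beta>} y' *\<^sub>R (of_real (landau_kernel N a d t0 y' y) * \<gamma> y')))
        \<le> K * real N powr (- (1 / 4)) * sqrt (LINT t|lborel. indicator {\<alpha>..\<beta>} t * ((norm (\<gamma> t))\<^sup>2 + (norm (\<gamma>' t :: complex))\<^sup>2)))"
proof -
  define p where "p = inv_coord d t0"
  define p0 where "p0 = p \<alpha>"
  have p: "p y > 0" "p y \<le> 1" "p0 \<le> p y" "(p has_real_derivative (p y)\<^sup>2 / d) (at y)" if "y \<in> {\<alpha>..\<beta>}" for y
    using inv_coord_props[OF d ab t0 that] by (simp_all add: p_def p0_def)
  have p0: "p0 > 0" "p0 \<le> 1" using p[of \<alpha>] ab by (auto simp: p0_def)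
  have p\<beta>: "p \<beta> = 1" using d t0 by (simp add: p_def inv_coord_def)
  define w where "w y = p y powr (- a)" for y
  define w' where "w' y = (- a) * p y powr (- a - 1) * ((p y)\<^sup>2 / d)" for y
  define w0 where "w0 = p0 powr (- a)"
  define w1 where "w1 = a * p0 powr (- a - 1) * (1 / d)"
  have w_der: "(w has_real_derivative w' y) (at y)" if "y \<in> {\<alpha>..\<beta>}" for y
    unfolding w_def[abs_def] w'_def
    by (rule has_real_derivative_powr[THEN DERIV_chain2[OF _ p(4)[OF that]]]) (use p[OF that] in auto)
  have w0_le: "\<bar>w y\<bar> \<le> w0" if "y \<in> {\<alpha>..\<beta>}" for y
    unfolding w_def w0_def using p[OF that] p0 a by (simp add: powr_mono2')
  have w1_le: "\<bar>w' y\<bar> \<le> w1" if "y \<in> {\<alpha>..\<beta>}" for y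
  proof -
    have "(p y)\<^sup>2 \<le> 1" using p[OF that] by (simp add: power_le_one)
    then show ?thesis
      unfolding w'_def w1_def abs_mult using p[OF that] p0 a d
      by (intro mult_mono) (auto intro!: powr_mono2' divide_right_mono)
  qed
  define K1 where "K1 = sqrt (2 * (w0\<^sup>2 + w1\<^sup>2))"
  have K1: "K1 \<ge> 0" by (simp add: K1_def)
  \<comment> \<open>\<open>sqrt d / p0\<close> is the square root of the Lipschitz constant
    \<open>d / p0^2\<close> of the inverse of p; 2 is the constant of
    \<open>landau_approx\<close>.\<close>
  define K where "K = 2 * (K1 * sqrt d / p0)"
  have K: "K \<ge> 0" unfolding K_def using K1 p0 d by simp
  have "norm (\<gamma> y - (LINT y'|lborel. indicator {\<alpha>..\<beta>} y' *\<^sub>R (of_real (landau_kernel N a d t0 y' y) * \<gamma> y')))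
        \<le> K * real N powr (- (1 / 4)) * sqrt (LINT t|lborel. indicator {\<alpha>..\<beta>} t * ((norm (\<gamma> t))\<^sup>2 + (norm (\<gamma>' t))\<^sup>2))"
    if N: "N \<ge> 1" and \<gamma>: "\<And>y. y \<in> {\<alpha>..\<beta>} \<Longrightarrow> (\<gamma> has_vector_derivative \<gamma>' y) (at y)" and c\<gamma>': "continuous_on {\<alpha>..\<beta>} \<gamma>'"
      and \<gamma>0: "\<gamma> \<alpha> = 0" "\<gamma> \<beta> = 0" and y: "y \<in> {\<alpha>..\<beta>}" for N y and \<gamma> \<gamma>' :: "real \<Rightarrow> complex"
  proof -
    define D where "D = sqrt (LINT t|lborel. indicator {\<alpha>..\<beta>} t * ((norm (\<gamma> t))\<^sup>2 + (norm (\<gamma>' t))\<^sup>2))"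
    have D0: "D \<ge> 0" by (simp add: D_def)
    define G where "G y = w y *\<^sub>R \<gamma> y" for y
    define G' where "G' y = w y *\<^sub>R \<gamma>' y + w' y *\<^sub>R \<gamma> y" for y
    have G: "(G has_vector_derivative G' y) (at y)" if "y \<in> {\<alpha>..\<beta>}" for y
      unfolding G_def[abs_def] G'_def by (rule has_vector_derivative_scaleR[OF w_der \<gamma>]) (use that in auto)
    have c\<gamma>: "continuous_on {\<alpha>..\<beta>} \<gamma>"
      by (intro continuous_at_imp_continuous_on ballI has_vector_derivative_continuous[OF \<gamma>])
    have cp: "continuous_on {\<alpha>..\<beta>} p"
      by (intro continuous_at_imp_continuous_on ballI DERIV_isCont[OF p(4)])
    have pn0: "\<forall>y\<in>{\<alpha>..\<beta>}. p y \<noteq> 0" using p(1) by force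
    have cw: "continuous_on {\<alpha>..\<beta>} w" "continuous_on {\<alpha>..\<beta>} w'"
      unfolding w_def w'_def using pn0 d by (auto intro!: continuous_intros cp)
    have cG: "continuous_on {\<alpha>..\<beta>} G" and cG': "continuous_on {\<alpha>..\<beta>} G'"
      unfolding G_def G'_def by (intro continuous_intros cw c\<gamma> c\<gamma>')+
    have G'_le: "(norm (G' t))\<^sup>2 \<le> K1\<^sup>2 * ((norm (\<gamma> t))\<^sup>2 + (norm (\<gamma>' t))\<^sup>2)" if "t \<in> {\<alpha>..\<beta>}" for t
    proof -
      have "norm (G' t) \<le> w0 * norm (\<gamma>' t) + w1 * norm (\<gamma> t)"
        unfolding G'_def using w0_le[OF that] w1_le[OF that]
        by (intro order_trans[OF norm_triangle_ineq] add_mono) (auto intro!: mult_right_mono)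
      then have "(norm (G' t))\<^sup>2 \<le> (w0 * norm (\<gamma>' t) + w1 * norm (\<gamma> t))\<^sup>2" by (intro power_mono) auto
      also have "\<dots> \<le> 2 * ((w0 * norm (\<gamma>' t))\<^sup>2 + (w1 * norm (\<gamma> t))\<^sup>2)"
        using sum_squares_bound[of "w0 * norm (\<gamma>' t)" "w1 * norm (\<gamma> t)"] by (simp add: power2_sum)
      also have "\<dots> \<le> 2 * (w0\<^sup>2 + w1\<^sup>2) * ((norm (\<gamma> t))\<^sup>2 + (norm (\<gamma>' t))\<^sup>2)"
        by (simp add: power_mult_distrib algebra_simps)
      finally show ?thesis by (simp add: K1_def)
    qed
    have "(LINT t|lborel. indicator {\<alpha>..\<beta>} t * (norm (G' t))\<^sup>2) \<le> (LINT t|lborel. K1\<^sup>2 * (indicator {\<alpha>..\<beta>} t * ((norm (\<gamma> t))\<^sup>2 + (norm (\<gamma>' t))\<^sup>2)))"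
    proof (rule integral_mono)
      show "integrable lborel (\<lambda>t. indicator {\<alpha>..\<beta>} t * (norm (G' t))\<^sup>2)"
        using borel_integrable_compact[of "{\<alpha>..\<beta>}" "\<lambda>t. (norm (G' t))\<^sup>2"] by (simp add: continuous_intros cG')
      show "integrable lborel (\<lambda>t. K1\<^sup>2 * (indicator {\<alpha>..\<beta>} t * ((norm (\<gamma> t))\<^sup>2 + (norm (\<gamma>' t))\<^sup>2)))"
        using borel_integrable_compact[of "{\<alpha>..\<beta>}" "\<lambda>t. (norm (\<gamma> t))\<^sup>2 + (norm (\<gamma>' t))\<^sup>2"] by (simp add: continuous_intros c\<gamma> c\<gamma>')
    qed (use G'_le in \<open>auto simp: indicator_def\<close>)
    then have "sqrt (LINT t|lborel. indicator {\<alpha>..\<beta>} t * (norm (G' t))\<^sup>2) \<le> sqrt (K1\<^sup>2 * (LINT t|lborel. indicator {\<alpha>..\<beta>} t * ((norm (\<gamma> t))\<^sup>2 + (norm (\<gamma>' t))\<^sup>2)))"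
      by simp
    also have "\<dots> = K1 * D" unfolding real_sqrt_mult D_def using K1 by simp
    finally have G'D: "sqrt (LINT t|lborel. indicator {\<alpha>..\<beta>} t * (norm (G' t))\<^sup>2) \<le> K1 * D" .
    have Gh: "norm (G y - G z) \<le> sqrt \<bar>y - z\<bar> * (K1 * D)" if "y \<in> {\<alpha>..\<beta>}" "z \<in> {\<alpha>..\<beta>}" for y z
      using holder_of_square_integrable_derivative[OF G cG' that] mult_left_mono[OF G'D, of "sqrt \<bar>y - z\<bar>"] by simp
    \<comment> \<open>Clamping q to [p0, 1] before inverting p extends f from that interval to the
      line by its boundary values, and these are 0.\<close>
    define cl where "cl q = max p0 (min 1 q)" for q
    have cl: "p0 \<le> cl q" "cl q \<le> 1" "cl q > 0" for q using p0 by (auto simp: cl_def)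
    define Y where "Y q = t0 - d / cl q" for q
    have Yin: "Y q \<in> {\<alpha>..\<beta>}" for q
    proof -
      have "d / cl q \<le> d / p0" using cl[of q] p0 d by (intro divide_left_mono) auto
      moreover have "d / p0 = t0 - \<alpha>" using d ab t0 by (simp add: p0_def p_def inv_coord_def)
      moreover have "d \<le> d / cl q" using cl[of q] d by (simp add: pos_le_divide_eq)
      ultimately show ?thesis using t0 by (simp add: Y_def)
    qed
    have Ylip: "\<bar>Y q - Y r\<bar> \<le> d / p0\<^sup>2 * \<bar>q - r\<bar>" for q r
    proof -
      have "Y q - Y r = d * (cl q - cl r) / (cl q * cl r)"
        using cl(3)[of q] cl(3)[of r] by (simp add: Y_def field_simps)
      then have "\<bar>Y q - Y r\<bar> = d * \<bar>cl q - cl r\<bar> / (cl q * cl r)"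
        using cl(3)[of q] cl(3)[of r] d by (simp add: abs_mult)
      also have "\<dots> \<le> d * \<bar>q - r\<bar> / (p0 * p0)"
      proof -
        have "\<bar>cl q - cl r\<bar> \<le> \<bar>q - r\<bar>" by (auto simp: cl_def max_def min_def abs_if)
        then show ?thesis
          using cl[of q] cl[of r] p0 d by (intro frac_le mult_mono mult_left_mono) auto
      qed
      finally show ?thesis by (simp add: power2_eq_square)
    qed
    define f where "f q = G (Y q)" for q
    define M where "M = K1 * D * (sqrt d / p0)"
    have M0: "M \<ge> 0" unfolding M_def using K1 D0 d p0 by simp
    have fh: "norm (f q - f r) \<le> M * sqrt \<bar>q - r\<bar>" for q r
    proof -
      have "norm (f q - f r) \<le> sqrt \<bar>Y q - Y r\<bar> * (K1 * D)" unfolding f_def by (rule Gh[OF Yin Yin])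
      also have "\<dots> \<le> sqrt (d / p0\<^sup>2 * \<bar>q - r\<bar>) * (K1 * D)"
        using K1 D0 by (intro mult_right_mono real_sqrt_le_mono Ylip) auto
      also have "\<dots> = M * sqrt \<bar>q - r\<bar>" using p0 unfolding real_sqrt_mult real_sqrt_divide M_def by simp
      finally show ?thesis .
    qed
    have cf: "continuous_on S f" for S using continuous_on_holder[OF fh] .
    have Yp: "Y (p z) = z" if "z \<in> {\<alpha>..\<beta>}" for z
      using p[OF that] that d t0 by (simp add: Y_def cl_def) (simp add: p_def inv_coord_def)
    have f0: "f q = 0" if "q \<le> p0 \<or> q \<ge> 1" for q
    proof -
      have "Y q = \<alpha> \<or> Y q = \<beta>"
        using that
      proof
        assume "q \<le> p0"
        then have "cl q = p \<alpha>" using p0 by (simp add: cl_def p0_def)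
        then show ?thesis using Yp[of \<alpha>] ab p(2)[of \<alpha>] by (simp add: Y_def cl_def p0_def)
      next
        assume "q \<ge> 1"
        then have "cl q = 1" using p0 by (simp add: cl_def)
        then show ?thesis using t0 by (simp add: Y_def)
      qed
      then show ?thesis using \<gamma>0 by (auto simp: f_def G_def)
    qed
    have fb: "norm (f q) \<le> sqrt (\<beta> - \<alpha>) * (K1 * D)" for q
    proof -
      have "G \<alpha> = 0" using \<gamma>0 by (simp add: G_def)
      then have "norm (f q) \<le> sqrt \<bar>Y q - \<alpha>\<bar> * (K1 * D)"
        using Gh[OF Yin[of q], of \<alpha>] ab unfolding f_def by simp
      also have "\<dots> \<le> sqrt (\<beta> - \<alpha>) * (K1 * D)"
        using K1 D0 Yin[of q] by (intro mult_right_mono real_sqrt_le_mono) auto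
      finally show ?thesis .
    qed
    have main: "norm (f (p y) - (LINT q|lborel. of_real (landau N (p y - q)) * f q)) \<le> 2 * M * real N powr (- (1 / 4))"
      by (rule landau_approx[OF N M0 fh borel_measurable_continuous_onI[OF cf] fb])
    have py: "p y > 0" "p y \<le> 1" "p0 \<le> p y" using p[OF y] by auto
    define J where "J = (LINT r::real|lborel. indicator {-1..1} r * (1 - r\<^sup>2) ^ N)"
    have J: "J > 0" unfolding J_def by (rule landau_props)
    let ?L = "\<lambda>q. of_real (landau N (p y - q)) * f q"
    \<comment> \<open>\<open>landau\<close> jumps to its cutoff outside [-1, 1] in general, but
      \<open>p y - q\<close> stays inside for q in [p0, 1]. The integrand is a polynomial times f
      there, which provides the continuity required for the substitution.\<close>
    have cL: "continuous_on {p0..1} ?L"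
    proof (rule continuous_on_eq)
      show "continuous_on {p0..1} (\<lambda>q. of_real ((1 - (p y - q)\<^sup>2) ^ N / J) * f q)"
        using J by (intro continuous_intros cf) auto
      show "of_real ((1 - (p y - q)\<^sup>2) ^ N / J) * f q = ?L q" if "q \<in> {p0..1}" for q
      proof -
        have "p y - q \<in> {-1..1}" using that py p0 by auto
        then show ?thesis by (simp add: landau_def J_def)
      qed
    qed
    have img: "p ` {\<alpha>..\<beta>} \<subseteq> {p0..1}" using p by auto
    have "(LINT q|lborel. ?L q) = (LINT q:{p0..1}|lborel. ?L q)"
      unfolding set_lebesgue_integral_def using f0 by (intro Bochner_Integration.integral_cong) (auto simp: indicator_def)
    also have "\<dots> = (LBINT q=p \<alpha>..p \<beta>. ?L q)"
      using p0 by (simp add: interval_integral_Icc p0_def[symmetric] p\<beta>)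
    also have "\<dots> = (LBINT z=\<alpha>..\<beta>. ((p z)\<^sup>2 / d) *\<^sub>R ?L (p z))"
    proof (rule interval_integral_substitution_finite[symmetric])
      show "\<alpha> \<le> \<beta>" using ab by simp
      show "(p has_real_derivative (p z)\<^sup>2 / d) (at z within {\<alpha>..\<beta>})" if "\<alpha> \<le> z" "z \<le> \<beta>" for z
        using p(4)[of z] that by (simp add: has_field_derivative_at_within)
      show "continuous_on (p ` {\<alpha>..\<beta>}) ?L" by (rule continuous_on_subset[OF cL img])
      show "continuous_on {\<alpha>..\<beta>} (\<lambda>z. (p z)\<^sup>2 / d)" using d by (intro continuous_intros cp) auto
    qed
    also have "\<dots> = (LINT z:{\<alpha>..\<beta>}|lborel. ((p z)\<^sup>2 / d) *\<^sub>R ?L (p z))"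
      using ab by (simp add: interval_integral_Icc)
    also have "\<dots> = (LINT z|lborel. indicator {\<alpha>..\<beta>} z *\<^sub>R (((p z)\<^sup>2 / d * landau N (p y - p z) * p z powr (- a)) *\<^sub>R \<gamma> z))"
      unfolding set_lebesgue_integral_def
    proof (intro Bochner_Integration.integral_cong refl)
      fix z
      show "indicator {\<alpha>..\<beta>} z *\<^sub>R (((p z)\<^sup>2 / d) *\<^sub>R ?L (p z)) = indicator {\<alpha>..\<beta>} z *\<^sub>R (((p z)\<^sup>2 / d * landau N (p y - p z) * p z powr (- a)) *\<^sub>R \<gamma> z)"
        by (cases "z \<in> {\<alpha>..\<beta>}") (simp_all add: f_def Yp G_def w_def scaleR_conv_of_real)
    qed
    finally have L: "(LINT q|lborel. ?L q) = \<dots>" .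
    \<comment> \<open>Removing the weight again does not enlarge the error, since
      \<open>p y \<le> 1\<close> and \<open>a \<ge> 0\<close>.\<close>
    have pa: "p y powr a \<le> 1" using py a powr_mono2[of a "p y" 1] by simp
    have "p y powr a *\<^sub>R f (p y) = \<gamma> y"
      using py unfolding f_def Yp[OF y] G_def w_def scaleR_scaleR powr_add[symmetric] by simp
    moreover have "p y powr a *\<^sub>R (LINT q|lborel. ?L q) = (LINT y'|lborel. indicator {\<alpha>..\<beta>} y' *\<^sub>R (of_real (landau_kernel N a d t0 y' y) * \<gamma> y'))"
      unfolding L landau_kernel_def p_def[symmetric] integral_scaleR_right[symmetric]
      by (intro Bochner_Integration.integral_cong) (auto simp: scaleR_conv_of_real mult_ac)
    ultimately have "\<gamma> y - (LINT y'|lborel. indicator {\<alpha>..\<beta>} y' *\<^sub>R (of_real (landau_kernel N a d t0 y' y) * \<gamma> y')) = p y powr a *\<^sub>R (f (p y) - (LINT q|lborel. ?L q))"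
      by (simp add: scaleR_diff_right)
    also have "norm \<dots> \<le> 1 * (2 * M * real N powr (- (1 / 4)))"
      unfolding norm_scaleR using pa main by (intro mult_mono) auto
    also have "\<dots> = K * real N powr (- (1 / 4)) * D" by (simp add: M_def K_def mult_ac)
    finally show ?thesis unfolding D_def .
  qed
  then show ?thesis using K by (intro exI[of _ K]) blast
qed

section \<open>Iterated differences of bumps and the approximating kernel\<close>

lemma bdiff_has_derivative:
  assumes "\<And>t. (e has_real_derivative e' t) (at t)"
  shows "((bdiff \<delta> ^^ l) e has_real_derivative (bdiff \<delta> ^^ l) e' t) (at t)"
proof (induction l arbitrary: t)
  case 0
  then show ?case using assms by simp
next
  case (Suc l)
  let ?w = "(bdiff \<delta> ^^ l) e" and ?w' = "(bdiff \<delta> ^^ l) e'"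
  have "((\<lambda>t. ?w (t - \<delta>)) has_real_derivative ?w' (t - \<delta>) * 1) (at t)"
    by (rule DERIV_chain2[OF Suc.IH]) (auto intro!: derivative_eq_intros)
  note D = DERIV_cdivide[OF DERIV_diff[OF this Suc.IH], of \<delta>]
  have eq: "bdiff \<delta> ?w = (\<lambda>t. (?w (t - \<delta>) - ?w t) / \<delta>)" by (rule ext) (rule bdiff_def)
  show ?case using D by (simp add: eq bdiff_def[of \<delta> ?w'])
qed

lemma bdiff_le:
  assumes "\<And>t. \<bar>e t\<bar> \<le> A" "\<delta> > 0"
  shows "\<bar>(bdiff \<delta> ^^ l) e t\<bar> \<le> (2 / \<delta>) ^ l * A"
proof (induction l arbitrary: t)
  case 0
  then show ?case using assms by simp
next
  case (Suc l)
  let ?w = "(bdiff \<delta> ^^ l) e"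
  have "\<bar>bdiff \<delta> ?w t\<bar> \<le> (\<bar>?w (t - \<delta>)\<bar> + \<bar>?w t\<bar>) / \<delta>"
    unfolding bdiff_def[of \<delta> ?w] abs_divide using assms(2) by (simp add: divide_right_mono abs_triangle_ineq4)
  also have "\<dots> \<le> ((2 / \<delta>) ^ l * A + (2 / \<delta>) ^ l * A) / \<delta>"
    using Suc.IH[of t] Suc.IH[of "t - \<delta>"] assms(2) by (intro divide_right_mono add_mono) auto
  also have "\<dots> = (2 / \<delta>) ^ Suc l * A" by simp
  finally show ?case by simp
qed

lemma bdiff_support:
  assumes "\<And>t. t \<notin> {t0..t0 + \<delta>} \<Longrightarrow> e t = 0" "\<delta> > 0" "t \<notin> {t0..t0 + (real l + 1) * \<delta>}"
  shows "(bdiff \<delta> ^^ l) e t = 0"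
  using assms(3)
proof (induction l arbitrary: t)
  case 0
  then show ?case using assms(1) by simp
next
  case (Suc l)
  have "t \<notin> {t0..t0 + (real l + 1) * \<delta>}" "t - \<delta> \<notin> {t0..t0 + (real l + 1) * \<delta>}"
    using Suc.prems assms(2) by (auto simp: algebra_simps)
  then show ?case using Suc.IH by (simp add: bdiff_def)
qed

lemma smooth_bdiff:
  assumes "smooth (\<lambda>x::real^'n::finite. of_real (e (x $ i)))"
  shows "smooth (\<lambda>x::real^'n::finite. of_real ((bdiff \<delta> ^^ l) e (x $ i)))"
proof (induction l)
  case 0
  then show ?case using assms by simp
next
  case (Suc l)
  let ?w = "(bdiff \<delta> ^^ l) e"
  let ?v = "(- \<delta>) *\<^sub>R axis i 1 :: real^'n"
  have "smooth (\<lambda>x::real^'n. of_real (1 / \<delta>) * (of_real (?w ((x + ?v) $ i)) + (- 1) * of_real (?w (x $ i))))"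
    by (intro smooth_mult smooth_add smooth_const Suc smooth_translate[OF Suc])
  moreover have "complex_of_real (bdiff \<delta> ?w (x $ i)) = of_real (1 / \<delta>) * (of_real (?w ((x + ?v) $ i)) + (- 1) * of_real (?w (x $ i)))" for x
    by (simp add: bdiff_def[of \<delta> ?w] axis_def diff_divide_distrib)
  ultimately show ?case by simp
qed

lemma one_le_pochhammer: "a \<ge> 1 \<Longrightarrow> 1 \<le> pochhammer (a::real) l"
proof (induction l)
  case (Suc l)
  have "1 * 1 \<le> pochhammer a l * (a + real l)" by (intro mult_mono) (use Suc in auto)
  then show ?case by (simp add: pochhammer_Suc)
qed simp

text \<open>In the variable p the Landau kernel is a polynomial of degree 2N. Its monomial of degree
  l, times \<open>p powr a\<close>, is a multiple of the l-th derivative of the singular kernel at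
  t0, hence nearly a moment of the l-fold difference quotient of a bump. \<open>\<psi> l\<close> is
  this quotient and \<open>W l\<close> carries the coefficient, which depends on y'. The size is
  bounded for the product, in which the two always occur.\<close>

lemma exists_approximating_kernel:
  fixes i :: "'n::finite"
  assumes s: "0 < s" "s < 1" and d: "d > 0" and ab: "\<alpha> < \<beta>" and t0: "t0 = \<beta> + d" and \<rho>: "\<rho> > 0"
  shows "\<exists>K\<ge>1. \<forall>N\<ge>1. \<exists>W \<psi> \<psi>' :: nat \<Rightarrow> real \<Rightarrow> real.
    (\<forall>l. W l \<in> borel_measurable borel) \<and> (\<forall>l. \<exists>A. \<forall>y. \<bar>W l y\<bar> \<le> A) \<and> (\<forall>l y. y \<notin> {\<alpha>..\<beta>} \<longrightarrow> W l y = 0) \<and>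
    (\<forall>l. smooth (\<lambda>x::real^'n. of_real (\<psi> l (x $ i)))) \<and>
    (\<forall>l t. (\<psi> l has_real_derivative \<psi>' l t) (at t)) \<and>
    (\<forall>l\<le>2*N. \<forall>t. t \<notin> {t0..t0 + \<rho>} \<longrightarrow> \<psi> l t = 0 \<and> \<psi>' l t = 0) \<and>
    (\<forall>l\<le>2*N. \<forall>y t. \<bar>W l y\<bar> * \<bar>\<psi> l t\<bar> \<le> K ^ N\<^sup>2 \<and> \<bar>W l y\<bar> * \<bar>\<psi>' l t\<bar> \<le> K ^ N\<^sup>2) \<and>
    (\<forall>y\<in>{\<alpha>..\<beta>}. \<forall>y'\<in>{\<alpha>..\<beta>}. \<bar>(\<Sum>l\<le>2*N. W l y' * (LINT h|lborel. tail_kernel s d h * \<psi> l (y + h)))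
        - landau_kernel N (1 + 2 * s) d t0 y' y\<bar> \<le> 1 / real N)"
proof -
  define a where "a = 1 + 2 * s"
  have a: "a \<ge> 1" "a \<le> 3" using s by (auto simp: a_def)
  obtain B where B: "B \<ge> 1" and bump: "\<And>t0 \<delta>. \<delta> > 0 \<Longrightarrow> \<exists>e e'. (\<forall>t. (e has_real_derivative e' t) (at t)) \<and>
     (\<forall>t. 0 \<le> e t \<and> e t \<le> B / \<delta> \<and> \<bar>e' t\<bar> \<le> B / \<delta>\<^sup>2) \<and> (\<forall>t. t \<notin> {t0..t0 + \<delta>} \<longrightarrow> e t = 0 \<and> e' t = 0) \<and>
     (LINT t|lborel. e t) = 1 \<and> smooth (\<lambda>x::real^'n. of_real (e (x $ i)))"
    using bump_exists[where i = i] by blast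
  define p where "p = inv_coord d t0"
  define p0 where "p0 = p \<alpha>"
  have p: "p y > 0" "p y \<le> 1" "p0 \<le> p y" "(p has_real_derivative (p y)\<^sup>2 / d) (at y)" if "y \<in> {\<alpha>..\<beta>}" for y
    using inv_coord_props[OF d ab t0 that] by (simp_all add: p_def p0_def)
  have p0: "p0 > 0" using p[of \<alpha>] ab by (auto simp: p0_def)
  define w where "w y' = p y' powr (- a) * ((p y')\<^sup>2 / d)" for y'
  define K2 where "K2 = max 1 (p0 powr (- a) * (1 / d))"
  have K2: "K2 \<ge> 1" by (simp add: K2_def)
  have w_le: "\<bar>w y'\<bar> \<le> K2" if "y' \<in> {\<alpha>..\<beta>}" for y'
  proof -
    have "(p y')\<^sup>2 \<le> 1" using p[OF that] by (simp add: power_le_one)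
    then have "\<bar>w y'\<bar> \<le> p0 powr (- a) * (1 / d)"
      unfolding w_def abs_mult using p[OF that] p0 a d
      by (intro mult_mono) (auto intro!: powr_mono2' divide_right_mono)
    then show ?thesis by (simp add: K2_def)
  qed
  define D where "D = max 1 d"
  have D: "D \<ge> 1" "d \<le> D" by (auto simp: D_def)
  \<comment> \<open>\<open>\<rho> / 3\<close> keeps the shifted copies of a bump of width \<delta>,
    at most 2N + 1 widths altogether, inside the window of length \<rho>.
    \<open>d / (45 * K2)\<close> cancels the constant of the final error, where 45 is 3 times
    15.\<close>
  define \<kappa> where "\<kappa> = min 1 (min (d / (45 * K2)) (\<rho> / 3))"
  have \<kappa>: "\<kappa> > 0" "\<kappa> \<le> 1" "\<kappa> \<le> d / (45 * K2)" "\<kappa> \<le> \<rho> / 3"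
    unfolding \<kappa>_def using d K2 \<rho> by auto
  \<comment> \<open>The factors of the cost, each to be raised to the power N^2: 8 and K2 bound the
    Landau coefficients with their weight, and \<open>D ^ 5\<close> bounds
    \<open>d powr (a + l)\<close> because \<open>a + l \<le> 5 * N\<close>. Two of the four powers
    of \<open>256 / \<kappa>\<close> pay for \<open>(2 / \<delta>) ^ l\<close> with
    \<open>l \<le> 2 * N\<close>, the other two for the factor \<open>1 / \<delta>^2\<close> in the
    derivative of the bump.\<close>
  define K where "K = 8 * K2 * D ^ 5 * (256 / \<kappa>) ^ 4 * B"
  have k256: "256 / \<kappa> \<ge> 1" using \<kappa> by (simp add: field_simps)
  have K: "K \<ge> 1" unfolding K_def using K2 D B k256 by (intro mult_ge1_I one_le_power) auto
  have "\<exists>W \<psi> \<psi>' :: nat \<Rightarrow> real \<Rightarrow> real.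
    (\<forall>l. W l \<in> borel_measurable borel) \<and> (\<forall>l. \<exists>A. \<forall>y. \<bar>W l y\<bar> \<le> A) \<and> (\<forall>l y. y \<notin> {\<alpha>..\<beta>} \<longrightarrow> W l y = 0) \<and>
    (\<forall>l. smooth (\<lambda>x::real^'n. of_real (\<psi> l (x $ i)))) \<and>
    (\<forall>l t. (\<psi> l has_real_derivative \<psi>' l t) (at t)) \<and>
    (\<forall>l\<le>2*N. \<forall>t. t \<notin> {t0..t0 + \<rho>} \<longrightarrow> \<psi> l t = 0 \<and> \<psi>' l t = 0) \<and>
    (\<forall>l\<le>2*N. \<forall>y t. \<bar>W l y\<bar> * \<bar>\<psi> l t\<bar> \<le> K ^ N\<^sup>2 \<and> \<bar>W l y\<bar> * \<bar>\<psi>' l t\<bar> \<le> K ^ N\<^sup>2) \<and>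
    (\<forall>y\<in>{\<alpha>..\<beta>}. \<forall>y'\<in>{\<alpha>..\<beta>}. \<bar>(\<Sum>l\<le>2*N. W l y' * (LINT h|lborel. tail_kernel s d h * \<psi> l (y + h)))
        - landau_kernel N a d t0 y' y\<bar> \<le> 1 / real N)" if N: "N \<ge> 1" for N
  proof -
    obtain b :: "nat \<Rightarrow> real \<Rightarrow> real" where b: "\<forall>l. continuous_on UNIV (b l)"
      "\<forall>p q. (1 - (p - q)\<^sup>2) ^ N = (\<Sum>l\<le>2 * N. b l q * p ^ l)" "\<forall>l. \<forall>q\<in>{0..1}. \<bar>b l q\<bar> \<le> 4 ^ N"
      using landau_polynomial_coeffs[of N] by blast
    define J where "J = (LINT r::real|lborel. indicator {-1..1} r * (1 - r\<^sup>2) ^ N)"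
    have J: "J > 0" "1 / J \<le> 2 ^ N" unfolding J_def by (rule landau_props)+
    \<comment> \<open>The total error is a constant times \<open>N^3 * 8^N * \<delta>\<close> and
      has to be at most 1 / N. As \<open>N \<le> 2^N\<close>, one has
      \<open>N^4 * 8^N \<le> 128^N\<close>, which gives the base.\<close>
    define \<delta> where "\<delta> = \<kappa> / 128 ^ N"
    have \<delta>0: "\<delta> > 0" using \<kappa> by (simp add: \<delta>_def)
    have N2: "real N \<le> 2 ^ N" using less_exp[of N] by (metis less_imp_le of_nat_le_iff of_nat_numeral of_nat_power)
    have \<delta>1: "1 / \<delta> \<le> (256 / \<kappa>) ^ N" "2 / \<delta> \<le> (256 / \<kappa>) ^ N" "2 / \<delta> \<ge> 1"
    proof -
      have "1 / \<kappa> \<le> (1 / \<kappa>) ^ N" using N \<kappa> self_le_power[of "1 / \<kappa>" N] by simp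
      moreover have "(2::real) \<le> 2 ^ N" using N self_le_power[of 2 N] by simp
      ultimately have "(2 * 128 ^ N) * (1 / \<kappa>) \<le> (2 ^ N * 128 ^ N) * (1 / \<kappa>) ^ N"
        using \<kappa> by (intro mult_mono) auto
      also have "\<dots> = (256 / \<kappa>) ^ N" unfolding power_mult_distrib[symmetric] by simp
      finally show 2: "2 / \<delta> \<le> (256 / \<kappa>) ^ N" by (simp add: \<delta>_def)
      have "1 / \<delta> \<le> 2 / \<delta>" using \<delta>0 by (intro divide_right_mono) auto
      then show "1 / \<delta> \<le> (256 / \<kappa>) ^ N" using 2 by linarith
      have "\<delta> \<le> 1" unfolding \<delta>_def using \<kappa> by (simp add: divide_le_eq) (meson le_trans one_le_power order_trans one_le_numeral)
      then show "2 / \<delta> \<ge> 1" using \<delta>0 by (simp add: pos_le_divide_eq)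
    qed
    obtain e e' where e: "\<And>t. (e has_real_derivative e' t) (at t)" "\<And>t. 0 \<le> e t" "\<And>t. e t \<le> B / \<delta>" "\<And>t. \<bar>e' t\<bar> \<le> B / \<delta>\<^sup>2"
       "\<And>t. t \<notin> {t0..t0 + \<delta>} \<Longrightarrow> e t = 0" "\<And>t. t \<notin> {t0..t0 + \<delta>} \<Longrightarrow> e' t = 0"
       "(LINT t|lborel. e t) = 1" "smooth (\<lambda>x::real^'n. of_real (e (x $ i)))"
      using bump[OF \<delta>0, of t0] by blast
    have int_e: "integrable lborel e" using e(7) not_integrable_integral_eq by fastforce
    \<comment> \<open>The quotient by \<open>pochhammer a l\<close> and the sign undo the constant
      created by differentiating \<open>(t - y) powr (- a)\<close> l times, and
      \<open>d powr (a + l)\<close> turns powers of \<open>1 / (t0 - y)\<close> into powers of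
      p.\<close>
    define W where "W l y' = indicator {\<alpha>..\<beta>} y' * (1 / J * b l (p y') * w y' * (d powr (a + real l) * ((- 1) ^ l / pochhammer a l)))" for l y'
    define \<psi> where "\<psi> l = (bdiff \<delta> ^^ l) e" for l
    define \<psi>' where "\<psi>' l = (bdiff \<delta> ^^ l) e'" for l
    have poch: "1 \<le> pochhammer a l" for l by (rule one_le_pochhammer[OF a(1)])
    have bw: "\<bar>1 / J * b l (p y') * w y'\<bar> \<le> 8 ^ N * K2" if "y' \<in> {\<alpha>..\<beta>}" for l y'
    proof -
      have "p y' \<in> {0..1}" using p[OF that] by auto
      then have "\<bar>b l (p y')\<bar> \<le> 4 ^ N" using b(3) by blast
      then have "\<bar>1 / J\<bar> * \<bar>b l (p y')\<bar> * \<bar>w y'\<bar> \<le> 2 ^ N * 4 ^ N * K2"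
        using J w_le[OF that] by (intro mult_mono) auto
      also have "\<dots> = 8 ^ N * K2" unfolding power_mult_distrib[symmetric] by simp
      finally show ?thesis by (simp add: abs_mult)
    qed
    have W_le: "\<bar>W l y'\<bar> \<le> 8 ^ N * K2 * D ^ (5 * N)" if l: "l \<le> 2 * N" for l y'
    proof (cases "y' \<in> {\<alpha>..\<beta>}")
      case True
      have "d powr (a + real l) \<le> D powr (a + real l)" using d D a by (intro powr_mono2) auto
      also have "\<dots> \<le> D powr real (5 * N)" using D a l N by (intro powr_mono) auto
      also have "\<dots> = D ^ (5 * N)" using D by (intro powr_realpow) auto
      finally have "d powr (a + real l) \<le> D ^ (5 * N)" .
      moreover have "\<bar>(- 1) ^ l / pochhammer a l\<bar> \<le> 1" using poch[of l] by (simp add: abs_divide power_abs)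
      ultimately have "\<bar>d powr (a + real l) * ((- 1) ^ l / pochhammer a l)\<bar> \<le> D ^ (5 * N) * 1"
        unfolding abs_mult using D by (intro mult_mono) auto
      then have "\<bar>1 / J * b l (p y') * w y'\<bar> * \<bar>d powr (a + real l) * ((- 1) ^ l / pochhammer a l)\<bar> \<le> (8 ^ N * K2) * (D ^ (5 * N) * 1)"
        using K2 by (intro mult_mono bw True) auto
      then show ?thesis using True by (simp add: W_def abs_mult)
    next
      case False
      then show ?thesis using K2 D by (simp add: W_def)
    qed
    have prod_le: "\<bar>W l y'\<bar> * x \<le> K ^ N\<^sup>2" if l: "l \<le> 2 * N" and x: "0 \<le> x" "x \<le> (2 / \<delta>) ^ l * (B * (1 / \<delta>)\<^sup>2)" for l y' x
    proof -
      have NN: "N \<le> N\<^sup>2" using N by (simp add: power2_eq_square)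
      have "(2 / \<delta>) ^ l \<le> (2 / \<delta>) ^ (2 * N)" using l \<delta>1 by (intro power_increasing) auto
      also have "\<dots> \<le> ((256 / \<kappa>) ^ N) ^ (2 * N)" using \<delta>1 \<delta>0 by (intro power_mono) auto
      also have "\<dots> = (256 / \<kappa>) ^ (2 * N\<^sup>2)" by (simp add: power_mult[symmetric] power2_eq_square mult_ac)
      finally have 1: "(2 / \<delta>) ^ l \<le> (256 / \<kappa>) ^ (2 * N\<^sup>2)" .
      have "(1 / \<delta>)\<^sup>2 \<le> ((256 / \<kappa>) ^ N)\<^sup>2" using \<delta>0 by (intro power_mono \<delta>1) auto
      also have "\<dots> = (256 / \<kappa>) ^ (2 * N)" by (simp add: power_mult[symmetric] mult_ac)
      also have "\<dots> \<le> (256 / \<kappa>) ^ (2 * N\<^sup>2)" using NN k256 by (intro power_increasing) auto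
      finally have 2: "(1 / \<delta>)\<^sup>2 \<le> (256 / \<kappa>) ^ (2 * N\<^sup>2)" .
      have 3: "c ^ N \<le> c ^ N\<^sup>2" "c \<le> c ^ N\<^sup>2" if "c \<ge> 1" for c :: real
        using that NN N self_le_power[of c "N\<^sup>2"] by (auto intro!: power_increasing)
      have "\<bar>W l y'\<bar> * x \<le> (8 ^ N * K2 * D ^ (5 * N)) * ((2 / \<delta>) ^ l * (B * (1 / \<delta>)\<^sup>2))"
        using K2 D x by (intro mult_mono W_le l) auto
      also have "\<dots> \<le> (8 ^ N\<^sup>2 * K2 ^ N\<^sup>2 * (D ^ 5) ^ N\<^sup>2) * ((256 / \<kappa>) ^ (2 * N\<^sup>2) * (B ^ N\<^sup>2 * (256 / \<kappa>) ^ (2 * N\<^sup>2)))"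
      proof (intro mult_mono 1 2)
        show "(8::real) ^ N \<le> 8 ^ N\<^sup>2" by (rule 3) simp
        show "K2 \<le> K2 ^ N\<^sup>2" "B \<le> B ^ N\<^sup>2" using K2 B 3 by auto
        show "D ^ (5 * N) \<le> (D ^ 5) ^ N\<^sup>2" unfolding power_mult using 3(1)[of "D ^ 5"] D by (simp add: one_le_power)
      qed (use K2 D B \<delta>0 k256 \<kappa> in auto)
      also have "(256 / \<kappa>) ^ (2 * N\<^sup>2) * (B ^ N\<^sup>2 * (256 / \<kappa>) ^ (2 * N\<^sup>2)) = ((256 / \<kappa>) ^ 4) ^ N\<^sup>2 * B ^ N\<^sup>2"
      proof -
        have E: "(256 / \<kappa>) ^ (2 * N\<^sup>2) * (256 / \<kappa>) ^ (2 * N\<^sup>2) = ((256 / \<kappa>) ^ 4) ^ N\<^sup>2"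
          unfolding power_mult[symmetric] power_add[symmetric] by simp
        have "x * (y * x) = (x * x) * y" for x y :: real by simp
        then show ?thesis unfolding E[symmetric] .
      qed
      also have "8 ^ N\<^sup>2 * K2 ^ N\<^sup>2 * (D ^ 5) ^ N\<^sup>2 * (((256 / \<kappa>) ^ 4) ^ N\<^sup>2 * B ^ N\<^sup>2) = K ^ N\<^sup>2"
        unfolding K_def power_mult_distrib by (simp only: mult.assoc)
      finally show ?thesis .
    qed
    show ?thesis
    proof (rule exI[of _ W], rule exI[of _ \<psi>], rule exI[of _ \<psi>'], intro conjI allI impI ballI)
      have cp: "continuous_on {\<alpha>..\<beta>} p"
        by (intro continuous_at_imp_continuous_on ballI DERIV_isCont[OF p(4)])
      have [measurable]: "p \<in> borel_measurable borel" unfolding p_def inv_coord_def[abs_def] by measurable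
      show "W l \<in> borel_measurable borel" for l
      proof -
        have [measurable]: "b l \<in> borel_measurable borel" using b(1) by (intro borel_measurable_continuous_onI) auto
        show ?thesis unfolding W_def[abs_def] w_def by measurable
      qed
      show "\<exists>A. \<forall>y. \<bar>W l y\<bar> \<le> A" for l
      proof (intro exI[of _ "(8 ^ N * K2) * \<bar>d powr (a + real l) * ((- 1) ^ l / pochhammer a l)\<bar>"] allI)
        fix y
        show "\<bar>W l y\<bar> \<le> (8 ^ N * K2) * \<bar>d powr (a + real l) * ((- 1) ^ l / pochhammer a l)\<bar>"
        proof (cases "y \<in> {\<alpha>..\<beta>}")
          case True
          then show ?thesis using mult_right_mono[OF bw[OF True, of l], of "\<bar>d powr (a + real l) * ((- 1) ^ l / pochhammer a l)\<bar>"]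
            by (simp add: W_def abs_mult)
        next
          case False
          then show ?thesis using K2 by (simp add: W_def)
        qed
      qed
      show "W l y = 0" if "y \<notin> {\<alpha>..\<beta>}" for l y using that by (simp add: W_def)
      show "smooth (\<lambda>x::real^'n. of_real (\<psi> l (x $ i)))" for l unfolding \<psi>_def by (rule smooth_bdiff[OF e(8)])
      show "(\<psi> l has_real_derivative \<psi>' l t) (at t)" for l t unfolding \<psi>_def \<psi>'_def by (rule bdiff_has_derivative[OF e(1)])
      have sup: "t \<notin> {t0..t0 + (real l + 1) * \<delta>}" if "l \<le> 2 * N" "t \<notin> {t0..t0 + \<rho>}" for l t
      proof -
        have "real l + 1 \<le> 3 * real N" using that(1) N by linarith
        also have "\<dots> \<le> 3 * 2 ^ N" using N2 by simp
        also have "\<dots> \<le> 3 * 128 ^ N" by (intro mult_left_mono power_mono) auto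
        finally have "(real l + 1) * \<delta> \<le> 3 * 128 ^ N * \<delta>" using \<delta>0 by (intro mult_right_mono) auto
        also have "\<dots> = 3 * \<kappa>" by (simp add: \<delta>_def)
        also have "\<dots> \<le> \<rho>" using \<kappa> by simp
        finally show ?thesis using that(2) by auto
      qed
      show "\<psi> l t = 0" "\<psi>' l t = 0" if "l \<le> 2 * N" "t \<notin> {t0..t0 + \<rho>}" for l t
        unfolding \<psi>_def \<psi>'_def using bdiff_support[OF e(5) \<delta>0 sup[OF that]] bdiff_support[OF e(6) \<delta>0 sup[OF that]] by auto
      have \<delta>B: "B / \<delta> \<le> B * (1 / \<delta>)\<^sup>2" "B / \<delta>\<^sup>2 = B * (1 / \<delta>)\<^sup>2"
      proof -
        have "\<delta> \<le> 1" unfolding \<delta>_def using \<kappa> by (simp add: divide_le_eq) (meson le_trans one_le_power order_trans one_le_numeral)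
        then have "1 / \<delta> * 1 \<le> 1 / \<delta> * (1 / \<delta>)" using \<delta>0 by (intro mult_left_mono) auto
        then show "B / \<delta> \<le> B * (1 / \<delta>)\<^sup>2" using B mult_left_mono[of "1 / \<delta>" "1 / \<delta> * (1 / \<delta>)" B] by (simp add: power2_eq_square)
      qed (simp add: power_divide)
      show "\<bar>W l y\<bar> * \<bar>\<psi> l t\<bar> \<le> K ^ N\<^sup>2" if "l \<le> 2 * N" for l y t
      proof (rule prod_le[OF that])
        have "\<bar>e t\<bar> \<le> B * (1 / \<delta>)\<^sup>2" for t using e(2,3)[of t] \<delta>B by simp
        from bdiff_le[OF this \<delta>0] show "\<bar>\<psi> l t\<bar> \<le> (2 / \<delta>) ^ l * (B * (1 / \<delta>)\<^sup>2)" unfolding \<psi>_def .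
      qed simp
      show "\<bar>W l y\<bar> * \<bar>\<psi>' l t\<bar> \<le> K ^ N\<^sup>2" if "l \<le> 2 * N" for l y t
      proof (rule prod_le[OF that])
        have "\<bar>e' t\<bar> \<le> B * (1 / \<delta>)\<^sup>2" for t using e(4)[of t] \<delta>B by simp
        from bdiff_le[OF this \<delta>0] show "\<bar>\<psi>' l t\<bar> \<le> (2 / \<delta>) ^ l * (B * (1 / \<delta>)\<^sup>2)" unfolding \<psi>'_def .
      qed simp
      fix y y' assume y: "y \<in> {\<alpha>..\<beta>}" and y': "y' \<in> {\<alpha>..\<beta>}"
      define c where "c l = 1 / J * b l (p y') * w y'" for l
      define V where "V l = (LINT h|lborel. tail_kernel s d h * \<psi> l (y + h))" for l
      define u where "u l = (- 1) ^ l * pochhammer a l * (t0 - y) powr (- (a + real l))" for l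
      define z where "z l = d powr (a + real l) * ((- 1) ^ l / pochhammer a l)" for l
      have ty: "t0 - y > 0" "y + d \<le> t0" using y d t0 by auto
      have "p y' \<in> {0..1}" "p y \<in> {0..1}" using p[OF y] p[OF y'] by auto
      then have "p y - p y' \<in> {-1..1}" by auto
      then have "landau_kernel N a d t0 y' y = (1 - (p y - p y')\<^sup>2) ^ N / J * p y powr a * w y'"
        unfolding landau_kernel_def p_def[symmetric] landau_def J_def[symmetric] w_def by simp
      also have "\<dots> = (\<Sum>l\<le>2*N. c l * (p y powr a * p y ^ l))"
        unfolding b(2)[rule_format] c_def by (simp add: sum_distrib_left sum_distrib_right sum_divide_distrib mult_ac)
      also have "\<dots> = (\<Sum>l\<le>2*N. c l * (z l * u l))"
      proof (intro sum.cong refl)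
        fix l
        have "p y powr a * p y ^ l = p y powr (a + real l)"
          using p[OF y] by (simp add: powr_add powr_realpow)
        also have "\<dots> = d powr (a + real l) * (t0 - y) powr (- (a + real l))"
          unfolding p_def inv_coord_def powr_minus_divide using d ty by (simp add: powr_divide)
        also have "\<dots> = z l * u l"
        proof -
          have "((- 1) ^ l / pochhammer a l) * ((- 1) ^ l * pochhammer a l) = 1"
            using poch[of l] by (simp add: power_mult_distrib[symmetric] flip: power_add)
          moreover have "z l * u l = d powr (a + real l) * (t0 - y) powr (- (a + real l)) * (((- 1) ^ l / pochhammer a l) * ((- 1) ^ l * pochhammer a l))"
            unfolding z_def u_def by (simp only: mult_ac)
          ultimately show ?thesis by simp
        qed
        finally show "c l * (p y powr a * p y ^ l) = c l * (z l * u l)" by simp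
      qed
      finally have LK: "landau_kernel N a d t0 y' y = (\<Sum>l\<le>2*N. c l * (z l * u l))" .
      have "(\<Sum>l\<le>2*N. W l y' * V l) - landau_kernel N a d t0 y' y = (\<Sum>l\<le>2*N. c l * (z l * (V l - u l)))"
      proof -
        have "W l y' = c l * z l" for l using y' by (simp add: W_def c_def z_def)
        then show ?thesis unfolding LK sum_subtractf[symmetric] by (simp add: right_diff_distrib mult.assoc)
      qed
      \<comment> \<open>The quotient of the Pochhammer symbols of orders l + 1 and l is
        \<open>a + l \<le> 5 * N\<close>; together with \<open>l + 1 \<le> 3 * N\<close> this
        produces the constant 15 and the square of N.\<close>
      also have "\<bar>\<dots>\<bar> \<le> (\<Sum>l\<le>2*N. (8 ^ N * K2) * (15 * (real N)\<^sup>2 * \<delta> / d))"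
      proof (rule order_trans[OF sum_abs], rule sum_mono)
        fix l assume "l \<in> {..2 * N}"
        then have l: "l \<le> 2 * N" by simp
        have "\<bar>V l - u l\<bar> \<le> (real l + 1) * \<delta> * (pochhammer a (Suc l) * d powr (- (a + real (Suc l))))"
          unfolding V_def u_def \<psi>_def a_def
          by (rule tail_kernel_moment[OF s(1) d \<delta>0 ty(2) e(2) int_e e(7) e(5)])
        then have "\<bar>z l * (V l - u l)\<bar> \<le> \<bar>z l\<bar> * ((real l + 1) * \<delta> * (pochhammer a (Suc l) * d powr (- (a + real (Suc l)))))"
          unfolding abs_mult by (intro mult_left_mono) auto
        also have "\<bar>z l\<bar> = d powr (a + real l) / pochhammer a l"
          unfolding z_def abs_mult using poch[of l] by (simp add: abs_divide power_abs)
        also have "d powr (a + real l) / pochhammer a l * ((real l + 1) * \<delta> * (pochhammer a (Suc l) * d powr (- (a + real (Suc l)))))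
            = (real l + 1) * (a + real l) * \<delta> * (d powr (a + real l) * d powr (- (a + real (Suc l))))"
          using poch[of l] by (simp add: pochhammer_Suc del: of_nat_Suc)
        also have "d powr (a + real l) * d powr (- (a + real (Suc l))) = 1 / d"
          unfolding powr_add[symmetric] using d by (simp add: powr_minus_divide)
        also have "(real l + 1) * (a + real l) * \<delta> * (1 / d) \<le> (3 * real N) * (5 * real N) * \<delta> * (1 / d)"
          using l N a d \<delta>0 by (intro mult_right_mono mult_mono) auto
        also have "\<dots> = 15 * (real N)\<^sup>2 * \<delta> / d" by (simp add: power2_eq_square)
        finally have "\<bar>z l * (V l - u l)\<bar> \<le> 15 * (real N)\<^sup>2 * \<delta> / d" .
        then show "\<bar>c l * (z l * (V l - u l))\<bar> \<le> (8 ^ N * K2) * (15 * (real N)\<^sup>2 * \<delta> / d)"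
          unfolding abs_mult[of "c l"] using bw[OF y', of l] K2 unfolding c_def by (intro mult_mono) auto
      qed
      also have "\<dots> = (real (2 * N) + 1) * ((8 ^ N * K2) * (15 * (real N)\<^sup>2 * \<delta> / d))" by simp
      also have "\<dots> \<le> (3 * real N) * ((8 ^ N * K2) * (15 * (real N)\<^sup>2 * \<delta> / d))"
        using N K2 \<delta>0 d by (intro mult_right_mono) auto
      also have "\<dots> = (45 * K2 / d) * ((real N) ^ 3 * 8 ^ N * \<delta>)" by (simp add: power2_eq_square power3_eq_cube)
      also have "\<dots> \<le> 1 / real N"
      proof -
        have "(real N) ^ 4 \<le> (2 ^ N) ^ 4" by (intro power_mono N2) auto
        also have "\<dots> = (16::real) ^ N" by (simp add: power_mult[symmetric] mult.commute[of N 4]) (simp add: power_mult)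
        finally have "(real N) ^ 4 * 8 ^ N \<le> 16 ^ N * 8 ^ N" by (intro mult_right_mono) auto
        also have "\<dots> = 128 ^ N" unfolding power_mult_distrib[symmetric] by simp
        finally have "(real N) ^ 4 * 8 ^ N * \<delta> \<le> 128 ^ N * \<delta>" using \<delta>0 by (intro mult_right_mono) auto
        also have "\<dots> = \<kappa>" by (simp add: \<delta>_def)
        also have "\<dots> \<le> d / (45 * K2)" by (rule \<kappa>)
        finally have "(45 * K2 / d) * ((real N) ^ 4 * 8 ^ N * \<delta>) \<le> (45 * K2 / d) * (d / (45 * K2))"
          using K2 d by (intro mult_left_mono) auto
        also have "\<dots> = 1" using K2 d by simp
        finally have "((45 * K2 / d) * ((real N) ^ 3 * 8 ^ N * \<delta>)) * real N \<le> 1" by (simp add: power_numeral_reduce mult_ac)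
        then show ?thesis using N by (simp add: pos_le_divide_eq)
      qed
      finally show "\<bar>(\<Sum>l\<le>2*N. W l y' * (LINT h|lborel. tail_kernel s d h * \<psi> l (y + h))) - landau_kernel N a d t0 y' y\<bar> \<le> 1 / real N"
        unfolding V_def .
    qed
  qed
  then show ?thesis using K unfolding a_def by blast
qed

section \<open>Superpositions along the fibres\<close>

definition slice :: "real^'n::{finite,linorder} \<Rightarrow> real \<Rightarrow> real^'n::{finite,linorder}" where
  "slice x y = x + (y - x $ last_ix) *\<^sub>R axis last_ix 1"

lemma slice_simps [simp]:
  "slice x y $ last_ix = y" "slice x (x $ last_ix) = x" "slice (x + h *\<^sub>R axis last_ix 1) y = slice x y"
  by (simp_all add: slice_def algebra_simps)

lemma borel_measurable_slice [measurable (raw)]: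
  fixes f :: "'a \<Rightarrow> real^'n::{finite,linorder}"
  assumes [measurable]: "f \<in> borel_measurable M" "g \<in> borel_measurable M"
  shows "(\<lambda>x. slice (f x) (g x)) \<in> borel_measurable M"
  unfolding slice_def by measurable

lemma continuous_on_slice: "continuous_on S (slice x)"
  unfolding slice_def by (intro continuous_intros)

definition weighted_fibre :: "(real \<Rightarrow> real) \<Rightarrow> (real^'n::{finite,linorder} \<Rightarrow> complex) \<Rightarrow> real^'n::{finite,linorder} \<Rightarrow> complex" where
  "weighted_fibre W G x = (LINT y|lborel. of_real (W y) * G (slice x y))"

definition fibre_sq :: "real \<Rightarrow> real \<Rightarrow> (real^'n::{finite,linorder} \<Rightarrow> complex) \<Rightarrow> real^'n::{finite,linorder} \<Rightarrow> real" where
  "fibre_sq \<alpha> \<beta> G x = (LINT y|lborel. indicator {\<alpha>..\<beta>} y * (norm (G (slice x y)))\<^sup>2)"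

definition admissible_weight :: "real \<Rightarrow> real \<Rightarrow> (real \<Rightarrow> real) \<Rightarrow> bool" where
  "admissible_weight \<alpha> \<beta> W \<longleftrightarrow> W \<in> borel_measurable borel \<and> (\<exists>A. \<forall>y. \<bar>W y\<bar> \<le> A) \<and> (\<forall>y. y \<notin> {\<alpha>..\<beta>} \<longrightarrow> W y = 0)"

lemma integrable_indicator_Icc: "integrable lborel (indicator {\<alpha>..\<beta>::real} :: real \<Rightarrow> real)"
  using borel_integrable_compact[of "{\<alpha>..\<beta>}" "\<lambda>_. 1 :: real"] by simp

lemma admissible_weight_integrable:
  assumes W: "admissible_weight \<alpha> \<beta> W" and u: "u \<in> borel_measurable borel" "\<And>y. norm (u y :: complex) \<le> A"
  shows "integrable lborel (\<lambda>y. of_real (W y) * u y)"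
proof -
  obtain C where C: "\<And>y. \<bar>W y\<bar> \<le> C" using W by (auto simp: admissible_weight_def)
  have [measurable]: "W \<in> borel_measurable borel" "u \<in> borel_measurable borel" using W u by (auto simp: admissible_weight_def)
  have A0: "A \<ge> 0" using u(2)[of 0] norm_ge_zero order_trans by blast
  show ?thesis
  proof (rule Bochner_Integration.integrable_bound)
    show "integrable lborel (\<lambda>y. (C * A) * indicator {\<alpha>..\<beta>} y)" by (intro integrable_mult_right integrable_indicator_Icc)
    have "norm (of_real (W y) * u y) \<le> norm ((C * A) * indicator {\<alpha>..\<beta>} y)" for y
    proof (cases "y \<in> {\<alpha>..\<beta>}")
      case True
      have "\<bar>W y\<bar> * norm (u y) \<le> C * A" using C[of y] by (intro mult_mono C u) auto
      then show ?thesis using True by (simp add: norm_mult)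
    next
      case False
      then show ?thesis using W by (simp add: admissible_weight_def)
    qed
    then show "AE y in lborel. norm (of_real (W y) * u y) \<le> norm ((C * A) * indicator {\<alpha>..\<beta>} y)" by simp
  qed measurable
qed

text \<open>The integral over a whole fibre does not depend on the last coordinate, so the
  derivative in that direction is 0, while the tangential ones fall on G. No derivative ever reaches
  W, which is only bounded and measurable.\<close>

lemma smooth_weighted_fibre:
  fixes G :: "real^'n::{finite,linorder} \<Rightarrow> complex"
  assumes W: "admissible_weight \<alpha> \<beta> W" and G: "schwartz G"
  shows "smooth (weighted_fibre W G)"
    and "partial_deriv i (weighted_fibre W G) = weighted_fibre W (if i = last_ix then (\<lambda>x. 0) else partial_deriv i G)"
proof -
  have D: "(weighted_fibre W G has_derivative (\<lambda>h. \<Sum>i\<in>UNIV. h $ i *\<^sub>R weighted_fibre W (if i = last_ix then (\<lambda>x. 0) else partial_deriv i G) x)) (at x)"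
    if G: "schwartz G" for G :: "(real, 'n) vec \<Rightarrow> complex" and x
  proof -
    have int: "integrable lborel (\<lambda>y. of_real (W y) * F (slice z y))" if F: "schwartz F" for F and z :: "(real, 'n) vec"
    proof -
      obtain A where "\<And>x. norm (F x) \<le> A" using schwartz_decay[OF F, of 0] by auto
      then show ?thesis using schwartz_borel[OF F] by (intro admissible_weight_integrable[OF W]) auto
    qed
    have zero: "schwartz (\<lambda>x::(real, 'n) vec. 0)" using schwartz_cmult[OF G, of 0] by simp
    obtain B where B: "B \<ge> 0" "\<And>x h. norm h \<le> 1 \<Longrightarrow>
      norm (G (x + h) - G x - (\<Sum>i\<in>UNIV. h $ i *\<^sub>R partial_deriv i G x)) \<le> (norm h)\<^sup>2 * (B / (1 + norm x) ^ 0)"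
      using schwartz_taylor[OF G, of 0] by blast
    show ?thesis
      unfolding weighted_fibre_def
    proof (rule has_derivative_LINT[where B = "\<lambda>y. \<bar>W y\<bar> * B"])
      show "integrable lborel (\<lambda>y. of_real (W y) * G (slice z y))" for z by (rule int[OF G])
      show "integrable lborel (\<lambda>y. of_real (W y) * (if i = last_ix then (\<lambda>x. 0) else partial_deriv i G) (slice x y))" for i
        by (rule int) (use zero G in \<open>auto intro: schwartz_partial\<close>)
      have "integrable lborel (\<lambda>y. of_real (W y) * (1 :: complex))" by (rule admissible_weight_integrable[OF W]) auto
      then have "integrable lborel (\<lambda>y. norm (of_real (W y) * (1 :: complex)))" by (rule integrable_norm)
      then show "integrable lborel (\<lambda>y. \<bar>W y\<bar> * B)" by simp
      fix h :: "(real, 'n) vec" and y assume h: "norm h \<le> 1"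
      \<comment> \<open>The increment h moves a slice by its tangential part k alone, and
        \<open>norm k \<le> norm h\<close>, so the Taylor estimate for G applies along k.\<close>
      define k where "k = h - h $ last_ix *\<^sub>R axis last_ix 1"
      have k_nth: "k $ i = (if i = last_ix then 0 else h $ i)" for i by (auto simp: k_def axis_def)
      have "norm k \<le> norm h"
        unfolding norm_vec_def by (intro L2_set_mono) (auto simp: k_nth)
      then have k: "norm k \<le> norm h" "norm k \<le> 1" using h by auto
      have sl: "slice (x + h) y = slice x y + k" by (simp add: slice_def k_def algebra_simps)
      have "(\<Sum>i\<in>UNIV. h $ i *\<^sub>R (of_real (W y) * (if i = last_ix then (\<lambda>x. 0) else partial_deriv i G) (slice x y))) =
          of_real (W y) * (\<Sum>i\<in>UNIV. k $ i *\<^sub>R partial_deriv i G (slice x y))"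
        unfolding sum_distrib_left by (intro sum.cong) (auto simp: k_nth)
      then have "of_real (W y) * G (slice (x + h) y) - of_real (W y) * G (slice x y) - (\<Sum>i\<in>UNIV. h $ i *\<^sub>R (of_real (W y) * (if i = last_ix then (\<lambda>x. 0) else partial_deriv i G) (slice x y)))
          = of_real (W y) * (G (slice x y + k) - G (slice x y) - (\<Sum>i\<in>UNIV. k $ i *\<^sub>R partial_deriv i G (slice x y)))"
        unfolding sl by (simp add: right_diff_distrib)
      also have "norm \<dots> \<le> \<bar>W y\<bar> * ((norm k)\<^sup>2 * B)"
        unfolding norm_mult using B(2)[OF k(2), of "slice x y"] by (simp add: mult_left_mono)
      also have "\<dots> \<le> \<bar>W y\<bar> * ((norm h)\<^sup>2 * B)"
        using k B(1) by (intro mult_left_mono mult_right_mono power_mono) auto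
      finally show "norm (of_real (W y) * G (slice (x + h) y) - of_real (W y) * G (slice x y) - (\<Sum>i\<in>UNIV. h $ i *\<^sub>R (of_real (W y) * (if i = last_ix then (\<lambda>x. 0) else partial_deriv i G) (slice x y)))) \<le> (norm h)\<^sup>2 * (\<bar>W y\<bar> * B)"
        by (simp add: mult_ac)
    qed
  qed
  have P: "partial_deriv i (weighted_fibre W G) = weighted_fibre W (if i = last_ix then (\<lambda>x. 0) else partial_deriv i G)"
    if "schwartz G" for G :: "(real, 'n) vec \<Rightarrow> complex" and i
    using partial_deriv_eq[OF D[OF that]] by (auto simp: sum_axis_scaleR)
  show "partial_deriv i (weighted_fibre W G) = weighted_fibre W (if i = last_ix then (\<lambda>x. 0) else partial_deriv i G)"
    by (rule P[OF G])
  show "smooth (weighted_fibre W G)"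
  proof (rule smooth_coinduct[of _ "{weighted_fibre W G | G. schwartz G}"])
    fix f :: "(real, 'n) vec \<Rightarrow> complex" and i
    assume "f \<in> {weighted_fibre W G | G. schwartz G}"
    then obtain F where F: "f = weighted_fibre W F" "schwartz F" by blast
    show "f differentiable (at x)" for x unfolding F(1) by (rule differentiableI[OF D[OF F(2)]])
    have "schwartz (if i = last_ix then (\<lambda>x. 0) else partial_deriv i F)"
      using schwartz_cmult[OF F(2), of 0] schwartz_partial[OF F(2)] by simp
    then show "partial_deriv i f \<in> {weighted_fibre W G | G. schwartz G}" unfolding F(1) P[OF F(2)] by blast
  qed (use G in blast)
qed

lemma weighted_fibre_zero: "weighted_fibre W (\<lambda>x. 0) x = 0"
  by (simp add: weighted_fibre_def)

lemma integrable_fibre: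
  fixes u :: "real \<Rightarrow> real"
  assumes "continuous_on {\<alpha>..\<beta>} u"
  shows "integrable lborel (\<lambda>y. indicator {\<alpha>..\<beta>} y * u y)"
  using borel_integrable_compact[of "{\<alpha>..\<beta>}" u] assms by simp

lemma fibre_continuous:
  assumes "schwartz G" shows "continuous_on S (\<lambda>y. G (slice x y))"
  by (rule continuous_on_compose2[OF smooth_continuous_on[OF schwartz_smooth[OF assms], of UNIV] continuous_on_slice]) auto

lemma fibre_sq_nonneg: "fibre_sq \<alpha> \<beta> G x \<ge> 0"
  by (simp add: fibre_sq_def)

lemma borel_measurable_fibre_sq:
  assumes "schwartz G" shows "fibre_sq \<alpha> \<beta> G \<in> borel_measurable borel"
proof -
  have [measurable]: "G \<in> borel_measurable borel" using assms by (rule schwartz_borel)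
  show ?thesis unfolding fibre_sq_def[abs_def] by measurable
qed

text \<open>Writing y as the last coordinate plus h turns the fibre integral into one over
  translates of G, and h ranges over an interval of length
  \<open>\<beta> - \<alpha> + (d - c)\<close> while the last coordinate is in [c, d]. Tonelli and
  translation invariance then give the bound without decomposing the space as a product.\<close>

lemma fibre_sq_integral:
  fixes G :: "real^'n::{finite,linorder} \<Rightarrow> complex"
  assumes G: "schwartz G" and "\<alpha> \<le> \<beta>" "c \<le> d"
  shows "integrable lborel (\<lambda>x. indicator {c..d} (x $ last_ix) * fibre_sq \<alpha> \<beta> G x)"
    and "(LINT x|lborel. indicator {c..d} (x $ last_ix) * fibre_sq \<alpha> \<beta> G x) \<le> (\<beta> - \<alpha> + (d - c)) * L2sq G"
proof -
  let ?e = "axis last_ix 1 :: (real, 'n) vec"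
  let ?L = "\<beta> - \<alpha> + (d - c)"
  have L: "?L \<ge> 0" using assms by simp
  have [measurable]: "G \<in> borel_measurable borel" using G by (rule schwartz_borel)
  have [measurable]: "fibre_sq \<alpha> \<beta> G \<in> borel_measurable borel" by (rule borel_measurable_fibre_sq[OF G])
  have "(\<integral>\<^sup>+x. ennreal (indicator {c..d} (x $ last_ix) * fibre_sq \<alpha> \<beta> G x) \<partial>lborel)
      \<le> (\<integral>\<^sup>+x. (\<integral>\<^sup>+h. ennreal (indicator {\<alpha> - d..\<beta> - c} h * (norm (G (x + h *\<^sub>R ?e)))\<^sup>2) \<partial>lborel) \<partial>lborel)"
  proof (rule nn_integral_mono)
    fix x :: "(real, 'n) vec"
    have i: "integrable lborel (\<lambda>y. indicator {\<alpha>..\<beta>} y * (norm (G (slice x y)))\<^sup>2)"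
      by (intro integrable_fibre continuous_intros fibre_continuous G)
    have "ennreal (indicator {c..d} (x $ last_ix) * fibre_sq \<alpha> \<beta> G x) =
       (\<integral>\<^sup>+y. ennreal (indicator {c..d} (x $ last_ix) * (indicator {\<alpha>..\<beta>} y * (norm (G (slice x y)))\<^sup>2)) \<partial>lborel)"
      unfolding fibre_sq_def integral_mult_right_zero[symmetric]
      by (rule nn_integral_eq_integral[symmetric]) (use i in auto)
    also have "\<dots> = (\<integral>\<^sup>+h. ennreal (indicator {c..d} (x $ last_ix) * (indicator {\<alpha>..\<beta>} (x $ last_ix + 1 * h) * (norm (G (slice x (x $ last_ix + 1 * h))))\<^sup>2)) \<partial>lborel)"
      by (subst nn_integral_real_affine[where c = 1 and t = "x $ last_ix"]) auto
    also have "\<dots> \<le> (\<integral>\<^sup>+h. ennreal (indicator {\<alpha> - d..\<beta> - c} h * (norm (G (x + h *\<^sub>R ?e)))\<^sup>2) \<partial>lborel)"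
      by (intro nn_integral_mono ennreal_leI) (auto simp: indicator_def slice_def)
    finally show "ennreal (indicator {c..d} (x $ last_ix) * fibre_sq \<alpha> \<beta> G x) \<le> \<dots>" .
  qed
  also have "\<dots> = (\<integral>\<^sup>+h. (\<integral>\<^sup>+x. ennreal (indicator {\<alpha> - d..\<beta> - c} h * (norm (G (x + h *\<^sub>R ?e)))\<^sup>2) \<partial>lborel) \<partial>lborel)"
    by (rule lborel_pair.Fubini'[symmetric]) measurable
  also have "\<dots> = (\<integral>\<^sup>+h. ennreal (indicator {\<alpha> - d..\<beta> - c} h) * ennreal (L2sq G) \<partial>lborel)"
  proof (rule nn_integral_cong)
    fix h :: real
    have "(\<integral>\<^sup>+x. ennreal ((norm (G x))\<^sup>2) \<partial>lborel) = (\<integral>\<^sup>+x. ennreal ((norm (G (h *\<^sub>R ?e + 1 *\<^sub>R x)))\<^sup>2) \<partial>lborel)"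
      by (subst nn_integral_lborel_affine[where c = 1 and t = "h *\<^sub>R ?e"]) auto
    moreover have "(\<integral>\<^sup>+x. ennreal ((norm (G x))\<^sup>2) \<partial>lborel) = ennreal (L2sq G)"
      unfolding L2sq_def by (rule nn_integral_eq_integral) (use schwartz_square_integrable[OF G] in auto)
    ultimately have "(\<integral>\<^sup>+x. ennreal ((norm (G (x + h *\<^sub>R ?e)))\<^sup>2) \<partial>lborel) = ennreal (L2sq G)"
      by (simp add: add.commute)
    then show "(\<integral>\<^sup>+x. ennreal (indicator {\<alpha> - d..\<beta> - c} h * (norm (G (x + h *\<^sub>R ?e)))\<^sup>2) \<partial>lborel) = ennreal (indicator {\<alpha> - d..\<beta> - c} h) * ennreal (L2sq G)"
      by (simp add: ennreal_mult' nn_integral_cmult)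
  qed
  also have "\<dots> = ennreal (L2sq G) * emeasure lborel {\<alpha> - d..\<beta> - c}"
    by (simp add: mult.commute[of _ "ennreal (L2sq G)"] nn_integral_cmult ennreal_indicator)
  also have "\<dots> = ennreal (?L * L2sq G)"
    using assms by (simp add: ennreal_mult'[symmetric] L2sq_nonneg mult.commute algebra_simps)
  finally have le: "(\<integral>\<^sup>+x. ennreal (indicator {c..d} (x $ last_ix) * fibre_sq \<alpha> \<beta> G x) \<partial>lborel) \<le> ennreal (?L * L2sq G)" .
  have nn: "0 \<le> indicator {c..d} (x $ last_ix) * fibre_sq \<alpha> \<beta> G x" for x :: "(real, 'n) vec" by (simp add: fibre_sq_nonneg)
  show int: "integrable lborel (\<lambda>x. indicator {c..d} (x $ last_ix) * fibre_sq \<alpha> \<beta> G x)"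
  proof (rule integrableI_nonneg)
    show "(\<integral>\<^sup>+x. ennreal (indicator {c..d} (x $ last_ix) * fibre_sq \<alpha> \<beta> G x) \<partial>lborel) < \<infinity>"
      using le by (rule order_le_less_trans) simp
  qed (use nn in auto)
  then have "ennreal (LINT x|lborel. indicator {c..d} (x $ last_ix) * fibre_sq \<alpha> \<beta> G x) \<le> ennreal (?L * L2sq G)"
    using le nn by (subst nn_integral_eq_integral[symmetric]) auto
  then show "(LINT x|lborel. indicator {c..d} (x $ last_ix) * fibre_sq \<alpha> \<beta> G x) \<le> ?L * L2sq G"
    using L L2sq_nonneg[of G] by (simp add: ennreal_le_iff)
qed

lemma weighted_fibre_le:
  fixes G :: "real^'n::{finite,linorder} \<Rightarrow> complex"
  assumes G: "schwartz G" and ab: "\<alpha> \<le> \<beta>" and w: "w \<ge> 0"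
    and W: "\<And>y. norm (W y :: complex) \<le> w * indicator {\<alpha>..\<beta>} y" and Wm: "W \<in> borel_measurable borel"
  shows "norm (LINT y|lborel. W y * G (slice x y)) \<le> w * (sqrt (\<beta> - \<alpha>) * sqrt (fibre_sq \<alpha> \<beta> G x))"
proof -
  have [measurable]: "G \<in> borel_measurable borel" "W \<in> borel_measurable borel" using G Wm by (auto intro: schwartz_borel)
  have c: "continuous_on S (\<lambda>y. norm (G (slice x y)))" for S by (intro continuous_intros fibre_continuous G)
  let ?I = "\<lambda>y. indicator {\<alpha>..\<beta>} y * norm (G (slice x y))"
  have i: "integrable lborel (\<lambda>y. w * ?I y)" by (intro integrable_mult_right integrable_fibre c)
  have le: "norm (W y * G (slice x y)) \<le> w * ?I y" for y
    using mult_right_mono[OF W[of y], of "norm (G (slice x y))"] by (simp add: norm_mult mult.assoc)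
  have "norm (LINT y|lborel. W y * G (slice x y)) \<le> (LINT y|lborel. w * ?I y)"
  proof (rule norm_LINT_le[OF _ i le])
    show "integrable lborel (\<lambda>y. W y * G (slice x y))"
    proof (rule Bochner_Integration.integrable_bound[OF i])
      have "norm (w * ?I y) = w * ?I y" for y using w by simp
      then show "AE y in lborel. norm (W y * G (slice x y)) \<le> norm (w * ?I y)" using le by simp
    qed measurable
  qed
  also have "\<dots> = w * (LINT y|lborel. indicator {\<alpha>..\<beta>} y * ?I y)"
  proof -
    have "?I y = indicator {\<alpha>..\<beta>} y * ?I y" for y by (simp add: indicator_def)
    then show ?thesis unfolding integral_mult_right_zero by (simp only:)
  qed
  also have "(LINT y|lborel. indicator {\<alpha>..\<beta>} y * ?I y) \<le> sqrt (\<beta> - \<alpha>) * sqrt (fibre_sq \<alpha> \<beta> G x)"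
  proof -
    have e1: "(indicator {\<alpha>..\<beta>} y :: real)\<^sup>2 = indicator {\<alpha>..\<beta>} y" for y by (simp add: indicator_def)
    have e2: "(?I y)\<^sup>2 = indicator {\<alpha>..\<beta>} y * (norm (G (slice x y)))\<^sup>2" for y by (simp add: indicator_def)
    have "\<bar>LINT y|lborel. indicator {\<alpha>..\<beta>} y * ?I y\<bar> \<le> sqrt (LINT y|lborel. (indicator {\<alpha>..\<beta>} y)\<^sup>2) * sqrt (LINT y|lborel. (?I y)\<^sup>2)"
      by (rule LINT_Cauchy_Schwarz(2)) (unfold e1 e2, auto intro!: integrable_indicator_Icc integrable_fibre continuous_intros fibre_continuous G)
    then show ?thesis unfolding e1 e2 using ab by (simp add: fibre_sq_def)
  qed
  finally show ?thesis using w by (simp add: mult_left_mono)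
qed

text \<open>Cauchy-Schwarz on the fibre bounds each of the M + 1 summands by E times the fibre norm
  of G, and the profiles confine the last coordinate to [c, d]. With G and the profiles left free,
  one bound serves the dual function, its tangential derivatives (G differentiated) and its normal
  derivative (profiles differentiated).\<close>

lemma superposition_L2sq_le:
  fixes G :: "real^'n::{finite,linorder} \<Rightarrow> complex"
  assumes G: "schwartz G" and ab: "\<alpha> \<le> \<beta>" "c \<le> d" and W: "\<And>l. admissible_weight \<alpha> \<beta> (W l)"
    and \<psi>0: "\<And>l t. l \<le> M \<Longrightarrow> t \<notin> {c..d} \<Longrightarrow> \<psi> l t = 0" and E: "\<And>l y t. l \<le> M \<Longrightarrow> \<bar>W l y\<bar> * \<bar>\<psi> l t\<bar> \<le> E"
    and meas: "(\<lambda>x. \<Sum>l\<le>M. weighted_fibre (W l) G x * of_real (\<psi> l (x $ last_ix))) \<in> borel_measurable borel"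
  shows "L2sq (\<lambda>x. \<Sum>l\<le>M. weighted_fibre (W l) G x * of_real (\<psi> l (x $ last_ix)))
    \<le> ((real M + 1) * E)\<^sup>2 * ((\<beta> - \<alpha>) * (\<beta> - \<alpha> + (d - c))) * L2sq G"
proof -
  let ?\<Psi> = "\<lambda>x. \<Sum>l\<le>M. weighted_fibre (W l) G x * of_real (\<psi> l (x $ last_ix))"
  define C where "C = ((real M + 1) * E)\<^sup>2 * (\<beta> - \<alpha>)"
  have E0: "E \<ge> 0" using E[of 0 0 0] by (meson abs_ge_zero mult_nonneg_nonneg order_trans zero_le)
  have pt: "(norm (?\<Psi> x))\<^sup>2 \<le> C * (indicator {c..d} (x $ last_ix) * fibre_sq \<alpha> \<beta> G x)" for x
  proof (cases "x $ last_ix \<in> {c..d}")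
    case True
    have "norm (weighted_fibre (W l) G x * of_real (\<psi> l (x $ last_ix))) \<le> E * (sqrt (\<beta> - \<alpha>) * sqrt (fibre_sq \<alpha> \<beta> G x))" if l: "l \<le> M" for l
    proof -
      have [measurable]: "W l \<in> borel_measurable borel" using W by (simp add: admissible_weight_def)
      have "weighted_fibre (W l) G x * of_real (\<psi> l (x $ last_ix)) = (LINT y|lborel. of_real (W l y * \<psi> l (x $ last_ix)) * G (slice x y))"
        unfolding weighted_fibre_def integral_mult_left_zero[symmetric] by (simp add: mult_ac)
      also have "norm \<dots> \<le> E * (sqrt (\<beta> - \<alpha>) * sqrt (fibre_sq \<alpha> \<beta> G x))"
      proof (rule weighted_fibre_le[OF G ab(1) E0])
        show "norm (complex_of_real (W l y * \<psi> l (x $ last_ix))) \<le> E * indicator {\<alpha>..\<beta>} y" for y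
          using E[OF l, of y "x $ last_ix"] W[of l] by (cases "y \<in> {\<alpha>..\<beta>}") (auto simp: norm_mult admissible_weight_def)
      qed measurable
      finally show ?thesis .
    qed
    then have "norm (?\<Psi> x) \<le> (\<Sum>l\<le>M. E * (sqrt (\<beta> - \<alpha>) * sqrt (fibre_sq \<alpha> \<beta> G x)))" by (intro sum_norm_le) auto
    also have "\<dots> = (real M + 1) * E * (sqrt (\<beta> - \<alpha>) * sqrt (fibre_sq \<alpha> \<beta> G x))" by simp
    finally have "(norm (?\<Psi> x))\<^sup>2 \<le> ((real M + 1) * E * (sqrt (\<beta> - \<alpha>) * sqrt (fibre_sq \<alpha> \<beta> G x)))\<^sup>2" by (intro power_mono) auto
    also have "\<dots> = C * fibre_sq \<alpha> \<beta> G x"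
      using ab fibre_sq_nonneg[of \<alpha> \<beta> G x] by (simp add: power_mult_distrib C_def)
    finally show ?thesis using True by simp
  next
    case False
    then have "?\<Psi> x = 0" using \<psi>0 by (intro sum.neutral) auto
    then show ?thesis using False by simp
  qed
  have C0: "C \<ge> 0" unfolding C_def using ab by simp
  have i: "integrable lborel (\<lambda>x. C * (indicator {c..d} (x $ last_ix) * fibre_sq \<alpha> \<beta> G x))"
    by (intro integrable_mult_right fibre_sq_integral(1)[OF G ab])
  have "L2sq ?\<Psi> \<le> (LINT x|lborel. C * (indicator {c..d} (x $ last_ix) * fibre_sq \<alpha> \<beta> G x))"
    unfolding L2sq_def
  proof (rule integral_mono[OF _ i pt])
    show "integrable lborel (\<lambda>x. (norm (?\<Psi> x))\<^sup>2)"
      by (rule Bochner_Integration.integrable_bound[OF i]) (use pt meas C0 in \<open>auto simp: fibre_sq_nonneg\<close>)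
  qed
  also have "\<dots> = C * (LINT x|lborel. (indicator {c..d} (x $ last_ix) * fibre_sq \<alpha> \<beta> G x))" by simp
  also have "\<dots> \<le> C * ((\<beta> - \<alpha> + (d - c)) * L2sq G)"
    by (intro mult_left_mono fibre_sq_integral(2)[OF G ab] C0)
  finally show ?thesis by (simp add: C_def mult_ac)
qed

section \<open>Supports in cylinders and the error on a fibre\<close>

lemma xprime_eq: "xprime x = x - (x $ last_ix) *\<^sub>R axis last_ix 1"
  by (simp add: xprime_def vec_eq_iff axis_def)

lemma xprime_slice [simp]: "xprime (slice x y) = xprime x"
  by (simp add: xprime_eq slice_def algebra_simps)

text \<open>The support of g is compact in the cylinder over Q, so its tangential projection is a
  compact subset of Q. The product of this projection with [c, d] is compact, lies in
  \<open>cylinder Q J\<close>, and carries \<Psi>.\<close>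

lemma test_fun_cylinderI:
  fixes g \<Psi> :: "real^'n::{finite,linorder} \<Rightarrow> complex"
  assumes g: "test_fun (cylinder Q I) g" and \<Psi>: "smooth \<Psi>" and cd: "{c..d} \<subseteq> J"
    and sup: "\<And>x. \<Psi> x \<noteq> 0 \<Longrightarrow> x $ last_ix \<in> {c..d} \<and> (\<exists>y. g (slice x y) \<noteq> 0)"
  shows "test_fun (cylinder Q J) \<Psi>"
proof (rule test_funI[OF \<Psi>])
  define S where "S = closure {x. g x \<noteq> 0}"
  have S: "compact S" "S \<subseteq> cylinder Q I" using g by (simp_all add: test_fun_def S_def)
  define F where "F = (\<lambda>p. fst p + snd p *\<^sub>R axis last_ix 1 :: (real, 'n) vec)"
  have "continuous_on S xprime" unfolding xprime_eq by (intro continuous_intros)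
  then have "compact (xprime ` S)" using S(1) by (rule compact_continuous_image)
  then have "compact (xprime ` S \<times> {c..d})" by (intro compact_Times) auto
  moreover have "continuous_on (xprime ` S \<times> {c..d}) F" unfolding F_def by (intro continuous_intros)
  ultimately show "compact (F ` (xprime ` S \<times> {c..d}))" by (intro compact_continuous_image)
  show "F ` (xprime ` S \<times> {c..d}) \<subseteq> cylinder Q J"
  proof
    fix x assume "x \<in> F ` (xprime ` S \<times> {c..d})"
    then obtain z t where z: "z \<in> S" "t \<in> {c..d}" "x = xprime z + t *\<^sub>R axis last_ix 1" by (auto simp: F_def)
    have "xprime x = xprime z" "x $ last_ix = t" unfolding z(3) by (simp_all add: xprime_eq)
    then show "x \<in> cylinder Q J" using z S(2) cd by (auto simp: cylinder_def)
  qed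
  fix x assume x: "x \<notin> F ` (xprime ` S \<times> {c..d})"
  show "\<Psi> x = 0"
  proof (rule ccontr)
    assume "\<Psi> x \<noteq> 0"
    then obtain y where y: "x $ last_ix \<in> {c..d}" "g (slice x y) \<noteq> 0" using sup by blast
    then have "slice x y \<in> S" unfolding S_def using closure_subset[of "{x. g x \<noteq> 0}"] by blast
    then have "xprime x \<in> xprime ` S" by (metis imageI xprime_slice)
    moreover have "x = F (xprime x, x $ last_ix)" by (simp add: F_def xprime_eq)
    ultimately have "x \<in> F ` (xprime ` S \<times> {c..d})" using y(1) by blast
    then show False using x by simp
  qed
qed

definition H1sq :: "(real^'n::finite \<Rightarrow> complex) \<Rightarrow> real" where
  "H1sq f = L2sq f + (\<Sum>i\<in>UNIV. L2sq (partial_deriv i f))"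

lemma L2sq_le_H1sq: "L2sq f \<le> H1sq f" "L2sq (partial_deriv i f) \<le> H1sq f"
  "L2sq f + L2sq (partial_deriv i f) \<le> H1sq f"
proof -
  have "L2sq (partial_deriv i f) \<le> (\<Sum>i\<in>UNIV. L2sq (partial_deriv i f))"
    by (rule member_le_sum) (auto simp: L2sq_nonneg)
  then show "L2sq f + L2sq (partial_deriv i f) \<le> H1sq f" by (simp add: H1sq_def)
  then show "L2sq f \<le> H1sq f" "L2sq (partial_deriv i f) \<le> H1sq f"
    using L2sq_nonneg[of f] L2sq_nonneg[of "partial_deriv i f"] by linarith+
qed

lemma H1sq_nonneg: "H1sq f \<ge> 0"
  using L2sq_le_H1sq(1)[of f] L2sq_nonneg[of f] by linarith

text \<open>By linearity the tail integral of the superposition acts on the fibre of G through the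
  kernel \<open>k\<close>, which is the Landau kernel up to 1 / N. The Landau error comes from
  \<open>lk\<close>, the remainder is estimated by Cauchy-Schwarz on the fibre, and bounding 1 / N
  by the power -1/4 of N merges the two.\<close>

lemma fibre_approximation:
  fixes G :: "real^'n::{finite,linorder} \<Rightarrow> complex" and \<psi> W :: "nat \<Rightarrow> real \<Rightarrow> real"
  assumes G: "schwartz G" and G0: "\<And>x. x $ last_ix \<notin> {\<alpha><..<\<beta>} \<Longrightarrow> G x = 0"
    and ab: "\<alpha> < \<beta>" and s: "0 < s" and d: "d > 0" and x: "x $ last_ix \<in> {\<alpha>..\<beta>}" and N: "N \<ge> 1" and K1: "K1 \<ge> 0"
    and W: "\<And>l. admissible_weight \<alpha> \<beta> (W l)"
    and \<psi>: "\<And>l. continuous_on UNIV (\<psi> l)" "\<And>l t. l \<le> M \<Longrightarrow> t \<notin> {t0..t0 + \<rho>} \<Longrightarrow> \<psi> l t = 0"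
    and appr: "\<And>y y'. y \<in> {\<alpha>..\<beta>} \<Longrightarrow> y' \<in> {\<alpha>..\<beta>} \<Longrightarrow>
       \<bar>(\<Sum>l\<le>M. W l y' * (LINT h|lborel. tail_kernel s d h * \<psi> l (y + h))) - landau_kernel N a d t0 y' y\<bar> \<le> 1 / real N"
    and lk: "\<forall>\<gamma> \<gamma>'. (\<forall>y\<in>{\<alpha>..\<beta>}. (\<gamma> has_vector_derivative \<gamma>' y) (at y)) \<longrightarrow>
     continuous_on {\<alpha>..\<beta>} \<gamma>' \<longrightarrow> \<gamma> \<alpha> = 0 \<longrightarrow> \<gamma> \<beta> = 0 \<longrightarrow>
     (\<forall>y\<in>{\<alpha>..\<beta>}. norm (\<gamma> y - (LINT y'|lborel. indicator {\<alpha>..\<beta>} y' *\<^sub>R (of_real (landau_kernel N a d t0 y' y) * \<gamma> y')))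
        \<le> K1 * real N powr (- (1 / 4)) * sqrt (LINT t|lborel. indicator {\<alpha>..\<beta>} t * ((norm (\<gamma> t))\<^sup>2 + (norm (\<gamma>' t :: complex))\<^sup>2)))"
  shows "norm (G x - (LINT h|lborel. of_real (tail_kernel s d h) *
       (\<Sum>l\<le>M. weighted_fibre (W l) G (x + h *\<^sub>R axis last_ix 1) * of_real (\<psi> l ((x + h *\<^sub>R axis last_ix 1) $ last_ix)))))
    \<le> (K1 + sqrt (\<beta> - \<alpha>)) * real N powr (- (1 / 4)) * sqrt (fibre_sq \<alpha> \<beta> G x + fibre_sq \<alpha> \<beta> (partial_deriv last_ix G) x)"
proof -
  let ?y = "x $ last_ix"
  let ?DG = "partial_deriv last_ix G"
  have DG: "schwartz ?DG" by (rule schwartz_partial[OF G])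
  define V where "V l = (LINT h|lborel. tail_kernel s d h * \<psi> l (?y + h))" for l
  define T where "T = fibre_sq \<alpha> \<beta> G x + fibre_sq \<alpha> \<beta> ?DG x"
  have [measurable]: "\<psi> l \<in> borel_measurable borel" "W l \<in> borel_measurable borel" "G \<in> borel_measurable borel" for l
    using \<psi>(1) W G by (auto intro: borel_measurable_continuous_onI schwartz_borel simp: admissible_weight_def)
  have iV: "integrable lborel (\<lambda>h. tail_kernel s d h * \<psi> l (?y + h))" if l: "l \<le> M" for l
  proof -
    have "bounded (\<psi> l ` {t0..t0 + \<rho>})"
      by (intro compact_imp_bounded compact_continuous_image continuous_on_subset[OF \<psi>(1)]) auto
    then obtain A where A: "A > 0" "\<And>t. t \<in> {t0..t0 + \<rho>} \<Longrightarrow> \<bar>\<psi> l t\<bar> \<le> A" unfolding bounded_pos by auto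
    have A': "\<bar>\<psi> l t\<bar> \<le> A" for t using A \<psi>(2)[OF l, of t] by (cases "t \<in> {t0..t0 + \<rho>}") auto
    show ?thesis
    proof (rule Bochner_Integration.integrable_bound)
      show "integrable lborel (\<lambda>h. A * tail_kernel s d h)" using integrable_tail_kernel[OF s d] by simp
      have "\<bar>tail_kernel s d h\<bar> * \<bar>\<psi> l (?y + h)\<bar> \<le> \<bar>tail_kernel s d h\<bar> * A" for h by (intro mult_left_mono A') auto
      then show "AE h in lborel. norm (tail_kernel s d h * \<psi> l (?y + h)) \<le> norm (A * tail_kernel s d h)"
        using A(1) by (simp add: abs_mult mult.commute)
    qed measurable
  qed
  obtain A where A: "\<And>z. norm (G z) \<le> A" using schwartz_decay[OF G, of 0] by auto
  have iW: "integrable lborel (\<lambda>y. of_real (W l y) * G (slice x y))" for l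
    by (rule admissible_weight_integrable[OF W _ A]) measurable
  have "(LINT h|lborel. of_real (tail_kernel s d h) * (\<Sum>l\<le>M. weighted_fibre (W l) G (x + h *\<^sub>R axis last_ix 1) * of_real (\<psi> l ((x + h *\<^sub>R axis last_ix 1) $ last_ix))))
     = (LINT h|lborel. (\<Sum>l\<le>M. weighted_fibre (W l) G x * of_real (tail_kernel s d h * \<psi> l (?y + h))))"
    unfolding weighted_fibre_def by (simp add: sum_distrib_left mult_ac)
  also have "\<dots> = (\<Sum>l\<le>M. (LINT h|lborel. weighted_fibre (W l) G x * of_real (tail_kernel s d h * \<psi> l (?y + h))))"
    by (rule Bochner_Integration.integral_sum) (intro integrable_mult_right integrable_of_real iV, simp)
  also have "\<dots> = (\<Sum>l\<le>M. weighted_fibre (W l) G x * of_real (V l))"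
    unfolding integral_mult_right_zero integral_complex_of_real V_def ..
  also have "\<dots> = (\<Sum>l\<le>M. (LINT y'|lborel. of_real (W l y' * V l) * G (slice x y')))"
    unfolding weighted_fibre_def integral_mult_left_zero[symmetric] by (simp add: mult_ac)
  also have "\<dots> = (LINT y'|lborel. (\<Sum>l\<le>M. of_real (W l y' * V l) * G (slice x y')))"
  proof (rule Bochner_Integration.integral_sum[symmetric])
    fix l
    have "integrable lborel (\<lambda>y'. of_real (V l) * (of_real (W l y') * G (slice x y')))" by (intro integrable_mult_right iW)
    then show "integrable lborel (\<lambda>y'. of_real (W l y' * V l) * G (slice x y'))" by (simp add: mult_ac)
  qed
  finally have A_eq: "(LINT h|lborel. of_real (tail_kernel s d h) * (\<Sum>l\<le>M. weighted_fibre (W l) G (x + h *\<^sub>R axis last_ix 1) * of_real (\<psi> l ((x + h *\<^sub>R axis last_ix 1) $ last_ix))))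
     = (LINT y'|lborel. (\<Sum>l\<le>M. of_real (W l y' * V l) * G (slice x y')))" .
  define k where "k y' = (\<Sum>l\<le>M. W l y' * V l)" for y'
  define r where "r y' = indicator {\<alpha>..\<beta>} y' * (landau_kernel N a d t0 y' ?y - k y')" for y'
  have km: "k \<in> borel_measurable borel" unfolding k_def[abs_def] by measurable
  have lkm: "(\<lambda>y'. landau_kernel N a d t0 y' ?y) \<in> borel_measurable borel"
    unfolding landau_kernel_def inv_coord_def by measurable
  have [measurable]: "r \<in> borel_measurable borel" unfolding r_def[abs_def] using km lkm by measurable
  have k0: "k y' = 0" if "y' \<notin> {\<alpha>..\<beta>}" for y' using that W unfolding k_def admissible_weight_def by simp
  have r_le: "\<bar>r y'\<bar> \<le> (1 / real N) * indicator {\<alpha>..\<beta>} y'" for y'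
    using appr[OF x, of y'] unfolding r_def k_def V_def by (cases "y' \<in> {\<alpha>..\<beta>}") (auto simp: abs_minus_commute)
  have ik: "integrable lborel (\<lambda>y'. of_real (k y') * G (slice x y'))"
  proof -
    have "integrable lborel (\<lambda>y'. \<Sum>l\<le>M. of_real (V l) * (of_real (W l y') * G (slice x y')))"
      by (intro Bochner_Integration.integrable_sum integrable_mult_right iW)
    then show ?thesis by (simp add: k_def sum_distrib_left sum_distrib_right mult_ac)
  qed
  have ir: "integrable lborel (\<lambda>y'. of_real (r y') * G (slice x y'))"
  proof (rule admissible_weight_integrable[OF _ _ A])
    have "\<bar>r y\<bar> \<le> 1 / real N" for y using r_le[of y] by (cases "y \<in> {\<alpha>..\<beta>}") auto
    then show "admissible_weight \<alpha> \<beta> r" unfolding admissible_weight_def by (auto simp: r_def)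
  qed measurable
  have lk_eq: "indicator {\<alpha>..\<beta>} y' *\<^sub>R (of_real (landau_kernel N a d t0 y' ?y) * G (slice x y')) = of_real (k y') * G (slice x y') + of_real (r y') * G (slice x y')" for y'
    using k0[of y'] by (cases "y' \<in> {\<alpha>..\<beta>}") (auto simp: r_def algebra_simps)
  have "G x - (LINT y'|lborel. of_real (k y') * G (slice x y'))
      = (G x - (LINT y'|lborel. indicator {\<alpha>..\<beta>} y' *\<^sub>R (of_real (landau_kernel N a d t0 y' ?y) * G (slice x y')))) + (LINT y'|lborel. of_real (r y') * G (slice x y'))"
    unfolding lk_eq using ik ir by simp
  also have "norm \<dots> \<le> K1 * real N powr (- (1 / 4)) * sqrt T + (1 / real N) * (sqrt (\<beta> - \<alpha>) * sqrt (fibre_sq \<alpha> \<beta> G x))"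
  proof (rule order_trans[OF norm_triangle_ineq add_mono])
    have e: "\<And>t. slice x t = (x - ?y *\<^sub>R axis last_ix 1) + t *\<^sub>R axis last_ix 1" by (simp add: slice_def algebra_simps)
    have der: "((\<lambda>y. G (slice x y)) has_vector_derivative ?DG (slice x y)) (at y)" for y
    proof -
      have 1: "(slice x has_derivative (\<lambda>h. h *\<^sub>R axis last_ix 1)) (at y)"
        unfolding e[abs_def] by (auto intro!: derivative_eq_intros)
      have "((\<lambda>y. G (slice x y)) has_derivative (\<lambda>h. \<Sum>i\<in>UNIV. (h *\<^sub>R axis last_ix 1) $ i *\<^sub>R partial_deriv i G (slice x y))) (at y)"
        by (rule has_derivative_compose[OF 1 smooth_has_derivative[OF schwartz_smooth[OF G]]])
      moreover have "(\<Sum>i\<in>UNIV. (h *\<^sub>R axis last_ix 1) $ i *\<^sub>R partial_deriv i G (slice x y)) = h *\<^sub>R ?DG (slice x y)" for h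
        using sum_axis_scaleR[of last_ix "\<lambda>i. partial_deriv i G (slice x y)"] by (simp add: scaleR_scaleR[symmetric] scaleR_sum_right[symmetric] del: scaleR_scaleR)
      ultimately show ?thesis by (simp add: has_vector_derivative_def)
    qed
    have i: "integrable lborel (\<lambda>t. indicator {\<alpha>..\<beta>} t * (norm (F (slice x t)))\<^sup>2)" if "schwartz F" for F
      by (intro integrable_fibre continuous_intros fibre_continuous that)
    have T_eq: "(LINT t|lborel. indicator {\<alpha>..\<beta>} t * ((norm (G (slice x t)))\<^sup>2 + (norm (?DG (slice x t)))\<^sup>2)) = T"
      unfolding T_def fibre_sq_def distrib_left by (rule Bochner_Integration.integral_add) (use i[OF G] i[OF DG] in simp_all)
    have z: "G (slice x \<alpha>) = 0" "G (slice x \<beta>) = 0" by (auto intro: G0)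
    from lk[rule_format, of "\<lambda>y. G (slice x y)" "\<lambda>y. ?DG (slice x y)", OF der fibre_continuous[OF DG] z x]
    show "norm (G x - (LINT y'|lborel. indicator {\<alpha>..\<beta>} y' *\<^sub>R (of_real (landau_kernel N a d t0 y' ?y) * G (slice x y')))) \<le> K1 * real N powr (- (1 / 4)) * sqrt T"
      unfolding T_eq by simp
    show "norm (LINT y'|lborel. of_real (r y') * G (slice x y')) \<le> (1 / real N) * (sqrt (\<beta> - \<alpha>) * sqrt (fibre_sq \<alpha> \<beta> G x))"
      by (rule weighted_fibre_le[OF G]) (use ab r_le in auto)
  qed
  also have "(1 / real N) * (sqrt (\<beta> - \<alpha>) * sqrt (fibre_sq \<alpha> \<beta> G x)) \<le> real N powr (- (1 / 4)) * (sqrt (\<beta> - \<alpha>) * sqrt T)"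
  proof (intro mult_mono)
    have "1 / real N = real N powr (- 1)" using N by (simp add: powr_minus_divide)
    also have "\<dots> \<le> real N powr (- (1 / 4))" using N by (intro powr_mono) auto
    finally show "1 / real N \<le> real N powr (- (1 / 4))" .
    show "sqrt (fibre_sq \<alpha> \<beta> G x) \<le> sqrt T" unfolding T_def using fibre_sq_nonneg[of \<alpha> \<beta> ?DG x] by simp
  qed (use ab fibre_sq_nonneg[of \<alpha> \<beta> G x] in auto)
  also have "K1 * real N powr (- (1 / 4)) * sqrt T + real N powr (- (1 / 4)) * (sqrt (\<beta> - \<alpha>) * sqrt T)
      = (K1 + sqrt (\<beta> - \<alpha>)) * real N powr (- (1 / 4)) * sqrt T" by (simp add: algebra_simps)
  finally have fin: "norm (G x - (LINT y'|lborel. of_real (k y') * G (slice x y'))) \<le> (K1 + sqrt (\<beta> - \<alpha>)) * real N powr (- (1 / 4)) * sqrt T" by simp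
  have "(\<Sum>l\<le>M. of_real (W l y' * V l) * G (slice x y')) = of_real (k y') * G (slice x y')" for y'
    by (simp add: k_def sum_distrib_right)
  then show ?thesis unfolding A_eq using fin by (simp add: T_def)
qed

section \<open>The main estimate\<close>

text \<open>With A the tail integral of \<Psi>, \<open>L2sq g\<close> is the integral of
  \<open>g * A\<close> plus that of \<open>g * (cnj g - A)\<close>. The first is, up to sign and the
  factor \<open>2 * cos_const s\<close>, the pairing of \<open>frac_D_last s g\<close> with \<Psi>;
  the second is small by \<open>fibre_approximation\<close>. All constants are independent of N and
  g, so the degree can be adapted to g afterwards.\<close>

lemma observability:
  fixes Q :: "(real^'n::{finite,linorder}) set"
  assumes s: "0 < s" "s < 1" and ab: "\<alpha> < \<beta>" "\<beta> < t0" and \<rho>: "\<rho> > 0"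
    and I: "I \<subseteq> {\<alpha><..<\<beta>}" and J: "{t0..t0 + \<rho>} \<subseteq> J"
  shows "\<exists>K\<ge>1. \<exists>C>0. \<forall>N\<ge>1. \<forall>g. test_fun (cylinder Q I) g \<longrightarrow>
    (\<exists>\<Psi>. test_fun (cylinder Q J) \<Psi> \<and> H1sq \<Psi> \<le> (C * (2 * real N + 1) * K ^ N\<^sup>2)\<^sup>2 * H1sq g \<and>
      L2sq g \<le> C * norm (LINT x|lborel. frac_D_last s g x * \<Psi> x) + C * real N powr (- (1 / 4)) * sqrt (L2sq g) * sqrt (H1sq g))"
proof -
  define d where "d = t0 - \<beta>"
  have d: "d > 0" "t0 = \<beta> + d" using ab by (simp_all add: d_def)
  obtain K1 where K1: "K1 \<ge> 0" and lk: "\<forall>N\<ge>1. \<forall>\<gamma> \<gamma>'. (\<forall>y\<in>{\<alpha>..\<beta>}. (\<gamma> has_vector_derivative \<gamma>' y) (at y)) \<longrightarrow>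
     continuous_on {\<alpha>..\<beta>} \<gamma>' \<longrightarrow> \<gamma> \<alpha> = 0 \<longrightarrow> \<gamma> \<beta> = 0 \<longrightarrow>
     (\<forall>y\<in>{\<alpha>..\<beta>}. norm (\<gamma> y - (LINT y'|lborel. indicator {\<alpha>..\<beta>} y' *\<^sub>R (of_real (landau_kernel N (1 + 2 * s) d t0 y' y) * \<gamma> y')))
        \<le> K1 * real N powr (- (1 / 4)) * sqrt (LINT t|lborel. indicator {\<alpha>..\<beta>} t * ((norm (\<gamma> t))\<^sup>2 + (norm (\<gamma>' t :: complex))\<^sup>2)))"
    using landau_kernel_approx[OF d(1) ab(1) d(2), of "1 + 2 * s"] s by auto
  obtain K where K: "K \<ge> 1" and ker: "\<forall>N\<ge>1. \<exists>W \<psi> \<psi>' :: nat \<Rightarrow> real \<Rightarrow> real.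
    (\<forall>l. W l \<in> borel_measurable borel) \<and> (\<forall>l. \<exists>A. \<forall>y. \<bar>W l y\<bar> \<le> A) \<and> (\<forall>l y. y \<notin> {\<alpha>..\<beta>} \<longrightarrow> W l y = 0) \<and>
    (\<forall>l. smooth (\<lambda>x::(real, 'n) vec. of_real (\<psi> l (x $ last_ix)))) \<and>
    (\<forall>l t. (\<psi> l has_real_derivative \<psi>' l t) (at t)) \<and>
    (\<forall>l\<le>2*N. \<forall>t. t \<notin> {t0..t0 + \<rho>} \<longrightarrow> \<psi> l t = 0 \<and> \<psi>' l t = 0) \<and>
    (\<forall>l\<le>2*N. \<forall>y t. \<bar>W l y\<bar> * \<bar>\<psi> l t\<bar> \<le> K ^ N\<^sup>2 \<and> \<bar>W l y\<bar> * \<bar>\<psi>' l t\<bar> \<le> K ^ N\<^sup>2) \<and>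
    (\<forall>y\<in>{\<alpha>..\<beta>}. \<forall>y'\<in>{\<alpha>..\<beta>}. \<bar>(\<Sum>l\<le>2*N. W l y' * (LINT h|lborel. tail_kernel s d h * \<psi> l (y + h)))
        - landau_kernel N (1 + 2 * s) d t0 y' y\<bar> \<le> 1 / real N)"
    using exists_approximating_kernel[OF s d(1) ab(1) d(2) \<rho>, where i = "last_ix :: 'n"] by auto
  define c0 where "c0 = (\<beta> - \<alpha>) * (\<beta> - \<alpha> + \<rho>)"
  have c0: "c0 \<ge> 0" using ab \<rho> by (simp add: c0_def)
  define c1 where "c1 = sqrt (2 * c0)"
  define c2 where "c2 = 2 * cos_const s"
  have c2: "c2 > 0" using cos_const_pos[OF s] by (simp add: c2_def)
  define c3 where "c3 = (K1 + sqrt (\<beta> - \<alpha>)) * sqrt (2 * (\<beta> - \<alpha>))"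
  have c3: "c3 \<ge> 0" using K1 ab by (simp add: c3_def)
  define C where "C = c1 + c2 + c3"
  have "c1 \<ge> 0" using c0 by (simp add: c1_def)
  then have C: "C > 0" "c1 \<le> C" "c2 \<le> C" "c3 \<le> C" using c2 c3 by (simp_all add: C_def)
  have "\<exists>\<Psi>. test_fun (cylinder Q J) \<Psi> \<and> H1sq \<Psi> \<le> (C * (2 * real N + 1) * K ^ N\<^sup>2)\<^sup>2 * H1sq g \<and>
      L2sq g \<le> C * norm (LINT x|lborel. frac_D_last s g x * \<Psi> x) + C * real N powr (- (1 / 4)) * sqrt (L2sq g) * sqrt (H1sq g)"
    if N: "N \<ge> 1" and g: "test_fun (cylinder Q I) g" for N and g :: "(real, 'n) vec \<Rightarrow> complex"
  proof -
    obtain W \<psi> \<psi>' :: "nat \<Rightarrow> real \<Rightarrow> real" where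
      W: "\<And>l. W l \<in> borel_measurable borel" "\<And>l. \<exists>A. \<forall>y. \<bar>W l y\<bar> \<le> A" "\<And>l y. y \<notin> {\<alpha>..\<beta>} \<Longrightarrow> W l y = 0" and
      \<psi>: "\<And>l. smooth (\<lambda>x::(real, 'n) vec. of_real (\<psi> l (x $ last_ix)))"
         "\<And>l t. (\<psi> l has_real_derivative \<psi>' l t) (at t)"
         "\<And>l t. l \<le> 2 * N \<Longrightarrow> t \<notin> {t0..t0 + \<rho>} \<Longrightarrow> \<psi> l t = 0" "\<And>l t. l \<le> 2 * N \<Longrightarrow> t \<notin> {t0..t0 + \<rho>} \<Longrightarrow> \<psi>' l t = 0" and
      E: "\<And>l y t. l \<le> 2 * N \<Longrightarrow> \<bar>W l y\<bar> * \<bar>\<psi> l t\<bar> \<le> K ^ N\<^sup>2" "\<And>l y t. l \<le> 2 * N \<Longrightarrow> \<bar>W l y\<bar> * \<bar>\<psi>' l t\<bar> \<le> K ^ N\<^sup>2" and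
      appr: "\<And>y y'. y \<in> {\<alpha>..\<beta>} \<Longrightarrow> y' \<in> {\<alpha>..\<beta>} \<Longrightarrow> \<bar>(\<Sum>l\<le>2*N. W l y' * (LINT h|lborel. tail_kernel s d h * \<psi> l (y + h)))
        - landau_kernel N (1 + 2 * s) d t0 y' y\<bar> \<le> 1 / real N"
      using ker[rule_format, OF N] by (elim exE conjE) blast
    have aW: "admissible_weight \<alpha> \<beta> (W l)" for l using W by (simp add: admissible_weight_def)
    have c\<psi>: "continuous_on UNIV (\<psi> l)" for l
      using \<psi>(2) by (meson DERIV_isCont continuous_at_imp_continuous_on)
    \<comment> \<open>The pairing is bilinear, so the tail integral of \<Psi> has to reproduce the
      conjugate of g.\<close>
    define G where "G x = cnj (g x)" for x
    have tG: "test_fun (cylinder Q I) G" unfolding G_def[abs_def] by (rule test_fun_cnj[OF g])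
    have G: "schwartz G" by (rule test_fun_schwartz[OF tG])
    have gs: "schwartz g" by (rule test_fun_schwartz[OF g])
    have g0: "g x = 0" if "x $ last_ix \<notin> {\<alpha><..<\<beta>}" for x
      using that I by (intro test_fun_support[OF g]) (auto simp: cylinder_def)
    have G0: "G x = 0" if "x $ last_ix \<notin> {\<alpha><..<\<beta>}" for x using g0[OF that] by (simp add: G_def)
    have pG: "partial_deriv i G = (\<lambda>x. cnj (partial_deriv i g x))" for i
      unfolding G_def[abs_def] by (auto intro!: partial_deriv_cnj schwartz_differentiable gs)
    have L2G: "L2sq G = L2sq g" "L2sq (partial_deriv i G) = L2sq (partial_deriv i g)" for i
      unfolding pG by (simp_all add: G_def[abs_def])
    define \<Psi> where "\<Psi> x = (\<Sum>l\<le>2*N. weighted_fibre (W l) G x * of_real (\<psi> l (x $ last_ix)))" for x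
    have sm\<Psi>: "smooth \<Psi>"
      unfolding \<Psi>_def[abs_def] by (intro smooth_sum smooth_mult smooth_weighted_fibre(1)[OF aW G] \<psi>(1))
    have t\<Psi>: "test_fun (cylinder Q J) \<Psi>"
    proof (rule test_fun_cylinderI[OF g sm\<Psi> J])
      fix x assume nz: "\<Psi> x \<noteq> 0"
      have "x $ last_ix \<in> {t0..t0 + \<rho>}"
      proof (rule ccontr)
        assume "x $ last_ix \<notin> {t0..t0 + \<rho>}"
        then have "\<Psi> x = 0" unfolding \<Psi>_def using \<psi>(3) by (intro sum.neutral) auto
        then show False using nz by simp
      qed
      moreover have "\<exists>y. g (slice x y) \<noteq> 0"
      proof (rule ccontr)
        assume "\<not> ?thesis"
        then have "\<Psi> x = 0" unfolding \<Psi>_def weighted_fibre_def G_def by simp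
        then show False using nz by simp
      qed
      ultimately show "x $ last_ix \<in> {t0..t0 + \<rho>} \<and> (\<exists>y. g (slice x y) \<noteq> 0)" ..
    qed
    have \<Psi>s: "schwartz \<Psi>" by (rule test_fun_schwartz[OF t\<Psi>])
    define M where "M = ((2 * real N + 1) * K ^ N\<^sup>2)\<^sup>2 * c0"
    have M0: "M \<ge> 0" using c0 by (simp add: M_def)
    have p\<Psi>_ne: "\<And>i. i \<noteq> last_ix \<Longrightarrow> partial_deriv i \<Psi> = (\<lambda>x. \<Sum>l\<le>2*N. weighted_fibre (W l) (partial_deriv i G) x * of_real (\<psi> l (x $ last_ix)))"
      and p\<Psi>_last: "partial_deriv last_ix \<Psi> = (\<lambda>x. \<Sum>l\<le>2*N. weighted_fibre (W l) G x * of_real (\<psi>' l (x $ last_ix)))"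
    proof -
      have 1: "((\<lambda>x. complex_of_real (\<psi> l (x $ last_ix))) has_derivative (\<lambda>h. of_real (\<psi>' l (x $ last_ix) * h $ last_ix))) (at x)" for l and x :: "(real, 'n) vec"
      proof (intro has_derivative_of_real)
        show "((\<lambda>x. \<psi> l (x $ last_ix)) has_derivative (\<lambda>h. \<psi>' l (x $ last_ix) * h $ last_ix)) (at x)"
          by (rule has_derivative_compose[OF bounded_linear_imp_has_derivative[OF bounded_linear_vec_nth] \<psi>(2)[unfolded has_field_derivative_def]])
      qed
      have 2: "(weighted_fibre (W l) G has_derivative (\<lambda>h. \<Sum>i\<in>UNIV. h $ i *\<^sub>R partial_deriv i (weighted_fibre (W l) G) x)) (at x)" for l x
        by (rule smooth_has_derivative[OF smooth_weighted_fibre(1)[OF aW G]])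
      have "(\<Psi> has_derivative (\<lambda>h. \<Sum>l\<le>2*N. weighted_fibre (W l) G x * of_real (\<psi>' l (x $ last_ix) * h $ last_ix) + (\<Sum>i\<in>UNIV. h $ i *\<^sub>R partial_deriv i (weighted_fibre (W l) G) x) * of_real (\<psi> l (x $ last_ix)))) (at x)" for x
        unfolding \<Psi>_def[abs_def] by (intro has_derivative_sum has_derivative_mult 1 2)
      note D = partial_deriv_eq[OF this]
      have D': "partial_deriv i \<Psi> x = (\<Sum>l\<le>2*N. weighted_fibre (W l) G x * of_real (\<psi>' l (x $ last_ix) * axis i 1 $ last_ix) + partial_deriv i (weighted_fibre (W l) G) x * of_real (\<psi> l (x $ last_ix)))" for i x
        unfolding D sum_axis_scaleR ..
      show "partial_deriv i \<Psi> = (\<lambda>x. \<Sum>l\<le>2*N. weighted_fibre (W l) (partial_deriv i G) x * of_real (\<psi> l (x $ last_ix)))" if "i \<noteq> last_ix" for i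
        using that by (intro ext) (simp add: D' axis_def smooth_weighted_fibre(2)[OF aW G])
      show "partial_deriv last_ix \<Psi> = (\<lambda>x. \<Sum>l\<le>2*N. weighted_fibre (W l) G x * of_real (\<psi>' l (x $ last_ix)))"
        by (intro ext) (simp add: D' axis_def smooth_weighted_fibre(2)[OF aW G] weighted_fibre_zero)
    qed
    have c0': "(\<beta> - \<alpha>) * (\<beta> - \<alpha> + (t0 + \<rho> - t0)) = c0" by (simp add: c0_def)
    have meas: "\<Psi> \<in> borel_measurable borel" "partial_deriv i \<Psi> \<in> borel_measurable borel" for i
      by (intro schwartz_borel \<Psi>s schwartz_partial)+
    have b1: "L2sq \<Psi> \<le> M * L2sq g"
      using superposition_L2sq_le[OF G, of \<alpha> \<beta> t0 "t0 + \<rho>" W "2 * N" \<psi> "K ^ N\<^sup>2"] ab \<rho> aW \<psi>(3) E(1) meas(1)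
      unfolding c0' \<Psi>_def[abs_def, symmetric] L2G M_def by simp
    have b2: "L2sq (partial_deriv i \<Psi>) \<le> M * L2sq (partial_deriv i g)" if i: "i \<noteq> last_ix" for i
      using superposition_L2sq_le[OF schwartz_partial[OF G, of i], of \<alpha> \<beta> t0 "t0 + \<rho>" W "2 * N" \<psi> "K ^ N\<^sup>2"] ab \<rho> aW \<psi>(3) E(1) meas(2)[of i]
      unfolding c0' p\<Psi>_ne[OF i, symmetric] L2G M_def by simp
    have b3: "L2sq (partial_deriv last_ix \<Psi>) \<le> M * L2sq g"
      using superposition_L2sq_le[OF G, of \<alpha> \<beta> t0 "t0 + \<rho>" W "2 * N" \<psi>' "K ^ N\<^sup>2"] ab \<rho> aW \<psi>(4) E(2) meas(2)[of last_ix]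
      unfolding c0' p\<Psi>_last[symmetric] L2G M_def by simp
    \<comment> \<open>The normal derivative is paid for by \<open>L2sq g\<close> instead of a
      derivative of g; this is the extra summand at \<open>last_ix\<close>, and it leads to the
      factor 2 in \<open>2 * M\<close> below.\<close>
    have "(\<Sum>i\<in>UNIV. L2sq (partial_deriv i \<Psi>)) \<le> (\<Sum>i\<in>UNIV. M * L2sq (partial_deriv i g) + (if i = last_ix then M * L2sq g else 0))"
    proof (rule sum_mono)
      fix i
      show "L2sq (partial_deriv i \<Psi>) \<le> M * L2sq (partial_deriv i g) + (if i = last_ix then M * L2sq g else 0)"
        using b2[of i] b3 mult_nonneg_nonneg[OF M0 L2sq_nonneg[of "partial_deriv i g"]] by auto
    qed
    also have "\<dots> = M * (\<Sum>i\<in>UNIV. L2sq (partial_deriv i g)) + M * L2sq g"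
      by (simp add: sum.distrib sum_distrib_left)
    finally have "H1sq \<Psi> \<le> M * L2sq g + M * H1sq g" using b1 unfolding H1sq_def distrib_left by linarith
    also have "\<dots> \<le> 2 * M * H1sq g" using mult_left_mono[OF L2sq_le_H1sq(1)[of g] M0] by simp
    also have "2 * M = (c1 * (2 * real N + 1) * K ^ N\<^sup>2)\<^sup>2"
      using c0 by (simp add: M_def c1_def power_mult_distrib)
    also have "\<dots> * H1sq g \<le> (C * (2 * real N + 1) * K ^ N\<^sup>2)\<^sup>2 * H1sq g"
      using C c0 K by (intro mult_right_mono power_mono H1sq_nonneg) (auto simp: c1_def)
    finally have H1\<Psi>: "H1sq \<Psi> \<le> (C * (2 * real N + 1) * K ^ N\<^sup>2)\<^sup>2 * H1sq g" .
    define A where "A x = (LINT h|lborel. of_real (tail_kernel s d h) * \<Psi> (x + h *\<^sub>R axis last_ix 1))" for x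
    define T where "T x = fibre_sq \<alpha> \<beta> G x + fibre_sq \<alpha> \<beta> (partial_deriv last_ix G) x" for x
    have T0: "T x \<ge> 0" for x unfolding T_def by (intro add_nonneg_nonneg fibre_sq_nonneg)
    have pair: "of_real c2 * (LINT x|lborel. frac_D_last s g x * \<Psi> x) = - (LINT x|lborel. g x * A x)"
      unfolding c2_def A_def
    proof (rule frac_D_last_pairing[OF s g t\<Psi> d(1), of \<beta>])
      show "g x = 0" if "x $ last_ix \<ge> \<beta>" for x using that by (intro g0) auto
      show "\<Psi> x = 0" if "x $ last_ix < \<beta> + d" for x
        unfolding \<Psi>_def using \<psi>(3) that d(2) by (intro sum.neutral) auto
    qed
    have err: "norm (G x - A x) \<le> (K1 + sqrt (\<beta> - \<alpha>)) * real N powr (- (1 / 4)) * sqrt (T x)" if "x $ last_ix \<in> {\<alpha>..\<beta>}" for x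
      unfolding A_def T_def \<Psi>_def
      by (rule fibre_approximation[OF G G0 ab(1) s(1) d(1) that N K1 aW c\<psi> \<psi>(3) appr lk[THEN spec, THEN mp, OF N]])
    define \<kappa> where "\<kappa> = (K1 + sqrt (\<beta> - \<alpha>)) * real N powr (- (1 / 4))"
    have \<kappa>: "\<kappa> \<ge> 0" using K1 ab by (simp add: \<kappa>_def)
    \<comment> \<open>\<open>T\<close> is constant along the fibres and hence in general not
      integrable over the whole space; the cutoff to the slab around the support of g makes it so
      and keeps the values where g is nonzero.\<close>
    define u where "u x = indicator {\<alpha>..\<beta>} (x $ last_ix) * fibre_sq \<alpha> \<beta> G x + indicator {\<alpha>..\<beta>} (x $ last_ix) * fibre_sq \<alpha> \<beta> (partial_deriv last_ix G) x" for x
    have u0: "u x \<ge> 0" for x unfolding u_def by (simp add: fibre_sq_nonneg)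
    have DG: "schwartz (partial_deriv last_ix G)" by (rule schwartz_partial[OF G])
    note fi = fibre_sq_integral[OF G less_imp_le[OF ab(1)] less_imp_le[OF ab(1)]] fibre_sq_integral[OF DG less_imp_le[OF ab(1)] less_imp_le[OF ab(1)]]
    have iu: "integrable lborel u" unfolding u_def[abs_def] by (intro Bochner_Integration.integrable_add fi)
    have "(LINT x|lborel. u x) \<le> (\<beta> - \<alpha> + (\<beta> - \<alpha>)) * (L2sq G + L2sq (partial_deriv last_ix G))"
      unfolding u_def using fi by (simp add: distrib_left)
    also have "\<dots> \<le> 2 * (\<beta> - \<alpha>) * H1sq g"
      unfolding L2G using ab L2sq_le_H1sq(3)[of g last_ix] by (intro mult_mono) (auto simp: L2sq_nonneg)
    finally have Iu: "(LINT x|lborel. u x) \<le> 2 * (\<beta> - \<alpha>) * H1sq g" .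
    have [measurable]: "g \<in> borel_measurable borel" "G \<in> borel_measurable borel" "\<Psi> \<in> borel_measurable borel" "u \<in> borel_measurable borel"
      using gs G meas iu by (auto intro: schwartz_borel)
    have [measurable]: "A \<in> borel_measurable borel" unfolding A_def[abs_def] by measurable
    obtain B where B: "\<And>x. norm (\<Psi> x) \<le> B" using schwartz_decay[OF \<Psi>s, of 0] by auto
    have A_le: "norm (A x) \<le> (LINT h|lborel. B * tail_kernel s d h)" for x
      unfolding A_def
    proof (rule norm_LINT_le)
      show it: "integrable lborel (\<lambda>h. B * tail_kernel s d h)" using integrable_tail_kernel[OF s(1) d(1)] by simp
      have le: "norm (of_real (tail_kernel s d h) * \<Psi> (x + h *\<^sub>R axis last_ix 1)) \<le> B * tail_kernel s d h" for h
        using mult_right_mono[OF B[of "x + h *\<^sub>R axis last_ix 1"] tail_kernel_nonneg[of s d h]]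
        by (simp add: norm_mult tail_kernel_nonneg mult.commute)
      then show "norm (of_real (tail_kernel s d h) * \<Psi> (x + h *\<^sub>R axis last_ix 1)) \<le> B * tail_kernel s d h" for h .
      show "integrable lborel (\<lambda>h. of_real (tail_kernel s d h) * \<Psi> (x + h *\<^sub>R axis last_ix 1))"
      proof (rule Bochner_Integration.integrable_bound[OF it])
        show "AE h in lborel. norm (of_real (tail_kernel s d h) * \<Psi> (x + h *\<^sub>R axis last_ix 1)) \<le> norm (B * tail_kernel s d h)"
          using le by (intro AE_I2) (metis abs_ge_self order_trans real_norm_def)
      qed measurable
    qed
    have igA: "integrable lborel (\<lambda>x. g x * A x)"
      using integrable_bounded_mult_schwartz[of A, OF _ A_le gs] by (simp add: mult.commute)
    obtain BG where BG: "\<And>x. norm (G x) \<le> BG" using schwartz_decay[OF G, of 0] by auto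
    have igG: "integrable lborel (\<lambda>x. g x * G x)"
      using integrable_bounded_mult_schwartz[of G, OF _ BG gs] by (simp add: mult.commute)
    have ig: "integrable lborel (\<lambda>x. (norm (g x))\<^sup>2)" by (rule schwartz_square_integrable[OF gs])
    have squ: "(sqrt (u x))\<^sup>2 = u x" for x using u0 by simp
    have CS: "integrable lborel (\<lambda>x. norm (g x) * sqrt (u x))"
      "\<bar>LINT x|lborel. norm (g x) * sqrt (u x)\<bar> \<le> sqrt (LINT x|lborel. (norm (g x))\<^sup>2) * sqrt (LINT x|lborel. (sqrt (u x))\<^sup>2)"
      by (rule LINT_Cauchy_Schwarz, measurable, rule ig, simp add: squ iu)+
    have "complex_of_real (L2sq g) = (LINT x|lborel. g x * G x)"
      unfolding L2sq_def G_def integral_complex_of_real[symmetric] by (simp only: complex_norm_square)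
    also have "\<dots> = (LINT x|lborel. g x * A x) + (LINT x|lborel. g x * (G x - A x))"
      using igG igA by (simp add: right_diff_distrib)
    finally have "norm (complex_of_real (L2sq g)) \<le> norm (LINT x|lborel. g x * A x) + norm (LINT x|lborel. g x * (G x - A x))"
      by (simp only: norm_triangle_ineq)
    then have 1: "L2sq g \<le> norm (LINT x|lborel. g x * A x) + norm (LINT x|lborel. g x * (G x - A x))"
      by (simp add: L2sq_nonneg)
    have "(LINT x|lborel. g x * A x) = - (of_real c2 * (LINT x|lborel. frac_D_last s g x * \<Psi> x))" using pair by simp
    then have 2: "norm (LINT x|lborel. g x * A x) = c2 * norm (LINT x|lborel. frac_D_last s g x * \<Psi> x)"
      using c2 by (simp add: norm_mult)
    have "norm (LINT x|lborel. g x * (G x - A x)) \<le> (LINT x|lborel. \<kappa> * (norm (g x) * sqrt (u x)))"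
    proof (rule norm_LINT_le)
      show "integrable lborel (\<lambda>x. g x * (G x - A x))" using igG igA by (simp add: right_diff_distrib)
      show "integrable lborel (\<lambda>x. \<kappa> * (norm (g x) * sqrt (u x)))" by (intro integrable_mult_right CS)
      fix x
      show "norm (g x * (G x - A x)) \<le> \<kappa> * (norm (g x) * sqrt (u x))"
      proof (cases "x $ last_ix \<in> {\<alpha>..\<beta>}")
        case True
        then have "u x = T x" by (simp add: u_def T_def)
        then have "norm (G x - A x) \<le> \<kappa> * sqrt (u x)" using err[OF True] by (simp add: \<kappa>_def)
        from mult_left_mono[OF this, of "norm (g x)"] show ?thesis by (simp add: norm_mult mult_ac)
      next
        case False
        then have "g x = 0" by (intro g0) auto
        then show ?thesis by simp
      qed
    qed
    also have "\<dots> = \<kappa> * (LINT x|lborel. norm (g x) * sqrt (u x))" by simp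
    also have "\<dots> \<le> \<kappa> * (sqrt (L2sq g) * sqrt (2 * (\<beta> - \<alpha>) * H1sq g))"
    proof (rule mult_left_mono[OF _ \<kappa>])
      have "(LINT x|lborel. norm (g x) * sqrt (u x)) \<le> sqrt (L2sq g) * sqrt (LINT x|lborel. u x)"
        using CS(2) unfolding squ L2sq_def by linarith
      also have "\<dots> \<le> sqrt (L2sq g) * sqrt (2 * (\<beta> - \<alpha>) * H1sq g)"
        using Iu L2sq_nonneg[of g] by (intro mult_left_mono real_sqrt_le_mono) auto
      finally show "(LINT x|lborel. norm (g x) * sqrt (u x)) \<le> \<dots>" .
    qed
    also have "\<dots> = c3 * (real N powr (- (1 / 4)) * sqrt (L2sq g) * sqrt (H1sq g))"
      unfolding real_sqrt_mult \<kappa>_def c3_def by (simp add: mult_ac)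
    also have "\<dots> \<le> C * (real N powr (- (1 / 4)) * sqrt (L2sq g) * sqrt (H1sq g))"
      using C H1sq_nonneg[of g] L2sq_nonneg[of g] by (intro mult_right_mono) auto
    finally have 3: "norm (LINT x|lborel. g x * (G x - A x)) \<le> C * (real N powr (- (1 / 4)) * sqrt (L2sq g) * sqrt (H1sq g))" .
    have "c2 * norm (LINT x|lborel. frac_D_last s g x * \<Psi> x) \<le> C * norm (LINT x|lborel. frac_D_last s g x * \<Psi> x)"
      using C by (intro mult_right_mono) auto
    then have "L2sq g \<le> C * norm (LINT x|lborel. frac_D_last s g x * \<Psi> x) + C * real N powr (- (1 / 4)) * sqrt (L2sq g) * sqrt (H1sq g)"
      using 1 2 3 by (simp only: mult.assoc)
    then show ?thesis using t\<Psi> H1\<Psi> by blast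
  qed
  then show ?thesis using K C(1) by blast
qed

text \<open>The degree \<open>N\<close> is taken of the order of \<open>(S / b)^4\<close>, so that the second term on the right-hand side
  of the observability inequality is absorbed.\<close>

lemma absorb_and_exponentiate:
  fixes K C m :: real
  assumes K: "K \<ge> 1" and C: "C > 0" and m: "m \<ge> 1"
  shows "\<exists>C'>0. \<forall>b S F h. b > 0 \<longrightarrow> S \<ge> b \<longrightarrow> F \<ge> 0 \<longrightarrow> h \<ge> 0 \<longrightarrow> h \<le> m * S \<longrightarrow>
     (\<forall>N\<ge>1. b\<^sup>2 \<le> C * (F * (C * (2 * real N + 1) * K ^ N\<^sup>2 * h)) + C * real N powr (- (1 / 4)) * b * h) \<longrightarrow>
     S \<le> C' * exp (C' * (S / b) powr 8) * F"
proof -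
  \<comment> \<open>Below, N is at most \<open>z ^ 4 + 2\<close>, and \<open>R \<ge> 1\<close> turns
    this into \<open>D * R ^ 4\<close>. The square of N in the cost then becomes
    \<open>R ^ 8\<close>, the exponent of the final estimate.\<close>
  define D where "D = (2 * C * m) ^ 4 + 2"
  have D: "D \<ge> 2" by (simp add: D_def)
  \<comment> \<open>Taken as a sum in order to dominate both the prefactor and the coefficient in
    the exponent.\<close>
  define C' where "C' = 6 * C\<^sup>2 * m + (D\<^sup>2 * (1 + ln K) + 1)"
  have lnK: "ln K \<ge> 0" using K by simp
  have Cm: "6 * C\<^sup>2 * m > 0" using C m by simp
  have D1: "D\<^sup>2 * (1 + ln K) + 1 \<ge> 1" using lnK by simp
  have C': "C' > 0" "6 * C\<^sup>2 * m \<le> C'" "D\<^sup>2 * (1 + ln K) + 1 \<le> C'" using Cm D1 unfolding C'_def by linarith+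
  have "S \<le> C' * exp (C' * (S / b) powr 8) * F"
    if b: "b > 0" and S: "S \<ge> b" and F: "F \<ge> 0" and h: "h \<ge> 0" "h \<le> m * S"
      and ineq: "\<And>N. N \<ge> 1 \<Longrightarrow> b\<^sup>2 \<le> C * (F * (C * (2 * real N + 1) * K ^ N\<^sup>2 * h)) + C * real N powr (- (1 / 4)) * b * h" for b S F h
  proof -
    define R where "R = S / b"
    have R: "R \<ge> 1" "S = R * b" using b S by (simp_all add: R_def)
    \<comment> \<open>Once the power -1/4 of N is at most 1 / z, the bound
      \<open>h \<le> m * R * b\<close> makes the error term at most
      \<open>C * b * (m * R * b) / z = b^2 / 2\<close>, which the left-hand side absorbs.\<close>
    define z where "z = 2 * C * m * R"
    have z: "z > 0" using C m R by (simp add: z_def)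
    define N where "N = nat \<lceil>z ^ 4\<rceil> + 1"
    have N: "N \<ge> 1" "z ^ 4 \<le> real N" "real N \<le> z ^ 4 + 2"
    proof -
      have "z ^ 4 > 0" using z by simp
      then have "z ^ 4 \<le> real_of_int \<lceil>z ^ 4\<rceil>" "real_of_int \<lceil>z ^ 4\<rceil> \<le> z ^ 4 + 1" "\<lceil>z ^ 4\<rceil> \<ge> 0"
        by linarith+
      moreover from this have "real N = real_of_int \<lceil>z ^ 4\<rceil> + 1" by (simp add: N_def of_nat_nat)
      ultimately show "z ^ 4 \<le> real N" "real N \<le> z ^ 4 + 2" by linarith+
      show "N \<ge> 1" by (simp add: N_def)
    qed
    have R4: "1 \<le> R ^ 4" using R by (simp add: one_le_power)
    have ND: "real N \<le> D * R ^ 4"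
      using N(3) R4 unfolding z_def D_def power_mult_distrib distrib_right by linarith
    have "real N powr (- (1 / 4)) \<le> (z ^ 4) powr (- (1 / 4))" using N z by (intro powr_mono2') auto
    also have "\<dots> = z powr (- 1)" using z powr_powr[of z 4 "- (1 / 4)"] by simp
    finally have Np: "real N powr (- (1 / 4)) \<le> 1 / z" using z by (simp add: powr_minus_divide)
    have hR: "h \<le> m * R * b" using h R by simp
    have "C * real N powr (- (1 / 4)) * b * h \<le> C * (1 / z) * b * (m * R * b)"
      using C b z h hR Np by (intro mult_mono) auto
    also have "\<dots> = b\<^sup>2 / 2" using C m R by (simp add: z_def power2_eq_square)
    finally have 1: "C * real N powr (- (1 / 4)) * b * h \<le> b\<^sup>2 / 2" .
    have "C * (F * (C * (2 * real N + 1) * K ^ N\<^sup>2 * h)) \<le> C * (F * (C * (3 * real N) * K ^ N\<^sup>2 * (m * R * b)))"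
      using C F K h hR N by (intro mult_left_mono mult_mono) auto
    with ineq[OF N(1)] 1 have "b\<^sup>2 \<le> 2 * (C * (F * (C * (3 * real N) * K ^ N\<^sup>2 * (m * R * b))))" by linarith
    also have "\<dots> = (6 * C\<^sup>2 * m * real N * K ^ N\<^sup>2 * R * F) * b" by (simp add: power2_eq_square)
    finally have "b \<le> 6 * C\<^sup>2 * m * real N * K ^ N\<^sup>2 * R * F" using b by (simp add: power2_eq_square)
    then have "S \<le> R * (6 * C\<^sup>2 * m * real N * K ^ N\<^sup>2 * R * F)"
      unfolding R(2) using R(1) by (intro mult_left_mono) auto
    also have "\<dots> = 6 * C\<^sup>2 * m * (real N * K ^ N\<^sup>2 * R\<^sup>2) * F" by (simp add: power2_eq_square)
    also have "\<dots> \<le> C' * exp (C' * R ^ 8) * F"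
    proof (intro mult_right_mono[OF _ F] mult_mono C')
      have "(real N)\<^sup>2 \<le> (D * R ^ 4)\<^sup>2" using ND by (intro power_mono) auto
      then have N2: "(real N)\<^sup>2 \<le> D\<^sup>2 * R ^ 8" by (simp add: power_mult_distrib flip: power_mult)
      have "real N * 1 \<le> real N * real N" using N by (intro mult_left_mono) auto
      then have N1: "real N \<le> D\<^sup>2 * R ^ 8" using N2 by (simp add: power2_eq_square)
      have "real N \<le> exp (real N)" using exp_ge_add_one_self[of "real N"] by linarith
      also have "\<dots> \<le> exp (D\<^sup>2 * R ^ 8)" using N1 by simp
      finally have a: "real N \<le> exp (D\<^sup>2 * R ^ 8)" .
      have "K ^ N\<^sup>2 = exp (ln K * (real N)\<^sup>2)" using K exp_of_nat_mult[of "N\<^sup>2" "ln K"] by (simp add: mult.commute)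
      also have "\<dots> \<le> exp (ln K * (D\<^sup>2 * R ^ 8))" using N2 lnK by (simp add: mult_left_mono)
      finally have bb: "K ^ N\<^sup>2 \<le> exp (ln K * (D\<^sup>2 * R ^ 8))" .
      have "R\<^sup>2 \<le> R ^ 8" using R by (intro power_increasing) auto
      also have "\<dots> \<le> exp (R ^ 8)" using exp_ge_add_one_self[of "R ^ 8"] by linarith
      finally have c: "R\<^sup>2 \<le> exp (R ^ 8)" .
      have "real N * K ^ N\<^sup>2 * R\<^sup>2 \<le> exp (D\<^sup>2 * R ^ 8) * exp (ln K * (D\<^sup>2 * R ^ 8)) * exp (R ^ 8)"
        using a bb c K by (intro mult_mono) auto
      also have "\<dots> = exp ((D\<^sup>2 * (1 + ln K) + 1) * R ^ 8)" unfolding exp_add[symmetric] by (simp add: algebra_simps)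
      also have "\<dots> \<le> exp (C' * R ^ 8)" using C' R by (simp add: mult_right_mono)
      finally show "real N * K ^ N\<^sup>2 * R\<^sup>2 \<le> exp (C' * R ^ 8)" .
    qed (use C'(1) Cm K in \<open>simp_all add: less_imp_le\<close>)
    also have "R ^ 8 = (S / b) powr 8" unfolding R_def[symmetric] using R(1) by simp
    finally show ?thesis .
  qed
  then show ?thesis using C'(1) by blast
qed

text \<open>The symbol is at most \<open>(1 + norm \<xi>)^2\<close>, so the transform still
  decreases rapidly and every Sobolev order is allowed. This function is the global extension that
  puts \<open>P_op s k a m g\<close> into the space of order -s on the outer cylinder.\<close>

lemma frac_D_last_sobolev:
  fixes g :: "real^'n::{finite,linorder} \<Rightarrow> complex"
  assumes s: "0 \<le> s" "s \<le> 1" and g: "schwartz g"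
  shows "dist_of (frac_D_last s g) \<in> sobolev r"
  unfolding frac_D_last_def multiplier_def
proof (rule sobolev_inv_fourier, rule rapid_mult[OF rapid_schwartz[OF schwartz_fourier[OF g]], of _ 2])
  fix \<xi> :: "(real, 'n) vec"
  have "\<bar>\<xi> $ last_ix\<bar> powr (2 * s) \<le> (1 + norm \<xi>) powr (2 * s)"
    using component_le_norm_cart[of \<xi> last_ix] s by (intro powr_mono2) auto
  also have "\<dots> \<le> (1 + norm \<xi>) powr 2" using s by (intro powr_mono) auto
  also have "\<dots> = (1 + norm \<xi>)\<^sup>2" by (simp add: add_pos_nonneg)
  finally show "norm (complex_of_real (\<bar>\<xi> $ last_ix\<bar> powr (2 * s))) \<le> (1 + norm \<xi>)\<^sup>2" by simp
qed measurable

lemma diff_op_outside: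
  assumes g: "test_fun U g" and x: "x \<notin> U"
  shows "diff_op k a g x = 0"
proof -
  have "D_multi \<alpha> g x = 0" for \<alpha>
    unfolding D_multi_def using test_fun_support[OF test_fun_partials[OF g] x] by simp
  then show ?thesis by (simp add: diff_op_def)
qed

lemma L2_norm_on_test_fun:
  assumes "test_fun U g" shows "L2_norm_on U g = sqrt (L2sq g)"
proof -
  have "indicator U x *\<^sub>R (norm (g x))\<^sup>2 = (norm (g x))\<^sup>2" for x
    using test_fun_support[OF assms, of x] by (cases "x \<in> U") auto
  then show ?thesis by (simp only: L2_norm_on_def set_lebesgue_integral_def L2sq_def)
qed

text \<open>The degenerate case of the theorem. For g = 0 the quotient of the norms is 0 by the
  convention for division, and the right-hand side is only known to be nonnegative, so the left-hand
  side itself has to vanish. A function of L^2 norm 0 defines the zero functional, which reduces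
  this to \<open>sobolev_norm_zero\<close>.\<close>

lemma sobolev_on_norm_eq_0:
  assumes g: "test_fun U g" and z: "L2sq g = 0" shows "sobolev_on_norm r U (dist_of g) \<le> 0"
proof -
  have gs: "schwartz g" by (rule test_fun_schwartz[OF g])
  have T: "dist_of g \<in> sobolev r" by (rule sobolev_schwartz[OF gs])
  then have "dist_of g \<in> extensions r U (dist_of g)" by (simp add: extensions_def)
  then have "sobolev_on_norm r U (dist_of g) \<le> sobolev_norm r (dist_of g)" by (rule sobolev_on_norm_le)
  also have "AE x in lborel. (norm (g x))\<^sup>2 = 0"
    using z integral_nonneg_eq_0_iff_AE[OF schwartz_square_integrable[OF gs]] by (simp add: L2sq_def)
  then have "AE x in lborel. g x = 0" by simp
  then have "dist_of g \<phi> = 0" for \<phi>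
    unfolding dist_of_def by (intro integral_eq_zero_AE) (auto elim!: eventually_mono)
  then have "sobolev_norm r (dist_of g) = 0" by (intro sobolev_norm_zero[OF T])
  finally show ?thesis .
qed

text \<open>By duality each of the n + 1 squares in \<open>H1sq\<close> is at most the square of the
  quotient norm.\<close>

lemma H1sq_le_sobolev:
  fixes g :: "real^'n::{finite,linorder} \<Rightarrow> complex"
  assumes g: "test_fun U g" and u: "dist_of g \<in> sobolev_on r U" and r: "r \<ge> 1"
  shows "sqrt (H1sq g) \<le> sqrt (real CARD('n) + 1) * sobolev_on_norm r U (dist_of g)"
proof -
  let ?S = "sobolev_on_norm r U (dist_of g)"
  have S: "?S \<ge> 0" by (rule sobolev_on_norm_nonneg[OF u])
  have le: "a \<le> ?S\<^sup>2" if "sqrt a \<le> ?S" "a \<ge> 0" for a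
    using that power_mono[of "sqrt a" ?S 2] by simp
  have "H1sq g \<le> ?S\<^sup>2 + (\<Sum>i\<in>(UNIV::'n set). ?S\<^sup>2)"
    unfolding H1sq_def by (intro add_mono sum_mono le L2sq_le_sobolev[OF g u r] L2sq_nonneg)
  also have "\<dots> = (real CARD('n) + 1) * ?S\<^sup>2" by (simp add: distrib_right)
  finally have "sqrt (H1sq g) \<le> sqrt ((real CARD('n) + 1) * ?S\<^sup>2)" by simp
  then show ?thesis using S by (simp add: real_sqrt_mult)
qed

theorem theorem1p7:
  fixes I J1 J2 :: "real set"
    and Q :: "(real^'n::{finite,linorder}) set"
    and s :: real
    and k :: nat
    and a :: "('n \<Rightarrow> nat) \<Rightarrow> complex"
    and m :: "real^'n::{finite,linorder} \<Rightarrow> complex"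
  assumes I: "open I" "connected I" "bounded I" "I \<noteq> {}"
    and J1: "open J1" "connected J1" "bounded J1" "J1 \<noteq> {}"
    and J2: "open J2" "connected J2" "bounded J2" "J2 \<noteq> {}"
    and disj: "closure I \<inter> closure J1 = {}" "closure I \<inter> closure J2 = {}"
    and left: "\<forall>t\<in>J1. \<forall>u\<in>I. t < u"
    and right: "\<forall>t\<in>J2. \<forall>u\<in>I. u < t"
    and Q: "Q \<subseteq> base_plane" "openin (top_of_set base_plane) Q" "bounded Q"
    and s: "1 / 2 \<le> s" "s < 1"
    and m: "tempered_symbol (\<lambda>\<xi>. m (xprime \<xi>))"
    and m_local: "\<forall>g. test_fun (cylinder Q I) g \<longrightarrow>
                    (\<forall>x\<in>cylinder Q (J1 \<union> J2). tangential_op m g x = 0)"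
  shows "\<exists>C \<mu>. C > 0 \<and> \<mu> > 0 \<and>
    (\<forall>g. test_fun (cylinder Q I) g \<longrightarrow>
       dist_of g \<in> sobolev_on (2 * s) (cylinder Q I) \<and>
       dist_of (P_op s k a m g) \<in> sobolev_on (- s) (cylinder Q (J1 \<union> J2)) \<and>
       sobolev_on_norm (2 * s) (cylinder Q I) (dist_of g)
         \<le> C * exp (C * (sobolev_on_norm (2 * s) (cylinder Q I) (dist_of g)
                           / L2_norm_on (cylinder Q I) g) powr \<mu>)
             * sobolev_on_norm (- s) (cylinder Q (J1 \<union> J2)) (dist_of (P_op s k a m g)))"
proof -
  let ?UI = "cylinder Q I" and ?UJ = "cylinder Q (J1 \<union> J2)"
  define \<alpha> where "\<alpha> = Inf I"
  define \<beta> where "\<beta> = Sup I"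
  have bdd: "bdd_above I" "bdd_below I" using I(3) by (auto intro: bounded_imp_bdd_above bounded_imp_bdd_below)
  have I_sub: "I \<subseteq> {\<alpha><..<\<beta>}"
  proof
    fix t assume t: "t \<in> I"
    obtain e where e: "e > 0" "ball t e \<subseteq> I" using I(1) t openE by blast
    have "t + e / 2 \<in> I" "t - e / 2 \<in> I" using e by (auto simp: dist_real_def intro!: subsetD[OF e(2)])
    then have "t + e / 2 \<le> \<beta>" "\<alpha> \<le> t - e / 2"
      unfolding \<alpha>_def \<beta>_def using bdd by (auto intro: cSup_upper cInf_lower)
    then show "t \<in> {\<alpha><..<\<beta>}" using e(1) by auto
  qed
  have ab: "\<alpha> < \<beta>" using I_sub I(4) by fastforce
  obtain t1 where t1: "t1 \<in> J2" using J2(4) by blast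
  have "\<beta> \<le> t1" unfolding \<beta>_def using I(4) right t1 by (intro cSup_least) (auto intro: less_imp_le)
  obtain e where e: "e > 0" "ball t1 e \<subseteq> J2" using J2(1) t1 openE by blast
  \<comment> \<open>From \<open>right\<close> one gets \<open>\<beta> \<le> t1\<close>. A shift by
    \<open>e / 4\<close> inside the ball makes the distance to I strictly positive and leaves room
    in J2 for a window of length \<open>e / 4\<close>.\<close>
  define t0 where "t0 = t1 + e / 4"
  have t0: "\<beta> < t0" "{t0..t0 + e / 4} \<subseteq> J2"
    using \<open>\<beta> \<le> t1\<close> e by (auto simp: t0_def dist_real_def intro!: subsetD[OF e(2)])
  have s0: "0 < s" using s by simp
  obtain K C where K: "K \<ge> 1" and C: "C > 0" and obs: "\<And>N g. N \<ge> 1 \<Longrightarrow> test_fun ?UI g \<Longrightarrow>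
    \<exists>\<Psi>. test_fun (cylinder Q J2) \<Psi> \<and> H1sq \<Psi> \<le> (C * (2 * real N + 1) * K ^ N\<^sup>2)\<^sup>2 * H1sq g \<and>
      L2sq g \<le> C * norm (LINT x|lborel. frac_D_last s g x * \<Psi> x) + C * real N powr (- (1 / 4)) * sqrt (L2sq g) * sqrt (H1sq g)"
    using observability[OF s0 s(2) ab t0(1) _ I_sub t0(2), of Q] e(1) by auto
  define M where "M = sqrt (real CARD('n) + 1)"
  have M: "M \<ge> 1" by (simp add: M_def)
  obtain C' where C': "C' > 0" and num: "\<And>b S F h. b > 0 \<Longrightarrow> S \<ge> b \<Longrightarrow> F \<ge> 0 \<Longrightarrow> h \<ge> 0 \<Longrightarrow> h \<le> M * S \<Longrightarrow>
     (\<forall>N\<ge>1. b\<^sup>2 \<le> C * (F * (C * (2 * real N + 1) * K ^ N\<^sup>2 * h)) + C * real N powr (- (1 / 4)) * b * h) \<Longrightarrow>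
     S \<le> C' * exp (C' * (S / b) powr 8) * F"
    using absorb_and_exponentiate[OF K C M] by blast
  have "dist_of g \<in> sobolev_on (2 * s) ?UI \<and> dist_of (P_op s k a m g) \<in> sobolev_on (- s) ?UJ \<and>
       sobolev_on_norm (2 * s) ?UI (dist_of g)
         \<le> C' * exp (C' * (sobolev_on_norm (2 * s) ?UI (dist_of g) / L2_norm_on ?UI g) powr 8)
             * sobolev_on_norm (- s) ?UJ (dist_of (P_op s k a m g))" if g: "test_fun ?UI g" for g
  proof -
    let ?S = "sobolev_on_norm (2 * s) ?UI (dist_of g)"
    let ?F = "sobolev_on_norm (- s) ?UJ (dist_of (P_op s k a m g))"
    have gs: "schwartz g" by (rule test_fun_schwartz[OF g])
    have u: "dist_of g \<in> sobolev_on (2 * s) ?UI"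
      using sobolev_schwartz[OF gs, of "2 * s"] by (auto simp: sobolev_on_def extensions_def)
    \<comment> \<open>The cylinders are disjoint: on the outer one g and all its derivatives vanish,
      which removes the differential part, and the tangential part is 0 there by
      \<open>m_local\<close>.\<close>
    have "x \<notin> ?UI" if "x \<in> ?UJ" for x using that left right by (fastforce simp: cylinder_def)
    then have P: "P_op s k a m g x = frac_D_last s g x" if "x \<in> ?UJ" for x
      using that m_local g diff_op_outside[OF g] by (simp add: P_op_def)
    have pair: "dist_of (P_op s k a m g) \<phi> = (LINT x|lborel. frac_D_last s g x * \<phi> x)" if \<phi>: "test_fun ?UJ \<phi>" for \<phi>
      unfolding dist_of_def
    proof (intro Bochner_Integration.integral_cong refl)
      fix x
      show "P_op s k a m g x * \<phi> x = frac_D_last s g x * \<phi> x"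
        using P[of x] test_fun_support[OF \<phi>, of x] by (cases "x \<in> ?UJ") auto
    qed
    have v: "dist_of (P_op s k a m g) \<in> sobolev_on (- s) ?UJ"
      using frac_D_last_sobolev[of s g "- s", OF _ _ gs] s pair by (auto simp: sobolev_on_def extensions_def dist_of_def)
    have F0: "?F \<ge> 0" by (rule sobolev_on_norm_nonneg[OF v])
    have "?S \<le> C' * exp (C' * (?S / sqrt (L2sq g)) powr 8) * ?F"
    proof (cases "L2sq g = 0")
      case True
      then have "?S \<le> 0" by (rule sobolev_on_norm_eq_0[OF g])
      also have "0 \<le> C' * exp (C' * (?S / sqrt (L2sq g)) powr 8) * ?F" using C' F0 by simp
      finally show ?thesis .
    next
      case False
      have r: "2 * s \<ge> 1" using s by simp
      \<comment> \<open>In \<open>num\<close>, b is the L^2 norm of g, S its quotient norm of order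
        2s, F the norm of \<open>P_op s k a m g\<close>, and h the H^1 norm, which S dominates up to
        M.\<close>
      show ?thesis
      proof (rule num[of _ _ _ "sqrt (H1sq g)"])
        show "sqrt (L2sq g) > 0" using False L2sq_nonneg[of g] by simp
        show "sqrt (L2sq g) \<le> ?S" by (rule L2sq_le_sobolev(1)[OF g u r])
        show "sqrt (H1sq g) \<le> M * ?S" unfolding M_def by (rule H1sq_le_sobolev[OF g u r])
        show "\<forall>N\<ge>1. (sqrt (L2sq g))\<^sup>2 \<le> C * (?F * (C * (2 * real N + 1) * K ^ N\<^sup>2 * sqrt (H1sq g))) + C * real N powr (- (1 / 4)) * sqrt (L2sq g) * sqrt (H1sq g)"
        proof (intro allI impI)
          fix N :: nat assume N: "N \<ge> 1"
          obtain \<Psi> where \<Psi>: "test_fun (cylinder Q J2) \<Psi>" "H1sq \<Psi> \<le> (C * (2 * real N + 1) * K ^ N\<^sup>2)\<^sup>2 * H1sq g"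
            "L2sq g \<le> C * norm (LINT x|lborel. frac_D_last s g x * \<Psi> x) + C * real N powr (- (1 / 4)) * sqrt (L2sq g) * sqrt (H1sq g)"
            using obs[OF N g] by blast
          have \<Psi>t: "test_fun ?UJ \<Psi>" using \<Psi>(1) by (auto simp: test_fun_def cylinder_def)
          \<comment> \<open>Duality in order -s, followed by the comparison of the dual norm of
            \<Psi> with H^1, which is the norm that the observability estimate controls.\<close>
          have "norm (LINT x|lborel. frac_D_last s g x * \<Psi> x) \<le> ?F * dual_norm (- s) \<Psi>"
            using sobolev_on_duality[OF v \<Psi>t] unfolding pair[OF \<Psi>t] .
          also have "\<dots> \<le> ?F * sqrt (H1sq \<Psi>)"
            using dual_norm_neg_le[OF test_fun_schwartz[OF \<Psi>t], of s] s F0 unfolding H1sq_def by (intro mult_left_mono) auto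
          also have "\<dots> \<le> ?F * sqrt ((C * (2 * real N + 1) * K ^ N\<^sup>2)\<^sup>2 * H1sq g)"
            using \<Psi>(2) F0 by (intro mult_left_mono real_sqrt_le_mono)
          also have "sqrt ((C * (2 * real N + 1) * K ^ N\<^sup>2)\<^sup>2 * H1sq g) = C * (2 * real N + 1) * K ^ N\<^sup>2 * sqrt (H1sq g)"
            using C K by (simp add: real_sqrt_mult)
          finally have "C * norm (LINT x|lborel. frac_D_last s g x * \<Psi> x) \<le> C * (?F * (C * (2 * real N + 1) * K ^ N\<^sup>2 * sqrt (H1sq g)))"
            using C by (intro mult_left_mono) auto
          then show "(sqrt (L2sq g))\<^sup>2 \<le> C * (?F * (C * (2 * real N + 1) * K ^ N\<^sup>2 * sqrt (H1sq g))) + C * real N powr (- (1 / 4)) * sqrt (L2sq g) * sqrt (H1sq g)"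
            using \<Psi>(3) L2sq_nonneg[of g] by simp
        qed
      qed (use F0 H1sq_nonneg in auto)
    qed
    then show ?thesis using u v L2_norm_on_test_fun[OF g] by simp
  qed
  then show ?thesis using C' by (intro exI[of _ C'] exI[of _ 8]) auto
qed

end
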